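(* Let $n\ge 3$, let $\Omega\subset\mathbb{R}^n$ be a bounded domain containing the origin, set $D:=\sup_{x\in\Omega}|x|$, let $a>0$, and set $$C_n(a)=\begin{cases}(n-2)^{-\frac{2(n-1)}{n}}\,S_n, & a\ge \frac{1}{n-2},\\[4pt] a^{\frac{2(n-1)}{n}}\,S_n, & 0<a<\frac1{n-2}.\end{cases}$$ Then for every $u\in C_0^\infty(\Omega)$, $$\int_{\Omega}|\nabla u|^2\,dx\ \ge\ \Big(\frac{n-2}{2}\Big)^2\int_{\Omega}\frac{u^2}{|x|^2}\,dx+C_n(a)\left(\int_{\Omega}X_1^{\frac{2(n-1)}{n-2}}\Big(a,\frac{|x|}{D}\Big)|u|^{\frac{2n}{n-2}}\,dx\right)^{\frac{n-2}{n}},$$ and $C_n(a)$ is the best (largest) constant for which this inequality holds for all $u\in C_0^\infty(\Omega)$; in particular the best constant is independent of $\Omega$.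
   Context: For $a>0$ and $0<s\le 1$, $X_1(a,s):=(a-\ln s)^{-1}$. $S_n=\pi n(n-2)\left(\Gamma(\tfrac n2)/\Gamma(n)\right)^{2/n}$ is the best constant in the Sobolev inequality $\int_{\mathbb{R}^n}|\nabla u|^2dx\ge S_n\left(\int_{\mathbb{R}^n}|u|^{\frac{2n}{n-2}}dx\right)^{\frac{n-2}{n}}$, $u\in C_0^\infty(\mathbb{R}^n)$. A domain is a connected open set. $C_0^\infty(\Omega)$ denotes smooth real-valued functions with compact support in $\Omega$. *)

theory Defs
  imports "HOL-Analysis.Analysis"
begin

fun times_cont_differentiable :: "nat \<Rightarrow> ('a::real_normed_vector \<Rightarrow> real) \<Rightarrow> bool" where
  "times_cont_differentiable 0 f \<longleftrightarrow> continuous_on UNIV f"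
| "times_cont_differentiable (Suc k) f \<longleftrightarrow>
     (\<forall>x. f differentiable (at x)) \<and>
     (\<forall>v. times_cont_differentiable k (\<lambda>x. frechet_derivative f (at x) v))"

definition smooth :: "('a::real_normed_vector \<Rightarrow> real) \<Rightarrow> bool" where
  "smooth f \<longleftrightarrow> (\<forall>k. times_cont_differentiable k f)"

(* Smooth functions with compact support in \<Omega>, identified with their extension by zero
   to the whole space. *)
definition test_functions :: "'a::real_normed_vector set \<Rightarrow> ('a \<Rightarrow> real) set" where
  "test_functions \<Omega> =
     {u. smooth u \<and> compact (closure {x. u x \<noteq> 0}) \<and> closure {x. u x \<noteq> 0} \<subseteq> \<Omega>}"

definition gradient :: "('a::real_inner \<Rightarrow> real) \<Rightarrow> 'a \<Rightarrow> 'a" where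
  "gradient u x = (THE D. GDERIV u x :> D)"

(* Only used for 0 < s \<le> 1; the junk value at s = 0 affects a single point. *)
definition X1 :: "real \<Rightarrow> real \<Rightarrow> real" where
  "X1 a s = inverse (a - ln s)"

definition sobolev_const :: "nat \<Rightarrow> real" where
  "sobolev_const n =
     pi * real n * (real n - 2) * (Gamma (real n / 2) / Gamma (real n)) powr (2 / real n)"

definition hardy_sobolev_const :: "nat \<Rightarrow> real \<Rightarrow> real" where
  "hardy_sobolev_const n a =
     (if a \<ge> 1 / (real n - 2)
      then (real n - 2) powr (- (2 * (real n - 1) / real n)) * sobolev_const n
      else a powr (2 * (real n - 1) / real n) * sobolev_const n)"

definition radius_about_origin :: "'a::real_normed_vector set \<Rightarrow> real" where
  "radius_about_origin \<Omega> = (SUP x\<in>\<Omega>. norm x)"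

definition hardy_sobolev_ineq ::
    "real \<Rightarrow> (real ^ 'n::finite) set \<Rightarrow> real \<Rightarrow> (real ^ 'n \<Rightarrow> real) \<Rightarrow> bool" where
  "hardy_sobolev_ineq a \<Omega> C u \<longleftrightarrow>
     (let n = real CARD('n); D = radius_about_origin \<Omega> in
        (LINT x:\<Omega>|lborel. (norm (gradient u x))\<^sup>2) \<ge>
          ((n - 2) / 2)\<^sup>2 * (LINT x:\<Omega>|lborel. (u x)\<^sup>2 / (norm x)\<^sup>2)
          + C * (LINT x:\<Omega>|lborel.
                   X1 a (norm x / D) powr (2 * (n - 1) / (n - 2)) *
                   \<bar>u x\<bar> powr (2 * n / (n - 2))) powr ((n - 2) / n))"

definition is_best_hardy_sobolev_const ::
    "real \<Rightarrow> (real ^ 'n::finite) set \<Rightarrow> real \<Rightarrow> bool" where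
  "is_best_hardy_sobolev_const a \<Omega> C \<longleftrightarrow>
     (\<forall>u\<in>test_functions \<Omega>. hardy_sobolev_ineq a \<Omega> C u) \<and>
     (\<forall>C'. (\<forall>u\<in>test_functions \<Omega>. hardy_sobolev_ineq a \<Omega> C' u) \<longrightarrow> C' \<le> C)"

definition bounded_domain_around_origin :: "'a::real_normed_vector set \<Rightarrow> bool" where
  "bounded_domain_around_origin \<Omega> \<longleftrightarrow> open \<Omega> \<and> connected \<Omega> \<and> bounded \<Omega> \<and> 0 \<in> \<Omega>"

end

(* Put kappa = min(a, 1/(n-2)), tau(r) = a - ln(r/D) and rho = tau^(-kappa). The function
   phi(r) = r^(-(n-2)/2) tau(r)^beta with beta = (1 - kappa (n-2))/2 is a positive supersolution of the
   Hardy operator, so for u supported away from the origin int |grad u|^2 exceeds the Hardy term by at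
   least int |phi grad(u/phi)|^2. Transplanting u/phi along the radial map r -> rho(r), which does not
   increase this integral up to the factor kappa (the condition kappa <= 1/(n-2) is beta >= 0, and
   kappa <= a makes the tangential part favourable), turns the weighted norm of u into the unweighted
   one, and the sharp Sobolev inequality gives the constant kappa^(2(n-1)/n) S_n. A cutoff near the
   origin removes the restriction on the support.

   The sharp Sobolev inequality comes from Brunn-Minkowski: the Borell-Brascamp-Lieb inequality for
   infimal convolutions with multiples of 1 + |y|^2, differentiated at s = 0. *)
theory Submission imports Defs begin

section \<open>Smooth functions\<close>

text \<open>The power of tau in phi is forced. Along a ray, the energy of u/phi has the weight
  phi(r)^2 r^(n-1), and this has to become \<kappa> rho^(n-1) in the new radius; that leaves only
  the exponent \<open>be\<close>. Radial derivatives are then carried over without loss, while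
  tangential ones shrink by the ratio \<kappa>/tau, so equality survives for radial functions. In
  fact phi solves the Hardy equation with the additional potential be (1 - be) / (tau^2 |x|^2). For
  \<kappa> = 1/(n-2) this potential is zero, and pulled-back Talenti functions are almost extremal.
  For \<kappa> = a < 1/(n-2) it is a real loss near the origin; but where |x| is close to D, tau is
  close to \<kappa>, the radial map is nearly conformal, and functions concentrating there lose
  nothing in the limit.

  In the Sobolev inequality the substitution is f = |z|^(-2/(n-2)): then 1/f^n is the critical power
  of z, and |grad f|^2 / f^n is 4/(n-2)^2 times |grad z|^2. Before differentiation the exponent is n
  - 1, and the derivative raises it to n. The quadratic 1 + |x|^2 corresponds to the Talenti
  function.\<close>

fun times_cont_differentiable_on :: "nat \<Rightarrow> 'a::real_normed_vector set \<Rightarrow> ('a \<Rightarrow> real) \<Rightarrow> bool" where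
  "times_cont_differentiable_on 0 S f \<longleftrightarrow> continuous_on S f"
| "times_cont_differentiable_on (Suc k) S f \<longleftrightarrow>
     (\<forall>x\<in>S. f differentiable (at x)) \<and>
     (\<forall>v. times_cont_differentiable_on k S (\<lambda>x. frechet_derivative f (at x) v))"

text \<open>\<open>smooth\<close> speaks of the whole space, but the powers, logarithms and
  exponentials from which functions are built here are smooth only on a half-line or away from the
  origin. They are treated on an open set and extended by zero at the end.\<close>

definition smooth_on :: "'a::real_normed_vector set \<Rightarrow> ('a \<Rightarrow> real) \<Rightarrow> bool" where
  "smooth_on S f \<longleftrightarrow> (\<forall>k. times_cont_differentiable_on k S f)"

lemma times_cont_differentiable_on_UNIV:
  "times_cont_differentiable_on k UNIV f \<longleftrightarrow> times_cont_differentiable k f"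
  by (induction k arbitrary: f) auto

lemma smooth_on_UNIV: "smooth_on UNIV f \<longleftrightarrow> smooth f"
  by (simp add: smooth_on_def smooth_def times_cont_differentiable_on_UNIV)

lemma times_cont_differentiable_on_continuous_on:
  "times_cont_differentiable_on k S f \<Longrightarrow> continuous_on S f"
  by (cases k) (auto intro!: continuous_at_imp_continuous_on differentiable_imp_continuous_within)

lemma times_cont_differentiable_on_SucD:
  "times_cont_differentiable_on (Suc k) S f \<Longrightarrow> times_cont_differentiable_on k S f"
proof (induction k arbitrary: f)
  case 0
  then show ?case by (simp del: times_cont_differentiable_on.simps(2) add: times_cont_differentiable_on_continuous_on)
next
  case (Suc k)
  then show ?case by (metis times_cont_differentiable_on.simps(2))
qed

text \<open>Since \<open>S\<close> is open, derivatives at its points depend on the values in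
  \<open>S\<close> alone; the induction passes from the functions to their directional
  derivatives.\<close>

lemma times_cont_differentiable_on_cong:
  assumes "open S" "\<And>x. x \<in> S \<Longrightarrow> f x = g x" "times_cont_differentiable_on k S f"
  shows "times_cont_differentiable_on k S g"
  using assms(2,3)
proof (induction k arbitrary: f g)
  case 0
  then show ?case by (simp cong: continuous_on_cong)
next
  case (Suc k)
  have D: "(g has_derivative frechet_derivative f (at x)) (at x)" if "x \<in> S" for x
  proof (rule has_derivative_transform_within_open[OF _ \<open>open S\<close> that])
    show "(f has_derivative frechet_derivative f (at x)) (at x)"
      using Suc.prems(2) that by (simp add: frechet_derivative_works)
  qed (use Suc.prems in auto)
  then have eq: "frechet_derivative g (at x) = frechet_derivative f (at x)" if "x \<in> S" for x
    using that frechet_derivative_at by metis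
  have "times_cont_differentiable_on k S (\<lambda>x. frechet_derivative g (at x) v)" for v
    by (rule Suc.IH[where f = "\<lambda>x. frechet_derivative f (at x) v"]) (use Suc.prems(2) eq in auto)
  then show ?case
    using D by (auto simp: differentiable_def)
qed

text \<open>Replaces \<open>frechet_derivative\<close> in the recursive clause by any explicit
  formula for the derivative, which is how the closure properties are proved by induction on the
  order.\<close>

lemma times_cont_differentiable_on_SucI:
  assumes "open S" "\<And>x. x \<in> S \<Longrightarrow> (f has_derivative f' x) (at x)"
    "\<And>v. times_cont_differentiable_on k S (\<lambda>x. f' x v)"
  shows "times_cont_differentiable_on (Suc k) S f"
proof -
  have "frechet_derivative f (at x) = f' x" if "x \<in> S" for x
    using assms(2)[OF that] frechet_derivative_at by metis
  then have "times_cont_differentiable_on k S (\<lambda>x. frechet_derivative f (at x) v)" for v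
    by (intro times_cont_differentiable_on_cong[OF \<open>open S\<close> _ assms(3)]) auto
  then show ?thesis
    using assms(2) by (auto simp: differentiable_def)
qed

lemma times_cont_differentiable_on_SucD_has_derivative:
  "times_cont_differentiable_on (Suc k) S f \<Longrightarrow> x \<in> S \<Longrightarrow>
    (f has_derivative frechet_derivative f (at x)) (at x)"
  by (simp add: frechet_derivative_works)

lemma times_cont_differentiable_on_const:
  "times_cont_differentiable_on k S (\<lambda>x. c)"
  by (induction k arbitrary: c) (auto simp: frechet_derivative_const)

lemma times_cont_differentiable_on_add:
  assumes "open S"
  shows "times_cont_differentiable_on k S f \<Longrightarrow> times_cont_differentiable_on k S g \<Longrightarrow>
    times_cont_differentiable_on k S (\<lambda>x. f x + g x)"
proof (induction k arbitrary: f g)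
  case 0
  then show ?case by (simp add: continuous_on_add)
next
  case (Suc k)
  show ?case
  proof (rule times_cont_differentiable_on_SucI[OF \<open>open S\<close>])
    show "((\<lambda>x. f x + g x) has_derivative
        (\<lambda>v. frechet_derivative f (at x) v + frechet_derivative g (at x) v)) (at x)" if "x \<in> S" for x
      using Suc.prems that by (intro has_derivative_add) (auto simp: frechet_derivative_works)
  qed (use Suc in auto)
qed

lemma times_cont_differentiable_on_mult:
  assumes "open S"
  shows "times_cont_differentiable_on k S f \<Longrightarrow> times_cont_differentiable_on k S g \<Longrightarrow>
    times_cont_differentiable_on k S (\<lambda>x. f x * g x)"
proof (induction k arbitrary: f g)
  case 0
  then show ?case by (simp add: continuous_on_mult)
next
  case (Suc k)
  show ?case
  proof (rule times_cont_differentiable_on_SucI[OF \<open>open S\<close>])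
    show "((\<lambda>x. f x * g x) has_derivative
        (\<lambda>v. f x * frechet_derivative g (at x) v + frechet_derivative f (at x) v * g x)) (at x)" if "x \<in> S" for x
      using Suc.prems that by (intro has_derivative_mult) (auto simp: frechet_derivative_works)
    show "times_cont_differentiable_on k S
        (\<lambda>x. f x * frechet_derivative g (at x) v + frechet_derivative f (at x) v * g x)" for v
      using Suc.prems Suc.IH times_cont_differentiable_on_SucD[OF Suc.prems(1)] times_cont_differentiable_on_SucD[OF Suc.prems(2)]
      by (intro times_cont_differentiable_on_add[OF \<open>open S\<close>] Suc.IH) auto
  qed
qed

lemma times_cont_differentiable_on_sum:
  assumes "open S" "\<And>i. i \<in> I \<Longrightarrow> times_cont_differentiable_on k S (f i)"
  shows "times_cont_differentiable_on k S (\<lambda>x. \<Sum>i\<in>I. f i x)"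
  using assms(2)
  by (induction I rule: infinite_finite_induct)
     (auto intro: times_cont_differentiable_on_const times_cont_differentiable_on_add[OF \<open>open S\<close>])

text \<open>The chain rule in coordinates: the derivative of \<open>f (g x)\<close> along
  \<open>v\<close> is a sum of products of a derivative of a coordinate of \<open>g\<close> and a
  partial derivative of \<open>f\<close> at \<open>g x\<close>, and the latter is again a
  composition, of lower order. Smoothness of \<open>g\<close> is asked coordinatewise because the
  notion is defined for real-valued functions.\<close>

lemma times_cont_differentiable_on_compose:
  fixes f :: "'b::euclidean_space \<Rightarrow> real" and g :: "'a::real_normed_vector \<Rightarrow> 'b"
  assumes "open S" "open T" "\<And>x. x \<in> S \<Longrightarrow> g x \<in> T"
  shows "times_cont_differentiable_on k T f \<Longrightarrow>
    (\<And>b. b \<in> Basis \<Longrightarrow> times_cont_differentiable_on k S (\<lambda>x. g x \<bullet> b)) \<Longrightarrow>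
    times_cont_differentiable_on k S (\<lambda>x. f (g x))"
proof (induction k arbitrary: f)
  case 0
  have "continuous_on S g"
    using 0 continuous_on_componentwise[of S g] by auto
  then show ?case
    using 0 assms(3) by (auto intro: continuous_on_compose2)
next
  case (Suc k)
  define G where "G x v = (\<Sum>b\<in>Basis. frechet_derivative (\<lambda>x. g x \<bullet> b) (at x) v *\<^sub>R b)" for x v
  have G: "(g has_derivative G x) (at x)" if "x \<in> S" for x
  proof -
    have "((\<lambda>x. g x \<bullet> b) has_derivative (\<lambda>v. G x v \<bullet> b)) (at x)" if b: "b \<in> Basis" for b
    proof -
      have "(\<lambda>v. G x v \<bullet> b) = frechet_derivative (\<lambda>x. g x \<bullet> b) (at x)"
        using b by (simp add: G_def inner_sum_left inner_Basis if_distrib sum.If_cases cong: if_cong)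
      then show ?thesis
        using times_cont_differentiable_on_SucD_has_derivative[OF Suc.prems(2)[OF b] \<open>x \<in> S\<close>] by simp
    qed
    then show ?thesis
      using has_derivative_componentwise_within[of g "G x" x UNIV] by simp
  qed
  have lin: "frechet_derivative f (at (g x)) (G x v) =
      (\<Sum>b\<in>Basis. frechet_derivative (\<lambda>x. g x \<bullet> b) (at x) v * frechet_derivative f (at (g x)) b)"
    if "x \<in> S" for x v
  proof -
    have "linear (frechet_derivative f (at (g x)))"
      using Suc.prems(1) assms(3)[OF that] by (auto intro: linear_frechet_derivative)
    then show ?thesis
      by (simp add: G_def linear_sum linear_cmul)
  qed
  show ?case
  proof (rule times_cont_differentiable_on_SucI[OF \<open>open S\<close>])
    show "((\<lambda>x. f (g x)) has_derivative (\<lambda>v. frechet_derivative f (at (g x)) (G x v))) (at x)"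
      if "x \<in> S" for x
      using has_derivative_compose[OF G[OF that], of f]
        times_cont_differentiable_on_SucD_has_derivative[OF Suc.prems(1) assms(3)[OF that]]
      by simp
    show "times_cont_differentiable_on k S (\<lambda>x. frechet_derivative f (at (g x)) (G x v))" for v
    proof (rule times_cont_differentiable_on_cong[OF \<open>open S\<close> lin[symmetric]])
      show "times_cont_differentiable_on k S (\<lambda>x. \<Sum>b\<in>Basis.
        frechet_derivative (\<lambda>x. g x \<bullet> b) (at x) v * frechet_derivative f (at (g x)) b)"
      proof (intro times_cont_differentiable_on_sum times_cont_differentiable_on_mult \<open>open S\<close>)
        fix b :: 'b assume b: "b \<in> Basis"
        show "times_cont_differentiable_on k S (\<lambda>x. frechet_derivative (\<lambda>x. g x \<bullet> b) (at x) v)"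
          using Suc.prems(2)[OF b] by simp
        show "times_cont_differentiable_on k S (\<lambda>x. frechet_derivative f (at (g x)) b)"
        proof (rule Suc.IH)
          show "times_cont_differentiable_on k T (\<lambda>y. frechet_derivative f (at y) b)"
            using Suc.prems(1) by simp
          show "times_cont_differentiable_on k S (\<lambda>x. g x \<bullet> b)" if "b \<in> Basis" for b
            using Suc.prems(2)[OF that] by (rule times_cont_differentiable_on_SucD)
        qed
      qed
    qed
  qed
qed

lemma times_cont_differentiable_on_union:
  "open S \<Longrightarrow> open T \<Longrightarrow> times_cont_differentiable_on k S f \<Longrightarrow> times_cont_differentiable_on k T f
    \<Longrightarrow> times_cont_differentiable_on k (S \<union> T) f"
proof (induction k arbitrary: f)
  case 0
  then show ?case by (simp add: continuous_on_open_Un)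
qed auto

lemma times_cont_differentiable_on_subset:
  "times_cont_differentiable_on k T f \<Longrightarrow> S \<subseteq> T \<Longrightarrow> times_cont_differentiable_on k S f"
  by (induction k arbitrary: f) (auto intro: continuous_on_subset)

lemma smooth_on_cong:
  "open S \<Longrightarrow> (\<And>x. x \<in> S \<Longrightarrow> f x = g x) \<Longrightarrow> smooth_on S f \<Longrightarrow> smooth_on S g"
  unfolding smooth_on_def using times_cont_differentiable_on_cong by blast

lemma smooth_onI:
  assumes "open S" "\<And>x. x \<in> S \<Longrightarrow> (f has_derivative f' x) (at x)" "\<And>v. smooth_on S (\<lambda>x. f' x v)"
  shows "smooth_on S f"
  unfolding smooth_on_def
proof
  fix k
  have "times_cont_differentiable_on (Suc k) S f"
    using assms by (intro times_cont_differentiable_on_SucI[of S f f']) (auto simp: smooth_on_def)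
  then show "times_cont_differentiable_on k S f"
    by (rule times_cont_differentiable_on_SucD)
qed

lemma smooth_on_const [intro, simp]: "smooth_on S (\<lambda>x. c)"
  by (simp add: smooth_on_def times_cont_differentiable_on_const)

lemma smooth_on_add: "open S \<Longrightarrow> smooth_on S f \<Longrightarrow> smooth_on S g \<Longrightarrow> smooth_on S (\<lambda>x. f x + g x)"
  by (simp add: smooth_on_def times_cont_differentiable_on_add)

lemma smooth_on_mult: "open S \<Longrightarrow> smooth_on S f \<Longrightarrow> smooth_on S g \<Longrightarrow> smooth_on S (\<lambda>x. f x * g x)"
  by (simp add: smooth_on_def times_cont_differentiable_on_mult)

lemma smooth_on_diff:
  assumes "open S" "smooth_on S f" "smooth_on S g" shows "smooth_on S (\<lambda>x. f x - g x)"
  using smooth_on_add[OF assms(1,2) smooth_on_mult[OF assms(1) smooth_on_const[where c = "-1"] assms(3)]]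
  by simp

lemma smooth_on_compose:
  fixes f :: "'b::euclidean_space \<Rightarrow> real"
  assumes "open S" "open T" "\<And>x. x \<in> S \<Longrightarrow> g x \<in> T" "smooth_on T f"
    "\<And>b. b \<in> Basis \<Longrightarrow> smooth_on S (\<lambda>x. g x \<bullet> b)"
  shows "smooth_on S (\<lambda>x. f (g x))"
  unfolding smooth_on_def
proof
  show "times_cont_differentiable_on k S (\<lambda>x. f (g x))" for k
    by (rule times_cont_differentiable_on_compose[OF assms(1-3)])
       (use assms(4,5) in \<open>auto simp: smooth_on_def\<close>)
qed

lemma smooth_on_compose_real:
  fixes f :: "real \<Rightarrow> real"
  assumes "open S" "open T" "\<And>x. x \<in> S \<Longrightarrow> g x \<in> T" "smooth_on T f" "smooth_on S g"
  shows "smooth_on S (\<lambda>x. f (g x))"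
  using smooth_on_compose[OF assms(1-4)] assms(5) by simp

lemma smooth_on_union:
  "open S \<Longrightarrow> open T \<Longrightarrow> smooth_on S f \<Longrightarrow> smooth_on T f \<Longrightarrow> smooth_on (S \<union> T) f"
  by (simp add: smooth_on_def times_cont_differentiable_on_union)

lemma smooth_on_subset: "smooth_on T f \<Longrightarrow> S \<subseteq> T \<Longrightarrow> smooth_on S f"
  by (meson smooth_on_def times_cont_differentiable_on_subset)

text \<open>\<open>S\<close> and the complement of \<open>K\<close> are open and cover the space,
  and \<open>f\<close> is smooth on each of them.\<close>

lemma smooth_on_extend:
  assumes "open S" "smooth_on S f" "closed K" "K \<subseteq> S" "\<And>x. x \<notin> K \<Longrightarrow> f x = 0"
  shows "smooth f"
proof -
  have "smooth_on (- K) f"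
    by (rule smooth_on_cong[where f = "\<lambda>_. 0"]) (use assms in auto)
  then have "smooth_on (S \<union> - K) f"
    using assms by (intro smooth_on_union) auto
  moreover have "S \<union> - K = UNIV" using assms by auto
  ultimately show ?thesis by (simp add: smooth_on_UNIV)
qed

lemma smooth_on_bounded_linear:
  assumes "open S" "bounded_linear f" shows "smooth_on S f"
  by (rule smooth_onI[OF assms(1), where f' = "\<lambda>x. f"])
     (use assms in \<open>auto intro: bounded_linear_imp_has_derivative\<close>)

lemma smooth_on_ident: "open S \<Longrightarrow> smooth_on S (\<lambda>x::real. x)"
  by (rule smooth_on_bounded_linear) (auto simp: bounded_linear_ident)

lemma smooth_on_inner_const: "open S \<Longrightarrow> smooth_on S (\<lambda>x::'a::real_inner. x \<bullet> b)"
  by (rule smooth_on_bounded_linear) (auto simp: bounded_linear_inner_left)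

lemma smooth_on_inner_self: "open S \<Longrightarrow> smooth_on S (\<lambda>x::'a::real_inner. x \<bullet> x)"
proof (rule smooth_onI)
  show "((\<lambda>x. x \<bullet> x) has_derivative (\<lambda>v. 2 * (x \<bullet> v))) (at x)" for x :: 'a
    by (auto intro!: derivative_eq_intros simp: inner_commute)
  show "smooth_on S (\<lambda>x. 2 * (x \<bullet> v))" if "open S" for v :: 'a
    using that by (intro smooth_on_mult smooth_on_inner_const) auto
qed

lemma smooth_on_real_derivI:
  fixes f :: "real \<Rightarrow> real"
  assumes "open S" "\<And>x. x \<in> S \<Longrightarrow> (f has_real_derivative f' x) (at x)" "smooth_on S f'"
  shows "smooth_on S f"
proof (rule smooth_onI[OF assms(1)])
  show "(f has_derivative (\<lambda>v. f' x * v)) (at x)" if "x \<in> S" for x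
    using assms(2)[OF that] by (simp add: has_field_derivative_def)
  show "smooth_on S (\<lambda>x. f' x * v)" for v
    using assms by (intro smooth_on_mult) auto
qed

lemma smooth_on_exp: "smooth_on S (exp :: real \<Rightarrow> real)"
proof -
  have "times_cont_differentiable_on k UNIV (exp :: real \<Rightarrow> real)" for k
  proof (induction k)
    case (Suc k)
    show ?case
    proof (rule times_cont_differentiable_on_SucI[where f' = "\<lambda>x v. exp x * v"])
      show "times_cont_differentiable_on k UNIV (\<lambda>x::real. exp x * v)" for v
        by (intro times_cont_differentiable_on_mult Suc times_cont_differentiable_on_const) auto
    qed (auto intro!: derivative_eq_intros)
  qed (auto intro: continuous_intros)
  then show ?thesis
    by (meson smooth_on_def smooth_on_subset top_greatest)
qed

text \<open>The exponent stays free in the induction, since the derivative of a power is a multiple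
  of another power.\<close>

lemma smooth_on_powr: "smooth_on {0<..} (\<lambda>x::real. x powr p)"
proof -
  have "times_cont_differentiable_on k {0<..} (\<lambda>x::real. x powr p)" for k
  proof (induction k arbitrary: p)
    case (Suc k)
    show ?case
    proof (rule times_cont_differentiable_on_SucI[where f' = "\<lambda>x v. p * x powr (p - 1) * v"])
      show "times_cont_differentiable_on k {0<..} (\<lambda>x::real. p * x powr (p - 1) * v)" for v
        by (intro times_cont_differentiable_on_mult Suc times_cont_differentiable_on_const) auto
      show "((\<lambda>x. x powr p) has_derivative (\<lambda>v. p * x powr (p - 1) * v)) (at x)" if "x \<in> {0<..}" for x
        using has_real_derivative_powr[of x p] that by (simp add: has_field_derivative_def)
    qed auto
  qed (auto intro!: continuous_intros)
  then show ?thesis by (simp add: smooth_on_def)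
qed

lemma smooth_on_ln: "smooth_on {0<..} (ln :: real \<Rightarrow> real)"
proof (rule smooth_on_real_derivI)
  show "smooth_on {0<..} (\<lambda>x::real. x powr (-1))" by (rule smooth_on_powr)
  show "(ln has_real_derivative x powr (-1)) (at x)" if "x \<in> {0<..}" for x :: real
    using that by (auto intro!: derivative_eq_intros simp: powr_minus divide_inverse)
qed auto

lemma smooth_on_divide:
  assumes "open S" "smooth_on S f" "smooth_on S g" "\<And>x. x \<in> S \<Longrightarrow> g x > 0"
  shows "smooth_on S (\<lambda>x. f x / g x)"
proof -
  have "smooth_on S (\<lambda>x. f x * g x powr (-1))"
    by (intro smooth_on_mult smooth_on_compose_real[OF assms(1) open_greaterThan _ smooth_on_powr])
       (use assms in auto)
  then show ?thesis
    by (rule smooth_on_cong[OF assms(1), rotated])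
       (use assms(4) in \<open>fastforce simp: powr_minus divide_inverse\<close>)
qed

section \<open>Smooth transition functions from exp(-1/x)\<close>

text \<open>\<open>flat 0\<close> is the standard function exp(-1/x) that vanishes to infinite order
  at 0. The factors x^(-k) make the family closed under differentiation up to linear combinations,
  so that one induction reaches all orders.\<close>

definition flat :: "nat \<Rightarrow> real \<Rightarrow> real" where
  "flat k x = (if x \<le> 0 then 0 else inverse x ^ k * exp (- inverse x))"

lemma flat_LIM_0: "((\<lambda>x. flat k x) \<longlongrightarrow> 0) (at 0)"
proof -
  have "((\<lambda>y::real. y ^ k / exp y) \<longlongrightarrow> 0) at_top"
    by (rule tendsto_power_div_exp_0[of k])
  then have "((\<lambda>x. inverse x ^ k / exp (inverse x)) \<longlongrightarrow> 0) (at_right (0::real))"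
    by (rule filterlim_compose[OF _ filterlim_inverse_at_top_right])
  then have "(flat k \<longlongrightarrow> 0) (at_right 0)"
    by (rule Lim_transform_eventually)
       (auto simp: eventually_at_filter flat_def exp_minus divide_inverse)
  moreover have "(flat k \<longlongrightarrow> 0) (at_left 0)"
    by (rule Lim_transform_eventually[OF tendsto_const]) (auto simp: eventually_at_filter flat_def)
  ultimately show ?thesis
    by (simp add: filterlim_split_at)
qed

lemma flat_has_real_derivative:
  "(flat k has_real_derivative flat (k + 2) x - real k * flat (k + 1) x) (at x)"
proof -
  consider "x > 0" | "x < 0" | "x = 0" by linarith
  then show ?thesis
  proof cases
    case 1
    have "((\<lambda>x. inverse x ^ k * exp (- inverse x)) has_real_derivative
        flat (k + 2) x - real k * flat (k + 1) x) (at x)"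
    proof (cases k)
      case 0
      then show ?thesis
        using 1 by (auto intro!: derivative_eq_intros simp: flat_def field_simps power2_eq_square)
    next
      case (Suc j)
      have inv: "((\<lambda>x. inverse x) has_real_derivative - (inverse x ^ 2)) (at x)"
        using 1 DERIV_inverse[of x] by (simp add: numeral_2_eq_2)
      have "((\<lambda>x. exp (- inverse x)) has_real_derivative exp (- inverse x) * inverse x ^ 2) (at x)"
        using DERIV_fun_exp[OF DERIV_minus[OF inv]] by simp
      with inv have "((\<lambda>x. inverse x ^ Suc j * exp (- inverse x)) has_real_derivative
          (1 + real j) * (- (inverse x ^ 2) * inverse x ^ j) * exp (- inverse x)
          + exp (- inverse x) * inverse x ^ 2 * inverse x ^ Suc j) (at x)"
        using DERIV_mult[OF DERIV_power_Suc] by fastforce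
      then show ?thesis
        using 1 Suc by (simp add: flat_def power2_eq_square algebra_simps)
    qed
    then show ?thesis
      by (rule DERIV_cong_ev[THEN iffD1, rotated -1])
         (use 1 in \<open>auto simp: flat_def intro!: eventually_nhds_in_open[of "{0<..}", THEN eventually_mono]\<close>)
  next
    case 2
    have "((\<lambda>x. 0) has_real_derivative flat (k + 2) x - real k * flat (k + 1) x) (at x)"
      using 2 by (auto simp: flat_def)
    then show ?thesis
      by (rule DERIV_cong_ev[THEN iffD1, rotated -1])
         (use 2 in \<open>auto simp: flat_def intro!: eventually_nhds_in_open[of "{..<0}", THEN eventually_mono]\<close>)
  next
    case 3
    \<comment> \<open>At the origin the difference quotient of \<open>flat k\<close> is
      \<open>flat (Suc k)\<close> itself.\<close>
    have "((\<lambda>h. (flat k (0 + h) - flat k 0) / h) \<longlongrightarrow> 0) (at 0)"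
      by (rule Lim_transform_eventually[OF flat_LIM_0[of "Suc k"]])
         (auto simp: eventually_at_filter flat_def divide_inverse)
    then show ?thesis
      using 3 by (simp add: DERIV_def flat_def)
  qed
qed

lemma smooth_on_flat: "smooth_on UNIV (flat k)"
proof -
  have "times_cont_differentiable_on m UNIV (flat k)" for m
  proof (induction m arbitrary: k)
    case 0
    show ?case
      using flat_has_real_derivative by (auto intro!: DERIV_isCont continuous_at_imp_continuous_on)
  next
    case (Suc m)
    show ?case
    proof (rule times_cont_differentiable_on_SucI[where f' = "\<lambda>x v. (flat (k + 2) x + (- real k) * flat (k + 1) x) * v"])
      show "times_cont_differentiable_on m UNIV (\<lambda>x. (flat (k + 2) x + (- real k) * flat (k + 1) x) * v)" for v
        by (intro times_cont_differentiable_on_mult times_cont_differentiable_on_add Suc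
            times_cont_differentiable_on_const) auto
      show "(flat k has_derivative (\<lambda>v. (flat (k + 2) x + (- real k) * flat (k + 1) x) * v)) (at x)" for x
        using flat_has_real_derivative[of k x] by (simp add: has_field_derivative_def)
    qed auto
  qed
  then show ?thesis by (simp add: smooth_on_def)
qed

text \<open>The first bump vanishes up to 1 and the second from 2 on, so the quotient climbs from 0
  to 1 between these points. At every \<open>s\<close> one of the two is positive, which keeps the
  denominator away from 0.\<close>

definition smooth_step :: "real \<Rightarrow> real" where
  "smooth_step s = flat 0 (s - 1) / (flat 0 (s - 1) + flat 0 (2 - s))"

lemma flat_0_pos: "x > 0 \<Longrightarrow> flat 0 x > 0" and flat_0_nonneg: "flat 0 x \<ge> 0"
  by (auto simp: flat_def)

lemma smooth_step_denom: "flat 0 (s - 1) + flat 0 (2 - s) > 0"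
  using flat_0_pos[of "s - 1"] flat_0_pos[of "2 - s"] flat_0_nonneg[of "s - 1"] flat_0_nonneg[of "2 - s"]
  by (cases "s > 1") auto

lemma smooth_step_eq_0: "s \<le> 1 \<Longrightarrow> smooth_step s = 0"
  and smooth_step_eq_1: "s \<ge> 2 \<Longrightarrow> smooth_step s = 1"
  and smooth_step_nonneg: "smooth_step s \<ge> 0"
  and smooth_step_le_1: "smooth_step s \<le> 1"
  using smooth_step_denom[of s] flat_0_nonneg[of "s - 1"] flat_0_nonneg[of "2 - s"]
  by (auto simp: smooth_step_def flat_def)

lemma smooth_on_smooth_step: "smooth_on UNIV smooth_step"
  unfolding smooth_step_def[abs_def]
  by (intro smooth_on_divide smooth_on_add smooth_on_compose_real[OF open_UNIV open_UNIV _ smooth_on_flat]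
      smooth_on_diff smooth_on_ident smooth_step_denom) auto

lemma smooth_on_has_derivative:
  "smooth_on S f \<Longrightarrow> x \<in> S \<Longrightarrow> (f has_derivative frechet_derivative f (at x)) (at x)"
  using times_cont_differentiable_on_SucD_has_derivative[of 0 S f x] by (simp only: smooth_on_def)

lemma smooth_on_frechet_derivative:
  "smooth_on S f \<Longrightarrow> smooth_on S (\<lambda>x. frechet_derivative f (at x) v)"
  unfolding smooth_on_def by (metis times_cont_differentiable_on.simps(2))

lemma smooth_on_continuous_on: "smooth_on S f \<Longrightarrow> continuous_on S f"
  by (metis smooth_on_def times_cont_differentiable_on.simps(1))

section \<open>Brunn--Minkowski inequalities for infimal convolutions\<close>

text \<open>Tonelli's theorem for the region between 0 and the graph of \<open>u\<close>.\<close>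

lemma nn_integral_layer_cake:
  fixes u :: "'a::euclidean_space \<Rightarrow> real"
  assumes [measurable]: "u \<in> borel_measurable borel" and nn: "\<And>x. u x \<ge> 0"
  shows "(\<integral>\<^sup>+x. ennreal (u x) \<partial>lborel)
    = (\<integral>\<^sup>+l. indicator {0<..} l * emeasure lborel {x. u x > l} \<partial>lborel)"
proof -
  have "(\<integral>\<^sup>+x. ennreal (u x) \<partial>lborel) = (\<integral>\<^sup>+x. (\<integral>\<^sup>+l. indicator {(x, l). 0 < l \<and> l < u x} (x, l) \<partial>lborel) \<partial>lborel)"
  proof (rule nn_integral_cong)
    fix x
    have "(\<integral>\<^sup>+l. indicator {(x, l). 0 < l \<and> l < u x} (x, l) \<partial>lborel) = (\<integral>\<^sup>+l. indicator {0<..<u x} l \<partial>lborel)"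
      by (intro nn_integral_cong) (auto split: split_indicator)
    then show "ennreal (u x) = (\<integral>\<^sup>+l. indicator {(x, l). 0 < l \<and> l < u x} (x, l) \<partial>lborel)"
      using nn[of x] by simp
  qed
  also have "\<dots> = (\<integral>\<^sup>+l. (\<integral>\<^sup>+x. indicator {(x, l). 0 < l \<and> l < u x} (x, l) \<partial>lborel) \<partial>lborel)"
    by (rule lborel_pair.Fubini'[symmetric]) (simp add: case_prod_beta')
  also have "\<dots> = (\<integral>\<^sup>+l. indicator {0<..} l * emeasure lborel {x. u x > l} \<partial>lborel)"
  proof (rule nn_integral_cong)
    fix l :: real
    have "(\<integral>\<^sup>+x. indicator {(x, l). 0 < l \<and> l < u x} (x, l) \<partial>lborel)
      = (\<integral>\<^sup>+x. indicator {0<..} l * indicator {x. u x > l} x \<partial>lborel)"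
      by (intro nn_integral_cong) (auto split: split_indicator)
    also have "\<dots> = indicator {0<..} l * emeasure lborel {x. u x > l}"
      by (subst nn_integral_cmult) auto
    finally show "(\<integral>\<^sup>+x. indicator {(x, l). 0 < l \<and> l < u x} (x, l) \<partial>lborel)
        = indicator {0<..} l * emeasure lborel {x. u x > l}" .
  qed
  finally show ?thesis .
qed

text \<open>A set of reals need not have a largest element. Cutting it at its own points and taking
  the supremum takes the place of an inner approximation by compact sets in the proof of
  Brunn-Minkowski.\<close>

lemma emeasure_lborel_eq_SUP_atMost:
  fixes A :: "real set"
  assumes A [measurable]: "A \<in> sets borel" and ne: "A \<noteq> {}"
  shows "emeasure lborel A = (SUP a\<in>A. emeasure lborel (A \<inter> {..a}))"
proof (rule antisym)
  have step: "emeasure lborel A \<le> (SUP a\<in>A. emeasure lborel (A \<inter> {..a}))"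
    if inc: "incseq (\<lambda>n::nat. A \<inter> {..c n})" and U: "emeasure lborel A \<le> emeasure lborel (\<Union>n. A \<inter> {..c n})"
      and c: "\<And>n. \<exists>a\<in>A. c n \<le> a" for c :: "nat \<Rightarrow> real"
  proof -
    have "emeasure lborel (\<Union>n. A \<inter> {..c n}) = (SUP n. emeasure lborel (A \<inter> {..c n}))"
      by (rule SUP_emeasure_incseq[symmetric]) (use inc in auto)
    also have "\<dots> \<le> (SUP a\<in>A. emeasure lborel (A \<inter> {..a}))"
    proof (rule SUP_mono)
      fix n show "\<exists>a\<in>A. emeasure lborel (A \<inter> {..c n}) \<le> emeasure lborel (A \<inter> {..a})"
      proof -
        obtain a where "a \<in> A" "c n \<le> a" using c by auto
        then show ?thesis by (intro bexI[of _ a] emeasure_mono) auto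
      qed
    qed
    finally show ?thesis using U by simp
  qed
  show "emeasure lborel A \<le> (SUP a\<in>A. emeasure lborel (A \<inter> {..a}))"
  proof (cases "bdd_above A")
    case False
    show ?thesis
    proof (rule step[of real])
      show "emeasure lborel A \<le> emeasure lborel (\<Union>n. A \<inter> {..real n})"
        using real_arch_simple by (intro emeasure_mono) auto
      show "\<exists>a\<in>A. real n \<le> a" for n
        using False by (meson bdd_above.I linear)
    qed (auto simp: incseq_def)
  next
    case True
    define S where "S = Sup A"
    have S: "a \<le> S" if "a \<in> A" for a
      unfolding S_def using True that by (rule cSup_upper[rotated])
    show ?thesis
    \<comment> \<open>The cut points approach \<open>S\<close> strictly from below. The point
      \<open>S\<close> may belong to the set, but it has measure zero.\<close>
    proof (rule step[of "\<lambda>n. S - 1 / real (Suc n)"])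
      have "emeasure lborel A \<le> emeasure lborel (A \<inter> {..<S} \<union> {S})"
        using S by (intro emeasure_mono) fastforce+
      also have "\<dots> \<le> emeasure lborel (A \<inter> {..<S}) + emeasure lborel {S}"
        by (intro emeasure_subadditive) auto
      also have "\<dots> = emeasure lborel (A \<inter> {..<S})" by simp
      also have "\<dots> \<le> emeasure lborel (\<Union>n. A \<inter> {..S - 1 / real (Suc n)})"
      proof (intro emeasure_mono subsetI)
        fix x assume x: "x \<in> A \<inter> {..<S}"
        then obtain n where "inverse (real (Suc n)) < S - x"
          using reals_Archimedean[of "S - x"] by auto
        then have "x \<le> S - 1 / real (Suc n)" by (simp add: inverse_eq_divide)
        with x show "x \<in> (\<Union>n. A \<inter> {..S - 1 / real (Suc n)})" by blast
      qed auto
      finally show "emeasure lborel A \<le> emeasure lborel (\<Union>n. A \<inter> {..S - 1 / real (Suc n)})" .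
      show "\<exists>a\<in>A. S - 1 / real (Suc n) \<le> a" for n
        using less_cSupD[OF ne, of "S - 1 / real (Suc n)"] unfolding S_def[symmetric] by (auto intro: less_imp_le)
    qed (auto simp: incseq_def frac_le intro: order_trans)
  qed
  show "(SUP a\<in>A. emeasure lborel (A \<inter> {..a})) \<le> emeasure lborel A"
    by (intro SUP_least emeasure_mono) auto
qed

text \<open>Mirror image of the preceding lemma under x -> -x, for the summand that is cut from the
  other side.\<close>

lemma emeasure_lborel_eq_SUP_atLeast:
  fixes A :: "real set"
  assumes A [measurable]: "A \<in> sets borel" and ne: "A \<noteq> {}"
  shows "emeasure lborel A = (SUP a\<in>A. emeasure lborel (A \<inter> {a..}))"
proof -
  have refl: "emeasure lborel B = emeasure lborel (uminus -` B)" if "B \<in> sets borel" for B :: "real set"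
    using that by (subst lborel_distr_uminus[symmetric], subst emeasure_distr) auto
  have [measurable]: "uminus -` A \<in> sets borel"
    using measurable_sets_borel[of uminus borel A] by simp
  have "emeasure lborel A = (SUP a\<in>uminus -` A. emeasure lborel (uminus -` A \<inter> {..a}))"
  proof -
    obtain x where "x \<in> A" using ne by auto
    then have "- x \<in> uminus -` A" by simp
    then have "uminus -` A \<noteq> {}" by blast
    then show ?thesis
      by (subst refl, simp, subst emeasure_lborel_eq_SUP_atMost) auto
  qed
  also have "\<dots> = (SUP a\<in>uminus -` A. emeasure lborel (A \<inter> {- a..}))"
  proof (intro SUP_cong HOL.refl)
    fix a
    have "uminus -` A \<inter> {..a} = uminus -` (A \<inter> {- a..})" by auto
    then show "emeasure lborel (uminus -` A \<inter> {..a}) = emeasure lborel (A \<inter> {- a..})"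
      using refl[of "A \<inter> {- a..}"] by simp
  qed
  also have "\<dots> = (SUP a\<in>A. emeasure lborel (A \<inter> {a..}))"
  proof -
    have "A = uminus ` (uminus -` A)" by force
    then show ?thesis by (metis (no_types, lifting) SUP_cong SUP_image comp_apply image_image)
  qed
  finally show ?thesis .
qed

text \<open>Fix \<open>a\<close> in \<open>A\<close> and \<open>b\<close> in \<open>B\<close>. The
  part of \<open>A\<close> up to \<open>a\<close>, shifted by s b, and s times the part of
  \<open>B\<close> from \<open>b\<close> on, shifted by \<open>a\<close>, both lie in
  \<open>E\<close> and meet at most in the point a + s b. Hence their lengths add up, and the
  supremum over \<open>a\<close> and \<open>b\<close> gives the claim. A Borel set \<open>E\<close>
  containing the sum is used because the sum itself need not be Borel.\<close>

lemma brunn_minkowski_real: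
  fixes A B E :: "real set"
  assumes [measurable]: "A \<in> sets borel" "B \<in> sets borel" "E \<in> sets borel"
    and ne: "A \<noteq> {}" "B \<noteq> {}" and s: "s > 0"
    and sub: "\<And>a b. a \<in> A \<Longrightarrow> b \<in> B \<Longrightarrow> a + s * b \<in> E"
  shows "emeasure lborel A + ennreal s * emeasure lborel B \<le> emeasure lborel E"
proof -
  have *: "emeasure lborel (A \<inter> {..a}) + ennreal s * emeasure lborel (B \<inter> {b..}) \<le> emeasure lborel E"
    if a: "a \<in> A" and b: "b \<in> B" for a b
  proof -
    define A' where "A' = (\<lambda>x. - (s * b) + 1 * x) -` (A \<inter> {..a})"
    define B' where "B' = (\<lambda>x. - (a / s) + (1 / s) * x) -` (B \<inter> {b..})"
    have [measurable]: "A' \<in> sets borel" "B' \<in> sets borel"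
      unfolding A'_def B'_def by (intro measurable_sets_borel[of _ borel]; simp)+
    have aff: "emeasure lborel X = ennreal \<bar>c\<bar> * emeasure lborel ((\<lambda>x. t + c * x) -` X)"
      if [measurable]: "X \<in> sets borel" and "c \<noteq> 0" for X :: "real set" and c t
    proof -
      have "emeasure lborel X = (\<integral>\<^sup>+x. indicator X x \<partial>lborel)" by simp
      also have "\<dots> = \<bar>c\<bar> * (\<integral>\<^sup>+x. indicator X (t + c * x) \<partial>lborel)"
        using that by (intro nn_integral_real_affine) auto
      also have "(\<integral>\<^sup>+x. indicator X (t + c * x) \<partial>lborel) = (\<integral>\<^sup>+x. indicator ((\<lambda>x. t + c * x) -` X) x \<partial>lborel)"
        by (intro nn_integral_cong) (auto split: split_indicator)
      also have "\<dots> = emeasure lborel ((\<lambda>x. t + c * x) -` X)"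
        using measurable_sets_borel[of "\<lambda>x. t + c * x" borel X] by simp
      finally show ?thesis .
    qed
    have eA: "emeasure lborel A' = emeasure lborel (A \<inter> {..a})"
      unfolding A'_def by (subst aff[of _ 1 "- (s * b)"]) auto
    have eB: "emeasure lborel B' = ennreal s * emeasure lborel (B \<inter> {b..})"
    proof -
      have "ennreal s * emeasure lborel (B \<inter> {b..}) = ennreal s * (ennreal (1 / s) * emeasure lborel B')"
        unfolding B'_def using s by (subst aff[of _ "1 / s" "- (a / s)"]) auto
      also have "\<dots> = emeasure lborel B'"
        using s by (simp add: mult.assoc[symmetric] ennreal_mult[symmetric])
      finally show ?thesis by simp
    qed
    have subE: "A' \<union> (B' - {a + s * b}) \<subseteq> E"
    proof
      fix x assume "x \<in> A' \<union> (B' - {a + s * b})"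
      then consider "x \<in> A'" | "x \<in> B'" by auto
      then show "x \<in> E"
      proof cases
        case 1
        then show ?thesis using sub[OF _ b, of "x - s * b"] by (auto simp: A'_def)
      next
        case 2
        then have "a + s * (- (a / s) + (1 / s) * x) \<in> E"
          by (intro sub a) (auto simp: B'_def)
        then show ?thesis using s by (simp add: field_simps)
      qed
    qed
    have "x \<notin> A'" if "x \<in> B' - {a + s * b}" for x
      using that s by (auto simp: A'_def B'_def field_simps)
    then have disj: "A' \<inter> (B' - {a + s * b}) = {}" by auto
    have "emeasure lborel A' + emeasure lborel B' = emeasure lborel A' + emeasure lborel (B' - {a + s * b})"
      by (subst emeasure_Diff_null_set) auto
    also have "\<dots> = emeasure lborel (A' \<union> (B' - {a + s * b}))"
      using disj by (intro plus_emeasure) auto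
    also have "\<dots> \<le> emeasure lborel E"
      using subE by (intro emeasure_mono) auto
    finally show ?thesis by (simp add: eA eB)
  qed
  have "emeasure lborel A + ennreal s * emeasure lborel B
    = (SUP a\<in>A. emeasure lborel (A \<inter> {..a})) + ennreal s * (SUP b\<in>B. emeasure lborel (B \<inter> {b..}))"
    using emeasure_lborel_eq_SUP_atMost[of A] emeasure_lborel_eq_SUP_atLeast[of B] ne by simp
  also have "\<dots> = (SUP a\<in>A. SUP b\<in>B. emeasure lborel (A \<inter> {..a}) + ennreal s * emeasure lborel (B \<inter> {b..}))"
    using ne by (simp add: SUP_mult_left_ennreal ennreal_SUP_add_left[symmetric] ennreal_SUP_add_right[symmetric])
  also have "\<dots> \<le> emeasure lborel E"
    by (intro SUP_least *)
  finally show ?thesis .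
qed

text \<open>At every height below \<open>m\<close> both superlevel sets are nonempty, and their sum,
  the second one scaled by \<open>s\<close>, lies in the superlevel set of \<open>W\<close> at the
  same height. The inequality for sets is then integrated over the heights. That inequality asks for
  nonempty sets, hence the common supremum \<open>m\<close>.\<close>

lemma brunn_minkowski_functional:
  fixes U V W :: "real \<Rightarrow> real"
  assumes [measurable]: "U \<in> borel_measurable borel" "V \<in> borel_measurable borel" "W \<in> borel_measurable borel"
    and nn: "\<And>x. U x \<ge> 0" "\<And>x. V x \<ge> 0" "\<And>x. W x \<ge> 0"
    and le: "\<And>x. U x \<le> m" "\<And>x. V x \<le> m"
    and ex: "\<And>l. l < m \<Longrightarrow> \<exists>x. U x > l" "\<And>l. l < m \<Longrightarrow> \<exists>x. V x > l"
    and s: "s > 0"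
    and W: "\<And>x y. min (U x) (V y) \<le> W (x + s * y)"
  shows "(\<integral>\<^sup>+x. ennreal (U x) \<partial>lborel) + ennreal s * (\<integral>\<^sup>+x. ennreal (V x) \<partial>lborel)
    \<le> (\<integral>\<^sup>+x. ennreal (W x) \<partial>lborel)"
proof -
  have meas: "(\<lambda>l. emeasure lborel {x. X x > l}) \<in> borel_measurable borel"
    if [measurable]: "X \<in> borel_measurable borel" for X :: "real \<Rightarrow> real"
  proof -
    have "{(l, x). X x > l} \<in> sets (lborel \<Otimes>\<^sub>M lborel)"
    proof -
      have "{p \<in> space (lborel \<Otimes>\<^sub>M lborel). X (snd p) > fst p} \<in> sets (lborel \<Otimes>\<^sub>M lborel)"
        by measurable
      then show ?thesis by (simp add: space_pair_measure case_prod_beta')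
    qed
    then have "(\<lambda>l. emeasure lborel (Pair l -` {(l, x). X x > l})) \<in> borel_measurable lborel"
      by (rule lborel.measurable_emeasure_Pair)
    then show ?thesis by simp
  qed
  note [measurable] = meas[OF assms(1)] meas[OF assms(2)] meas[OF assms(3)]
  have "(\<integral>\<^sup>+x. ennreal (U x) \<partial>lborel) + ennreal s * (\<integral>\<^sup>+x. ennreal (V x) \<partial>lborel)
    = (\<integral>\<^sup>+l. indicator {0<..} l * emeasure lborel {x. U x > l}
        + ennreal s * (indicator {0<..} l * emeasure lborel {x. V x > l}) \<partial>lborel)"
    unfolding nn_integral_layer_cake[OF assms(1) nn(1)] nn_integral_layer_cake[OF assms(2) nn(2)]
    by (subst nn_integral_add) (auto simp: nn_integral_cmult)
  also have "\<dots> \<le> (\<integral>\<^sup>+l. indicator {0<..} l * emeasure lborel {x. W x > l} \<partial>lborel)"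
  proof (rule nn_integral_mono)
    fix l :: real
    have "emeasure lborel {x. U x > l} + ennreal s * emeasure lborel {x. V x > l} \<le> emeasure lborel {x. W x > l}"
    proof (cases "l < m")
      case True
      show ?thesis
      proof (rule brunn_minkowski_real)
        show "{x. U x > l} \<noteq> {}" "{x. V x > l} \<noteq> {}" using ex[OF True] by auto
        show "x + s * y \<in> {x. W x > l}" if "x \<in> {x. U x > l}" "y \<in> {x. V x > l}" for x y
          using that W[of x y] by auto
      qed (use s in auto)
    next
      case False
      then have "{x. U x > l} = {}" "{x. V x > l} = {}" using le by (auto simp: not_less intro: order_trans)
      then show ?thesis by simp
    qed
    then show "indicator {0<..} l * emeasure lborel {x. U x > l}
        + ennreal s * (indicator {0<..} l * emeasure lborel {x. V x > l})
        \<le> indicator {0<..} l * emeasure lborel {x. W x > l}"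
      by (auto split: split_indicator)
  qed
  also have "\<dots> = (\<integral>\<^sup>+x. ennreal (W x) \<partial>lborel)"
    by (rule nn_integral_layer_cake[symmetric]) (use nn in auto)
  finally show ?thesis .
qed

section \<open>Infimal convolutions on the line\<close>

text \<open>Convexity of the power, by induction from the fact that u - v and u^n - v^n have the
  same sign.\<close>

lemma convex_power_two:
  fixes p q u v :: real
  assumes "p \<ge> 0" "q \<ge> 0" "p + q = 1" "u \<ge> 0" "v \<ge> 0"
  shows "(p * u + q * v) ^ n \<le> p * u ^ n + q * v ^ n"
proof (induction n)
  case (Suc n)
  have "(u - v) * (u ^ n - v ^ n) \<ge> 0"
    using assms power_mono[of u v n] power_mono[of v u n]
    by (cases "u \<le> v") (auto simp: zero_le_mult_iff)
  then have "0 \<le> p * q * ((u - v) * (u ^ n - v ^ n))"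
    using assms by simp
  also have "\<dots> = p * u ^ Suc n * (p + q) + q * v ^ Suc n * (p + q) - p * u ^ Suc n * p - q * v ^ Suc n * q
      - p * q * (u * v ^ n + v * u ^ n)"
    by (simp add: algebra_simps)
  also have "\<dots> = p * u ^ Suc n + q * v ^ Suc n - (p * u + q * v) * (p * u ^ n + q * v ^ n)"
    using assms(3) by (simp add: algebra_simps)
  finally have "(p * u + q * v) * (p * u ^ n + q * v ^ n) \<le> p * u ^ Suc n + q * v ^ Suc n" by simp
  moreover have "(p * u + q * v) ^ Suc n \<le> (p * u + q * v) * (p * u ^ n + q * v ^ n)"
    using Suc assms by (simp add: mult_left_mono)
  ultimately show ?case by linarith
qed (use assms in auto)

text \<open>Convexity of the power at the points a/\<alpha> and b/\<beta> with the weights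
  \<alpha>/T and s \<beta>/T; in other words, the perspective a^(m+1)/\<alpha>^m is
  subadditive.\<close>

lemma holder_power_two:
  fixes a b \<alpha> \<beta> s :: real
  assumes "a > 0" "b > 0" "\<alpha> > 0" "\<beta> > 0" "s > 0"
  shows "(a + s * b) ^ Suc m / (\<alpha> + s * \<beta>) ^ m \<le> a ^ Suc m / \<alpha> ^ m + s * b ^ Suc m / \<beta> ^ m"
proof -
  define T where "T = \<alpha> + s * \<beta>"
  have T: "T > 0" using assms by (simp add: T_def add_pos_pos)
  have "(\<alpha> / T * (a / \<alpha>) + s * \<beta> / T * (b / \<beta>)) ^ Suc m \<le> \<alpha> / T * (a / \<alpha>) ^ Suc m + s * \<beta> / T * (b / \<beta>) ^ Suc m"
  proof (rule convex_power_two)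
    show "\<alpha> / T + s * \<beta> / T = 1" using T by (simp add: T_def add_divide_distrib[symmetric])
  qed (use assms T in auto)
  also have "\<alpha> / T * (a / \<alpha>) + s * \<beta> / T * (b / \<beta>) = (a + s * b) / T"
    using assms T by (simp add: add_divide_distrib)
  also have "\<alpha> / T * (a / \<alpha>) ^ Suc m + s * \<beta> / T * (b / \<beta>) ^ Suc m
      = (a ^ Suc m / \<alpha> ^ m + s * b ^ Suc m / \<beta> ^ m) / T"
    using assms T by (simp add: power_divide add_divide_distrib mult.commute)
  finally have "((a + s * b) / T) ^ Suc m * T \<le> a ^ Suc m / \<alpha> ^ m + s * b ^ Suc m / \<beta> ^ m"
    using T by (simp add: pos_le_divide_eq)
  moreover have "((a + s * b) / T) ^ Suc m * T = (a + s * b) ^ Suc m / T ^ m"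
    using T by (simp add: power_divide)
  ultimately show ?thesis by (simp add: T_def)
qed

text \<open>\<open>a\<close> and \<open>b\<close> are the infima of \<open>f\<close> and
  \<open>g\<close>: with them (a/f)^N and (b/g)^N have the common supremum 1 that the functional
  Brunn-Minkowski inequality asks for. They stay in the conclusion and are eliminated later by
  convexity.\<close>

lemma inf_convolution_real:
  fixes f g k :: "real \<Rightarrow> real"
  assumes [measurable]: "f \<in> borel_measurable borel" "g \<in> borel_measurable borel" "k \<in> borel_measurable borel"
    and c: "c > 0" and lb: "\<And>x. c \<le> f x" "\<And>x. c \<le> g x" "\<And>x. k x > 0"
    and s: "s > 0" and k: "\<And>x y. k (x + s * y) \<le> f x + s * g y"
    and N: "N > 0"
    and A: "(\<integral>\<^sup>+x. ennreal (1 / f x ^ N) \<partial>lborel) = ennreal A" "A \<ge> 0"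
    and B: "(\<integral>\<^sup>+x. ennreal (1 / g x ^ N) \<partial>lborel) = ennreal B" "B \<ge> 0"
    and K: "(\<integral>\<^sup>+x. ennreal (1 / k x ^ N) \<partial>lborel) = ennreal K" "K \<ge> 0"
  obtains a b where "a > 0" "b > 0" "a ^ N * A + s * (b ^ N * B) \<le> (a + s * b) ^ N * K"
proof -
  \<comment> \<open>The infimum is positive because of the bound \<open>c\<close>, and points where
    \<open>h\<close> comes close to it bring the quotient close to 1.\<close>
  have lower: "\<exists>a>0. (\<forall>x. a \<le> h x) \<and> (\<forall>l<1. \<exists>x. l < (a / h x) ^ N)"
    if h: "\<And>x. c \<le> h x" for h :: "real \<Rightarrow> real"
  proof (rule exI[of _ "Inf (range h)"], intro conjI allI impI)
    have bdd: "bdd_below (range h)" using h by (auto intro!: bdd_belowI[of _ c])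
    show a0: "Inf (range h) > 0"
      using c h by (intro less_le_trans[OF c] cInf_greatest) auto
    show "Inf (range h) \<le> h x" for x by (intro cInf_lower bdd) auto
    fix l :: real assume l: "l < 1"
    show "\<exists>x. l < (Inf (range h) / h x) ^ N"
    proof (cases "l \<le> 0")
      case True
      have "0 < (Inf (range h) / h 0) ^ N" using a0 less_le_trans[OF c h] by simp
      then show ?thesis using True le_less_trans by blast
    next
      case False
      have q: "0 < root N l" "root N l < 1" using False l N by auto
      then have "Inf (range h) < Inf (range h) / root N l" using a0 by (simp add: pos_less_divide_eq)
      then obtain x where "h x < Inf (range h) / root N l"
        using cInf_lessD[of "range h"] by auto
      then have "root N l < Inf (range h) / h x"
        using q less_le_trans[OF c h[of x]] by (simp add: field_simps)
      then have "root N l ^ N < (Inf (range h) / h x) ^ N"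
        using q N by (intro power_strict_mono) auto
      then show ?thesis using False N by auto
    qed
  qed
  obtain a where a: "a > 0" "\<And>x. a \<le> f x" "\<And>l. l < 1 \<Longrightarrow> \<exists>x. l < (a / f x) ^ N"
    using lower[of f] lb(1) by blast
  obtain b where b: "b > 0" "\<And>x. b \<le> g x" "\<And>l. l < 1 \<Longrightarrow> \<exists>x. l < (b / g x) ^ N"
    using lower[of g] lb(2) by blast
  have fp: "f x > 0" "g x > 0" for x using less_le_trans[OF c lb(1)] less_le_trans[OF c lb(2)] by auto
  have ab: "a + s * b > 0" using a b s by (simp add: add_pos_pos)
  have "(\<integral>\<^sup>+x. ennreal ((a / f x) ^ N) \<partial>lborel) + ennreal s * (\<integral>\<^sup>+x. ennreal ((b / g x) ^ N) \<partial>lborel)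
    \<le> (\<integral>\<^sup>+x. ennreal (((a + s * b) / k x) ^ N) \<partial>lborel)"
  proof (rule brunn_minkowski_functional[where m = 1])
    show "(a / f x) ^ N \<le> 1" "(b / g x) ^ N \<le> 1" for x
      using a b fp[of x] by (auto intro!: power_le_one)
    show "min ((a / f x) ^ N) ((b / g y) ^ N) \<le> ((a + s * b) / k (x + s * y)) ^ N" for x y
    proof -
      \<comment> \<open>\<mu> times \<open>f x\<close> is at most \<open>a\<close> and \<mu> times
        \<open>g y\<close> at most \<open>b\<close>, so \<mu> times the value of \<open>k\<close> is
        at most a + s b.\<close>
      define \<mu> where "\<mu> = min (a / f x) (b / g y)"
      have mu: "\<mu> > 0" "\<mu> * f x \<le> a" "\<mu> * g y \<le> b"
        using a b fp[of x] fp[of y] by (auto simp: \<mu>_def min_def field_simps)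
      have "\<mu> * k (x + s * y) \<le> \<mu> * f x + s * (\<mu> * g y)"
        using mult_left_mono[OF k[of x y], of \<mu>] mu by (simp add: algebra_simps)
      also have "\<dots> \<le> a + s * b" using mu s by (intro add_mono mult_left_mono) auto
      finally have "\<mu> \<le> (a + s * b) / k (x + s * y)"
        using lb(3)[of "x + s * y"] by (simp add: pos_le_divide_eq)
      then have "\<mu> ^ N \<le> ((a + s * b) / k (x + s * y)) ^ N"
        using mu by (intro power_mono) auto
      moreover have "min ((a / f x) ^ N) ((b / g y) ^ N) \<le> \<mu> ^ N"
        by (auto simp: \<mu>_def min_def)
      ultimately show ?thesis by linarith
    qed
  qed (use a b fp lb(3) ab s in \<open>auto simp: less_imp_le\<close>)
  moreover have cm: "(\<integral>\<^sup>+x. ennreal ((d / h x) ^ N) \<partial>lborel) = ennreal (d ^ N * C)"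
    if "(\<integral>\<^sup>+x. ennreal (1 / h x ^ N) \<partial>lborel) = ennreal C" "d > 0" "C \<ge> 0"
      and [measurable]: "h \<in> borel_measurable borel" and "\<And>x. h x > 0" for h C d
  proof -
    have "(\<integral>\<^sup>+x. ennreal ((d / h x) ^ N) \<partial>lborel) = (\<integral>\<^sup>+x. ennreal (d ^ N) * ennreal (1 / h x ^ N) \<partial>lborel)"
      using that by (intro nn_integral_cong) (simp add: ennreal_mult[symmetric] power_divide less_imp_le)
    also have "\<dots> = ennreal (d ^ N) * ennreal C"
      using that by (simp add: nn_integral_cmult)
    finally show ?thesis using that by (simp add: ennreal_mult)
  qed
  ultimately have "ennreal (a ^ N * A) + ennreal s * ennreal (b ^ N * B) \<le> ennreal ((a + s * b) ^ N * K)"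
    using cm[OF A(1) a(1) A(2)] cm[OF B(1) b(1) B(2)] cm[OF K(1) ab K(2)] fp lb(3) by simp
  then have "a ^ N * A + s * (b ^ N * B) \<le> (a + s * b) ^ N * K"
    using a b s A B K ab by (simp add: ennreal_mult[symmetric] ennreal_plus[symmetric] del: ennreal_plus)
  then show thesis using that a b by blast
qed

text \<open>Twice the half-line integral of the derivative of arctan. It is the one-dimensional
  integral behind all majorants below.\<close>

lemma nn_integral_inverse_1_plus_square_finite:
  obtains P where "P > 0" "(\<integral>\<^sup>+t. ennreal (1 / (1 + t\<^sup>2)) \<partial>lborel) \<le> ennreal P"
proof -
  have pos: "0 < 1 + t\<^sup>2" for t :: real using zero_le_power2[of t] by linarith
  have half: "(\<integral>\<^sup>+t. ennreal (1 / (1 + t\<^sup>2)) * indicator {0..} t \<partial>lborel) = ennreal (pi / 2 - arctan 0)"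
  proof (rule nn_integral_FTC_atLeast)
    show "(arctan has_real_derivative 1 / (1 + t\<^sup>2)) (at t)" for t
      using DERIV_arctan[of t] by (simp add: inverse_eq_divide)
    show "(arctan \<longlongrightarrow> pi / 2) at_top" by (rule tendsto_arctan_at_top)
  qed (use pos less_imp_le in auto)
  have "(\<integral>\<^sup>+t. ennreal (1 / (1 + t\<^sup>2)) \<partial>lborel)
    \<le> (\<integral>\<^sup>+t. ennreal (1 / (1 + t\<^sup>2)) * indicator {0..} t + ennreal (1 / (1 + t\<^sup>2)) * indicator {0..} (-t) \<partial>lborel)"
    by (intro nn_integral_mono) (auto split: split_indicator)
  also have "\<dots> = ennreal (pi / 2) + (\<integral>\<^sup>+t. ennreal (1 / (1 + t\<^sup>2)) * indicator {0..} (-t) \<partial>lborel)"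
    using half by (subst nn_integral_add) auto
  also have "(\<integral>\<^sup>+t. ennreal (1 / (1 + t\<^sup>2)) * indicator {0..} (-t) \<partial>lborel) = ennreal (pi / 2)"
    using nn_integral_real_affine[of "\<lambda>t. ennreal (1 / (1 + t\<^sup>2)) * indicator {0..} t" "-1" 0] half by simp
  finally have "(\<integral>\<^sup>+t. ennreal (1 / (1 + t\<^sup>2)) \<partial>lborel) \<le> ennreal pi"
    by (simp add: ennreal_plus[symmetric] del: ennreal_plus)
  then show thesis using that[of pi] by simp
qed

section \<open>Integrating out one coordinate at a time\<close>

text \<open>Functions on coordinate families are total, so the last clause says that coordinates
  outside \<open>J\<close> do not matter. The quadratic lower bound keeps the reciprocal powers used
  below integrable.\<close>

definition quadratic_growth :: "real \<Rightarrow> 'i set \<Rightarrow> (('i \<Rightarrow> real) \<Rightarrow> real) \<Rightarrow> bool" where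
  "quadratic_growth c J f \<longleftrightarrow> f \<in> borel_measurable (Pi\<^sub>M J (\<lambda>_. lborel)) \<and>
     (\<forall>x. c * (1 + (\<Sum>i\<in>J. (x i)\<^sup>2)) \<le> f x) \<and>
     (\<forall>x y. (\<forall>i\<in>J. x i = y i) \<longrightarrow> f x = f y)"

text \<open>Normalised so that the m-th reciprocal power of the marginal is the integral of the
  (m+1)-st reciprocal power of \<open>f\<close>. Integrating out a coordinate thus lowers the
  exponent together with the dimension, and the marginal again grows quadratically.\<close>

definition marginal :: "'i \<Rightarrow> nat \<Rightarrow> (('i \<Rightarrow> real) \<Rightarrow> real) \<Rightarrow> ('i \<Rightarrow> real) \<Rightarrow> real" where
  "marginal i m f x = 1 / root m (enn2real (\<integral>\<^sup>+t. ennreal (1 / f (x(i := t)) ^ Suc m) \<partial>lborel))"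

lemma quadratic_growth_pos:
  assumes "quadratic_growth c J f" "c > 0" shows "f x \<ge> c" "f x > 0"
proof -
  have "c * 1 \<le> c * (1 + (\<Sum>i\<in>J. (x i)\<^sup>2))"
    using assms(2) by (intro mult_left_mono) (auto intro: sum_nonneg)
  also have "\<dots> \<le> f x" using assms(1) by (auto simp: quadratic_growth_def)
  finally show "f x \<ge> c" by simp
  then show "f x > 0" using assms(2) by linarith
qed

lemma quadratic_growth_measurable:
  "quadratic_growth c J f \<Longrightarrow> f \<in> borel_measurable (Pi\<^sub>M J (\<lambda>_. lborel))"
  by (simp add: quadratic_growth_def)

lemma quadratic_growth_slice_measurable:
  assumes "quadratic_growth c (insert i J) f" "i \<notin> J"
  shows "(\<lambda>t. f (x(i := t))) \<in> borel_measurable borel"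
proof -
  define x' where "x' = restrict x J"
  have "(\<lambda>t. f (x'(i := t))) \<in> borel_measurable lborel"
    using measurable_comp[OF measurable_component_update[of x' J "\<lambda>_. lborel" i] quadratic_growth_measurable[OF assms(1)]] assms(2)
    by (simp add: x'_def space_PiM comp_def)
  moreover have "f (x'(i := t)) = f (x(i := t))" for t
    using assms by (auto simp: quadratic_growth_def x'_def)
  ultimately show ?thesis by simp
qed

text \<open>Let S be 1 plus the squares of the coordinates in \<open>J\<close>. As S is at least 1,
  (S + t^2)^(m+1) is at least S^m (1 + t^2), so the integral over t is at most a multiple of
  S^(-m).\<close>

lemma marginal_nn_integral:
  fixes f :: "('i \<Rightarrow> real) \<Rightarrow> real" and m :: nat
  assumes P: "(\<integral>\<^sup>+t. ennreal (1 / (1 + t\<^sup>2)) \<partial>lborel) \<le> ennreal P" "P > 0"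
    and f: "quadratic_growth c (insert i J) f" and i: "i \<notin> J" "finite J" and c: "c > 0"
  defines "A \<equiv> \<lambda>x. (\<integral>\<^sup>+t. ennreal (1 / f (x(i := t)) ^ Suc m) \<partial>lborel)"
  shows "A x \<le> ennreal (P / (c ^ Suc m * (1 + (\<Sum>j\<in>J. (x j)\<^sup>2)) ^ m))"
    and "A x = ennreal (enn2real (A x))" "enn2real (A x) > 0"
proof -
  note [measurable] = quadratic_growth_slice_measurable[OF f i(1)]
  define S where "S = 1 + (\<Sum>j\<in>J. (x j)\<^sup>2)"
  have S: "S \<ge> 1" by (simp add: S_def sum_nonneg)
  have "A x \<le> (\<integral>\<^sup>+t. ennreal (1 / (c ^ Suc m * S ^ m)) * ennreal (1 / (1 + t\<^sup>2)) \<partial>lborel)"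
    unfolding A_def
  proof (rule nn_integral_mono)
    fix t :: real
    have "c * (1 + (\<Sum>j\<in>insert i J. ((x(i := t)) j)\<^sup>2)) \<le> f (x(i := t))"
      using f unfolding quadratic_growth_def by blast
    moreover have "(\<Sum>j\<in>insert i J. ((x(i := t)) j)\<^sup>2) = t\<^sup>2 + (\<Sum>j\<in>J. (x j)\<^sup>2)"
      using i by (auto intro!: sum.cong)
    ultimately have le: "c * (S + t\<^sup>2) \<le> f (x(i := t))" by (simp add: S_def algebra_simps)
    have "S ^ m * (1 + t\<^sup>2) \<le> (S + t\<^sup>2) ^ m * (S + t\<^sup>2)"
      using S by (intro mult_mono power_mono) auto
    then have "c ^ Suc m * (S ^ m * (1 + t\<^sup>2)) \<le> (c * (S + t\<^sup>2)) ^ Suc m"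
      using c by (simp add: power_mult_distrib mult.commute[of _ "S + t\<^sup>2"])
    also have "\<dots> \<le> f (x(i := t)) ^ Suc m"
      using le c S by (intro power_mono) (auto intro!: mult_nonneg_nonneg)
    finally have "1 / f (x(i := t)) ^ Suc m \<le> 1 / (c ^ Suc m * (S ^ m * (1 + t\<^sup>2)))"
      using c S by (intro divide_left_mono mult_pos_pos zero_less_power quadratic_growth_pos[OF f c])
        (auto intro: add_pos_nonneg)
    then show "ennreal (1 / f (x(i := t)) ^ Suc m) \<le> ennreal (1 / (c ^ Suc m * S ^ m)) * ennreal (1 / (1 + t\<^sup>2))"
      using c S by (simp add: ennreal_mult[symmetric] ennreal_leI mult.assoc add_nonneg_nonneg)
  qed
  also have "\<dots> = ennreal (1 / (c ^ Suc m * S ^ m)) * (\<integral>\<^sup>+t. ennreal (1 / (1 + t\<^sup>2)) \<partial>lborel)"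
    by (rule nn_integral_cmult) auto
  also have "\<dots> \<le> ennreal (1 / (c ^ Suc m * S ^ m)) * ennreal P"
    by (intro mult_left_mono P) auto
  also have "\<dots> = ennreal (P / (c ^ Suc m * S ^ m))"
    using c S P by (simp add: ennreal_mult[symmetric])
  finally show le: "A x \<le> ennreal (P / (c ^ Suc m * (1 + (\<Sum>j\<in>J. (x j)\<^sup>2)) ^ m))"
    by (simp add: S_def)
  then have fin: "A x < top" using le_less_trans ennreal_less_top by blast
  then show "A x = ennreal (enn2real (A x))" by simp
  have "A x \<noteq> 0"
  proof
    assume "A x = 0"
    then have "AE t in lborel. ennreal (1 / f (x(i := t)) ^ Suc m) = 0"
      unfolding A_def by (subst (asm) nn_integral_0_iff_AE) auto
    moreover have "ennreal (1 / f (x(i := t)) ^ Suc m) \<noteq> 0" for t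
      using quadratic_growth_pos[OF f c, of "x(i := t)"] by simp
    ultimately have "AE t in (lborel :: real measure). False" by simp
    then show False using AE_iff_null_sets[of UNIV "lborel :: real measure"] by (simp add: null_sets_def)
  qed
  then show "enn2real (A x) > 0" using fin by (simp add: enn2real_positive_iff zero_less_iff_neq_zero)
qed

lemma marginal_power:
  fixes f :: "('i \<Rightarrow> real) \<Rightarrow> real"
  assumes "quadratic_growth c (insert i J) f" "i \<notin> J" "finite J" "c > 0" "m > 0"
  shows "marginal i m f x > 0"
    "(\<integral>\<^sup>+t. ennreal (1 / f (x(i := t)) ^ Suc m) \<partial>lborel) = ennreal (1 / marginal i m f x ^ m)"
proof -
  obtain P where P: "P > 0" "(\<integral>\<^sup>+t. ennreal (1 / (1 + t\<^sup>2)) \<partial>lborel) \<le> ennreal P"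
    by (rule nn_integral_inverse_1_plus_square_finite)
  note A = marginal_nn_integral(2,3)[OF P(2,1) assms(1-4), of x m]
  show "marginal i m f x > 0"
    using A(2) assms(5) by (simp add: marginal_def)
  show "(\<integral>\<^sup>+t. ennreal (1 / f (x(i := t)) ^ Suc m) \<partial>lborel) = ennreal (1 / marginal i m f x ^ m)"
    using A assms(5) by (simp add: marginal_def power_divide)
qed

text \<open>\<open>c'\<close> does not depend on \<open>f\<close>, so the three functions in an
  infimal convolution keep a common growth constant when a coordinate is integrated out.\<close>

lemma quadratic_growth_marginal:
  fixes J :: "'i set"
  assumes "i \<notin> J" "finite J" "c > 0" "m > 0"
  obtains c' where "c' > 0" "\<And>f. quadratic_growth c (insert i J) f \<Longrightarrow> quadratic_growth c' J (marginal i m f)"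
proof -
  obtain P where P: "P > 0" "(\<integral>\<^sup>+t. ennreal (1 / (1 + t\<^sup>2)) \<partial>lborel) \<le> ennreal P"
    by (rule nn_integral_inverse_1_plus_square_finite)
  \<comment> \<open>Obtained by taking the m-th root in the bound P / (c^(m+1) S^m) for the slice
    integral and inverting.\<close>
  define c' where "c' = root m (c ^ Suc m / P)"
  have c': "c' > 0" using assms P by (simp add: c'_def)
  have "quadratic_growth c' J (marginal i m f)" if f: "quadratic_growth c (insert i J) f" for f
    unfolding quadratic_growth_def
  proof (intro conjI allI impI)
    show "marginal i m f x = marginal i m f y" if "\<forall>j\<in>J. x j = y j" for x y
    proof -
      have "f (x(i := t)) = f (y(i := t))" for t
        using f that by (auto simp: quadratic_growth_def)
      then show ?thesis by (simp add: marginal_def)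
    qed
    have [measurable]: "f \<in> borel_measurable (Pi\<^sub>M (insert i J) (\<lambda>_. lborel))"
      by (rule quadratic_growth_measurable[OF f])
    show "marginal i m f \<in> borel_measurable (Pi\<^sub>M J (\<lambda>_. lborel))"
      unfolding marginal_def[abs_def] by measurable
    fix x :: "'i \<Rightarrow> real"
    define S where "S = 1 + (\<Sum>j\<in>J. (x j)\<^sup>2)"
    have S: "S \<ge> 1" by (simp add: S_def sum_nonneg)
    note A = marginal_nn_integral[OF P(2,1) f assms(1-3), of x m, folded S_def]
    let ?A = "enn2real (\<integral>\<^sup>+t. ennreal (1 / f (x(i := t)) ^ Suc m) \<partial>lborel)"
    have "?A \<le> P / (c ^ Suc m * S ^ m)"
      using A(1) P S assms by (intro enn2real_leI) auto
    then have "root m ?A \<le> root m (P / (c ^ Suc m * S ^ m))"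
      using assms by simp
    also have "\<dots> = 1 / (c' * S)"
      using assms S P by (simp add: c'_def real_root_divide real_root_mult real_root_power_cancel divide_simps)
    finally have "c' * S * root m ?A \<le> 1"
      using c' S by (simp add: field_simps)
    then show "c' * (1 + (\<Sum>j\<in>J. (x j)\<^sup>2)) \<le> marginal i m f x"
      using A(3) assms by (simp add: marginal_def pos_le_divide_eq S_def)
  qed
  then show thesis using that c' by blast
qed

text \<open>The inequality on the line, applied in coordinate \<open>i\<close>, supplies
  \<open>a\<close> and \<open>b\<close>. With F and G the marginals of \<open>f\<close> and
  \<open>g\<close>, \<open>holder_power_two\<close> bounds its left side below by (a + s b)^(m+1) /
  (F + s G)^m, and the factor (a + s b)^(m+1) cancels.\<close>

lemma inf_convolution_marginal:
  fixes f g k :: "('i \<Rightarrow> real) \<Rightarrow> real"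
  assumes qg: "quadratic_growth c (insert i J) f" "quadratic_growth c (insert i J) g" "quadratic_growth c (insert i J) k"
    and i: "i \<notin> J" "finite J" and c: "c > 0" and m: "m > 0" and s: "s > 0"
    and k: "\<And>x y. k (\<lambda>j. x j + s * y j) \<le> f x + s * g y"
  shows "marginal i m k (\<lambda>j. x j + s * y j) \<le> marginal i m f x + s * marginal i m g y"
proof -
  let ?z = "\<lambda>j. x j + s * y j"
  note mf = marginal_power[OF qg(1) i c m, of x]
  note mg = marginal_power[OF qg(2) i c m, of y]
  note mk = marginal_power[OF qg(3) i c m, of ?z]
  obtain a b where ab: "a > 0" "b > 0"
    "a ^ Suc m * (1 / marginal i m f x ^ m) + s * (b ^ Suc m * (1 / marginal i m g y ^ m))
      \<le> (a + s * b) ^ Suc m * (1 / marginal i m k ?z ^ m)"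
  proof (rule inf_convolution_real[of "\<lambda>t. f (x(i := t))" "\<lambda>t. g (y(i := t))" "\<lambda>t. k (?z(i := t))" c s "Suc m"])
    show "k (?z(i := t + s * t')) \<le> f (x(i := t)) + s * g (y(i := t'))" for t t'
    proof -
      have "?z(i := t + s * t') = (\<lambda>j. (x(i := t)) j + s * (y(i := t')) j)" by auto
      then show ?thesis using k[of "x(i := t)" "y(i := t')"] by (simp only:)
    qed
    show "(\<integral>\<^sup>+t. ennreal (1 / f (x(i := t)) ^ Suc m) \<partial>lborel) = ennreal (1 / marginal i m f x ^ m)" by (rule mf)
    show "(\<integral>\<^sup>+t. ennreal (1 / g (y(i := t)) ^ Suc m) \<partial>lborel) = ennreal (1 / marginal i m g y ^ m)" by (rule mg)
    show "(\<integral>\<^sup>+t. ennreal (1 / k (?z(i := t)) ^ Suc m) \<partial>lborel) = ennreal (1 / marginal i m k ?z ^ m)" by (rule mk)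
    show "(\<lambda>t. f (x(i := t))) \<in> borel_measurable borel" "(\<lambda>t. g (y(i := t))) \<in> borel_measurable borel"
      "(\<lambda>t. k (?z(i := t))) \<in> borel_measurable borel"
      by (rule quadratic_growth_slice_measurable[OF _ i(1)], rule qg)+
    show "c \<le> f (x(i := t))" "c \<le> g (y(i := t))" "k (?z(i := t)) > 0" for t
      by (rule quadratic_growth_pos[OF qg(1) c] quadratic_growth_pos[OF qg(2) c] quadratic_growth_pos[OF qg(3) c])+
  qed (use mf(1) mg(1) mk(1) s c in \<open>simp_all add: less_imp_le\<close>)
  have pos: "a + s * b > 0" "marginal i m f x + s * marginal i m g y > 0"
    using ab s mf(1) mg(1) by (auto intro: add_pos_pos)
  have "(a + s * b) ^ Suc m * (1 / (marginal i m f x + s * marginal i m g y) ^ m)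
    \<le> (a + s * b) ^ Suc m * (1 / marginal i m k ?z ^ m)"
    using holder_power_two[OF ab(1,2) mf(1) mg(1) s, of m] ab(3) by simp
  then have "1 / (marginal i m f x + s * marginal i m g y) ^ m \<le> 1 / marginal i m k ?z ^ m"
    using pos(1) by (subst (asm) mult_le_cancel_left_pos) auto
  then have "marginal i m k ?z ^ m \<le> (marginal i m f x + s * marginal i m g y) ^ m"
    using pos(2) mk(1) by (simp add: divide_simps)
  then show ?thesis using pos(2) m by (auto dest: power_mono_iff[THEN iffD1, rotated -1] simp: less_imp_le power_mono_iff mk(1))
qed

text \<open>The Borell-Brascamp-Lieb inequality in the borderline case where the exponent equals the
  dimension, in which the mean of the two integrals degenerates to their minimum. Marginals lower
  dimension and exponent together until the line is reached.\<close>

lemma inf_convolution_min: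
  fixes f g k :: "('i \<Rightarrow> real) \<Rightarrow> real"
  assumes J: "finite J" "J \<noteq> {}" and "c > 0" and s: "s > 0"
    and "quadratic_growth c J f" "quadratic_growth c J g" "quadratic_growth c J k"
    and "\<And>x y. k (\<lambda>j. x j + s * y j) \<le> f x + s * g y"
  shows "min (\<integral>\<^sup>+x. ennreal (1 / f x ^ card J) \<partial>Pi\<^sub>M J (\<lambda>_. lborel)) (\<integral>\<^sup>+x. ennreal (1 / g x ^ card J) \<partial>Pi\<^sub>M J (\<lambda>_. lborel))
    \<le> (\<integral>\<^sup>+x. ennreal (1 / k x ^ card J) \<partial>Pi\<^sub>M J (\<lambda>_. lborel))"
  using J assms(3,5-)
proof (induction J arbitrary: c f g k rule: finite_ne_induct)
  case (singleton i)
  interpret product_sigma_finite "\<lambda>_. lborel :: real measure" by standard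
  let ?u = "\<lambda>_. undefined :: real"
  obtain P where P: "P > 0" "(\<integral>\<^sup>+t. ennreal (1 / (1 + t\<^sup>2)) \<partial>lborel) \<le> ennreal P"
    by (rule nn_integral_inverse_1_plus_square_finite)
  let ?I = "\<lambda>f. enn2real (\<integral>\<^sup>+t. ennreal (1 / f (?u(i := t)) ^ Suc 0) \<partial>lborel)"
  have eq: "(\<integral>\<^sup>+x. ennreal (1 / h x ^ card {i}) \<partial>Pi\<^sub>M {i} (\<lambda>_. lborel)) = ennreal (?I h)"
    and int: "(\<integral>\<^sup>+t. ennreal (1 / h (?u(i := t)) ^ Suc 0) \<partial>lborel) = ennreal (?I h)"
    if "quadratic_growth c {i} h" for h :: "('i \<Rightarrow> real) \<Rightarrow> real"
  proof -
    have [measurable]: "h \<in> borel_measurable (Pi\<^sub>M {i} (\<lambda>_. lborel))"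
      using that by (rule quadratic_growth_measurable)
    show 1: "(\<integral>\<^sup>+t. ennreal (1 / h (?u(i := t)) ^ Suc 0) \<partial>lborel) = ennreal (?I h)"
      by (rule marginal_nn_integral(2)[OF P(2,1) that _ _ singleton(1)]) simp_all
    show "(\<integral>\<^sup>+x. ennreal (1 / h x ^ card {i}) \<partial>Pi\<^sub>M {i} (\<lambda>_. lborel)) = ennreal (?I h)"
    proof -
      have "(\<integral>\<^sup>+x. ennreal (1 / h x ^ card {i}) \<partial>Pi\<^sub>M {i} (\<lambda>_. lborel))
        = (\<integral>\<^sup>+x. (\<integral>\<^sup>+t. ennreal (1 / h (x(i := t)) ^ card {i}) \<partial>lborel) \<partial>Pi\<^sub>M {} (\<lambda>_. lborel))"
        by (rule product_nn_integral_insert) (simp, simp, measurable)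
      also have "\<dots> = (\<integral>\<^sup>+t. ennreal (1 / h (?u(i := t)) ^ card {i}) \<partial>lborel)"
        unfolding PiM_empty by (subst nn_integral_count_space_finite) (simp_all del: fun_upd_apply)
      also have "\<dots> = (\<integral>\<^sup>+t. ennreal (1 / h (?u(i := t)) ^ Suc 0) \<partial>lborel)"
        by (simp del: fun_upd_apply)
      finally show ?thesis using 1 by (rule trans)
    qed
  qed
  note qg = singleton(2,3,4)
  have dep: "\<And>x y. \<forall>j\<in>{i}. x j = y j \<Longrightarrow> k x = k y"
    using qg(3) unfolding quadratic_growth_def by (elim conjE allE impE)
  obtain a b where ab: "a > 0" "b > 0" "a ^ Suc 0 * ?I f + s * (b ^ Suc 0 * ?I g) \<le> (a + s * b) ^ Suc 0 * ?I k"
  proof (rule inf_convolution_real[of "\<lambda>t. f (?u(i := t))" "\<lambda>t. g (?u(i := t))" "\<lambda>t. k (?u(i := t))" c s "Suc 0"])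
    show "k (?u(i := t + s * t')) \<le> f (?u(i := t)) + s * g (?u(i := t'))" for t t'
    proof -
      have "k (?u(i := t + s * t')) = k (\<lambda>j. (?u(i := t)) j + s * (?u(i := t')) j)"
      proof (rule dep)
        show "\<forall>j\<in>{i}. (?u(i := t + s * t')) j = (?u(i := t)) j + s * (?u(i := t')) j" by simp
      qed
      then show ?thesis using singleton(5)[of "?u(i := t)" "?u(i := t')"] by (rule ord_eq_le_trans)
    qed
    show "(\<integral>\<^sup>+t. ennreal (1 / f (?u(i := t)) ^ Suc 0) \<partial>lborel) = ennreal (?I f)" by (rule int[OF qg(1)])
    show "(\<integral>\<^sup>+t. ennreal (1 / g (?u(i := t)) ^ Suc 0) \<partial>lborel) = ennreal (?I g)" by (rule int[OF qg(2)])
    show "(\<integral>\<^sup>+t. ennreal (1 / k (?u(i := t)) ^ Suc 0) \<partial>lborel) = ennreal (?I k)" by (rule int[OF qg(3)])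
    show "(\<lambda>t. f (?u(i := t))) \<in> borel_measurable borel" "(\<lambda>t. g (?u(i := t))) \<in> borel_measurable borel"
      "(\<lambda>t. k (?u(i := t))) \<in> borel_measurable borel"
      using quadratic_growth_slice_measurable[OF qg(1)] quadratic_growth_slice_measurable[OF qg(2)]
        quadratic_growth_slice_measurable[OF qg(3)] by blast+
    show "c \<le> f (?u(i := t))" "c \<le> g (?u(i := t))" "k (?u(i := t)) > 0" for t
      by (rule quadratic_growth_pos[OF qg(1) singleton(1)] quadratic_growth_pos[OF qg(2) singleton(1)]
          quadratic_growth_pos[OF qg(3) singleton(1)])+
  qed (use s singleton(1) in simp_all)
  \<comment> \<open>On the line the two infima act as weights: an average with the weights
    \<open>a\<close> and \<open>s * b\<close> is at least the minimum.\<close>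
  have wt: "(a + s * b) * min A B \<le> a * A + s * (b * B)" for A B
  proof -
    have "a * min A B \<le> a * A" "(s * b) * min A B \<le> (s * b) * B"
      using ab s by (intro mult_left_mono; simp)+
    then show ?thesis by (simp add: algebra_simps)
  qed
  have "(a + s * b) * min (?I f) (?I g) \<le> a * ?I f + s * (b * ?I g)"
    by (rule wt)
  also have "\<dots> \<le> (a + s * b) * ?I k" using ab(3) by simp
  finally have "min (?I f) (?I g) \<le> ?I k"
    using ab s by (subst (asm) mult_le_cancel_left_pos) (auto intro: add_pos_pos)
  then have "min (ennreal (?I f)) (ennreal (?I g)) \<le> ennreal (?I k)"
    by (simp add: min_def ennreal_leI split: if_splits)
  then show ?case unfolding eq[OF qg(1)] eq[OF qg(2)] eq[OF qg(3)] .
next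
  case (insert i J)
  interpret product_sigma_finite "\<lambda>_. lborel :: real measure" by standard
  have m: "card J > 0" using insert.hyps by (simp add: card_gt_0_iff)
  obtain c' where c': "c' > 0" "\<And>f. quadratic_growth c (insert i J) f \<Longrightarrow> quadratic_growth c' J (marginal i (card J) f)"
    using quadratic_growth_marginal[OF insert.hyps(3,1) insert.prems(1) m] by blast
  have eq: "(\<integral>\<^sup>+x. ennreal (1 / h x ^ card (insert i J)) \<partial>Pi\<^sub>M (insert i J) (\<lambda>_. lborel))
      = (\<integral>\<^sup>+x. ennreal (1 / marginal i (card J) h x ^ card J) \<partial>Pi\<^sub>M J (\<lambda>_. lborel))"
    if h: "quadratic_growth c (insert i J) h" for h
  proof -
    have [measurable]: "h \<in> borel_measurable (Pi\<^sub>M (insert i J) (\<lambda>_. lborel))"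
      using h by (rule quadratic_growth_measurable)
    show ?thesis
      using insert.hyps marginal_power(2)[OF h insert.hyps(3,1) insert.prems(1) m]
      by (subst product_nn_integral_insert) auto
  qed
  show ?case
    unfolding eq[OF insert.prems(2)] eq[OF insert.prems(3)] eq[OF insert.prems(4)]
    by (rule insert.IH[OF c'(1) c'(2)[OF insert.prems(2)] c'(2)[OF insert.prems(3)] c'(2)[OF insert.prems(4)]])
       (rule inf_convolution_marginal[OF insert.prems(2-4) insert.hyps(3,1) insert.prems(1) m s insert.prems(5)])
qed

section \<open>From coordinates to Euclidean space\<close>

lemma basis_sum_inner:
  "i \<in> Basis \<Longrightarrow> (\<Sum>b\<in>Basis. x b *\<^sub>R b) \<bullet> i = (x i :: real)"
  by (simp add: inner_sum_left inner_Basis if_distrib sum.If_cases cong: if_cong)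

lemma norm_basis_sum:
  "(norm (\<Sum>b\<in>Basis. x b *\<^sub>R (b::'a::euclidean_space)))\<^sup>2 = (\<Sum>b\<in>(Basis::'a set). (x b)\<^sup>2)"
  unfolding power2_norm_eq_inner
  by (subst euclidean_inner) (simp add: basis_sum_inner power2_eq_square)

lemma quadratic_growth_basis:
  fixes f :: "'a::euclidean_space \<Rightarrow> real"
  assumes [measurable]: "f \<in> borel_measurable borel" and "\<And>x. c * (1 + (norm x)\<^sup>2) \<le> f x"
  shows "quadratic_growth c Basis (\<lambda>x. f (\<Sum>b\<in>Basis. x b *\<^sub>R b))"
  unfolding quadratic_growth_def
proof (intro conjI allI impI)
  show "c * (1 + (\<Sum>b\<in>Basis. (x b)\<^sup>2)) \<le> f (\<Sum>b\<in>Basis. x b *\<^sub>R b)" for x :: "'a \<Rightarrow> real"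
    using assms(2)[of "\<Sum>b\<in>Basis. x b *\<^sub>R b"] by (simp add: norm_basis_sum)
  show "f (\<Sum>b\<in>Basis. x b *\<^sub>R b) = f (\<Sum>b\<in>Basis. y b *\<^sub>R b)" if "\<forall>i\<in>Basis. x i = y i" for x y :: "'a \<Rightarrow> real"
    using that by simp
qed measurable

lemma quadratic_growth_slice:
  assumes f: "quadratic_growth c (insert i J) f" and i: "i \<notin> J" "finite J" and c: "c \<ge> 0"
  shows "quadratic_growth c J (\<lambda>x. f (x(i := t)))"
  unfolding quadratic_growth_def
proof (intro conjI allI impI)
  have [measurable]: "f \<in> borel_measurable (Pi\<^sub>M (insert i J) (\<lambda>_. lborel))"
    by (rule quadratic_growth_measurable[OF f])
  show "(\<lambda>x. f (x(i := t))) \<in> borel_measurable (Pi\<^sub>M J (\<lambda>_. lborel))" by measurable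
  show "f (x(i := t)) = f (y(i := t))" if "\<forall>j\<in>J. x j = y j" for x y
    using f that by (auto simp: quadratic_growth_def)
  fix x
  have "c * (1 + (\<Sum>j\<in>insert i J. ((x(i := t)) j)\<^sup>2)) \<le> f (x(i := t))"
    using f unfolding quadratic_growth_def by blast
  moreover have "(\<Sum>j\<in>insert i J. ((x(i := t)) j)\<^sup>2) = t\<^sup>2 + (\<Sum>j\<in>J. (x j)\<^sup>2)"
    using i by (auto intro!: sum.cong)
  moreover have "c * (1 + (\<Sum>j\<in>J. (x j)\<^sup>2)) \<le> c * (1 + (t\<^sup>2 + (\<Sum>j\<in>J. (x j)\<^sup>2)))"
    using c by (intro mult_left_mono) auto
  ultimately show "c * (1 + (\<Sum>j\<in>J. (x j)\<^sup>2)) \<le> f (x(i := t))" by simp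
qed

text \<open>The product of the factors 1 + x_j^2 is at most (1 + |x|^2)^(card J), so the integral is
  dominated by a product of one-dimensional integrals, uniformly in \<open>f\<close>.\<close>

lemma quadratic_growth_nn_integral_bounded:
  fixes J :: "'i set"
  assumes J: "finite J" and c: "c > 0"
  obtains B where "B > 0" "\<And>f. quadratic_growth c J f \<Longrightarrow>
    (\<integral>\<^sup>+x. ennreal (1 / f x ^ card J) \<partial>Pi\<^sub>M J (\<lambda>_. lborel)) \<le> ennreal B"
proof -
  interpret product_sigma_finite "\<lambda>_. lborel :: real measure" by standard
  obtain P where P: "P > 0" "(\<integral>\<^sup>+t. ennreal (1 / (1 + t\<^sup>2)) \<partial>lborel) \<le> ennreal P"
    by (rule nn_integral_inverse_1_plus_square_finite)
  have p1: "1 + t\<^sup>2 > 0" for t :: real using zero_le_power2[of t] by linarith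
  have "(\<integral>\<^sup>+x. ennreal (1 / f x ^ card J) \<partial>Pi\<^sub>M J (\<lambda>_. lborel)) \<le> ennreal (1 / c ^ card J * P ^ card J)"
    if f: "quadratic_growth c J f" for f
  proof -
    have "(\<integral>\<^sup>+x. ennreal (1 / f x ^ card J) \<partial>Pi\<^sub>M J (\<lambda>_. lborel))
      \<le> (\<integral>\<^sup>+x. ennreal (1 / c ^ card J) * (\<Prod>j\<in>J. ennreal (1 / (1 + (x j)\<^sup>2))) \<partial>Pi\<^sub>M J (\<lambda>_. lborel))"
    proof (rule nn_integral_mono)
      fix x :: "'i \<Rightarrow> real"
      have "(\<Prod>j\<in>J. 1 + (x j)\<^sup>2) \<le> (\<Prod>j\<in>J. 1 + (\<Sum>j\<in>J. (x j)\<^sup>2))"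
        using J by (intro prod_mono) (auto intro!: member_le_sum)
      then have "c ^ card J * (\<Prod>j\<in>J. 1 + (x j)\<^sup>2) \<le> (c * (1 + (\<Sum>j\<in>J. (x j)\<^sup>2))) ^ card J"
        using c by (simp add: power_mult_distrib)
      also have "\<dots> \<le> f x ^ card J"
        using f c by (intro power_mono) (auto simp: quadratic_growth_def intro!: mult_nonneg_nonneg add_nonneg_nonneg sum_nonneg)
      finally have "1 / f x ^ card J \<le> 1 / (c ^ card J * (\<Prod>j\<in>J. 1 + (x j)\<^sup>2))"
        using c p1 quadratic_growth_pos[OF f c, of x] by (intro divide_left_mono) (auto intro!: mult_pos_pos prod_pos)
      then show "ennreal (1 / f x ^ card J) \<le> ennreal (1 / c ^ card J) * (\<Prod>j\<in>J. ennreal (1 / (1 + (x j)\<^sup>2)))"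
        using c p1 by (subst prod_ennreal) (auto simp: ennreal_mult[symmetric] prod_nonneg less_imp_le prod_dividef intro!: ennreal_leI)
    qed
    also have "\<dots> = ennreal (1 / c ^ card J) * (\<Prod>j\<in>J. \<integral>\<^sup>+t. ennreal (1 / (1 + t\<^sup>2)) \<partial>lborel)"
      using J by (subst nn_integral_cmult, measurable)
        (subst product_nn_integral_prod[where f = "\<lambda>_ t. ennreal (1 / (1 + t\<^sup>2))"], auto)
    also have "\<dots> \<le> ennreal (1 / c ^ card J) * ennreal P ^ card J"
      using P by (intro mult_left_mono) (auto intro!: power_mono)
    finally show ?thesis
      using c P by (simp add: ennreal_mult[symmetric] ennreal_power del: times_divide_eq_left)
  qed
  then show thesis using that[of "1 / c ^ card J * P ^ card J"] c P by simp
qed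

lemma nn_integral_PiM_pos:
  fixes f :: "('i \<Rightarrow> real) \<Rightarrow> real"
  assumes J: "finite J" and f: "quadratic_growth c J f" and c: "c > 0"
  shows "(\<integral>\<^sup>+x. ennreal (1 / f x ^ n) \<partial>Pi\<^sub>M J (\<lambda>_. lborel)) > 0"
proof (rule ccontr)
  interpret finite_product_sigma_finite "\<lambda>_. lborel :: real measure" J by standard fact
  note [measurable] = quadratic_growth_measurable[OF f]
  assume "\<not> ?thesis"
  then have "(\<integral>\<^sup>+x. ennreal (1 / f x ^ n) \<partial>Pi\<^sub>M J (\<lambda>_. lborel)) = 0"
    by (simp add: not_less)
  then have "AE x in Pi\<^sub>M J (\<lambda>_. lborel). ennreal (1 / f x ^ n) = 0"
    by (subst (asm) nn_integral_0_iff_AE) auto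
  moreover have "ennreal (1 / f x ^ n) \<noteq> 0" for x
    using quadratic_growth_pos[OF f c, of x] by simp
  ultimately have "AE x in Pi\<^sub>M J (\<lambda>_. lborel :: real measure). False" by simp
  then have "emeasure (Pi\<^sub>M J (\<lambda>_. lborel :: real measure)) (space (Pi\<^sub>M J (\<lambda>_. lborel :: real measure))) = 0"
    by (simp add: AE_iff_measurable[OF sets.top])
  moreover have "emeasure (Pi\<^sub>M J (\<lambda>_. lborel :: real measure)) (space (Pi\<^sub>M J (\<lambda>_. lborel :: real measure)))
      = (\<Prod>j\<in>J. emeasure lborel (UNIV :: real set))"
    by (subst space_PiM, subst measure_times) auto
  ultimately show False using J by simp
qed

text \<open>The exponent is one less than the dimension, which the lower-dimensional inequality on the
  hyperplanes \<open>x \<bullet> i = t\<close> tolerates once \<open>lam\<close> is chosen so that the largest slice integrals of the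
  two functions agree.\<close>

theorem inf_convolution_slices:
  fixes f :: "'a::euclidean_space \<Rightarrow> real"
  assumes [measurable]: "f \<in> borel_measurable borel" and c: "c > 0" and f: "\<And>x. c * (1 + (norm x)\<^sup>2) \<le> f x"
    and dim: "DIM('a) \<ge> 2"
  obtains lam where "lam > 0"
    "\<And>s c' k. s > 0 \<Longrightarrow> c' > 0 \<Longrightarrow> k \<in> borel_measurable borel \<Longrightarrow> (\<And>x. c' * (1 + (norm x)\<^sup>2) \<le> k x) \<Longrightarrow>
      (\<And>x y. k (x + s *\<^sub>R y) \<le> f x + s * (lam * (1 + (norm y)\<^sup>2))) \<Longrightarrow>
      (\<integral>\<^sup>+x. ennreal (1 / f x ^ (DIM('a) - 1)) \<partial>lborel)
        + ennreal s * (\<integral>\<^sup>+x. ennreal (1 / (lam * (1 + (norm x)\<^sup>2)) ^ (DIM('a) - 1)) \<partial>(lborel :: 'a measure))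
      \<le> (\<integral>\<^sup>+x. ennreal (1 / k x ^ (DIM('a) - 1)) \<partial>lborel)"
proof -
  interpret product_sigma_finite "\<lambda>_. lborel :: real measure" by standard
  \<comment> \<open>The hyperplanes orthogonal to this direction have dimension \<open>m\<close>,
    which equals the exponent: exactly the borderline case of
    \<open>inf_convolution_min\<close>.\<close>
  obtain i :: 'a where i: "i \<in> Basis" using nonempty_Basis by blast
  define J where "J = Basis - {i}"
  have J: "finite J" "i \<notin> J" "insert i J = Basis" "card J = DIM('a) - 1"
    using i by (auto simp: J_def)
  then have Jne: "J \<noteq> {}" using dim by (metis One_nat_def card.empty diff_is_0_eq not_less_eq_eq numeral_2_eq_2)
  define m where "m = card J"
  have m: "m > 0" "m = DIM('a) - 1" using J Jne by (auto simp: m_def card_gt_0_iff)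
  define L where "L h = (\<lambda>x. h (\<Sum>b\<in>Basis. x b *\<^sub>R b))" for h :: "'a \<Rightarrow> real"
  define I where "I h t = (\<integral>\<^sup>+x. ennreal (1 / L h (x(i := t)) ^ m) \<partial>Pi\<^sub>M J (\<lambda>_. lborel))" for h t
  have Lq: "quadratic_growth d (insert i J) (L h)"
    if "h \<in> borel_measurable borel" "\<And>x. d * (1 + (norm x)\<^sup>2) \<le> h x" for h d
    unfolding J(3) L_def using that by (rule quadratic_growth_basis)
  have int: "(\<integral>\<^sup>+x. ennreal (1 / h x ^ m) \<partial>lborel) = (\<integral>\<^sup>+t. I h t \<partial>lborel)"
    if [measurable]: "h \<in> borel_measurable borel" for h
  proof -
    have [measurable]: "L h \<in> borel_measurable (Pi\<^sub>M (insert i J) (\<lambda>_. lborel))"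
      unfolding L_def J(3) by measurable
    have "(\<integral>\<^sup>+x. ennreal (1 / h x ^ m) \<partial>lborel) = (\<integral>\<^sup>+x. ennreal (1 / L h x ^ m) \<partial>Pi\<^sub>M (insert i J) (\<lambda>_. lborel))"
      by (subst lborel_eq, subst nn_integral_distr) (simp_all add: L_def J(3))
    also have "\<dots> = (\<integral>\<^sup>+t. I h t \<partial>lborel)"
      unfolding I_def by (rule product_nn_integral_insert_rev[OF J(1,2)]) measurable
    finally show ?thesis .
  qed
  have Im: "I h \<in> borel_measurable borel" if [measurable]: "h \<in> borel_measurable borel" for h
  proof -
    interpret Jf: finite_product_sigma_finite "\<lambda>_. lborel :: real measure" J by standard (use J in auto)
    have [measurable]: "L h \<in> borel_measurable (Pi\<^sub>M (insert i J) (\<lambda>_. lborel))"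
      unfolding L_def J(3) by measurable
    have "(\<lambda>t. \<integral>\<^sup>+x. ennreal (1 / L h (x(i := t)) ^ m) \<partial>Pi\<^sub>M J (\<lambda>_. lborel)) \<in> borel_measurable lborel"
      by (rule Jf.borel_measurable_nn_integral) measurable
    then show ?thesis by (simp add: I_def[abs_def])
  qed
  have Ifin: "\<exists>B>0. \<forall>t. I h t \<le> ennreal B" and Ipos: "I h t > 0"
    if "h \<in> borel_measurable borel" "d > 0" "\<And>x. d * (1 + (norm x)\<^sup>2) \<le> h x" for h d t
  proof -
    have q: "quadratic_growth d J (\<lambda>x. L h (x(i := t)))" for t
      by (rule quadratic_growth_slice[OF Lq[OF that(1,3)]]) (use that J in auto)
    show "\<exists>B>0. \<forall>t. I h t \<le> ennreal B"
      using quadratic_growth_nn_integral_bounded[OF J(1) that(2)] q unfolding I_def m_def by metis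
    show "I h t > 0" unfolding I_def by (rule nn_integral_PiM_pos[OF J(1) q that(2)])
  qed
  define R where "R h t = enn2real (I h t)" for h t
  have RI: "I h t = ennreal (R h t)" "R h t > 0"
    if "h \<in> borel_measurable borel" "d > 0" "\<And>x. d * (1 + (norm x)\<^sup>2) \<le> h x" for h d t
  proof -
    note h = that
    obtain B where "I h t \<le> ennreal B" using Ifin[OF h] by blast
    then have "I h t < top" using le_less_trans ennreal_less_top by blast
    then show "I h t = ennreal (R h t)" "R h t > 0"
      using Ipos[OF that, of t] by (auto simp: R_def enn2real_positive_iff)
  qed
  have Rm: "R h \<in> borel_measurable borel" if [measurable]: "h \<in> borel_measurable borel" for h
    using Im[OF that] unfolding R_def[abs_def] by measurable
  define g where "g = (\<lambda>y::'a. 1 + (norm y)\<^sup>2)"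
  have gm [measurable]: "g \<in> borel_measurable borel" by (simp add: g_def)
  have g1: "1 * (1 + (norm x)\<^sup>2) \<le> g x" for x by (simp add: g_def)
  \<comment> \<open>The central slice of the quadratic has the largest integral, so its supremum is
    attained at height 0.\<close>
  have gmax: "R g t \<le> R g 0" for t
  proof -
    have "I g t \<le> I g 0"
      unfolding I_def
    proof (intro nn_integral_mono ennreal_leI divide_left_mono power_mono)
      fix x :: "'a \<Rightarrow> real"
      have Lg: "L g (x(i := t)) = 1 + (t\<^sup>2 + (\<Sum>j\<in>J. (x j)\<^sup>2))" for t
      proof -
        have "L g (x(i := t)) = 1 + (\<Sum>j\<in>insert i J. ((x(i := t)) j)\<^sup>2)"
          by (simp add: L_def g_def norm_basis_sum J(3))
        also have "(\<Sum>j\<in>insert i J. ((x(i := t)) j)\<^sup>2) = t\<^sup>2 + (\<Sum>j\<in>J. (x j)\<^sup>2)"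
          using J(1,2) by (auto intro!: sum.cong)
        finally show ?thesis .
      qed
      have sn: "(\<Sum>j\<in>J. (x j)\<^sup>2) \<ge> 0" by (rule sum_nonneg) simp
      show "L g (x(i := 0)) \<le> L g (x(i := t))" by (simp add: Lg)
      show "0 \<le> L g (x(i := 0))" using sn by (simp add: Lg)
      show "0 < L g (x(i := t)) ^ m * L g (x(i := 0)) ^ m"
        using sn by (intro mult_pos_pos zero_less_power) (simp_all only: Lg, auto intro: add_pos_nonneg)
    qed auto
    then show ?thesis
      using RI[OF gm zero_less_one g1, of t] RI[OF gm zero_less_one g1, of 0] by simp
  qed
  define M where "M = Sup (range (R f))"
  obtain B where B: "B > 0" "\<And>t. I f t \<le> ennreal B" using Ifin[OF assms(1) c f] by blast
  have bdd: "bdd_above (range (R f))"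
  proof (rule bdd_aboveI)
    fix z assume "z \<in> range (R f)"
    then obtain t where "z = R f t" by auto
    then show "z \<le> B" using B RI[OF assms(1) c f, of t] by (metis ennreal_le_iff less_imp_le)
  qed
  have fM: "R f t \<le> M" for t unfolding M_def by (intro cSup_upper bdd) auto
  have M: "M > 0" using fM[of 0] RI(2)[OF assms(1) c f, of 0] by linarith
  \<comment> \<open>Multiplying the quadratic by \<open>lam\<close> divides its slice integrals by
    lam^m; this value makes their maximum equal to \<open>M\<close>, the supremum of the slice
    integrals of \<open>f\<close>.\<close>
  define lam where "lam = root m (R g 0 / M)"
  have lam: "lam > 0" using M RI(2)[OF gm zero_less_one g1, of 0] m by (simp add: lam_def)
  have lam_m: "lam ^ m = R g 0 / M" using M RI(2)[OF gm zero_less_one g1, of 0] m by (simp add: lam_def)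
  define g' where "g' = (\<lambda>y::'a. lam * (1 + (norm y)\<^sup>2))"
  have g'm [measurable]: "g' \<in> borel_measurable borel" by (simp add: g'_def)
  have g'1: "lam * (1 + (norm x)\<^sup>2) \<le> g' x" for x by (simp add: g'_def)
  have g'R: "R g' t = M * R g t / R g 0" for t
  proof -
    have [measurable]: "(\<lambda>x. L g (x(i := t))) \<in> borel_measurable (Pi\<^sub>M J (\<lambda>_. lborel))"
      using quadratic_growth_slice[OF Lq[OF gm g1], of t] J by (simp add: quadratic_growth_def)
    have "I g' t = (\<integral>\<^sup>+x. ennreal (1 / lam ^ m) * ennreal (1 / L g (x(i := t)) ^ m) \<partial>Pi\<^sub>M J (\<lambda>_. lborel))"
      unfolding I_def
    proof (rule nn_integral_cong)
      fix x :: "'a \<Rightarrow> real"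
      have "L g' (x(i := t)) = lam * L g (x(i := t))" by (simp add: L_def g_def g'_def)
      moreover have "L g (x(i := t)) \<ge> 0" by (simp add: L_def g_def)
      ultimately show "ennreal (1 / L g' (x(i := t)) ^ m) = ennreal (1 / lam ^ m) * ennreal (1 / L g (x(i := t)) ^ m)"
        using lam by (simp add: power_mult_distrib ennreal_mult[symmetric])
    qed
    also have "\<dots> = ennreal (1 / lam ^ m) * I g t"
      unfolding I_def by (rule nn_integral_cmult) measurable
    finally have "ennreal (R g' t) = ennreal (1 / lam ^ m * R g t)"
      using RI[OF gm zero_less_one g1, of t] RI[OF g'm lam g'1, of t] lam
      by (simp add: ennreal_mult[symmetric] less_imp_le del: times_divide_eq_left)
    then have "R g' t = 1 / lam ^ m * R g t"
      using RI(2)[OF gm zero_less_one g1, of t] RI(2)[OF g'm lam g'1, of t] lam by (simp add: ennreal_inj)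
    then show ?thesis by (simp add: lam_m)
  qed
  show thesis
  proof (rule that[OF lam])
    fix s c' and k :: "'a \<Rightarrow> real"
    assume s: "s > 0" and c': "c' > 0" and km: "k \<in> borel_measurable borel"
      and k: "\<And>x. c' * (1 + (norm x)\<^sup>2) \<le> k x"
      and kle: "\<And>x y. k (x + s *\<^sub>R y) \<le> f x + s * (lam * (1 + (norm y)\<^sup>2))"
    have "(\<integral>\<^sup>+t. ennreal (R f t) \<partial>lborel) + ennreal s * (\<integral>\<^sup>+t. ennreal (R g' t) \<partial>lborel)
        \<le> (\<integral>\<^sup>+t. ennreal (R k t) \<partial>lborel)"
    proof (rule brunn_minkowski_functional[where m = M])
      show "R f t \<le> M" for t by (rule fM)
      show "R g' t \<le> M" for t
        using gmax[of t] M RI(2)[OF gm zero_less_one g1, of 0] by (simp add: g'R divide_simps)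
      show "\<exists>t. l < R f t" if "l < M" for l
        using less_cSupD[of "range (R f)" l] that by (auto simp: M_def)
      show "\<exists>t. l < R g' t" if "l < M" for l
        using that RI(2)[OF gm zero_less_one g1, of 0] by (intro exI[of _ 0]) (simp add: g'R)
      show "min (R f t) (R g' u) \<le> R k (t + s * u)" for t u
      proof -
        \<comment> \<open>A growth constant valid for \<open>f\<close>, \<open>g'\<close> and
          \<open>k\<close> at once.\<close>
        define c0 where "c0 = min c (min lam c')"
        have c0: "c0 > 0" "c0 \<le> c" "c0 \<le> lam" "c0 \<le> c'" using c c' lam by (auto simp: c0_def)
        have weak: "c0 * (1 + (norm x)\<^sup>2) \<le> d * (1 + (norm x)\<^sup>2)" if "c0 \<le> d" for d and x :: 'a
          using that by (intro mult_right_mono) auto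
        have qs: "quadratic_growth c0 J (\<lambda>x. L h (x(i := t)))"
          if "h \<in> borel_measurable borel" "\<And>x. c0 * (1 + (norm x)\<^sup>2) \<le> h x" for h t
          by (rule quadratic_growth_slice[OF Lq[OF that]]) (use c0 J in auto)
        have "min (I f t) (I g' u) \<le> I k (t + s * u)"
          unfolding I_def m_def
        proof (rule inf_convolution_min[OF J(1) Jne c0(1) s])
          show "quadratic_growth c0 J (\<lambda>x. L f (x(i := t)))"
            using order_trans[OF weak[OF c0(2)] f] by (intro qs) auto
          show "quadratic_growth c0 J (\<lambda>x. L g' (x(i := u)))"
            using order_trans[OF weak[OF c0(3)] g'1] by (intro qs) auto
          show "quadratic_growth c0 J (\<lambda>x. L k (x(i := t + s * u)))"
            using order_trans[OF weak[OF c0(4)] k] by (intro qs km) auto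
          fix x y :: "'a \<Rightarrow> real"
          have "(\<Sum>b\<in>Basis. ((\<lambda>j. x j + s * y j)(i := t + s * u)) b *\<^sub>R b)
            = (\<Sum>b\<in>Basis. (x(i := t)) b *\<^sub>R b) + s *\<^sub>R (\<Sum>b\<in>Basis. (y(i := u)) b *\<^sub>R b)"
            by (simp add: scaleR_sum_right sum.distrib[symmetric] scaleR_add_left[symmetric]) (auto intro!: sum.cong)
          then show "L k ((\<lambda>j. x j + s * y j)(i := t + s * u)) \<le> L f (x(i := t)) + s * L g' (y(i := u))"
            unfolding L_def g'_def by (simp only: kle)
        qed
        then show ?thesis
          using RI[OF assms(1) c f, of t] RI[OF g'm lam g'1, of u] RI[OF km c' k, of "t + s * u"]
          by (simp add: min_def split: if_splits)
      qed
      show "0 \<le> R f x" "0 \<le> R g' x" "0 \<le> R k x" for x by (auto simp: R_def)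
    qed (use s Rm km in auto)
    then show "(\<integral>\<^sup>+x. ennreal (1 / f x ^ (DIM('a) - 1)) \<partial>lborel)
        + ennreal s * (\<integral>\<^sup>+x. ennreal (1 / (lam * (1 + (norm x)\<^sup>2)) ^ (DIM('a) - 1)) \<partial>(lborel :: 'a measure))
      \<le> (\<integral>\<^sup>+x. ennreal (1 / k x ^ (DIM('a) - 1)) \<partial>lborel)"
      unfolding m(2)[symmetric]
      using int[OF assms(1), unfolded RI(1)[OF assms(1) c f]] int[OF g'm, unfolded RI(1)[OF g'm lam g'1]]
        int[OF km, unfolded RI(1)[OF km c' k]]
      by (simp only: g'_def)
  qed
qed

section \<open>The sharp Sobolev inequality\<close>

lemma nn_integral_Gamma_scaled:
  assumes "A > 0" "p > 0"
  shows "(\<integral>\<^sup>+t. ennreal (indicator {0<..} t * t powr (p - 1) * exp (- (A * t))) \<partial>lborel) = ennreal (Gamma p / A powr p)"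
proof -
  let ?g = "\<lambda>t. ennreal (indicator {0..} t * t powr (p - 1) / exp t)"
  have "ennreal (Gamma p) = (\<integral>\<^sup>+t. ?g t \<partial>lborel)"
    by (simp add: Gamma_conv_nn_integral_real[OF assms(2)])
  also have "\<dots> = ennreal A * (\<integral>\<^sup>+t. ?g (0 + A * t) \<partial>lborel)"
    using assms by (subst nn_integral_real_affine[where c = A and t = 0]) auto
  also have "(\<integral>\<^sup>+t. ?g (0 + A * t) \<partial>lborel)
      = (\<integral>\<^sup>+t. ennreal (A powr (p - 1)) * ennreal (indicator {0<..} t * t powr (p - 1) * exp (- (A * t))) \<partial>lborel)"
  proof (rule nn_integral_cong)
    fix t
    show "?g (0 + A * t) = ennreal (A powr (p - 1)) * ennreal (indicator {0<..} t * t powr (p - 1) * exp (- (A * t)))"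
    proof (cases "t > 0")
      case True
      then show ?thesis using assms
        by (simp add: ennreal_mult[symmetric] powr_mult exp_minus divide_inverse)
    next
      case False
      then show ?thesis using assms by (auto simp: indicator_def zero_le_mult_iff)
    qed
  qed
  also have "\<dots> = ennreal (A powr (p - 1)) * (\<integral>\<^sup>+t. ennreal (indicator {0<..} t * t powr (p - 1) * exp (- (A * t))) \<partial>lborel)"
    by (rule nn_integral_cmult) measurable
  finally have "ennreal (Gamma p) = ennreal (A powr p) * (\<integral>\<^sup>+t. ennreal (indicator {0<..} t * t powr (p - 1) * exp (- (A * t))) \<partial>lborel)"
    using assms by (simp add: mult.assoc[symmetric] ennreal_mult[symmetric] powr_mult_base)
  then have "ennreal (1 / A powr p) * ennreal (Gamma p) = ennreal (1 / A powr p) * ennreal (A powr p) *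
      (\<integral>\<^sup>+t. ennreal (indicator {0<..} t * t powr (p - 1) * exp (- (A * t))) \<partial>lborel)"
    by (simp add: mult.assoc)
  also have "ennreal (1 / A powr p) * ennreal (A powr p) = 1"
    using assms by (simp add: ennreal_mult[symmetric])
  finally show ?thesis using assms by (simp add: ennreal_mult[symmetric])
qed

text \<open>exp(-t |x|^2) is the integral of exp(-s) over s above t |x|^2. Exchanging the integrals
  leaves the volume of the ball of radius sqrt(s/t), and the resulting Gamma integral cancels the
  Gamma value in the volume of the unit ball.\<close>

lemma nn_integral_gaussian_euclidean:
  assumes t: "t > 0"
  shows "(\<integral>\<^sup>+x. ennreal (exp (- (t * (norm (x::'a::euclidean_space))\<^sup>2))) \<partial>lborel) = ennreal ((pi / t) powr (real DIM('a) / 2))"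
proof -
  let ?n = "real DIM('a)"
  have pp: "?n / 2 + 1 > 0" by (simp add: add_nonneg_pos)
  have Gpos: "Gamma (?n / 2 + 1) > 0" by (rule Gamma_real_pos[OF pp])
  then have Gne: "Gamma (?n / 2 + 1) \<noteq> 0" by linarith
  have "(\<integral>\<^sup>+x. ennreal (exp (- (t * (norm (x::'a))\<^sup>2))) \<partial>lborel)
    = (\<integral>\<^sup>+x. (\<integral>\<^sup>+s. ennreal (exp (- s)) * indicator {(x::'a, s). t * (norm x)\<^sup>2 \<le> s} (x, s) \<partial>lborel) \<partial>lborel)"
  proof (rule nn_integral_cong)
    fix x :: 'a
    define a where "a = t * (norm x)\<^sup>2"
    have "(\<integral>\<^sup>+s. ennreal (exp (- s)) * indicator {(x::'a, s). t * (norm x)\<^sup>2 \<le> s} (x, s) \<partial>lborel)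
      = (\<integral>\<^sup>+s. ennreal (exp (- s)) * indicator {a..} s \<partial>lborel)"
      by (intro nn_integral_cong) (auto simp: a_def split: split_indicator)
    also have "\<dots> = ennreal (0 - (- exp (- a)))"
    proof (rule nn_integral_FTC_atLeast)
      show "((\<lambda>s. - exp (- s)) has_real_derivative exp (- s)) (at s)" for s :: real
        by (auto intro!: derivative_eq_intros)
      have "((\<lambda>s::real. - inverse (exp s)) \<longlongrightarrow> - 0) at_top"
        by (intro tendsto_minus tendsto_inverse_0_at_top exp_at_top)
      then show "((\<lambda>s::real. - exp (- s)) \<longlongrightarrow> 0) at_top" by (simp add: exp_minus)
    qed auto
    finally show "ennreal (exp (- (t * (norm x)\<^sup>2)))
        = (\<integral>\<^sup>+s. ennreal (exp (- s)) * indicator {(x::'a, s). t * (norm x)\<^sup>2 \<le> s} (x, s) \<partial>lborel)"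
      by (simp add: a_def)
  qed
  also have "\<dots> = (\<integral>\<^sup>+s. (\<integral>\<^sup>+x. ennreal (exp (- s)) * indicator {(x::'a, s). t * (norm x)\<^sup>2 \<le> s} (x, s) \<partial>lborel) \<partial>lborel)"
    by (rule lborel_pair.Fubini'[symmetric]) (simp add: case_prod_beta')
  also have "\<dots> = (\<integral>\<^sup>+s. ennreal (unit_ball_vol ?n / t powr (?n / 2))
      * ennreal (indicator {0<..} s * s powr (?n / 2 + 1 - 1) * exp (- (1 * s))) \<partial>lborel)"
  proof (rule nn_integral_cong_AE)
    have "AE s in lborel. s \<noteq> (0::real)" by (rule AE_lborel_singleton)
    then show "AE s in lborel. (\<integral>\<^sup>+x. ennreal (exp (- s)) * indicator {(x::'a, s). t * (norm x)\<^sup>2 \<le> s} (x, s) \<partial>lborel)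
      = ennreal (unit_ball_vol ?n / t powr (?n / 2)) * ennreal (indicator {0<..} s * s powr (?n / 2 + 1 - 1) * exp (- (1 * s)))"
    proof eventually_elim
      fix s :: real assume "s \<noteq> 0"
      have meas: "{x::'a. t * (norm x)\<^sup>2 \<le> s} \<in> sets borel" by measurable
      have "(\<integral>\<^sup>+x. ennreal (exp (- s)) * indicator {(x::'a, s). t * (norm x)\<^sup>2 \<le> s} (x, s) \<partial>lborel)
        = (\<integral>\<^sup>+x. ennreal (exp (- s)) * indicator {x::'a. t * (norm x)\<^sup>2 \<le> s} x \<partial>lborel)"
        by (intro nn_integral_cong) (auto split: split_indicator)
      also have "\<dots> = ennreal (exp (- s)) * emeasure lborel {x::'a. t * (norm x)\<^sup>2 \<le> s}"
        using meas by (subst nn_integral_cmult) auto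
      finally have *: "(\<integral>\<^sup>+x. ennreal (exp (- s)) * indicator {(x::'a, s). t * (norm x)\<^sup>2 \<le> s} (x, s) \<partial>lborel)
        = ennreal (exp (- s)) * emeasure lborel {x::'a. t * (norm x)\<^sup>2 \<le> s}" .
      show "(\<integral>\<^sup>+x. ennreal (exp (- s)) * indicator {(x::'a, s). t * (norm x)\<^sup>2 \<le> s} (x, s) \<partial>lborel)
        = ennreal (unit_ball_vol ?n / t powr (?n / 2)) * ennreal (indicator {0<..} s * s powr (?n / 2 + 1 - 1) * exp (- (1 * s)))"
      proof (cases "s > 0")
        case True
        have cb: "{x::'a. t * (norm x)\<^sup>2 \<le> s} = cball 0 (sqrt (s / t))"
        proof -
          have "t * (norm x)\<^sup>2 \<le> s \<longleftrightarrow> norm x \<le> sqrt (s / t)" for x :: 'a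
          proof -
            have "t * (norm x)\<^sup>2 \<le> s \<longleftrightarrow> (norm x)\<^sup>2 \<le> s / t" using t by (simp add: field_simps)
            also have "\<dots> \<longleftrightarrow> norm x \<le> sqrt (s / t)"
              by (metis norm_ge_zero real_sqrt_le_iff real_sqrt_abs abs_norm_cancel)
            finally show ?thesis .
          qed
          then show ?thesis by (intro set_eqI) (simp only: mem_Collect_eq mem_cball_0)
        qed
        have "emeasure lborel {x::'a. t * (norm x)\<^sup>2 \<le> s} = ennreal (unit_ball_vol ?n * sqrt (s / t) ^ DIM('a))"
          unfolding cb by (rule emeasure_cball) (use True t in simp)
        also have "sqrt (s / t) ^ DIM('a) = s powr (?n / 2) / t powr (?n / 2)"
        proof -
          have st: "s / t > 0" using True t by simp
          have "sqrt (s / t) ^ DIM('a) = sqrt (s / t) powr ?n"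
            using st by (intro powr_realpow[symmetric]) simp
          also have "\<dots> = ((s / t) powr (1 / 2)) powr ?n"
            using st by (subst powr_half_sqrt) auto
          also have "((s / t) powr (1 / 2)) powr ?n = (s / t) powr (?n / 2)"
            by (simp only: powr_powr mult_1_left times_divide_eq_left)
          also have "\<dots> = s powr (?n / 2) / t powr (?n / 2)"
            by (rule powr_divide)
          finally show ?thesis .
        qed
        finally show ?thesis
          unfolding * using True t by (simp add: ennreal_mult[symmetric] mult_ac)
      next
        case False
        then have "{x::'a. t * (norm x)\<^sup>2 \<le> s} = {}"
          using t \<open>s \<noteq> 0\<close> by (auto simp: not_le intro: less_le_trans[of s 0])
        then show ?thesis unfolding * using False by simp
      qed
    qed
  qed
  also have "\<dots> = ennreal (unit_ball_vol ?n / t powr (?n / 2))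
      * (\<integral>\<^sup>+s. ennreal (indicator {0<..} s * s powr (?n / 2 + 1 - 1) * exp (- (1 * s))) \<partial>lborel)"
    by (rule nn_integral_cmult) measurable
  also have "\<dots> = ennreal (unit_ball_vol ?n / t powr (?n / 2)) * ennreal (Gamma (?n / 2 + 1))"
    by (subst nn_integral_Gamma_scaled) (use pp in auto)
  also have "\<dots> = ennreal ((pi / t) powr (?n / 2))"
    using t Gpos Gne by (simp add: ennreal_mult[symmetric] unit_ball_vol_def powr_divide less_imp_le)
  finally show ?thesis .
qed

text \<open>The power is written as a Gamma integral of exp(-(1 + |x|^2) t); after exchanging the
  integrals, the one over \<open>x\<close> is Gaussian.\<close>

lemma nn_integral_1_plus_norm_square_power:
  assumes m: "real m > real DIM('a::euclidean_space) / 2"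
  shows "(\<integral>\<^sup>+x. ennreal (1 / (1 + (norm (x::'a))\<^sup>2) ^ m) \<partial>lborel)
    = ennreal (pi powr (real DIM('a) / 2) * Gamma (real m - real DIM('a) / 2) / Gamma (real m))"
proof -
  let ?n = "real DIM('a)"
  have m0: "real m > 0" using m by (rule le_less_trans[rotated]) simp
  have G: "Gamma (real m) > 0" using m0 by (rule Gamma_real_pos)
  have Gm: "Gamma (real m - ?n / 2) > 0" using m by (intro Gamma_real_pos) simp
  have "(\<integral>\<^sup>+x. ennreal (1 / (1 + (norm (x::'a))\<^sup>2) ^ m) \<partial>lborel)
    = (\<integral>\<^sup>+x. (\<integral>\<^sup>+t. ennreal (1 / Gamma (real m)) *
        ennreal (indicator {0<..} t * t powr (real m - 1) * exp (- ((1 + (norm (x::'a))\<^sup>2) * t))) \<partial>lborel) \<partial>lborel)"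
  proof (rule nn_integral_cong)
    fix x :: 'a
    have p: "1 + (norm x)\<^sup>2 > 0" by (simp add: add_pos_nonneg)
    have "(\<integral>\<^sup>+t. ennreal (1 / Gamma (real m)) *
        ennreal (indicator {0<..} t * t powr (real m - 1) * exp (- ((1 + (norm (x::'a))\<^sup>2) * t))) \<partial>lborel)
      = ennreal (1 / Gamma (real m)) * ennreal (Gamma (real m) / (1 + (norm x)\<^sup>2) powr real m)"
      by (subst nn_integral_cmult, measurable) (simp only: nn_integral_Gamma_scaled[OF p m0])
    also have "\<dots> = ennreal (1 / (1 + (norm (x::'a))\<^sup>2) ^ m)"
      using G p by (simp add: ennreal_mult[symmetric] powr_realpow)
    finally show "ennreal (1 / (1 + (norm (x::'a))\<^sup>2) ^ m) = (\<integral>\<^sup>+t. ennreal (1 / Gamma (real m)) *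
        ennreal (indicator {0<..} t * t powr (real m - 1) * exp (- ((1 + (norm (x::'a))\<^sup>2) * t))) \<partial>lborel)" by simp
  qed
  also have "\<dots> = (\<integral>\<^sup>+t. (\<integral>\<^sup>+x. ennreal (1 / Gamma (real m)) *
        ennreal (indicator {0<..} t * t powr (real m - 1) * exp (- ((1 + (norm (x::'a))\<^sup>2) * t))) \<partial>lborel) \<partial>lborel)"
    by (rule lborel_pair.Fubini'[symmetric]) (simp add: case_prod_beta')
  also have "\<dots> = (\<integral>\<^sup>+t. ennreal (pi powr (?n / 2) / Gamma (real m)) *
        ennreal (indicator {0<..} t * t powr (real m - ?n / 2 - 1) * exp (- (1 * t))) \<partial>lborel)"
  proof (rule nn_integral_cong)
    fix t :: real
    show "(\<integral>\<^sup>+x. ennreal (1 / Gamma (real m)) *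
        ennreal (indicator {0<..} t * t powr (real m - 1) * exp (- ((1 + (norm (x::'a))\<^sup>2) * t))) \<partial>lborel)
      = ennreal (pi powr (?n / 2) / Gamma (real m)) *
        ennreal (indicator {0<..} t * t powr (real m - ?n / 2 - 1) * exp (- (1 * t)))"
    proof (cases "t > 0")
      case True
      have "(\<integral>\<^sup>+x. ennreal (1 / Gamma (real m)) *
        ennreal (indicator {0<..} t * t powr (real m - 1) * exp (- ((1 + (norm (x::'a))\<^sup>2) * t))) \<partial>lborel)
        = (\<integral>\<^sup>+x. ennreal (t powr (real m - 1) * exp (- t) / Gamma (real m)) * ennreal (exp (- (t * (norm (x::'a))\<^sup>2))) \<partial>lborel)"
        using True G by (intro nn_integral_cong) (simp add: ennreal_mult[symmetric] exp_add[symmetric] algebra_simps)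
      also have "\<dots> = ennreal (t powr (real m - 1) * exp (- t) / Gamma (real m)) * ennreal ((pi / t) powr (?n / 2))"
        by (subst nn_integral_cmult, measurable) (simp only: nn_integral_gaussian_euclidean[OF True])
      also have "\<dots> = ennreal (t powr (real m - 1) * exp (- t) / Gamma (real m) * (pi / t) powr (?n / 2))"
        using G by (intro ennreal_mult[symmetric]) auto
      also have "t powr (real m - 1) * exp (- t) / Gamma (real m) * (pi / t) powr (?n / 2)
          = pi powr (?n / 2) / Gamma (real m) * (t powr (real m - ?n / 2 - 1) * exp (- t))"
      proof -
        have "t powr (real m - ?n / 2 - 1) = t powr (real m - 1) / t powr (?n / 2)"
          using True by (simp add: powr_diff[symmetric] algebra_simps)
        then show ?thesis using True by (simp add: powr_divide)
      qed
      finally show ?thesis using True G by (simp add: ennreal_mult[symmetric])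
    qed simp
  qed
  also have "\<dots> = ennreal (pi powr (?n / 2) / Gamma (real m)) * ennreal (Gamma (real m - ?n / 2) / 1 powr (real m - ?n / 2))"
    using m by (subst nn_integral_cmult, measurable) (subst nn_integral_Gamma_scaled, auto)
  also have "\<dots> = ennreal (pi powr (?n / 2) * Gamma (real m - ?n / 2) / Gamma (real m))"
    using G Gm by (simp add: ennreal_mult[symmetric])
  finally show ?thesis .
qed

section \<open>Gradients and second-order Taylor bounds\<close>

text \<open>Resolves the definite description in \<open>gradient\<close>: the difference of two
  gradients, tested against itself, is 0.\<close>

lemma gradient_eqI: "GDERIV f x :> D \<Longrightarrow> gradient f x = D"
  unfolding gradient_def
proof (rule the_equality)
  fix D' assume "GDERIV f x :> D'" "GDERIV f x :> D"
  then have "(\<lambda>h. h \<bullet> D') = (\<lambda>h. h \<bullet> D)"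
    unfolding gderiv_def by (rule has_derivative_unique)
  then have "(D' - D) \<bullet> D' = (D' - D) \<bullet> D" by (rule fun_cong)
  then have "(D' - D) \<bullet> (D' - D) = 0" by (simp only: inner_diff_right[of "D' - D"])
  then show "D' = D" by simp
qed

lemma gradient_has_derivative:
  fixes f :: "'a::euclidean_space \<Rightarrow> real"
  assumes "f differentiable (at x)"
  shows "(f has_derivative (\<lambda>h. h \<bullet> gradient f x)) (at x)"
    and "gradient f x = (\<Sum>b\<in>Basis. frechet_derivative f (at x) b *\<^sub>R b)"
proof -
  define G where "G = (\<Sum>b\<in>Basis. frechet_derivative f (at x) b *\<^sub>R b)"
  have lin: "linear (frechet_derivative f (at x))" using assms by (rule linear_frechet_derivative)
  have "frechet_derivative f (at x) h = h \<bullet> G" for h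
  proof -
    have "frechet_derivative f (at x) h = frechet_derivative f (at x) (\<Sum>b\<in>Basis. (h \<bullet> b) *\<^sub>R b)"
      by (simp add: euclidean_representation)
    also have "\<dots> = (\<Sum>b\<in>Basis. (h \<bullet> b) * frechet_derivative f (at x) b)"
      using lin by (simp add: linear_sum linear_cmul)
    finally show ?thesis by (simp add: G_def inner_sum_right mult.commute)
  qed
  then have "frechet_derivative f (at x) = (\<lambda>h. h \<bullet> G)" by auto
  then have D: "(f has_derivative (\<lambda>h. h \<bullet> G)) (at x)"
    using assms by (simp add: frechet_derivative_works)
  then have eq: "gradient f x = G"
    by (intro gradient_eqI) (simp only: gderiv_def)
  then show "gradient f x = (\<Sum>b\<in>Basis. frechet_derivative f (at x) b *\<^sub>R b)"
    by (simp add: G_def)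
  show "(f has_derivative (\<lambda>h. h \<bullet> gradient f x)) (at x)"
    using D by (simp only: eq)
qed

lemma has_derivative_gradient_eqI:
  fixes f :: "'a::euclidean_space \<Rightarrow> real"
  assumes "(f has_derivative (\<lambda>h. h \<bullet> D)) (at x)" shows "gradient f x = D"
  using assms by (intro gradient_eqI) (simp add: gderiv_def)

lemma smooth_has_derivative_gradient:
  fixes f :: "'a::euclidean_space \<Rightarrow> real"
  assumes "smooth f" shows "(f has_derivative (\<lambda>h. h \<bullet> gradient f x)) (at x)"
  using assms gradient_has_derivative(1) smooth_on_has_derivative[of UNIV f x]
  by (auto simp: smooth_on_UNIV differentiable_def)

lemma smooth_continuous_gradient:
  fixes f :: "'a::euclidean_space \<Rightarrow> real"
  assumes "smooth f" shows "continuous_on UNIV (gradient f)"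
proof -
  have f: "smooth_on UNIV f" using assms by (simp add: smooth_on_UNIV)
  have "gradient f = (\<lambda>x. \<Sum>b\<in>Basis. frechet_derivative f (at x) b *\<^sub>R b)"
    using smooth_on_has_derivative[OF f] by (intro ext gradient_has_derivative(2)) (auto simp: differentiable_def)
  then show ?thesis
    using smooth_on_continuous_on[OF smooth_on_frechet_derivative[OF f]] by (auto intro!: continuous_intros)
qed

text \<open>Taylor's formula along the segment from \<open>x\<close> to x + v. The second partial
  derivatives vanish outside the compact set, so they are bounded on the whole space.\<close>

lemma smooth_taylor_bound:
  fixes e :: "'a::euclidean_space \<Rightarrow> real"
  assumes e: "smooth e" and K: "compact K" "\<And>x. x \<notin> K \<Longrightarrow> e x = 0"
  obtains M where "M \<ge> 0" "\<And>x v. \<bar>e (x + v) - e x - v \<bullet> gradient e x\<bar> \<le> M / 2 * (norm v)\<^sup>2"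
proof -
  have es: "smooth_on UNIV e" using e by (simp add: smooth_on_UNIV)
  define d where "d c y = frechet_derivative e (at y) c" for c y
  define dd where "dd c b y = frechet_derivative (d c) (at y) b" for c b y
  have ds: "smooth_on UNIV (d c)" and dds: "smooth_on UNIV (dd c b)" for c b
    unfolding d_def[abs_def] dd_def[abs_def] by (intro smooth_on_frechet_derivative es)+
  have oK: "open (- K)" using K(1) compact_imp_closed by (intro open_Compl) auto
  have d0: "d c y = 0" if "y \<in> - K" for c y
  proof -
    have "(e has_derivative (\<lambda>_. 0)) (at y)"
      by (rule has_derivative_transform_within_open[OF has_derivative_const[of 0] _ that])
         (use K oK in auto)
    then show ?thesis using frechet_derivative_at[of e "\<lambda>_. 0" y] by (simp add: d_def fun_eq_iff)
  qed
  have dd0: "dd c b y = 0" if "y \<in> - K" for c b y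
  proof -
    have "(d c has_derivative (\<lambda>_. 0)) (at y)"
      by (rule has_derivative_transform_within_open[OF has_derivative_const[of 0] _ that])
         (use K d0 oK in auto)
    then show ?thesis using frechet_derivative_at[of "d c" "\<lambda>_. 0" y] by (simp add: dd_def fun_eq_iff)
  qed
  have "\<exists>B. \<forall>y. \<bar>dd c b y\<bar> \<le> B" for c b
  proof -
    have "bounded (dd c b ` K)"
      using smooth_on_continuous_on[OF dds] K by (intro compact_imp_bounded compact_continuous_image) (auto intro: continuous_on_subset)
    then obtain B where "\<forall>y\<in>K. \<bar>dd c b y\<bar> \<le> B" by (auto simp: bounded_iff)
    then have "\<bar>dd c b y\<bar> \<le> max B 0" for y using dd0[of y c b] by (cases "y \<in> K") auto
    then show ?thesis by blast
  qed
  then obtain B where B: "\<And>c b y. \<bar>dd c b y\<bar> \<le> B c b" by metis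
  define M where "M = (\<Sum>c\<in>(Basis::'a set). \<Sum>b\<in>(Basis::'a set). B c b)"
  have B0: "B c b \<ge> 0" for c b using B[of c b 0] by linarith
  have M: "M \<ge> 0" unfolding M_def by (intro sum_nonneg B0)
  have "\<bar>e (x + v) - e x - v \<bullet> gradient e x\<bar> \<le> M / 2 * (norm v)\<^sup>2" for x v
  proof -
    define h where "h t = e (x + t *\<^sub>R v)" for t
    define h1 where "h1 t = (\<Sum>c\<in>Basis. (v \<bullet> c) * d c (x + t *\<^sub>R v))" for t
    define h2 where "h2 t = (\<Sum>c\<in>Basis. (v \<bullet> c) * (\<Sum>b\<in>Basis. (v \<bullet> b) * dd c b (x + t *\<^sub>R v)))" for t
    have lin: "frechet_derivative f (at y) v = (\<Sum>c\<in>Basis. (v \<bullet> c) * frechet_derivative f (at y) c)"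
      if "smooth_on UNIV f" for f :: "'a \<Rightarrow> real" and y
    proof -
      have "linear (frechet_derivative f (at y))"
        using smooth_on_has_derivative[OF that, of y] by (auto intro!: linear_frechet_derivative simp: differentiable_def)
      then have "frechet_derivative f (at y) (\<Sum>c\<in>Basis. (v \<bullet> c) *\<^sub>R c) = (\<Sum>c\<in>Basis. (v \<bullet> c) * frechet_derivative f (at y) c)"
        by (simp add: linear_sum linear_cmul)
      then show ?thesis by (simp add: euclidean_representation)
    qed
    have line: "((\<lambda>t. f (x + t *\<^sub>R v)) has_real_derivative (\<Sum>c\<in>Basis. (v \<bullet> c) * frechet_derivative f (at (x + t *\<^sub>R v)) c)) (at t)"
      if "smooth_on UNIV f" for f :: "'a \<Rightarrow> real" and t
    proof -
      have "((\<lambda>t. x + t *\<^sub>R v) has_derivative (\<lambda>s. s *\<^sub>R v)) (at t)"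
        by (auto intro!: derivative_eq_intros)
      from has_derivative_compose[OF this smooth_on_has_derivative[OF that UNIV_I]]
      have D: "((\<lambda>t. f (x + t *\<^sub>R v)) has_derivative (\<lambda>s. frechet_derivative f (at (x + t *\<^sub>R v)) (s *\<^sub>R v))) (at t)" .
      have "linear (frechet_derivative f (at (x + t *\<^sub>R v)))"
        using smooth_on_has_derivative[OF that, of "x + t *\<^sub>R v"] by (auto intro!: linear_frechet_derivative simp: differentiable_def)
      then have "frechet_derivative f (at (x + t *\<^sub>R v)) (s *\<^sub>R v) = (\<Sum>c\<in>Basis. (v \<bullet> c) * frechet_derivative f (at (x + t *\<^sub>R v)) c) * s" for s
        using lin[OF that, of "x + t *\<^sub>R v"] by (simp add: linear_cmul)
      with D show ?thesis by (simp add: has_field_derivative_def)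
    qed
    have D1: "(h has_real_derivative h1 t) (at t)" for t
      using line[OF es, of t] by (simp add: h_def[abs_def] h1_def d_def)
    have D2: "(h1 has_real_derivative h2 t) (at t)" for t
      unfolding h1_def[abs_def] h2_def using line[OF ds, where t = t]
      by (intro DERIV_sum DERIV_cmult) (simp add: dd_def)
    define diff where "diff = (\<lambda>m::nat. if m = 0 then h else if m = 1 then h1 else h2)"
    have "\<forall>m t. m < 2 \<and> 0 \<le> t \<and> t \<le> 1 \<longrightarrow> (diff m has_real_derivative diff (Suc m) t) (at t)"
      using D1 D2 by (auto simp: diff_def less_2_cases_iff)
    then obtain t where "h 1 = (\<Sum>m<2. diff m 0 / fact m * 1 ^ m) + diff 2 t / fact 2 * 1 ^ 2"
      using Maclaurin2[of 1 diff h 2] by (auto simp: diff_def)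
    then have h: "h 1 = h 0 + h1 0 + h2 t / 2" by (simp add: diff_def numeral_2_eq_2)
    have "\<bar>h2 t\<bar> \<le> (\<Sum>c\<in>Basis. \<Sum>b\<in>Basis. (norm v)\<^sup>2 * B c b)"
      unfolding h2_def sum_distrib_left
    proof (rule order_trans[OF sum_abs], rule sum_mono, rule order_trans[OF sum_abs], rule sum_mono)
      fix c b :: 'a assume cb: "c \<in> Basis" "b \<in> Basis"
      have "\<bar>v \<bullet> c\<bar> * (\<bar>v \<bullet> b\<bar> * \<bar>dd c b (x + t *\<^sub>R v)\<bar>) \<le> norm v * (norm v * B c b)"
        using cb B by (intro mult_mono Basis_le_norm) auto
      then show "\<bar>(v \<bullet> c) * ((v \<bullet> b) * dd c b (x + t *\<^sub>R v))\<bar> \<le> (norm v)\<^sup>2 * B c b"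
        by (simp add: abs_mult power2_eq_square mult.assoc)
    qed
    also have "\<dots> = M * (norm v)\<^sup>2" by (simp add: M_def sum_distrib_left sum_distrib_right mult.commute)
    finally have "\<bar>h2 t / 2\<bar> \<le> M / 2 * (norm v)\<^sup>2" by simp
    moreover have "h1 0 = v \<bullet> gradient e x"
    proof -
      have "gradient e x = (\<Sum>b\<in>Basis. frechet_derivative e (at x) b *\<^sub>R b)"
        using smooth_on_has_derivative[OF es, of x] by (intro gradient_has_derivative(2)) (auto simp: differentiable_def)
      then show ?thesis by (simp add: h1_def d_def inner_sum_right mult.commute)
    qed
    ultimately show ?thesis using h by (simp add: h_def)
  qed
  then show thesis using that M by blast
qed

lemma integrable_1_plus_norm_square_power:
  assumes m: "real m > real DIM('a::euclidean_space) / 2"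
  shows "integrable lborel (\<lambda>x::'a. 1 / (1 + (norm x)\<^sup>2) ^ m)" (is ?int)
    and "(LINT x::'a|lborel. 1 / (1 + (norm x)\<^sup>2) ^ m)
      = pi powr (real DIM('a) / 2) * Gamma (real m - real DIM('a) / 2) / Gamma (real m)" (is ?eq)
proof -
  have m0: "real m > 0" using m by (rule le_less_trans[rotated]) simp
  have G: "Gamma (real m) > 0" using m0 by (rule Gamma_real_pos)
  have Gm: "Gamma (real m - real DIM('a) / 2) > 0" using m by (intro Gamma_real_pos) simp
  show ?int
    by (rule integrableI_nonneg) (use nn_integral_1_plus_norm_square_power[OF m] in auto)
  show ?eq
    using nn_integral_1_plus_norm_square_power[OF m] G Gm
    by (subst integral_eq_nn_integral) auto
qed

section \<open>The infimal convolution inequality differentiated at time 0\<close>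

text \<open>An upper bound with the exact first-order term and an error quadratic in
  \<open>v\<close>, uniform for |v| up to 1/2. The induction adds one factor 1/(1 + v) at a
  time.\<close>

lemma inverse_power_expansion:
  obtains L where "L \<ge> 0" "\<And>v::real. \<bar>v\<bar> \<le> 1 / 2 \<Longrightarrow> (1 / (1 + v)) ^ N \<le> 1 - real N * v + L * v\<^sup>2"
proof -
  have "\<exists>L\<ge>0. \<forall>v::real. \<bar>v\<bar> \<le> 1 / 2 \<longrightarrow> (1 / (1 + v)) ^ N \<le> 1 - real N * v + L * v\<^sup>2"
  proof (induction N)
    case 0
    show ?case by (intro exI[of _ 0]) auto
  next
    case (Suc N)
    then obtain L where L: "L \<ge> 0" "\<And>v::real. \<bar>v\<bar> \<le> 1 / 2 \<Longrightarrow> (1 / (1 + v)) ^ N \<le> 1 - real N * v + L * v\<^sup>2"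
      by blast
    show ?case
    \<comment> \<open>Half of this constant is L + N + 1, which is what the bound 1 + v \<ge> 1/2
      asks for below.\<close>
    proof (rule exI[of _ "2 * L + 2 + 2 * real N"], intro conjI allI impI)
      fix v :: real assume v: "\<bar>v\<bar> \<le> 1 / 2"
      have p: "1 + v \<ge> 1 / 2" using v by linarith
      have pp: "1 + v > 0" using p by linarith
      have "(1 / (1 + v)) ^ Suc N \<le> (1 / (1 + v)) * (1 - real N * v + L * v\<^sup>2)"
        using L(2)[OF v] pp by (simp add: divide_right_mono)
      also have "\<dots> \<le> 1 - real (Suc N) * v + (2 * L + 2 + 2 * real N) * v\<^sup>2"
      proof -
        have "1 - real N * v + L * v\<^sup>2 \<le> (1 - real (Suc N) * v + (2 * L + 2 + 2 * real N) * v\<^sup>2) * (1 + v)"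
        proof -
          have "(1 - real (Suc N) * v + (2 * L + 2 + 2 * real N) * v\<^sup>2) * (1 + v) - (1 - real N * v + L * v\<^sup>2)
            = v\<^sup>2 * ((2 * L + 2 + 2 * real N) * (1 + v) - real (Suc N) - L)"
            by (simp add: algebra_simps power2_eq_square)
          moreover have "(2 * L + 2 + 2 * real N) * (1 / 2) \<le> (2 * L + 2 + 2 * real N) * (1 + v)"
            using p L(1) by (intro mult_left_mono) auto
          then have "(2 * L + 2 + 2 * real N) * (1 + v) - real (Suc N) - L \<ge> 0" by simp
          ultimately show ?thesis using mult_nonneg_nonneg[of "v\<^sup>2"] by (smt (verit) zero_le_power2)
        qed
        then show ?thesis using pp by (simp add: pos_divide_le_eq)
      qed
      finally show "(1 / (1 + v)) ^ Suc N \<le> 1 - real (Suc N) * v + (2 * L + 2 + 2 * real N) * v\<^sup>2" .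
    qed (use L in auto)
  qed
  then show thesis using that by blast
qed

text \<open>The derivative at \<open>s = 0\<close> of the inequality for the Hopf--Lax evolution of \<open>f\<close>, whose value
  at time \<open>s\<close> is bounded below by \<open>f + s * (lam - w * (norm G)\<^sup>2)\<close>.\<close>

lemma infinitesimal_inf_convolution:
  fixes f :: "'a::euclidean_space \<Rightarrow> real" and G :: "'a \<Rightarrow> 'a"
  assumes dim: "DIM('a) \<ge> 3"
    and [measurable]: "f \<in> borel_measurable borel" "G \<in> borel_measurable borel"
    and c: "c > 0" and f: "\<And>x. c * (1 + (norm x)\<^sup>2) \<le> f x"
    and M: "M > 0" and T: "\<And>x v. \<bar>f (x + v) - f x - v \<bullet> G x\<bar> \<le> M / 2 * (norm v)\<^sup>2"
  obtains lam where "lam > 0"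
    "1 / lam ^ (DIM('a) - 1) * (LINT x::'a|lborel. 1 / (1 + (norm x)\<^sup>2) ^ (DIM('a) - 1))
      + real (DIM('a) - 1) * lam * (LINT x|lborel. 1 / f x ^ DIM('a))
      \<le> real (DIM('a) - 1) / (4 * lam) * (LINT x|lborel. (norm (G x))\<^sup>2 / f x ^ DIM('a))"
    "integrable lborel (\<lambda>x. 1 / f x ^ DIM('a))" "integrable lborel (\<lambda>x. (norm (G x))\<^sup>2 / f x ^ DIM('a))"
proof -
  define N where "N = DIM('a) - 1"
  have N: "DIM('a) = Suc N" "N \<ge> 2" using dim by (auto simp: N_def)
  have fc: "f x \<ge> c" "f x > 0" for x
  proof -
    have "c * 1 \<le> c * (1 + (norm x)\<^sup>2)" using c by (intro mult_left_mono) auto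
    then show "f x \<ge> c" using f[of x] by simp
    then show "f x > 0" using c by linarith
  qed
  \<comment> \<open>A gradient step of length |G|/M lowers the quadratic upper bound for
    \<open>f\<close> by |G|^2 / (2 M), and \<open>f\<close> stays positive.\<close>
  have G2: "(norm (G x))\<^sup>2 \<le> 2 * M * f x" for x
  proof -
    have "f (x + (- (1 / M)) *\<^sub>R G x) \<le> f x + ((- (1 / M)) *\<^sub>R G x) \<bullet> G x + M / 2 * (norm ((- (1 / M)) *\<^sub>R G x))\<^sup>2"
      using T[of x "(- (1 / M)) *\<^sub>R G x"] by linarith
    also have "\<dots> = f x - (norm (G x))\<^sup>2 / (2 * M)"
      using M by (simp add: power2_norm_eq_inner[symmetric] power_mult_distrib power2_eq_square field_simps)
    finally have "(norm (G x))\<^sup>2 / (2 * M) \<le> f x" using fc(2)[of "x + (- (1 / M)) *\<^sub>R G x"] by linarith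
    then show ?thesis using M by (simp add: field_simps)
  qed
  \<comment> \<open>The integrals with exponent n - 1 converge because the dimension exceeds
    2.\<close>
  have Nn: "real N > real DIM('a) / 2" using N by simp
  have intN: "integrable lborel (\<lambda>x. 1 / f x ^ N)"
  proof (rule Bochner_Integration.integrable_bound)
    show "integrable lborel (\<lambda>x::'a. 1 / c ^ N * (1 / (1 + (norm x)\<^sup>2) ^ N))"
      by (intro integrable_mult_right integrable_1_plus_norm_square_power Nn)
    show "AE x in lborel. norm (1 / f x ^ N) \<le> norm (1 / c ^ N * (1 / (1 + (norm x)\<^sup>2) ^ N))"
    proof (rule AE_I2)
      fix x
      have "(c * (1 + (norm x)\<^sup>2)) ^ N \<le> f x ^ N"
        using f c by (intro power_mono) auto
      moreover have "0 < (c * (1 + (norm x)\<^sup>2)) ^ N"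
        using c by (intro zero_less_power mult_pos_pos) (auto simp: add_pos_nonneg)
      ultimately have "1 / f x ^ N \<le> 1 / (c * (1 + (norm x)\<^sup>2)) ^ N"
        using fc[of x] by (intro divide_left_mono mult_pos_pos) auto
      then show "norm (1 / f x ^ N) \<le> norm (1 / c ^ N * (1 / (1 + (norm x)\<^sup>2) ^ N))"
        using fc[of x] c by (simp add: power_mult_distrib)
    qed
  qed measurable
  have intn: "integrable lborel (\<lambda>x. 1 / f x ^ Suc N)"
  proof (rule Bochner_Integration.integrable_bound)
    show "integrable lborel (\<lambda>x::'a. 1 / c * (1 / f x ^ N))" by (intro integrable_mult_right intN)
    show "AE x in lborel. norm (1 / f x ^ Suc N) \<le> norm (1 / c * (1 / f x ^ N))"
    proof (rule AE_I2)
      fix x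
      have "1 / f x * (1 / f x ^ N) \<le> 1 / c * (1 / f x ^ N)"
        using fc[of x] c by (intro mult_right_mono frac_le) auto
      then show "norm (1 / f x ^ Suc N) \<le> norm (1 / c * (1 / f x ^ N))"
        using fc[of x] c by simp
    qed
  qed measurable
  have intG: "integrable lborel (\<lambda>x. (norm (G x))\<^sup>2 / f x ^ Suc N)"
  proof (rule Bochner_Integration.integrable_bound)
    show "integrable lborel (\<lambda>x::'a. 2 * M * (1 / f x ^ N))" by (intro integrable_mult_right intN)
    show "AE x in lborel. norm ((norm (G x))\<^sup>2 / f x ^ Suc N) \<le> norm (2 * M * (1 / f x ^ N))"
    proof (rule AE_I2)
      fix x
      have "(norm (G x))\<^sup>2 / f x ^ Suc N \<le> 2 * M * f x / f x ^ Suc N"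
        using G2 fc[of x] by (intro divide_right_mono) auto
      then show "norm ((norm (G x))\<^sup>2 / f x ^ Suc N) \<le> norm (2 * M * (1 / f x ^ N))"
        using fc[of x] M by simp
    qed
  qed measurable
  have dim2: "DIM('a) \<ge> 2" using dim by simp
  obtain lam where lam: "lam > 0" and
    ineq: "\<And>s c' k. s > 0 \<Longrightarrow> c' > 0 \<Longrightarrow> k \<in> borel_measurable borel \<Longrightarrow> (\<And>x. c' * (1 + (norm x)\<^sup>2) \<le> k x) \<Longrightarrow>
      (\<And>x y. k (x + s *\<^sub>R y) \<le> f x + s * (lam * (1 + (norm y)\<^sup>2))) \<Longrightarrow>
      (\<integral>\<^sup>+x. ennreal (1 / f x ^ N) \<partial>lborel)
        + ennreal s * (\<integral>\<^sup>+x. ennreal (1 / (lam * (1 + (norm x)\<^sup>2)) ^ N) \<partial>(lborel :: 'a measure))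
      \<le> (\<integral>\<^sup>+x. ennreal (1 / k x ^ N) \<partial>lborel)"
    by (rule inf_convolution_slices[OF assms(2) c f dim2, folded N_def]) blast
  obtain L where L: "L \<ge> 0" "\<And>v::real. \<bar>v\<bar> \<le> 1 / 2 \<Longrightarrow> (1 / (1 + v)) ^ N \<le> 1 - real N * v + L * v\<^sup>2"
    by (rule inverse_power_expansion[of N]) blast
  define A where "A = (LINT x|lborel. 1 / f x ^ N)"
  define B where "B = (LINT x|lborel. 1 / f x ^ Suc N)"
  define E where "E = (LINT x|lborel. (norm (G x))\<^sup>2 / f x ^ Suc N)"
  define I where "I = (LINT x::'a|lborel. 1 / (1 + (norm x)\<^sup>2) ^ N)"
  \<comment> \<open>A bound for |q / f| below: lam/c controls the constant term of \<open>q\<close>,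
    and M/lam, through \<open>G2\<close>, its gradient term.\<close>
  define Q where "Q = lam / c + M / lam"
  have Q: "Q > 0" using lam c M by (simp add: Q_def add_pos_pos)
  \<comment> \<open>The coefficient from Young's inequality once the Taylor remainder M s^2 |y|^2 /
    2 has been absorbed into s lam |y|^2. It tends to 1/(4 lam) as s tends to 0.\<close>
  define w where "w s = 1 / (4 * (lam - M * s / 2))" for s
  have main: "1 / lam ^ N * I + real N * lam * B \<le> real N * w s * E + s * (L * Q\<^sup>2 * A)"
    if s: "0 < s" "s < 1 / (2 * Q)" for s
  proof -
    have sQ: "s * Q \<le> 1 / 2" using s Q by (simp add: field_simps)
    have "s * (M / lam) \<le> s * Q" using s lam c by (intro mult_left_mono) (auto simp: Q_def)
    then have "s * (M / lam) \<le> 1 / 2" using sQ by linarith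
    then have sM: "s * M \<le> lam / 2" using lam by (simp add: field_simps)
    have mu: "lam - M * s / 2 \<ge> lam / 2" using sM lam by (simp add: algebra_simps)
    then have mu0: "lam - M * s / 2 > 0" using lam by linarith
    have w0: "w s > 0" using mu0 by (simp add: w_def)
    have w1: "w s \<le> 1 / (2 * lam)" unfolding w_def using mu lam by (intro divide_left_mono) (auto intro!: mult_pos_pos mu0)
    define q where "q x = lam - w s * (norm (G x))\<^sup>2" for x
    define v where "v x = s * (q x / f x)" for x
    have qf: "\<bar>q x / f x\<bar> \<le> Q" for x
    proof -
      have "w s * (norm (G x))\<^sup>2 \<le> 1 / (2 * lam) * (2 * M * f x)"
        using w1 w0 G2[of x] lam by (intro mult_mono) auto
      then have "w s * (norm (G x))\<^sup>2 \<le> M / lam * f x" using lam by simp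
      moreover have "lam \<le> lam / c * f x" using fc(1)[of x] c lam by (simp add: field_simps)
      ultimately have "\<bar>q x\<bar> \<le> Q * f x"
        using w0 lam unfolding q_def Q_def
        by (smt (verit) distrib_right mult_nonneg_nonneg zero_le_power2)
      then show ?thesis using fc(2)[of x] by (simp add: pos_divide_le_eq)
    qed
    have v12: "\<bar>v x\<bar> \<le> 1 / 2" for x
    proof -
      have "\<bar>v x\<bar> = s * \<bar>q x / f x\<bar>" using s by (simp add: v_def abs_mult)
      also have "\<dots> \<le> s * Q" using qf s by (intro mult_left_mono) auto
      finally show ?thesis using sQ by linarith
    qed
    \<comment> \<open>An explicit minorant of the infimal convolution; it is visibly measurable, and
      no infimum has to be formed.\<close>
    define k where "k x = f x + s * q x" for x
    have km [measurable]: "k \<in> borel_measurable borel" unfolding k_def[abs_def] q_def by measurable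
    have kv: "k x = f x * (1 + v x)" for x using fc(2)[of x] by (simp add: k_def v_def field_simps)
    have kf: "f x / 2 \<le> k x" for x
    proof -
      have "f x * (1 / 2) \<le> f x * (1 + v x)" using v12[of x] fc(2)[of x] by (intro mult_left_mono) linarith+
      then show ?thesis by (simp add: kv)
    qed
    have "(\<integral>\<^sup>+x. ennreal (1 / f x ^ N) \<partial>lborel)
        + ennreal s * (\<integral>\<^sup>+x. ennreal (1 / (lam * (1 + (norm x)\<^sup>2)) ^ N) \<partial>(lborel :: 'a measure))
      \<le> (\<integral>\<^sup>+x. ennreal (1 / k x ^ N) \<partial>lborel)"
    proof (rule ineq[OF s(1), of "c / 2"])
      show "c / 2 * (1 + (norm x)\<^sup>2) \<le> k x" for x using f[of x] kf[of x] by simp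
      fix x y :: 'a
      define X where "X = x + s *\<^sub>R y"
      \<comment> \<open>The Taylor bound is based at the end point \<open>X\<close> and read
        backwards along - s y, because \<open>k\<close> is expressed through the gradient at
        \<open>X\<close>.\<close>
      have "f X + (- s *\<^sub>R y) \<bullet> G X - M / 2 * (norm (- s *\<^sub>R y))\<^sup>2 \<le> f (X + (- s *\<^sub>R y))"
        using T[of X "- s *\<^sub>R y"] by linarith
      then have 1: "f X \<le> f x + s * (y \<bullet> G X) + M / 2 * (s\<^sup>2 * (norm y)\<^sup>2)"
        by (simp add: X_def power_mult_distrib)
      have "y \<bullet> G X \<le> w s * (norm (G X))\<^sup>2 + (lam - M * s / 2) * (norm y)\<^sup>2"
      proof -
        define \<mu> where "\<mu> = lam - M * s / 2"
        have m: "\<mu> > 0" using mu0 by (simp add: \<mu>_def)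
        have "0 \<le> (norm (G X) - 2 * \<mu> * norm y)\<^sup>2" by simp
        then have "4 * \<mu> * (norm y * norm (G X)) \<le> (norm (G X))\<^sup>2 + 4 * \<mu> * (\<mu> * (norm y)\<^sup>2)"
          by (simp add: power2_eq_square algebra_simps)
        moreover have "4 * \<mu> * (y \<bullet> G X) \<le> 4 * \<mu> * (norm y * norm (G X))"
          using m norm_cauchy_schwarz by (intro mult_left_mono) auto
        ultimately have "4 * \<mu> * (y \<bullet> G X) \<le> (norm (G X))\<^sup>2 + 4 * \<mu> * (\<mu> * (norm y)\<^sup>2)"
          by (rule order_trans[rotated])
        also have "\<dots> = 4 * \<mu> * ((norm (G X))\<^sup>2 / (4 * \<mu>) + \<mu> * (norm y)\<^sup>2)"
          using m by (simp add: distrib_left)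
        finally have "4 * \<mu> * (y \<bullet> G X) \<le> 4 * \<mu> * ((norm (G X))\<^sup>2 / (4 * \<mu>) + \<mu> * (norm y)\<^sup>2)" .
        then have "y \<bullet> G X \<le> (norm (G X))\<^sup>2 / (4 * \<mu>) + \<mu> * (norm y)\<^sup>2"
          using m by (subst (asm) mult_le_cancel_left_pos) auto
        then show ?thesis by (simp add: w_def \<mu>_def)
      qed
      then have "s * (y \<bullet> G X) \<le> s * (w s * (norm (G X))\<^sup>2 + (lam - M * s / 2) * (norm y)\<^sup>2)"
        using s by (intro mult_left_mono) auto
      with 1 have "f X \<le> f x + s * (w s * (norm (G X))\<^sup>2 + (lam - M * s / 2) * (norm y)\<^sup>2) + M / 2 * (s\<^sup>2 * (norm y)\<^sup>2)"
        by linarith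
      also have "\<dots> = f x + s * (lam * (norm y)\<^sup>2) + s * (w s * (norm (G X))\<^sup>2)"
        by (simp add: algebra_simps power2_eq_square)
      finally show "k (x + s *\<^sub>R y) \<le> f x + s * (lam * (1 + (norm y)\<^sup>2))"
        by (simp add: k_def q_def X_def[symmetric] algebra_simps)
    qed (use c km in auto)
    also have "(\<integral>\<^sup>+x. ennreal (1 / f x ^ N) \<partial>lborel) = ennreal A"
      unfolding A_def using fc(2) by (intro nn_integral_eq_integral intN) (auto simp: less_imp_le)
    also have "(\<integral>\<^sup>+x. ennreal (1 / (lam * (1 + (norm x)\<^sup>2)) ^ N) \<partial>(lborel :: 'a measure)) = ennreal (1 / lam ^ N * I)"
    proof -
      have "(\<integral>\<^sup>+x. ennreal (1 / lam ^ N * (1 / (1 + (norm x)\<^sup>2) ^ N)) \<partial>(lborel :: 'a measure))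
        = ennreal (LINT x::'a|lborel. 1 / lam ^ N * (1 / (1 + (norm x)\<^sup>2) ^ N))"
        using lam by (intro nn_integral_eq_integral integrable_mult_right integrable_1_plus_norm_square_power Nn) auto
      moreover have "1 / lam ^ N * (1 / (1 + (norm x)\<^sup>2) ^ N) = 1 / (lam * (1 + (norm x)\<^sup>2)) ^ N" for x :: 'a
        by (simp add: power_mult_distrib)
      moreover have "(LINT x::'a|lborel. 1 / lam ^ N * (1 / (1 + (norm x)\<^sup>2) ^ N)) = 1 / lam ^ N * I"
        unfolding I_def by (rule integral_mult_right_zero)
      ultimately show ?thesis by simp
    qed
    \<comment> \<open>Expansion of 1 / k^N to first order in \<open>s\<close>. The first-order terms
      carry f^(N+1) in the denominator: here the exponent rises from n - 1 to n.\<close>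
    also have "(\<integral>\<^sup>+x. ennreal (1 / k x ^ N) \<partial>lborel)
      \<le> (\<integral>\<^sup>+x. ennreal ((1 / f x ^ N - real N * s * lam * (1 / f x ^ Suc N)
          + real N * s * w s * ((norm (G x))\<^sup>2 / f x ^ Suc N)) + L * (s\<^sup>2 * Q\<^sup>2) * (1 / f x ^ N)) \<partial>lborel)"
    proof (intro nn_integral_mono ennreal_leI)
      fix x
      have "1 / k x ^ N = (1 / f x ^ N) * (1 / (1 + v x)) ^ N"
        by (simp add: kv power_mult_distrib power_divide)
      also have "\<dots> \<le> (1 / f x ^ N) * (1 - real N * v x + L * (v x)\<^sup>2)"
        using L(2)[OF v12] fc(2)[of x] by (intro mult_left_mono) auto
      also have "\<dots> \<le> (1 / f x ^ N) * (1 - real N * v x + L * (s\<^sup>2 * Q\<^sup>2))"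
      proof -
        have "(v x)\<^sup>2 = s\<^sup>2 * (q x / f x)\<^sup>2" unfolding v_def by (rule power_mult_distrib)
        also have "(q x / f x)\<^sup>2 \<le> Q\<^sup>2" using qf[of x] by (metis abs_ge_zero power2_abs power_mono)
        finally have "(v x)\<^sup>2 \<le> s\<^sup>2 * Q\<^sup>2" by (simp add: mult_left_mono)
        then show ?thesis using L(1) fc(2)[of x] by (intro mult_left_mono add_left_mono) auto
      qed
      also have "\<dots> = (1 / f x ^ N - real N * s * lam * (1 / f x ^ Suc N)
          + real N * s * w s * ((norm (G x))\<^sup>2 / f x ^ Suc N)) + L * (s\<^sup>2 * Q\<^sup>2) * (1 / f x ^ N)"
        using fc(2)[of x] by (simp add: v_def q_def field_simps)
      finally show "1 / k x ^ N \<le> \<dots>" .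
    qed
    also have "\<dots> = ennreal (LINT x|lborel. (1 / f x ^ N - real N * s * lam * (1 / f x ^ Suc N)
          + real N * s * w s * ((norm (G x))\<^sup>2 / f x ^ Suc N)) + L * (s\<^sup>2 * Q\<^sup>2) * (1 / f x ^ N))"
    proof (rule nn_integral_eq_integral)
      show "integrable lborel (\<lambda>x. (1 / f x ^ N - real N * s * lam * (1 / f x ^ Suc N)
          + real N * s * w s * ((norm (G x))\<^sup>2 / f x ^ Suc N)) + L * (s\<^sup>2 * Q\<^sup>2) * (1 / f x ^ N))"
        by (intro Bochner_Integration.integrable_add Bochner_Integration.integrable_diff integrable_mult_right intN intn intG)
      show "AE x in lborel. 0 \<le> (1 / f x ^ N - real N * s * lam * (1 / f x ^ Suc N)
          + real N * s * w s * ((norm (G x))\<^sup>2 / f x ^ Suc N)) + L * (s\<^sup>2 * Q\<^sup>2) * (1 / f x ^ N)"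
      proof (rule AE_I2)
        fix x
        have "0 < (1 / (1 + v x)) ^ N" using v12[of x] by (intro zero_less_power) auto
        also have "\<dots> \<le> 1 - real N * v x + L * (v x)\<^sup>2" by (rule L(2)[OF v12])
        also have "\<dots> \<le> 1 - real N * v x + L * (s\<^sup>2 * Q\<^sup>2)"
        proof -
          have "(v x)\<^sup>2 = s\<^sup>2 * (q x / f x)\<^sup>2" unfolding v_def by (rule power_mult_distrib)
          also have "(q x / f x)\<^sup>2 \<le> Q\<^sup>2" using qf[of x] by (metis abs_ge_zero power2_abs power_mono)
          finally have "(v x)\<^sup>2 \<le> s\<^sup>2 * Q\<^sup>2" by (simp add: mult_left_mono)
          then show ?thesis using L(1) by (intro mult_left_mono add_left_mono) auto
        qed
        finally have "0 \<le> (1 / f x ^ N) * (1 - real N * v x + L * (s\<^sup>2 * Q\<^sup>2))"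
          using fc(2)[of x] by (intro mult_nonneg_nonneg) auto
        also have "\<dots> = (1 / f x ^ N - real N * s * lam * (1 / f x ^ Suc N)
          + real N * s * w s * ((norm (G x))\<^sup>2 / f x ^ Suc N)) + L * (s\<^sup>2 * Q\<^sup>2) * (1 / f x ^ N)"
          using fc(2)[of x] by (simp add: v_def q_def field_simps)
        finally show "0 \<le> \<dots>" .
      qed
    qed
    also have "(LINT x|lborel. (1 / f x ^ N - real N * s * lam * (1 / f x ^ Suc N)
          + real N * s * w s * ((norm (G x))\<^sup>2 / f x ^ Suc N)) + L * (s\<^sup>2 * Q\<^sup>2) * (1 / f x ^ N))
        = A - real N * s * lam * B + real N * s * w s * E + L * (s\<^sup>2 * Q\<^sup>2) * A"
      unfolding A_def B_def E_def
      by (subst Bochner_Integration.integral_add Bochner_Integration.integral_diff,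
          (intro Bochner_Integration.integrable_add Bochner_Integration.integrable_diff integrable_mult_right intN intn intG)+)+
         (simp only: integral_mult_right_zero)
    finally have fin: "ennreal A + ennreal s * ennreal (1 / lam ^ N * I)
      \<le> ennreal (A - real N * s * lam * B + real N * s * w s * E + L * (s\<^sup>2 * Q\<^sup>2) * A)" .
    have A0: "A \<ge> 0" and I0: "I \<ge> 0"
      unfolding A_def I_def using fc(2) by (auto intro!: integral_nonneg_AE simp: less_imp_le)
    have AI: "0 < A + s * (1 / lam ^ N * I) \<or> A + s * (1 / lam ^ N * I) = 0"
      using A0 I0 s lam by (smt (verit) divide_nonneg_pos mult_nonneg_nonneg zero_less_power)
    have "ennreal A + ennreal s * ennreal (1 / lam ^ N * I) = ennreal (A + s * (1 / lam ^ N * I))"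
      using A0 I0 s lam by (simp add: ennreal_mult[symmetric] ennreal_plus[symmetric] del: ennreal_plus)
    with fin have fin': "ennreal (A + s * (1 / lam ^ N * I))
      \<le> ennreal (A - real N * s * lam * B + real N * s * w s * E + L * (s\<^sup>2 * Q\<^sup>2) * A)" by (simp only:)
    \<comment> \<open>\<open>ennreal\<close> sends negative numbers to 0, so the sign of the right
      side has to be settled before the inequality can be read off in the reals.\<close>
    have Bp: "A - real N * s * lam * B + real N * s * w s * E + L * (s\<^sup>2 * Q\<^sup>2) * A \<ge> 0 \<or> A + s * (1 / lam ^ N * I) = 0"
    proof (rule ccontr)
      assume "\<not> ?thesis"
      with AI have "A + s * (1 / lam ^ N * I) > 0"
        "A - real N * s * lam * B + real N * s * w s * E + L * (s\<^sup>2 * Q\<^sup>2) * A < 0" by auto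
      with fin' show False by (simp add: ennreal_neg)
    qed
    have Apos: "A > 0"
    proof -
      have "A \<noteq> 0"
      proof
        assume "A = 0"
        then have ae: "AE x in (lborel :: 'a measure). 1 / f x ^ N = 0"
          using integral_nonneg_eq_0_iff_AE[OF intN] fc(2) by (auto simp: A_def less_imp_le)
        have "1 / f x ^ N \<noteq> 0" for x using fc(2)[of x] by simp
        then have "AE x in (lborel :: 'a measure). False"
          by (intro eventually_mono[OF ae]) blast
        then show False using AE_iff_null_sets[of UNIV "lborel :: 'a measure"] by (simp add: null_sets_def)
      qed
      then show ?thesis using A0 by linarith
    qed
    have "A + s * (1 / lam ^ N * I) > 0" using Apos I0 s lam by (intro add_pos_nonneg) auto
    with Bp fin' have "A + s * (1 / lam ^ N * I)
      \<le> A - real N * s * lam * B + real N * s * w s * E + L * (s\<^sup>2 * Q\<^sup>2) * A"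
      by (subst (asm) ennreal_le_iff) auto
    \<comment> \<open>The zeroth-order term \<open>A\<close> cancels, and every other term has a
      factor \<open>s\<close>. The quadratic error keeps one more \<open>s\<close> and disappears in
      the limit.\<close>
    then have "s * (1 / lam ^ N * I + real N * lam * B) \<le> s * (real N * w s * E + s * (L * Q\<^sup>2 * A))"
      by (simp add: algebra_simps power2_eq_square)
    then show ?thesis using s by (subst (asm) mult_le_cancel_left_pos) auto
  qed
  \<comment> \<open>The right side is spelled out with 0 in place of \<open>s\<close>, so that it is
    literally the limit of the bounds in \<open>main\<close>.\<close>
  have "1 / lam ^ N * I + real N * lam * B \<le> real N * (1 / (4 * (lam - M * 0 / 2))) * E + 0 * (L * Q\<^sup>2 * A)"
  proof (rule tendsto_lowerbound)
    show "((\<lambda>s. real N * w s * E + s * (L * Q\<^sup>2 * A)) \<longlongrightarrow> real N * (1 / (4 * (lam - M * 0 / 2))) * E + 0 * (L * Q\<^sup>2 * A)) (at_right 0)"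
      unfolding w_def using lam by (intro tendsto_intros) auto
    have "\<forall>\<^sub>F s in at_right 0. s \<in> {0<..<1 / (2 * Q)}"
      using Q by (intro eventually_at_right_real) auto
    then show "\<forall>\<^sub>F s in at_right 0. 1 / lam ^ N * I + real N * lam * B \<le> real N * w s * E + s * (L * Q\<^sup>2 * A)"
    proof (rule eventually_mono)
      fix s assume "s \<in> {0<..<1 / (2 * Q)}"
      then show "1 / lam ^ N * I + real N * lam * B \<le> real N * w s * E + s * (L * Q\<^sup>2 * A)"
        by (intro main) auto
    qed
  qed auto
  then show thesis
    using that[OF lam] intn intG N unfolding A_def B_def E_def I_def by simp
qed

section \<open>From the differentiated inequality to the sharp constant\<close>

text \<open>\<open>K\<close> is the critical integral of the Talenti function, and K^(2/n) produces
  the factors pi and Gamma(n/2) / Gamma(n) of the Sobolev constant. The functional equation of Gamma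
  at n/2 and at n links the exponents n - 1 and n.\<close>

lemma sobolev_const_eq_integral:
  assumes dim: "DIM('a::euclidean_space) \<ge> 3"
  defines "n \<equiv> real DIM('a)"
  defines "K \<equiv> (LINT x::'a|lborel. 1 / (1 + (norm x)\<^sup>2) ^ DIM('a))"
  shows "K > 0" and "sobolev_const DIM('a) = n * (n - 2) * K powr (2 / n)"
    and "(LINT x::'a|lborel. 1 / (1 + (norm x)\<^sup>2) ^ (DIM('a) - 1)) = K * (2 * n - 2) / (n - 2)"
proof -
  have n: "n \<ge> 3" using dim by (simp add: n_def)
  have G: "Gamma (n / 2) > 0" "Gamma n > 0" "Gamma (n / 2 - 1) > 0" "Gamma (n - 1) > 0"
    using n by (auto intro!: Gamma_real_pos)
  have K: "K = pi powr (n / 2) * Gamma (n / 2) / Gamma n"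
    unfolding K_def by (subst integrable_1_plus_norm_square_power(2)) (use dim in \<open>auto simp: n_def\<close>)
  show "K > 0" using G by (simp add: K)
  have "K powr (2 / n) = (pi powr (n / 2)) powr (2 / n) * (Gamma (n / 2) / Gamma n) powr (2 / n)"
    by (simp add: K powr_mult powr_divide)
  also have "(pi powr (n / 2)) powr (2 / n) = pi"
    using n by (simp add: powr_powr)
  finally show "sobolev_const DIM('a) = n * (n - 2) * K powr (2 / n)"
    by (simp add: sobolev_const_def n_def)
  have 1: "Gamma (n / 2) = (n / 2 - 1) * Gamma (n / 2 - 1)"
    using Gamma_plus1[of "n / 2 - 1"] n by (auto simp: nonpos_Ints_def)
  have 2: "Gamma n = (n - 1) * Gamma (n - 1)"
    using Gamma_plus1[of "n - 1"] n by (auto simp: nonpos_Ints_def)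
  have "(LINT x::'a|lborel. 1 / (1 + (norm x)\<^sup>2) ^ (DIM('a) - 1))
      = pi powr (n / 2) * Gamma (n / 2 - 1) / Gamma (n - 1)"
  proof -
    have "real (DIM('a) - 1) = n - 1" using dim by (simp add: n_def)
    then show ?thesis
      using n by (subst integrable_1_plus_norm_square_power(2)) (auto simp: n_def[symmetric])
  qed
  also have "\<dots> = K * (2 * n - 2) / (n - 2)"
  proof -
    have "K * (2 * n - 2) / (n - 2)
        = pi powr (n / 2) * Gamma (n / 2 - 1) * ((n / 2 - 1) * (2 * n - 2)) / ((n - 1) * (n - 2) * Gamma (n - 1))"
      unfolding K 1 2 by (simp only: times_divide_eq_left times_divide_eq_right divide_divide_eq_left mult_ac)
    also have "(n / 2 - 1) * (2 * n - 2) = (n - 1) * (n - 2)" by (simp add: algebra_simps)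
    also have "pi powr (n / 2) * Gamma (n / 2 - 1) * ((n - 1) * (n - 2)) / ((n - 1) * (n - 2) * Gamma (n - 1))
        = pi powr (n / 2) * Gamma (n / 2 - 1) / Gamma (n - 1)"
    proof -
      have "(n - 1) * (n - 2) \<noteq> 0" using n by auto
      then show ?thesis by (metis (no_types) mult.commute nonzero_mult_divide_mult_cancel_left)
    qed
    finally show ?thesis by simp
  qed
  finally show "(LINT x::'a|lborel. 1 / (1 + (norm x)\<^sup>2) ^ (DIM('a) - 1)) = K * (2 * n - 2) / (n - 2)" .
qed

lemma powr_square: "(x powr a)\<^sup>2 = x powr (2 * a)" for x a :: real
  by (simp add: power2_eq_square powr_add[symmetric])

lemma has_derivative_powr_compose:
  fixes g :: "'a::real_normed_vector \<Rightarrow> real"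
  assumes "(g has_derivative g') (at x)" "g x > 0"
  shows "((\<lambda>y. g y powr p) has_derivative (\<lambda>h. p * g x powr (p - 1) * g' h)) (at x)"
proof -
  have "((\<lambda>t. t powr p) has_derivative (\<lambda>v. p * g x powr (p - 1) * v)) (at (g x))"
    using has_real_derivative_powr[OF assms(2), of p] by (simp add: has_field_derivative_def)
  from has_derivative_compose[OF assms(1) this] show ?thesis .
qed

text \<open>When Z = a^2 + b^2, this bounds the squared gradient of sqrt Z by the sum of the squared
  gradients of a and b.\<close>

lemma norm_lincomb2:
  fixes p q :: "'a::real_inner"
  shows "(norm (a *\<^sub>R p + b *\<^sub>R q))\<^sup>2 \<le> (a\<^sup>2 + b\<^sup>2) * ((norm p)\<^sup>2 + (norm q)\<^sup>2)"
proof -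
  have "norm (a *\<^sub>R p + b *\<^sub>R q) \<le> \<bar>a\<bar> * norm p + \<bar>b\<bar> * norm q"
    using norm_triangle_ineq[of "a *\<^sub>R p" "b *\<^sub>R q"] by simp
  then have "(norm (a *\<^sub>R p + b *\<^sub>R q))\<^sup>2 \<le> (\<bar>a\<bar> * norm p + \<bar>b\<bar> * norm q)\<^sup>2"
    by (intro power_mono) auto
  also have "\<dots> \<le> (\<bar>a\<bar>\<^sup>2 + \<bar>b\<bar>\<^sup>2) * ((norm p)\<^sup>2 + (norm q)\<^sup>2)"
  proof -
    have "(A * P + B * Q)\<^sup>2 \<le> (A\<^sup>2 + B\<^sup>2) * (P\<^sup>2 + Q\<^sup>2)" for A B P Q :: real
    proof -
      have "0 \<le> (A * Q - B * P)\<^sup>2" by simp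
      then show ?thesis by (simp add: power2_eq_square algebra_simps)
    qed
    then show ?thesis .
  qed
  also have "\<dots> = (a\<^sup>2 + b\<^sup>2) * ((norm p)\<^sup>2 + (norm q)\<^sup>2)" by simp
  finally show ?thesis .
qed

text \<open>Smooth positive replacement for \<open>\<bar>z\<bar>\<close>: with \<open>d\<^sup>2 (1 + \<bar>x\<bar>\<^sup>2)\<^sup>2\<^sup>-\<^sup>n\<close> added to \<open>z\<^sup>2\<close>, the function \<open>f\<close>
  is exactly quadratic outside the support of \<open>z\<close>.\<close>

lemma sobolev_regularized:
  fixes z :: "'a::euclidean_space \<Rightarrow> real"
  assumes dim: "DIM('a) \<ge> 3" and z: "smooth z" and K: "compact K" "\<And>x. x \<notin> K \<Longrightarrow> z x = 0" and d: "d > 0"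
    and int: "integrable lborel (\<lambda>x. (norm (gradient z x))\<^sup>2)"
    and intp: "integrable lborel (\<lambda>x. \<bar>z x\<bar> powr (2 * real DIM('a) / (real DIM('a) - 2)))"
  defines "n \<equiv> real DIM('a)"
  shows "sobolev_const DIM('a) * (LINT x|lborel. \<bar>z x\<bar> powr (2 * n / (n - 2))) powr ((n - 2) / n)
    \<le> (LINT x|lborel. (norm (gradient z x))\<^sup>2)
      + d\<^sup>2 * (n - 2)\<^sup>2 * (LINT x::'a|lborel. 1 / (1 + (norm x)\<^sup>2) ^ (DIM('a) - 1))"
proof -
  have n: "n \<ge> 3" using dim by (simp add: n_def)
  have ex: "- (n - 2) * (- 1 / (n - 2)) = 1" using n by (simp add: field_simps)
  define P where "P x = 1 + x \<bullet> x" for x :: 'a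
  have P1: "P x \<ge> 1" for x by (simp add: P_def)
  have P0: "P x > 0" for x using P1[of x] by linarith
  have Pn: "P x = 1 + (norm x)\<^sup>2" for x by (simp add: P_def power2_norm_eq_inner)
  define Z where "Z x = (z x)\<^sup>2 + d\<^sup>2 * P x powr (- (n - 2))" for x
  have Z0: "Z x > 0" for x unfolding Z_def using d P0[of x] by (intro add_nonneg_pos) auto
  define f where "f x = Z x powr (- 1 / (n - 2))" for x
  have zs: "smooth_on UNIV z" using z by (simp add: smooth_on_UNIV)
  have Ps: "smooth_on UNIV P" unfolding P_def[abs_def] by (intro smooth_on_add smooth_on_inner_self) auto
  have Zs: "smooth_on UNIV Z"
    unfolding Z_def[abs_def] power2_eq_square
    by (intro smooth_on_add smooth_on_mult zs smooth_on_const open_UNIV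
        smooth_on_compose_real[OF open_UNIV open_greaterThan _ smooth_on_powr Ps])
       (simp add: P0)
  have fs: "smooth_on UNIV f"
    unfolding f_def[abs_def]
    by (rule smooth_on_compose_real[OF open_UNIV open_greaterThan _ smooth_on_powr Zs]) (simp add: Z0)
  define c1 where "c1 = (d\<^sup>2) powr (- 1 / (n - 2))"
  have c1: "c1 > 0" using d by (simp add: c1_def)
  \<comment> \<open>The deviation from the pure quadratic has compact support, so
    \<open>smooth_taylor_bound\<close> applies to it; the quadratic itself contributes 2 c1 to the
    constant.\<close>
  define e where "e x = f x - c1 * P x" for x
  have es: "smooth e"
    unfolding smooth_on_UNIV[symmetric] e_def[abs_def] by (intro smooth_on_diff smooth_on_mult fs Ps) auto
  have e0: "e x = 0" if "x \<notin> K" for x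
  proof -
    have "Z x powr (- 1 / (n - 2)) = (d\<^sup>2) powr (- 1 / (n - 2)) * (P x powr (- (n - 2))) powr (- 1 / (n - 2))"
      using that K by (simp add: Z_def powr_mult)
    also have "(P x powr (- (n - 2))) powr (- 1 / (n - 2)) = P x"
      using P0[of x] by (simp only: powr_powr ex) simp
    finally show ?thesis by (simp add: e_def f_def c1_def)
  qed
  obtain Me where Me: "Me \<ge> 0" "\<And>x v. \<bar>e (x + v) - e x - v \<bullet> gradient e x\<bar> \<le> Me / 2 * (norm v)\<^sup>2"
    using smooth_taylor_bound[OF es K(1) e0] by blast
  define G where "G x = gradient f x" for x
  have Gm [measurable]: "G \<in> borel_measurable borel"
    unfolding G_def[abs_def] using fs
    by (intro borel_measurable_continuous_onI smooth_continuous_gradient) (simp add: smooth_on_UNIV)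
  have fm [measurable]: "f \<in> borel_measurable borel"
    by (intro borel_measurable_continuous_onI smooth_on_continuous_on fs)
  have Ge: "gradient f x = gradient e x + (2 * c1) *\<^sub>R x" for x
  proof (rule has_derivative_gradient_eqI)
    have "((\<lambda>x. e x + c1 * P x) has_derivative (\<lambda>h. h \<bullet> gradient e x + c1 * (2 * (x \<bullet> h)))) (at x)"
      unfolding P_def
      by (rule has_derivative_add[OF smooth_has_derivative_gradient[OF es]])
         (auto intro!: derivative_eq_intros simp: inner_commute algebra_simps)
    then show "(f has_derivative (\<lambda>h. h \<bullet> (gradient e x + (2 * c1) *\<^sub>R x))) (at x)"
      by (simp add: e_def inner_add_right inner_commute[of x] mult_ac)
  qed
  define M where "M = Me + 2 * c1"
  have M: "M > 0" using Me c1 by (simp add: M_def)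
  have T: "\<bar>f (x + v) - f x - v \<bullet> G x\<bar> \<le> M / 2 * (norm v)\<^sup>2" for x v
  proof -
    have "f (x + v) - f x - v \<bullet> G x = (e (x + v) - e x - v \<bullet> gradient e x) + c1 * (norm v)\<^sup>2"
      by (simp add: G_def Ge e_def P_def power2_norm_eq_inner inner_add_left inner_add_right inner_commute algebra_simps)
    also have "\<bar>\<dots>\<bar> \<le> Me / 2 * (norm v)\<^sup>2 + \<bar>c1 * (norm v)\<^sup>2\<bar>"
      using Me(2)[of x v] by linarith
    also have "\<dots> = M / 2 * (norm v)\<^sup>2" using c1 by (simp add: M_def algebra_simps)
    finally show ?thesis .
  qed
  \<comment> \<open>A quadratic lower bound for \<open>f\<close> amounts to an upper bound of order
    P^(2-n) for \<open>Z\<close>. On \<open>K\<close> it comes from compactness, and elsewhere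
    \<open>z\<close> vanishes.\<close>
  have "\<exists>C>0. \<forall>x. Z x \<le> C * P x powr (- (n - 2))"
  proof -
    have "continuous_on UNIV (\<lambda>x. (z x)\<^sup>2 * P x powr (n - 2))"
      using smooth_on_continuous_on[OF zs] smooth_on_continuous_on[OF Ps] P0
      by (intro continuous_intros) (auto simp: less_imp_neq[symmetric])
    then have "bounded ((\<lambda>x. (z x)\<^sup>2 * P x powr (n - 2)) ` K)"
      using K by (intro compact_imp_bounded compact_continuous_image) (auto intro: continuous_on_subset)
    then obtain B where B: "\<And>x. x \<in> K \<Longrightarrow> (z x)\<^sup>2 * P x powr (n - 2) \<le> B"
      by (force simp: bounded_iff)
    have "Z x \<le> (\<bar>B\<bar> + d\<^sup>2) * P x powr (- (n - 2))" for x
    proof -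
      have "(z x)\<^sup>2 * P x powr (n - 2) \<le> \<bar>B\<bar>"
        using B[of x] K(2)[of x] by (cases "x \<in> K") auto
      then have "(z x)\<^sup>2 \<le> \<bar>B\<bar> * P x powr (- (n - 2))"
        using P0[of x] by (simp add: powr_minus_divide pos_le_divide_eq del: minus_diff_eq)
      then show ?thesis by (simp add: Z_def distrib_right)
    qed
    then show ?thesis using d by (intro exI[of _ "\<bar>B\<bar> + d\<^sup>2"]) (auto intro: add_nonneg_pos)
  qed
  then obtain C where C: "C > 0" "\<And>x. Z x \<le> C * P x powr (- (n - 2))" by blast
  define c where "c = C powr (- 1 / (n - 2))"
  have c: "c > 0" using C by (simp add: c_def)
  have fl: "c * (1 + (norm x)\<^sup>2) \<le> f x" for x
  proof -
    have "(C * P x powr (- (n - 2))) powr (- 1 / (n - 2)) \<le> Z x powr (- 1 / (n - 2))"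
      using C(2)[of x] Z0[of x] n by (intro powr_mono2') auto
    moreover have "(C * P x powr (- (n - 2))) powr (- 1 / (n - 2)) = c * P x"
      using P0[of x] C by (simp only: powr_mult powr_powr c_def ex) simp
    ultimately show ?thesis by (simp add: f_def Pn)
  qed
  obtain lam where lam: "lam > 0" and
    core: "1 / lam ^ (DIM('a) - 1) * (LINT x::'a|lborel. 1 / (1 + (norm x)\<^sup>2) ^ (DIM('a) - 1))
      + real (DIM('a) - 1) * lam * (LINT x|lborel. 1 / f x ^ DIM('a))
      \<le> real (DIM('a) - 1) / (4 * lam) * (LINT x|lborel. (norm (G x))\<^sup>2 / f x ^ DIM('a))"
    and ints: "integrable lborel (\<lambda>x. 1 / f x ^ DIM('a))" "integrable lborel (\<lambda>x. (norm (G x))\<^sup>2 / f x ^ DIM('a))"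
    by (rule infinitesimal_inf_convolution[OF dim fm Gm c fl M T]) blast
  have fpow: "1 / f x ^ DIM('a) = Z x powr (n / (n - 2))" for x
  proof -
    have "f x ^ DIM('a) = f x powr n" using Z0[of x] by (simp add: f_def n_def powr_realpow)
    also have "\<dots> = Z x powr (- (n / (n - 2)))" by (simp add: f_def powr_powr)
    finally show ?thesis using Z0[of x] by (simp add: powr_minus divide_inverse)
  qed
  define I where "I = (LINT x::'a|lborel. 1 / (1 + (norm x)\<^sup>2) ^ (DIM('a) - 1))"
  define D where "D = (LINT x|lborel. (norm (gradient z x))\<^sup>2)"
  define B where "B = (LINT x|lborel. 1 / f x ^ DIM('a))"
  define E where "E = (LINT x|lborel. (norm (G x))\<^sup>2 / f x ^ DIM('a))"
  define S where "S = (LINT x|lborel. \<bar>z x\<bar> powr (2 * n / (n - 2)))"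
  \<comment> \<open>The regularisation only increases the critical integral.\<close>
  have SB: "S \<le> B"
    unfolding S_def B_def
  proof (rule integral_mono)
    show "integrable lborel (\<lambda>x. \<bar>z x\<bar> powr (2 * n / (n - 2)))" using intp by (simp add: n_def)
    fix x
    have "\<bar>z x\<bar> powr (2 * n / (n - 2)) = (\<bar>z x\<bar> powr 2) powr (n / (n - 2))"
      unfolding powr_powr by simp
    also have "\<dots> = ((z x)\<^sup>2) powr (n / (n - 2))" by (cases "z x = 0") (simp_all add: powr_numeral)
    also have "\<dots> \<le> Z x powr (n / (n - 2))"
      using n d by (intro powr_mono2) (auto simp: Z_def)
    finally show "\<bar>z x\<bar> powr (2 * n / (n - 2)) \<le> 1 / f x ^ DIM('a)" by (simp add: fpow)
  qed (rule ints)
  \<comment> \<open>\<open>Z\<close> is the sum of the squares of \<open>z\<close> and of d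
    P^(-(n-2)/2). By Cauchy-Schwarz the gradient of its square root costs no more than the two
    separate gradients, after which all powers of \<open>Z\<close> cancel. The second gradient gives
    the error term in \<open>d\<close>.\<close>
  have Eb: "(norm (G x))\<^sup>2 / f x ^ DIM('a)
      \<le> 4 / (n - 2)\<^sup>2 * ((norm (gradient z x))\<^sup>2 + d\<^sup>2 * (n - 2)\<^sup>2 * (1 / (1 + (norm x)\<^sup>2) ^ (DIM('a) - 1)))" for x
  proof -
    define a b where "a = z x" and "b = d * P x powr (- (n - 2) / 2)"
    define p q where "p = gradient z x" and "q = (- (d * (n - 2) * P x powr (- n / 2))) *\<^sub>R x"
    have ab: "a\<^sup>2 + b\<^sup>2 = Z x"
    proof -
      have "2 * (- (n - 2) / 2) = - (n - 2)" by simp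
      then have "(P x powr (- (n - 2) / 2))\<^sup>2 = P x powr (- (n - 2))" by (simp only: powr_square)
      then show ?thesis by (simp only: a_def b_def Z_def power_mult_distrib)
    qed
    have Zd: "(Z has_derivative (\<lambda>h. h \<bullet> (2 *\<^sub>R (a *\<^sub>R p + b *\<^sub>R q)))) (at x)"
    proof -
      have 1: "((\<lambda>y. (z y)\<^sup>2) has_derivative (\<lambda>h. 2 * (z x * (h \<bullet> p)))) (at x)"
        using has_derivative_power[OF smooth_has_derivative_gradient[OF z, of x], of 2] by (simp add: p_def mult_ac)
      have 2: "(P has_derivative (\<lambda>h. 2 * (h \<bullet> x))) (at x)"
        unfolding P_def[abs_def] by (auto intro!: derivative_eq_intros simp: inner_commute)
      have 3: "((\<lambda>y. P y powr (- (n - 2))) has_derivative (\<lambda>h. (- (n - 2)) * P x powr (- (n - 2) - 1) * (2 * (h \<bullet> x)))) (at x)"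
        by (rule has_derivative_powr_compose[OF 2 P0])
      have "(Z has_derivative (\<lambda>h. 2 * (z x * (h \<bullet> p)) + d\<^sup>2 * ((- (n - 2)) * P x powr (- (n - 2) - 1) * (2 * (h \<bullet> x))))) (at x)"
        unfolding Z_def[abs_def] by (intro has_derivative_add 1 has_derivative_mult_right 3)
      moreover have W: "b * (d * (n - 2) * P x powr (- n / 2)) = d\<^sup>2 * ((n - 2) * P x powr (- (n - 2) - 1))"
      proof -
        have "P x powr (- (n - 2) / 2) * P x powr (- n / 2) = P x powr (- (n - 2) - 1)"
        proof -
          have "- (n - 2) / 2 + - n / 2 = - (n - 2) - 1" by (simp add: field_simps)
          then show ?thesis by (simp only: powr_add[symmetric])
        qed
        then show ?thesis by (simp add: b_def power2_eq_square)
      qed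
      have "2 * (z x * (h \<bullet> p)) + d\<^sup>2 * ((- (n - 2)) * P x powr (- (n - 2) - 1) * (2 * (h \<bullet> x)))
          = h \<bullet> (2 *\<^sub>R (a *\<^sub>R p + b *\<^sub>R q))" for h
      proof -
        have "h \<bullet> (2 *\<^sub>R (a *\<^sub>R p + b *\<^sub>R q)) = 2 * (z x * (h \<bullet> p)) - 2 * (b * (d * (n - 2) * P x powr (- n / 2)) * (h \<bullet> x))"
          by (simp add: inner_add_right q_def a_def algebra_simps)
        then show ?thesis unfolding W by (simp add: algebra_simps)
      qed
      ultimately show ?thesis by simp
    qed
    have "(f has_derivative (\<lambda>h. (- 1 / (n - 2)) * Z x powr (- 1 / (n - 2) - 1) * (h \<bullet> (2 *\<^sub>R (a *\<^sub>R p + b *\<^sub>R q))))) (at x)"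
      unfolding f_def[abs_def]
      by (rule has_derivative_powr_compose[OF Zd Z0])
    then have "G x = ((- 1 / (n - 2)) * Z x powr (- 1 / (n - 2) - 1)) *\<^sub>R (2 *\<^sub>R (a *\<^sub>R p + b *\<^sub>R q))"
      unfolding G_def by (intro has_derivative_gradient_eqI) (simp add: mult_ac)
    then have "(norm (G x))\<^sup>2 = (2 / (n - 2) * Z x powr (- 1 / (n - 2) - 1))\<^sup>2 * (norm (a *\<^sub>R p + b *\<^sub>R q))\<^sup>2"
      using n by (simp add: power_mult_distrib power_divide)
    also have "\<dots> \<le> (2 / (n - 2) * Z x powr (- 1 / (n - 2) - 1))\<^sup>2 * (Z x * ((norm p)\<^sup>2 + (norm q)\<^sup>2))"
      using norm_lincomb2[of a p b q] by (intro mult_left_mono) (auto simp: ab)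
    also have "(2 / (n - 2) * Z x powr (- 1 / (n - 2) - 1))\<^sup>2 = 4 / (n - 2)\<^sup>2 * Z x powr (2 * (- 1 / (n - 2) - 1))"
      by (simp add: power_mult_distrib power_divide powr_square)
    finally have "(norm (G x))\<^sup>2 / f x ^ DIM('a)
      \<le> 4 / (n - 2)\<^sup>2 * Z x powr (2 * (- 1 / (n - 2) - 1)) * (Z x * ((norm p)\<^sup>2 + (norm q)\<^sup>2)) * Z x powr (n / (n - 2))"
      unfolding fpow[symmetric] divide_inverse[of "(norm (G x))\<^sup>2"] inverse_eq_divide
      using Z0[of x] by (intro mult_right_mono) (auto simp: f_def)
    also have "\<dots> = 4 / (n - 2)\<^sup>2 * (Z x powr (2 * (- 1 / (n - 2) - 1)) * Z x powr 1 * Z x powr (n / (n - 2))) * ((norm p)\<^sup>2 + (norm q)\<^sup>2)"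
      using Z0[of x] by simp
    also have "Z x powr (2 * (- 1 / (n - 2) - 1)) * Z x powr 1 * Z x powr (n / (n - 2)) = 1"
    proof -
      have "2 * (- 1 / (n - 2) - 1) + 1 + n / (n - 2) = 0" using n by (simp add: field_simps)
      then show ?thesis using Z0[of x] by (simp only: powr_add[symmetric] powr_zero_eq_one) simp
    qed
    also have "(norm q)\<^sup>2 \<le> d\<^sup>2 * (n - 2)\<^sup>2 * (1 / (1 + (norm x)\<^sup>2) ^ (DIM('a) - 1))"
    proof -
      have "(norm q)\<^sup>2 = d\<^sup>2 * (n - 2)\<^sup>2 * (P x powr (- n) * (norm x)\<^sup>2)"
      proof -
        have "2 * (- n / 2) = - n" by simp
        then have "(P x powr (- n / 2))\<^sup>2 = P x powr (- n)" by (simp only: powr_square)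
        then show ?thesis by (simp add: q_def power_mult_distrib)
      qed
      also have "\<dots> \<le> d\<^sup>2 * (n - 2)\<^sup>2 * (P x powr (- n) * P x)"
        by (intro mult_left_mono) (auto simp: Pn)
      also have "P x powr (- n) * P x = 1 / P x ^ (DIM('a) - 1)"
      proof -
        have "P x ^ (DIM('a) - 1) = P x powr (n - 1)" using P0[of x] dim by (simp add: powr_realpow[symmetric] n_def)
        moreover have "P x powr (- n) * P x = P x powr (- (n - 1))"
          using P0[of x] powr_add[of "P x" "-n" 1] by simp
        ultimately show ?thesis using P0[of x] by (simp add: powr_minus_divide del: minus_diff_eq)
      qed
      finally show ?thesis by (simp add: Pn)
    qed
    finally show ?thesis using n by (simp add: p_def mult_left_mono divide_right_mono)
  qed
  have intI: "integrable lborel (\<lambda>x::'a. 1 / (1 + (norm x)\<^sup>2) ^ (DIM('a) - 1))"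
    by (rule integrable_1_plus_norm_square_power) (use dim in auto)
  have "E \<le> (LINT x|lborel. 4 / (n - 2)\<^sup>2 * ((norm (gradient z x))\<^sup>2 + d\<^sup>2 * (n - 2)\<^sup>2 * (1 / (1 + (norm x)\<^sup>2) ^ (DIM('a) - 1))))"
    unfolding E_def
    by (rule integral_mono[OF ints(2) _ Eb]) (intro integrable_mult_right Bochner_Integration.integrable_add int intI)
  also have "\<dots> = 4 / (n - 2)\<^sup>2 * (D + d\<^sup>2 * (n - 2)\<^sup>2 * I)"
    unfolding D_def I_def using int intI by (simp del: times_divide_eq_right times_divide_eq_left)
  finally have E1: "(n - 2)\<^sup>2 / 4 * E \<le> D + d\<^sup>2 * (n - 2)\<^sup>2 * I"
    using n by (simp add: field_simps)
  define K0 where "K0 = (LINT x::'a|lborel. 1 / (1 + (norm x)\<^sup>2) ^ DIM('a))"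
  note sc = sobolev_const_eq_integral[OF dim, folded n_def K0_def I_def]
  have S0: "S \<ge> 0" unfolding S_def by (intro integral_nonneg_AE) auto
  have "n * (n - 2) * K0 powr (2 / n) * S powr ((n - 2) / n) \<le> (n - 2)\<^sup>2 / 4 * E"
  proof (cases "S = 0")
    case True
    have "E \<ge> 0" unfolding E_def using Z0 by (intro integral_nonneg_AE) (auto simp: f_def)
    then show ?thesis using True n by simp
  next
    case False
    then have Sp: "S > 0" "B > 0" using S0 SB by auto
    define X Y where "X = lam\<^sup>2 * B" and "Y = K0 * lam powr (2 - n)"
    have XY: "X > 0" "Y > 0" using lam Sp sc(1) by (auto simp: X_def Y_def)
    \<comment> \<open>The differentiated inequality multiplied by 4 lam / (n-1), which turns its
      right side into \<open>E\<close> alone.\<close>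
    have "4 * (lam / (n - 1)) * (1 / lam ^ (DIM('a) - 1) * I) + 4 * lam\<^sup>2 * B \<le> E"
    proof -
      define J where "J = 1 / lam ^ (DIM('a) - 1) * I"
      have r: "real (DIM('a) - 1) = n - 1" using dim by (simp add: n_def)
      have n1: "n - 1 > 0" using n by simp
      have "J + (n - 1) * lam * B \<le> (n - 1) / (4 * lam) * E"
        using core unfolding r I_def[symmetric] B_def[symmetric] E_def[symmetric] J_def .
      then have "4 * (lam / (n - 1)) * (J + (n - 1) * lam * B) \<le> 4 * (lam / (n - 1)) * ((n - 1) / (4 * lam) * E)"
        using lam n1 by (intro mult_left_mono) auto
      also have "4 * (lam / (n - 1)) * ((n - 1) / (4 * lam) * E) = E" using lam n1 by simp
      also have "4 * (lam / (n - 1)) * (J + (n - 1) * lam * B) = 4 * (lam / (n - 1)) * J + 4 * lam\<^sup>2 * B"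
      proof -
        have "lam / (n - 1) * ((n - 1) * lam * B) = lam\<^sup>2 * B" using n1 by (simp add: power2_eq_square)
        then show ?thesis by (simp only: distrib_left mult.assoc)
      qed
      finally show ?thesis unfolding J_def .
    qed
    also have "4 * (lam / (n - 1)) * (1 / lam ^ (DIM('a) - 1) * I) = 8 / (n - 2) * Y"
    proof -
      have "lam ^ (DIM('a) - 1) = lam powr (n - 1)" using lam dim by (simp add: powr_realpow[symmetric] n_def)
      moreover have "lam powr (2 - n) = lam / lam powr (n - 1)"
        using lam powr_diff[of lam 1 "n - 1"] by simp
      moreover have "I / (n - 1) = 2 * K0 / (n - 2)"
      proof -
        have e: "2 * n - 2 = (n - 1) * 2" by simp
        have "n - 1 \<noteq> 0" using n by simp
        moreover have "K0 * (m * 2) / (n - 2) / m = 2 * K0 / (n - 2)" if "m \<noteq> 0" for m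
          using that by simp
        ultimately have "K0 * ((n - 1) * 2) / (n - 2) / (n - 1) = 2 * K0 / (n - 2)" by blast
        then show ?thesis unfolding sc(3) e .
      qed
      then have "4 * (lam / (n - 1)) * (1 / lam powr (n - 1) * I) = 8 / (n - 2) * (K0 * (lam / lam powr (n - 1)))"
        by (simp add: divide_inverse mult_ac)
      ultimately show ?thesis by (simp only: Y_def)
    qed
    finally have E2: "8 / (n - 2) * Y + 4 * X \<le> E" by (simp add: X_def)
    \<comment> \<open>Young's inequality with the weights (n-2)/n and 2/n: this is the proportion in
      which \<open>X\<close> and \<open>Y\<close> occur in \<open>E2\<close>, so no constant is
      lost.\<close>
    have "X powr ((n - 2) / n) * Y powr (2 / n) \<le> (n - 2) / n * X + 2 / n * Y"
      using n XY by (intro Youngs_inequality_0) (auto simp: field_simps)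
    also have "X powr ((n - 2) / n) * Y powr (2 / n) = K0 powr (2 / n) * B powr ((n - 2) / n)"
    proof -
      have "X powr ((n - 2) / n) = lam powr (2 * (n - 2) / n) * B powr ((n - 2) / n)"
      proof -
        have "(lam powr 2) powr ((n - 2) / n) = lam powr (2 * (n - 2) / n)" unfolding powr_powr by simp
        then show ?thesis using lam by (simp add: X_def powr_mult powr_numeral)
      qed
      moreover have "Y powr (2 / n) = K0 powr (2 / n) * lam powr ((2 - n) * (2 / n))"
        using lam by (simp add: Y_def powr_mult powr_powr)
      moreover have "lam powr (2 * (n - 2) / n) * lam powr ((2 - n) * (2 / n)) = 1"
      proof -
        have "2 * (n - 2) / n + (2 - n) * (2 / n) = (2 * (n - 2) + (2 - n) * 2) / n"
          by (simp only: add_divide_distrib times_divide_eq_right)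
        also have "2 * (n - 2) + (2 - n) * 2 = 0" by simp
        finally have "2 * (n - 2) / n + (2 - n) * (2 / n) = 0" by simp
        then show ?thesis using lam by (simp only: powr_add[symmetric] powr_zero_eq_one) simp
      qed
      ultimately show ?thesis by (simp add: mult_ac)
    qed
    finally have "K0 powr (2 / n) * B powr ((n - 2) / n) \<le> (n - 2) / n * X + 2 / n * Y" .
    moreover have "K0 powr (2 / n) * S powr ((n - 2) / n) \<le> K0 powr (2 / n) * B powr ((n - 2) / n)"
      using SB S0 n by (intro mult_left_mono powr_mono2) auto
    ultimately have "K0 powr (2 / n) * S powr ((n - 2) / n) \<le> (n - 2) / n * X + 2 / n * Y" by linarith
    then have "n * (n - 2) * (K0 powr (2 / n) * S powr ((n - 2) / n)) \<le> n * (n - 2) * ((n - 2) / n * X + 2 / n * Y)"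
      using n by (intro mult_left_mono) auto
    also have "\<dots> = (n - 2)\<^sup>2 / 4 * (8 / (n - 2) * Y + 4 * X)"
      using n by (simp add: field_simps power2_eq_square)
    also have "\<dots> \<le> (n - 2)\<^sup>2 / 4 * E"
      using E2 by (intro mult_left_mono) auto
    finally show ?thesis by (simp add: mult.assoc)
  qed
  then show ?thesis
    using E1 by (simp only: sc(2) S_def[symmetric] D_def[symmetric] I_def[symmetric])
qed

lemma integrable_continuous_compact_support:
  fixes f :: "'a::euclidean_space \<Rightarrow> real"
  assumes "continuous_on K f" "compact K" "\<And>x. x \<notin> K \<Longrightarrow> f x = 0"
  shows "integrable lborel f"
proof -
  have "integrable lborel (\<lambda>x. indicator K x *\<^sub>R f x)"
    using borel_integrable_compact[OF assms(2,1)] by (auto simp: set_integrable_def)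
  moreover have "(\<lambda>x. indicator K x *\<^sub>R f x) = f"
    using assms(3) by (intro ext) (auto simp: indicator_def)
  ultimately show ?thesis by simp
qed

lemma gradient_eq_0_outside:
  fixes f :: "'a::euclidean_space \<Rightarrow> real"
  assumes "closed K" "\<And>x. x \<notin> K \<Longrightarrow> f x = 0" "x \<notin> K"
  shows "gradient f x = 0"
proof (rule has_derivative_gradient_eqI)
  have "(f has_derivative (\<lambda>_. 0)) (at x)"
    by (rule has_derivative_transform_within_open[OF has_derivative_const[of 0], where s = "- K"]) (use assms in auto)
  then show "(f has_derivative (\<lambda>h. h \<bullet> 0)) (at x)" by simp
qed

theorem sobolev_inequality:
  fixes z :: "'a::euclidean_space \<Rightarrow> real"
  assumes dim: "DIM('a) \<ge> 3" and z: "smooth z" and K: "compact K" "\<And>x. x \<notin> K \<Longrightarrow> z x = 0"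
  defines "n \<equiv> real DIM('a)"
  shows "sobolev_const DIM('a) * (LINT x|lborel. \<bar>z x\<bar> powr (2 * n / (n - 2))) powr ((n - 2) / n)
    \<le> (LINT x|lborel. (norm (gradient z x))\<^sup>2)"
proof (rule field_le_epsilon)
  have n: "n \<ge> 3" using dim by (simp add: n_def)
  have int: "integrable lborel (\<lambda>x. (norm (gradient z x))\<^sup>2)"
    by (rule integrable_continuous_compact_support[OF _ K(1)])
       (use gradient_eq_0_outside[of K z] K compact_imp_closed continuous_on_subset[OF smooth_continuous_gradient[OF z]] in \<open>auto intro!: continuous_intros\<close>)
  have zc: "continuous_on UNIV z" using smooth_on_continuous_on z by (simp add: smooth_on_UNIV[symmetric])
  have "continuous_on UNIV (\<lambda>x. \<bar>z x\<bar> powr (2 * n / (n - 2)))"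
    by (intro continuous_on_powr' continuous_on_rabs zc continuous_on_const) (use n in auto)
  then have intp: "integrable lborel (\<lambda>x. \<bar>z x\<bar> powr (2 * real DIM('a) / (real DIM('a) - 2)))"
    unfolding n_def
    by (intro integrable_continuous_compact_support[OF _ K(1)]) (use K in \<open>auto intro: continuous_on_subset\<close>)
  define I where "I = (LINT x::'a|lborel. 1 / (1 + (norm x)\<^sup>2) ^ (DIM('a) - 1))"
  have I: "I \<ge> 0" unfolding I_def by (intro integral_nonneg_AE) auto
  fix \<epsilon> :: real assume \<epsilon>: "\<epsilon> > 0"
  \<comment> \<open>Makes the error d^2 (n-2)^2 I at most \<epsilon>; the summand 1 keeps the
    denominator positive.\<close>
  define d where "d = sqrt (\<epsilon> / ((n - 2)\<^sup>2 * (I + 1)))"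
  have q: "(n - 2)\<^sup>2 * (I + 1) > 0" using n I by (intro mult_pos_pos) auto
  have d: "d > 0" "d\<^sup>2 = \<epsilon> / ((n - 2)\<^sup>2 * (I + 1))" using q \<epsilon> by (auto simp: d_def intro!: real_sqrt_pow2)
  have "d\<^sup>2 * (n - 2)\<^sup>2 * I \<le> d\<^sup>2 * (n - 2)\<^sup>2 * (I + 1)" by (intro mult_left_mono) auto
  also have "\<dots> = d\<^sup>2 * ((n - 2)\<^sup>2 * (I + 1))" by (simp only: mult.assoc)
  also have "\<dots> = \<epsilon>" using q unfolding d(2) by (metis less_irrefl nonzero_eq_divide_eq)
  finally show "sobolev_const DIM('a) * (LINT x|lborel. \<bar>z x\<bar> powr (2 * n / (n - 2))) powr ((n - 2) / n)
    \<le> (LINT x|lborel. (norm (gradient z x))\<^sup>2) + \<epsilon>"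
    using sobolev_regularized[OF dim z K d(1) int intp] unfolding n_def I_def by linarith
qed

section \<open>Polar coordinates\<close>

lemma nn_integral_lborel_affine:
  fixes h :: "'a::euclidean_space \<Rightarrow> ennreal"
  assumes [measurable]: "h \<in> borel_measurable borel" and c: "c > 0"
  shows "(\<integral>\<^sup>+x. h x \<partial>lborel) = ennreal (c ^ DIM('a)) * (\<integral>\<^sup>+x. h (t + c *\<^sub>R x) \<partial>lborel)"
  using c by (subst lborel_affine[of c t])
    (auto simp: nn_integral_density nn_integral_distr nn_integral_cmult)

definition radial_measure :: "nat \<Rightarrow> real measure" where
  "radial_measure n = density lborel (\<lambda>r. ennreal (indicator {0<..} r * r ^ (n - 1)))"

text \<open>Surface measure realised as cone measure: n times the volume of the part of the unit
  ball that lies over a set of directions. The origin, whose \<open>sgn\<close> is 0, is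
  negligible.\<close>

definition sphere_measure :: "'a::euclidean_space measure" where
  "sphere_measure = distr (density lborel (\<lambda>x. ennreal (real DIM('a)) * indicator (cball 0 1) x)) borel sgn"

lemma borel_measurable_sgn_euclidean [measurable]: "(sgn :: 'a::euclidean_space \<Rightarrow> 'a) \<in> borel_measurable borel"
  unfolding sgn_div_norm[abs_def] by measurable

lemma cball_measurable [measurable]: "cball (a::'a::euclidean_space) r \<in> sets borel"
  by simp

lemma sets_radial_measure [simp, measurable_cong]: "sets (radial_measure n) = sets borel"
  and space_radial_measure [simp]: "space (radial_measure n) = UNIV"
  and sets_sphere_measure [simp, measurable_cong]: "sets sphere_measure = sets borel"
  and space_sphere_measure [simp]: "space sphere_measure = UNIV"
  by (auto simp: radial_measure_def sphere_measure_def)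

lemma emeasure_sphere_measure:
  assumes [measurable]: "B \<in> sets borel"
  shows "emeasure (sphere_measure :: 'a::euclidean_space measure) B
    = ennreal (real DIM('a)) * emeasure lborel {x \<in> cball 0 1. sgn x \<in> B}"
proof -
  have [measurable]: "{x::'a. sgn x \<in> B} \<in> sets borel"
    using measurable_sets_borel[OF borel_measurable_sgn_euclidean, of B] by (simp add: vimage_def)
  have [measurable]: "{x::'a. norm x \<le> 1 \<and> sgn x \<in> B} \<in> sets borel" by measurable
  have "emeasure (sphere_measure :: 'a measure) B
      = (\<integral>\<^sup>+x. ennreal (real DIM('a)) * indicator (cball 0 1) x * indicator {x. sgn x \<in> B} x \<partial>lborel)"
    unfolding sphere_measure_def
    by (subst emeasure_distr, simp, simp, subst emeasure_density) (simp_all add: vimage_def)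
  also have "\<dots> = (\<integral>\<^sup>+x. ennreal (real DIM('a)) * indicator {x \<in> cball 0 1. sgn x \<in> B} x \<partial>lborel)"
    by (intro nn_integral_cong) (auto split: split_indicator)
  also have "\<dots> = ennreal (real DIM('a)) * emeasure lborel {x \<in> cball 0 1. sgn x \<in> B}"
    by (subst nn_integral_cmult) auto
  finally show ?thesis .
qed

lemma finite_measure_sphere_measure: "finite_measure (sphere_measure :: 'a::euclidean_space measure)"
proof
  have "emeasure (sphere_measure :: 'a measure) UNIV = ennreal (real DIM('a)) * emeasure lborel (cball (0::'a) 1)"
    by (subst emeasure_sphere_measure) (simp_all add: cball_def)
  also have "\<dots> < top"
    using emeasure_lborel_cball_finite[of "0::'a" 1] by (simp add: ennreal_mult_less_top)
  finally show "emeasure (sphere_measure :: 'a measure) (space sphere_measure) \<noteq> \<infinity>" by simp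
qed

lemma AE_sphere_measure: "AE \<theta> in (sphere_measure :: 'a::euclidean_space measure). norm \<theta> = 1"
proof -
  have "AE x in (lborel :: 'a measure). x \<noteq> 0" by (rule AE_lborel_singleton)
  then have "AE x in (lborel :: 'a measure). norm (sgn x) = 1"
    by (rule eventually_mono) (simp add: norm_sgn)
  then show ?thesis
    unfolding sphere_measure_def
    by (subst AE_distr_iff, simp, simp, subst AE_density) (auto elim: eventually_mono)
qed

lemma sigma_finite_radial_measure: "sigma_finite_measure (radial_measure n)"
  unfolding radial_measure_def
  by (subst sigma_finite_measure.sigma_finite_iff_density_finite[OF lborel.sigma_finite_measure_axioms]) auto

lemma emeasure_radial_measure_atMost:
  assumes "n > 0"
  shows "emeasure (radial_measure n) {..a} = ennreal (max a 0 ^ n / real n)"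
proof (cases "a \<ge> 0")
  case True
  have "emeasure (radial_measure n) {..a} = (\<integral>\<^sup>+r. ennreal (indicator {0<..} r * r ^ (n - 1)) * indicator {..a} r \<partial>lborel)"
    unfolding radial_measure_def by (subst emeasure_density) auto
  also have "\<dots> = (\<integral>\<^sup>+r. ennreal (r ^ (n - 1)) * indicator {0..a} r \<partial>lborel)"
    by (rule nn_integral_cong_AE) (use AE_lborel_singleton[of "0::real"] in \<open>auto elim!: eventually_mono split: split_indicator\<close>)
  also have "\<dots> = ennreal (a ^ n / real n - 0 ^ n / real n)"
  proof (rule nn_integral_FTC_Icc)
    fix x :: real
    show "((\<lambda>r. r ^ n / real n) has_real_derivative x ^ (n - 1)) (at x)"
      using assms by (auto intro!: derivative_eq_intros)
  qed (use True in auto)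
  finally show ?thesis using True assms by (simp add: max_def zero_power)
next
  case False
  have "emeasure (radial_measure n) {..a} = (\<integral>\<^sup>+r. ennreal (indicator {0<..} r * r ^ (n - 1)) * indicator {..a} r \<partial>lborel)"
    unfolding radial_measure_def by (subst emeasure_density) auto
  also have "\<dots> = (\<integral>\<^sup>+r. 0 \<partial>(lborel :: real measure))"
    using False by (intro nn_integral_cong) (auto split: split_indicator)
  finally show ?thesis using False assms by (simp add: max_def zero_power)
qed

text \<open>It suffices to compare rectangles. For a fixed set of directions both sides are measures
  in the radius, and they agree on all sets \<open>{..a}\<close>, because dilation by
  \<open>a\<close> preserves directions and multiplies volumes by a^n.\<close>

lemma polar_measure_eq:
  "radial_measure DIM('a::euclidean_space) \<Otimes>\<^sub>M (sphere_measure :: 'a measure)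
    = distr lborel (borel \<Otimes>\<^sub>M borel) (\<lambda>x::'a. (norm x, sgn x))"
proof (rule pair_measure_eqI)
  let ?n = "DIM('a)"
  show "sigma_finite_measure (radial_measure ?n)" by (rule sigma_finite_radial_measure)
  interpret S: finite_measure "sphere_measure :: 'a measure" by (rule finite_measure_sphere_measure)
  show "sigma_finite_measure (sphere_measure :: 'a measure)" by (rule S.sigma_finite_measure_axioms)
  show "sets (radial_measure ?n \<Otimes>\<^sub>M (sphere_measure :: 'a measure)) = sets (distr lborel (borel \<Otimes>\<^sub>M borel) (\<lambda>x::'a. (norm x, sgn x)))"
    unfolding sets_distr by (rule sets_pair_measure_cong) simp_all
  fix A and B :: "'a set" assume "A \<in> sets (radial_measure ?n)" "B \<in> sets (sphere_measure :: 'a measure)"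
  then have A [measurable]: "A \<in> sets borel" and B [measurable]: "B \<in> sets borel" by auto
  have sB [measurable]: "{x::'a. sgn x \<in> B} \<in> sets borel"
    using measurable_sets_borel[OF borel_measurable_sgn_euclidean, of B] by (simp add: vimage_def)
  define M1 where "M1 = distr (density lborel (indicator {x::'a. sgn x \<in> B})) borel norm"
  define M2 where "M2 = density (radial_measure ?n) (\<lambda>_. emeasure sphere_measure B)"
  have e1: "emeasure M1 X = emeasure lborel {x::'a. norm x \<in> X \<and> sgn x \<in> B}" if [measurable]: "X \<in> sets borel" for X
  proof -
    have [measurable]: "{x::'a. norm x \<in> X} \<in> sets borel"
      using measurable_sets_borel[OF borel_measurable_norm, of X] by (simp add: vimage_def)
    have "emeasure M1 X = (\<integral>\<^sup>+x. indicator {x::'a. sgn x \<in> B} x * indicator {x. norm x \<in> X} x \<partial>lborel)"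
      by (simp add: M1_def emeasure_distr emeasure_density vimage_def)
    also have "\<dots> = (\<integral>\<^sup>+x. indicator {x::'a. norm x \<in> X \<and> sgn x \<in> B} x \<partial>lborel)"
      by (intro nn_integral_cong) (auto split: split_indicator)
    finally show ?thesis by simp
  qed
  have e2: "emeasure M2 X = emeasure (radial_measure ?n) X * emeasure sphere_measure B" if [measurable]: "X \<in> sets borel" for X
    unfolding M2_def
    by (subst emeasure_density, simp, simp, subst nn_integral_cmult_indicator, simp, rule mult.commute)
  have scale: "emeasure M1 {..a} = emeasure M2 {..a}" for a
  proof -
    have m2: "emeasure M2 {..a} = ennreal (max a 0 ^ ?n) * emeasure lborel {x::'a. norm x \<le> 1 \<and> sgn x \<in> B}"
    proof -
      have "emeasure M2 {..a} = ennreal (max a 0 ^ ?n / real ?n) * (ennreal (real ?n) * emeasure lborel {x::'a. norm x \<le> 1 \<and> sgn x \<in> B})"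
        using e2[of "{..a}"] emeasure_radial_measure_atMost[of ?n a] emeasure_sphere_measure[OF B] by simp
      also have "\<dots> = ennreal (max a 0 ^ ?n / real ?n) * ennreal (real ?n) * emeasure lborel {x::'a. norm x \<le> 1 \<and> sgn x \<in> B}"
        by (simp only: mult.assoc)
      also have "ennreal (max a 0 ^ ?n / real ?n) * ennreal (real ?n) = ennreal (max a 0 ^ ?n)"
        by (subst ennreal_mult[symmetric]) auto
      finally show ?thesis .
    qed
    have m1: "emeasure M1 {..a} = emeasure lborel {x::'a. norm x \<le> a \<and> sgn x \<in> B}"
      using e1[of "{..a}"] by simp
    show ?thesis
    proof (cases "a > 0")
      case True
      have "emeasure lborel {x::'a. norm x \<le> a \<and> sgn x \<in> B} = (\<integral>\<^sup>+x. indicator {x::'a. norm x \<le> a \<and> sgn x \<in> B} x \<partial>lborel)"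
        by simp
      also have "\<dots> = ennreal (a ^ ?n) * (\<integral>\<^sup>+x. indicator {x::'a. norm x \<le> a \<and> sgn x \<in> B} (0 + a *\<^sub>R x) \<partial>lborel)"
        by (rule nn_integral_lborel_affine) (use True in auto)
      also have "(\<integral>\<^sup>+x. indicator {x::'a. norm x \<le> a \<and> sgn x \<in> B} (0 + a *\<^sub>R x) \<partial>lborel)
          = (\<integral>\<^sup>+x. indicator {x::'a. norm x \<le> 1 \<and> sgn x \<in> B} x \<partial>lborel)"
        using True by (intro nn_integral_cong) (simp add: indicator_def sgn_scaleR)
      finally show ?thesis using True by (simp add: m1 m2)
    next
      case False
      have "emeasure lborel {x::'a. norm x \<le> a \<and> sgn x \<in> B} \<le> emeasure lborel {0::'a}"
        using False by (intro emeasure_mono) (auto simp: not_less dest: order_trans)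
      then show ?thesis using False by (simp add: m1 m2 max_def zero_power)
    qed
  qed
  have "M1 = M2"
  proof (rule measure_eqI_generator_eq[where E = "range atMost" and \<Omega> = UNIV and A = "\<lambda>i. {..real i}"])
    show "Int_stable (range (atMost :: real \<Rightarrow> real set))"
      by (auto simp: Int_stable_def intro!: image_eqI[where x = "min _ _"])
    show "sets M1 = sigma_sets UNIV (range atMost)" "sets M2 = sigma_sets UNIV (range atMost)"
      by (simp_all add: M1_def M2_def borel_eq_atMost)
    show "(\<Union>i. {..real i}) = UNIV" using real_arch_simple by auto
    show "emeasure M1 {..real i} \<noteq> \<infinity>" for i
    proof -
      have "emeasure lborel {x::'a. norm x \<le> real i \<and> sgn x \<in> B} \<le> emeasure lborel (cball (0::'a) (real i))"
        by (intro emeasure_mono) auto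
      also have "\<dots> < \<infinity>" by (rule emeasure_lborel_cball_finite)
      finally show ?thesis using e1[of "{..real i}"] by simp
    qed
  qed (use scale in auto)
  then have "emeasure (radial_measure ?n) A * emeasure sphere_measure B = emeasure lborel {x::'a. norm x \<in> A \<and> sgn x \<in> B}"
    using e1[OF A] e2[OF A] by simp
  also have "\<dots> = emeasure (distr lborel (borel \<Otimes>\<^sub>M borel) (\<lambda>x::'a. (norm x, sgn x))) (A \<times> B)"
    by (subst emeasure_distr) (auto simp: vimage_def)
  finally show "emeasure (radial_measure ?n) A * emeasure sphere_measure B
    = emeasure (distr lborel (borel \<Otimes>\<^sub>M borel) (\<lambda>x::'a. (norm x, sgn x))) (A \<times> B)" .
qed

lemma norm_scaleR_sgn: "norm x *\<^sub>R sgn x = (x::'a::real_normed_vector)"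
  by (cases "x = 0") (simp_all add: sgn_div_norm)

lemma pair_sigma_finite_polar:
  "pair_sigma_finite (radial_measure n) (sphere_measure :: 'a::euclidean_space measure)"
  using sigma_finite_radial_measure finite_measure.axioms(1)[OF finite_measure_sphere_measure]
  by (auto intro: pair_sigma_finite.intro)

theorem nn_integral_polar:
  fixes h :: "'a::euclidean_space \<Rightarrow> ennreal"
  assumes [measurable]: "h \<in> borel_measurable borel"
  shows "(\<integral>\<^sup>+x. h x \<partial>lborel) = (\<integral>\<^sup>+\<theta>. (\<integral>\<^sup>+r. ennreal (indicator {0<..} r * r ^ (DIM('a) - 1)) * h (r *\<^sub>R \<theta>) \<partial>lborel) \<partial>sphere_measure)"
proof -
  interpret pair_sigma_finite "radial_measure DIM('a)" "sphere_measure :: 'a measure" by (rule pair_sigma_finite_polar)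
  have "(\<integral>\<^sup>+x. h x \<partial>lborel) = (\<integral>\<^sup>+x. h (fst (norm x, sgn x) *\<^sub>R snd (norm x, sgn x)) \<partial>lborel)"
    by (simp add: norm_scaleR_sgn)
  also have "\<dots> = (\<integral>\<^sup>+p. h (fst p *\<^sub>R snd p) \<partial>distr lborel (borel \<Otimes>\<^sub>M borel) (\<lambda>x::'a. (norm x, sgn x)))"
    by (subst nn_integral_distr) auto
  also have "\<dots> = (\<integral>\<^sup>+p. h (fst p *\<^sub>R snd p) \<partial>(radial_measure DIM('a) \<Otimes>\<^sub>M (sphere_measure :: 'a measure)))"
    by (simp add: polar_measure_eq)
  also have "\<dots> = (\<integral>\<^sup>+\<theta>. (\<integral>\<^sup>+r. h (r *\<^sub>R \<theta>) \<partial>radial_measure DIM('a)) \<partial>(sphere_measure :: 'a measure))"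
    by (subst nn_integral_snd[symmetric]) auto
  also have "\<dots> = (\<integral>\<^sup>+\<theta>. (\<integral>\<^sup>+r. ennreal (indicator {0<..} r * r ^ (DIM('a) - 1)) * h (r *\<^sub>R \<theta>) \<partial>lborel) \<partial>sphere_measure)"
    unfolding radial_measure_def by (intro nn_integral_cong) (subst nn_integral_density, auto)
  finally show ?thesis .
qed

text \<open>Meant for divergences of radial vector fields, whose integrals vanish along every single
  ray.\<close>

lemma integral_polar_eq_0:
  fixes h :: "'a::euclidean_space \<Rightarrow> real"
  assumes h: "integrable lborel h"
    and zero: "\<And>\<theta>. norm \<theta> = 1 \<Longrightarrow> (LINT r|lborel. indicator {0<..} r * r ^ (DIM('a) - 1) * h (r *\<^sub>R \<theta>)) = 0"
  shows "(LINT x|lborel. h x) = 0"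
proof -
  interpret pair_sigma_finite "radial_measure DIM('a)" "sphere_measure :: 'a measure" by (rule pair_sigma_finite_polar)
  have [measurable]: "h \<in> borel_measurable borel" using h by auto
  have eq: "h (fst (norm x, sgn x) *\<^sub>R snd (norm x, sgn x)) = h x" for x by (simp add: norm_scaleR_sgn)
  have "integrable (distr lborel (borel \<Otimes>\<^sub>M borel) (\<lambda>x::'a. (norm x, sgn x))) (\<lambda>p. h (fst p *\<^sub>R snd p))"
    using h by (subst integrable_distr_eq) (auto simp: norm_scaleR_sgn)
  then have int: "integrable (radial_measure DIM('a) \<Otimes>\<^sub>M (sphere_measure :: 'a measure)) (\<lambda>(r, \<theta>). h (r *\<^sub>R \<theta>))"
    by (simp add: polar_measure_eq case_prod_beta')
  have "(LINT x|lborel. h x) = (LINT x|lborel. h (fst (norm x, sgn x) *\<^sub>R snd (norm x, sgn x)))"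
    by (simp add: norm_scaleR_sgn)
  also have "\<dots> = (LINT p|distr lborel (borel \<Otimes>\<^sub>M borel) (\<lambda>x::'a. (norm x, sgn x)). h (fst p *\<^sub>R snd p))"
    by (subst integral_distr) auto
  also have "\<dots> = (LINT p|(radial_measure DIM('a) \<Otimes>\<^sub>M (sphere_measure :: 'a measure)). (\<lambda>(r, \<theta>). h (r *\<^sub>R \<theta>)) p)"
    by (simp add: polar_measure_eq case_prod_beta')
  also have "\<dots> = (LINT \<theta>|sphere_measure. (LINT r|radial_measure DIM('a). h (r *\<^sub>R \<theta>)))"
    by (subst integral_snd[OF int, symmetric]) simp
  also have "\<dots> = (LINT \<theta>|(sphere_measure :: 'a measure). 0)"
  proof (rule integral_cong_AE)
    show "AE \<theta> in (sphere_measure :: 'a measure). (LINT r|radial_measure DIM('a). h (r *\<^sub>R \<theta>)) = 0"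
      using AE_sphere_measure
    proof eventually_elim
      fix \<theta> :: 'a assume "norm \<theta> = 1"
      have "(LINT r|radial_measure DIM('a). h (r *\<^sub>R \<theta>)) = (LINT r|lborel. indicator {0<..} r * r ^ (DIM('a) - 1) * h (r *\<^sub>R \<theta>))"
        unfolding radial_measure_def by (subst integral_real_density) (auto split: split_indicator)
      then show "(LINT r|radial_measure DIM('a). h (r *\<^sub>R \<theta>)) = 0" using zero[OF \<open>norm \<theta> = 1\<close>] by simp
    qed
    show "(\<lambda>\<theta>. LINT r|radial_measure DIM('a). h (r *\<^sub>R \<theta>)) \<in> borel_measurable (sphere_measure :: 'a measure)"
      by (rule M1.borel_measurable_lebesgue_integral) measurable
  qed auto
  finally show ?thesis by simp
qed

text \<open>Along each ray this is the substitution s = p r. The factor (p/r)^(n-1) p' is the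
  Jacobian of the radial map that sends radius r to radius p r.\<close>

lemma nn_integral_radial_change:
  fixes h :: "'a::euclidean_space \<Rightarrow> real"
  assumes [measurable]: "h \<in> borel_measurable borel" and h0: "\<And>y. h y \<ge> 0"
    and r: "0 < r0" "r0 \<le> r1"
    and p: "\<And>r. r \<in> {r0..r1} \<Longrightarrow> (p has_real_derivative p' r) (at r)" "continuous_on {r0..r1} p'"
      "\<And>r. r \<in> {r0..r1} \<Longrightarrow> p' r \<ge> 0" "p r0 > 0"
    and pm [measurable]: "p \<in> borel_measurable borel" "p' \<in> borel_measurable borel"
    and supp: "\<And>y. norm y \<notin> {p r0..p r1} \<Longrightarrow> h y = 0"
  shows "(\<integral>\<^sup>+y. ennreal (h y) \<partial>lborel) = (\<integral>\<^sup>+x. ennreal (indicator {r0..r1} (norm x) *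
    ((p (norm x) / norm x) ^ (DIM('a) - 1) * p' (norm x)) * h ((p (norm x) / norm x) *\<^sub>R x)) \<partial>lborel)"
proof -
  let ?N = "DIM('a) - 1"
  have mono: "p r0 \<le> p r" if "r \<in> {r0..r1}" for r
    using that by (intro DERIV_nonneg_imp_nondecreasing[of r0 r p]) (auto intro!: p(1,3) exI)
  have pp: "p r > 0" if "r \<in> {r0..r1}" for r using mono[OF that] p(4) by linarith
  have "(\<integral>\<^sup>+y. ennreal (h y) \<partial>lborel) = (\<integral>\<^sup>+\<theta>. (\<integral>\<^sup>+s. ennreal (indicator {0<..} s * s ^ ?N) * ennreal (h (s *\<^sub>R \<theta>)) \<partial>lborel) \<partial>(sphere_measure :: 'a measure))"
    by (rule nn_integral_polar) measurable
  also have "\<dots> = (\<integral>\<^sup>+\<theta>. (\<integral>\<^sup>+s. ennreal (indicator {0<..} s * s ^ ?N) * ennreal (indicator {r0..r1} (norm (s *\<^sub>R \<theta>)) *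
    ((p (norm (s *\<^sub>R \<theta>)) / norm (s *\<^sub>R \<theta>)) ^ ?N * p' (norm (s *\<^sub>R \<theta>))) * h ((p (norm (s *\<^sub>R \<theta>)) / norm (s *\<^sub>R \<theta>)) *\<^sub>R (s *\<^sub>R \<theta>))) \<partial>lborel) \<partial>(sphere_measure :: 'a measure))"
  proof (rule nn_integral_cong_AE)
    show "AE \<theta> in (sphere_measure :: 'a measure). (\<integral>\<^sup>+s. ennreal (indicator {0<..} s * s ^ ?N) * ennreal (h (s *\<^sub>R \<theta>)) \<partial>lborel)
      = (\<integral>\<^sup>+s. ennreal (indicator {0<..} s * s ^ ?N) * ennreal (indicator {r0..r1} (norm (s *\<^sub>R \<theta>)) *
    ((p (norm (s *\<^sub>R \<theta>)) / norm (s *\<^sub>R \<theta>)) ^ ?N * p' (norm (s *\<^sub>R \<theta>))) * h ((p (norm (s *\<^sub>R \<theta>)) / norm (s *\<^sub>R \<theta>)) *\<^sub>R (s *\<^sub>R \<theta>))) \<partial>lborel)"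
      using AE_sphere_measure
    proof eventually_elim
      fix \<theta> :: 'a assume \<theta>: "norm \<theta> = 1"
      have "(\<integral>\<^sup>+s. ennreal (indicator {0<..} s * s ^ ?N) * ennreal (h (s *\<^sub>R \<theta>)) \<partial>lborel)
        = (\<integral>\<^sup>+s. ennreal (s ^ ?N * h (s *\<^sub>R \<theta>) * indicator {p r0..p r1} s) \<partial>lborel)"
      proof (rule nn_integral_cong)
        fix s :: real
        show "ennreal (indicator {0<..} s * s ^ ?N) * ennreal (h (s *\<^sub>R \<theta>)) = ennreal (s ^ ?N * h (s *\<^sub>R \<theta>) * indicator {p r0..p r1} s)"
          using supp[of "s *\<^sub>R \<theta>"] p(4) h0[of "s *\<^sub>R \<theta>"] \<theta>
          by (cases "s > 0") (auto simp: ennreal_mult[symmetric] split: split_indicator)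
      qed
      also have "\<dots> = (\<integral>\<^sup>+r. ennreal (p r ^ ?N * h (p r *\<^sub>R \<theta>) * p' r * indicator {r0..r1} r) \<partial>lborel)"
      proof (rule nn_integral_substitution)
        show "set_borel_measurable borel {p r0..p r1} (\<lambda>s. s ^ ?N * h (s *\<^sub>R \<theta>))"
          unfolding set_borel_measurable_def by measurable
      qed (use p r in auto)
      also have "\<dots> = (\<integral>\<^sup>+s. ennreal (indicator {0<..} s * s ^ ?N) * ennreal (indicator {r0..r1} (norm (s *\<^sub>R \<theta>)) *
    ((p (norm (s *\<^sub>R \<theta>)) / norm (s *\<^sub>R \<theta>)) ^ ?N * p' (norm (s *\<^sub>R \<theta>))) * h ((p (norm (s *\<^sub>R \<theta>)) / norm (s *\<^sub>R \<theta>)) *\<^sub>R (s *\<^sub>R \<theta>))) \<partial>lborel)"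
      proof (rule nn_integral_cong)
        fix s :: real
        show "ennreal (p s ^ ?N * h (p s *\<^sub>R \<theta>) * p' s * indicator {r0..r1} s)
          = ennreal (indicator {0<..} s * s ^ ?N) * ennreal (indicator {r0..r1} (norm (s *\<^sub>R \<theta>)) *
    ((p (norm (s *\<^sub>R \<theta>)) / norm (s *\<^sub>R \<theta>)) ^ ?N * p' (norm (s *\<^sub>R \<theta>))) * h ((p (norm (s *\<^sub>R \<theta>)) / norm (s *\<^sub>R \<theta>)) *\<^sub>R (s *\<^sub>R \<theta>)))"
        proof (cases "s \<in> {r0..r1}")
          case True
          then have s: "s > 0" "p s > 0" "p' s \<ge> 0" using r pp p(3) by auto
          show ?thesis using True s \<theta> h0 by (simp add: ennreal_mult[symmetric] power_divide)
        next
          case False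
          then show ?thesis using \<theta> r by (cases "s > 0") auto
        qed
      qed
      finally show "(\<integral>\<^sup>+s. ennreal (indicator {0<..} s * s ^ ?N) * ennreal (h (s *\<^sub>R \<theta>)) \<partial>lborel) = \<dots>" .
    qed
  qed
  also have "\<dots> = (\<integral>\<^sup>+x. ennreal (indicator {r0..r1} (norm x) *
    ((p (norm x) / norm x) ^ ?N * p' (norm x)) * h ((p (norm x) / norm x) *\<^sub>R x)) \<partial>lborel)"
    by (rule nn_integral_polar[symmetric]) measurable
  finally show ?thesis .
qed

text \<open>In polar coordinates the integrand is r^(n-3), which is bounded near 0 because n is at
  least 3.\<close>

lemma nn_integral_inverse_norm_square_ball:
  assumes dim: "DIM('a::euclidean_space) \<ge> 3"
  shows "(\<integral>\<^sup>+x. ennreal (indicator (cball 0 R) x / (norm (x::'a))\<^sup>2) \<partial>lborel) < \<infinity>"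
proof -
  interpret S: finite_measure "sphere_measure :: 'a measure" by (rule finite_measure_sphere_measure)
  let ?N = "DIM('a) - 1"
  have "(\<integral>\<^sup>+x. ennreal (indicator (cball 0 R) x / (norm (x::'a))\<^sup>2) \<partial>lborel)
    = (\<integral>\<^sup>+\<theta>. (\<integral>\<^sup>+r. ennreal (indicator {0<..} r * r ^ ?N) * ennreal (indicator (cball 0 R) (r *\<^sub>R \<theta>) / (norm (r *\<^sub>R \<theta>))\<^sup>2) \<partial>lborel) \<partial>(sphere_measure :: 'a measure))"
  proof (rule nn_integral_polar)
    have [measurable]: "cball (0::'a) R \<in> sets borel" by simp
    show "(\<lambda>x::'a. ennreal (indicator (cball 0 R) x / (norm x)\<^sup>2)) \<in> borel_measurable borel" by measurable
  qed
  also have "\<dots> \<le> (\<integral>\<^sup>+\<theta>. ennreal (\<bar>R\<bar> ^ (?N - 2)) * ennreal \<bar>R\<bar> \<partial>(sphere_measure :: 'a measure))"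
  proof (rule nn_integral_mono_AE)
    show "AE \<theta> in (sphere_measure :: 'a measure). (\<integral>\<^sup>+r. ennreal (indicator {0<..} r * r ^ ?N) * ennreal (indicator (cball 0 R) (r *\<^sub>R \<theta>) / (norm (r *\<^sub>R \<theta>))\<^sup>2) \<partial>lborel)
      \<le> ennreal (\<bar>R\<bar> ^ (?N - 2)) * ennreal \<bar>R\<bar>"
      using AE_sphere_measure
    proof eventually_elim
      fix \<theta> :: 'a assume \<theta>: "norm \<theta> = 1"
      have "(\<integral>\<^sup>+r. ennreal (indicator {0<..} r * r ^ ?N) * ennreal (indicator (cball 0 R) (r *\<^sub>R \<theta>) / (norm (r *\<^sub>R \<theta>))\<^sup>2) \<partial>lborel)
        \<le> (\<integral>\<^sup>+r. ennreal (\<bar>R\<bar> ^ (?N - 2)) * indicator {0..\<bar>R\<bar>} r \<partial>lborel)"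
      proof (rule nn_integral_mono)
        fix r :: real
        show "ennreal (indicator {0<..} r * r ^ ?N) * ennreal (indicator (cball 0 R) (r *\<^sub>R \<theta>) / (norm (r *\<^sub>R \<theta>))\<^sup>2)
          \<le> ennreal (\<bar>R\<bar> ^ (?N - 2)) * indicator {0..\<bar>R\<bar>} r"
        proof (cases "0 < r \<and> r \<le> R")
          case True
          have "?N = (?N - 2) + 2" using dim by simp
          then have "r ^ ?N = r ^ (?N - 2) * r\<^sup>2" by (metis power_add)
          then have "r ^ ?N / r\<^sup>2 = r ^ (?N - 2)" using True by simp
          also have "\<dots> \<le> \<bar>R\<bar> ^ (?N - 2)" using True by (intro power_mono) auto
          finally show ?thesis using True \<theta> by (simp add: ennreal_mult[symmetric] ennreal_leI)
        next
          case False
          then show ?thesis using \<theta> by (auto simp: indicator_def)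
        qed
      qed
      also have "\<dots> = ennreal (\<bar>R\<bar> ^ (?N - 2)) * ennreal \<bar>R\<bar>"
        by (subst nn_integral_cmult) auto
      finally show "(\<integral>\<^sup>+r. ennreal (indicator {0<..} r * r ^ ?N) * ennreal (indicator (cball 0 R) (r *\<^sub>R \<theta>) / (norm (r *\<^sub>R \<theta>))\<^sup>2) \<partial>lborel)
        \<le> ennreal (\<bar>R\<bar> ^ (?N - 2)) * ennreal \<bar>R\<bar>" .
    qed
  qed
  also have "\<dots> < \<infinity>"
  proof -
    have "emeasure (sphere_measure :: 'a measure) UNIV < top"
      using S.emeasure_finite[of UNIV] by (simp only: less_top infinity_ennreal_def)
    then show ?thesis by (simp add: ennreal_mult_less_top)
  qed
  finally show ?thesis .
qed

section \<open>The change of variables\<close>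

lemma integral_radial_change:
  fixes h :: "'a::euclidean_space \<Rightarrow> real"
  assumes [measurable]: "h \<in> borel_measurable borel" and h0: "\<And>y. h y \<ge> 0"
    and r: "0 < r0" "r0 \<le> r1"
    and p: "\<And>r. r \<in> {r0..r1} \<Longrightarrow> (p has_real_derivative p' r) (at r)" "continuous_on {r0..r1} p'"
      "\<And>r. r \<in> {r0..r1} \<Longrightarrow> p' r \<ge> 0" "p r0 > 0"
    and pm [measurable]: "p \<in> borel_measurable borel" "p' \<in> borel_measurable borel"
    and supp: "\<And>y. norm y \<notin> {p r0..p r1} \<Longrightarrow> h y = 0"
  shows "(LINT y|lborel. h y) = (LINT x|lborel. indicator {r0..r1} (norm x) *
    ((p (norm x) / norm x) ^ (DIM('a) - 1) * p' (norm x)) * h ((p (norm x) / norm x) *\<^sub>R x))"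
proof -
  have mono: "p r0 \<le> p r" if "r \<in> {r0..r1}" for r
    using that by (intro DERIV_nonneg_imp_nondecreasing[of r0 r p]) (auto intro!: p(1,3) exI)
  have pp: "p r > 0" if "r \<in> {r0..r1}" for r using mono[OF that] p(4) by linarith
  have nn: "0 \<le> indicator {r0..r1} (norm x) * ((p (norm x) / norm x) ^ (DIM('a) - 1) * p' (norm x)) * h ((p (norm x) / norm x) *\<^sub>R x)" for x :: 'a
    using pp[of "norm x"] p(3)[of "norm x"] h0 by (auto simp: indicator_def)
  show ?thesis
    using nn h0 nn_integral_radial_change[OF assms]
    by (subst (1 2) integral_eq_nn_integral) auto
qed

text \<open>\<open>n\<close> is a real number because it enters mainly through exponents; it is
  identified with the dimension where integrals occur. The lower bound is proved for every
  admissible \<kappa>, and the largest one, min(a, 1/(n-2)), gives the best constant.\<close>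

locale hs_transform =
  fixes n a D \<kappa> :: real
  assumes n3: "n \<ge> 3" and a0: "a > 0" and D0: "D > 0" and k0: "\<kappa> > 0" and ka: "\<kappa> \<le> a" and kn: "\<kappa> \<le> 1 / (n - 2)"
begin

text \<open>In the new radius, \<open>rho r\<close>, of a point with old radius \<open>r\<close>, everything depends smoothly on
  \<open>s = (rho r)\<^sup>2\<close>: \<open>tt s\<close> is \<open>tau r\<close>, \<open>rr s\<close> is \<open>r\<close>, \<open>cc s\<close> is the factor \<open>r / rho r\<close> of the inverse radial map,
  and \<open>psi s\<close> is the reciprocal of the supersolution \<open>r powr (- al) * tau r powr be\<close>. \<open>jac\<close> is the
  Jacobian of the radial map.\<close>

definition al :: real where "al = (n - 2) / 2"
definition be :: real where "be = (1 - \<kappa> * (n - 2)) / 2"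
definition qq :: real where "qq = 1 / (2 * \<kappa>)"
definition tau :: "real \<Rightarrow> real" where "tau r = a - ln (r / D)"
definition rho :: "real \<Rightarrow> real" where "rho r = tau r powr (- \<kappa>)"
definition tt :: "real \<Rightarrow> real" where "tt s = s powr (- qq)"
definition rr :: "real \<Rightarrow> real" where "rr s = D * exp (a - tt s)"
definition cc :: "real \<Rightarrow> real" where "cc s = rr s * s powr (- 1 / 2)"
definition psi :: "real \<Rightarrow> real" where "psi s = rr s powr al * s powr (be * qq)"
definition jac :: "real \<Rightarrow> real" where "jac r = (rho r / r) powr n * (\<kappa> / tau r)"

text \<open>u/phi in the new variable: \<open>cc (y \<bullet> y) *\<^sub>R y\<close> is the preimage
  of \<open>y\<close> under the radial map, and multiplying by \<open>psi\<close> divides by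
  phi.\<close>

definition transplant :: "('a::euclidean_space \<Rightarrow> real) \<Rightarrow> 'a \<Rightarrow> real" where
  "transplant u y = u (cc (y \<bullet> y) *\<^sub>R y) * psi (y \<bullet> y)"

text \<open>This is phi grad(u/phi), since the logarithmic derivative of phi in r is -(al +
  be/tau)/r.\<close>

definition ground_gradient :: "('a::euclidean_space \<Rightarrow> real) \<Rightarrow> 'a \<Rightarrow> 'a" where
  "ground_gradient u x = gradient u x + ((al + be / tau (norm x)) / (norm x)\<^sup>2 * u x) *\<^sub>R x"

lemma be_bounds: "be \<ge> 0" "be \<le> 1 / 2" "be < 1"
proof -
  have "\<kappa> * (n - 2) \<le> 1" using kn n3 by (simp add: pos_le_divide_eq)
  moreover have "\<kappa> * (n - 2) > 0" using k0 n3 by simp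
  ultimately show "be \<ge> 0" "be \<le> 1 / 2" "be < 1" by (auto simp: be_def)
qed

lemma qq_pos: "qq > 0" using k0 by (simp add: qq_def)

lemma rr_pos: "rr s > 0" using D0 by (simp add: rr_def)
lemma tt_pos: "s > 0 \<Longrightarrow> tt s > 0" by (simp add: tt_def)
lemma cc_pos: "s > 0 \<Longrightarrow> cc s > 0" using rr_pos by (simp add: cc_def)
lemma psi_pos: "s > 0 \<Longrightarrow> psi s > 0" using rr_pos[of s] by (auto simp: psi_def intro!: mult_pos_pos)

lemma tau_ge: "0 < r \<Longrightarrow> r \<le> D \<Longrightarrow> tau r \<ge> a"
  using D0 by (simp add: tau_def ln_div)

lemma tau_pos: "0 < r \<Longrightarrow> r \<le> D \<Longrightarrow> tau r > 0"
  using tau_ge[of r] a0 by linarith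

lemma rho_pos: "0 < r \<Longrightarrow> r \<le> D \<Longrightarrow> rho r > 0"
  using tau_pos[of r] by (simp add: rho_def)

lemma inverse_relations:
  assumes "0 < r" "r \<le> D"
  shows "tt ((rho r)\<^sup>2) = tau r" "rr ((rho r)\<^sup>2) = r" "cc ((rho r)\<^sup>2) = r / rho r"
proof -
  have t: "tau r > 0" and p: "rho r > 0" using tau_pos rho_pos assms by auto
  have "tt ((rho r)\<^sup>2) = (rho r powr 2) powr (- qq)"
    using p by (simp add: tt_def powr_numeral)
  also have "\<dots> = tau r powr (- \<kappa> * 2 * - qq)" unfolding rho_def powr_powr ..
  also have "- \<kappa> * 2 * - qq = 1" using k0 by (simp add: qq_def)
  finally show 1: "tt ((rho r)\<^sup>2) = tau r" using t by simp
  show 2: "rr ((rho r)\<^sup>2) = r" using assms D0 by (simp add: rr_def 1 tau_def)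
  have "(rho r)\<^sup>2 powr (- 1 / 2) = (rho r powr 2) powr (- 1 / 2)" using p by (simp add: powr_numeral)
  also have "\<dots> = rho r powr (- 1)" unfolding powr_powr by simp
  also have "\<dots> = 1 / rho r" using p by (simp add: powr_minus_divide)
  finally show "cc ((rho r)\<^sup>2) = r / rho r" by (simp add: cc_def 2)
qed

lemma tt_rr_inverse:
  assumes s: "s > 0"
  shows "tau (rr s) = tt s" "rr s \<le> D \<Longrightarrow> rho (rr s) = sqrt s"
proof -
  show 1: "tau (rr s) = tt s" using D0 by (simp add: tau_def rr_def)
  have "rho (rr s) = s powr (- qq * - \<kappa>)" unfolding rho_def 1 tt_def powr_powr ..
  also have "- qq * - \<kappa> = 1 / 2" using k0 by (simp add: qq_def)
  finally show "rho (rr s) = sqrt s" using s by (simp add: powr_half_sqrt)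
qed

lemma tau_antimono: "0 < r \<Longrightarrow> r \<le> r' \<Longrightarrow> tau r' \<le> tau r"
  using D0 by (simp add: tau_def ln_div)

lemma rho_mono: "0 < r \<Longrightarrow> r \<le> r' \<Longrightarrow> r' \<le> D \<Longrightarrow> rho r \<le> rho r'"
  using tau_antimono[of r r'] tau_pos[of r'] k0 unfolding rho_def by (intro powr_mono2') auto

lemma rho_has_derivative:
  assumes "0 < r" "r \<le> D"
  shows "(rho has_real_derivative \<kappa> * rho r / (tau r * r)) (at r)"
proof -
  have t: "tau r > 0" using tau_pos assms by auto
  have dt: "(tau has_real_derivative - 1 / r) (at r)"
    unfolding tau_def[abs_def] using assms D0 by (auto intro!: derivative_eq_intros)
  have "((\<lambda>r. tau r powr (- \<kappa>)) has_real_derivative (- \<kappa>) * tau r powr (- \<kappa> - 1) * (- 1 / r)) (at r)"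
    using DERIV_chain2[OF has_real_derivative_powr[OF t, of "- \<kappa>"] dt] by simp
  moreover have "tau r powr (- \<kappa> - 1) = rho r / tau r"
    using t by (simp add: rho_def powr_diff)
  ultimately show ?thesis by (simp add: rho_def[abs_def])
qed

text \<open>Logarithmic derivatives: \<open>cc\<close> and \<open>psi\<close> are products of powers
  of s and of \<open>rr s\<close>, and ln (rr s) has the derivative qq tt / s.\<close>

lemma cc_psi_derivatives:
  assumes s: "s > 0"
  shows "(cc has_real_derivative cc s * (qq * tt s - 1 / 2) / s) (at s)"
    and "(psi has_real_derivative psi s * (qq * (al * tt s + be)) / s) (at s)"
proof -
  have T: "(tt has_real_derivative - qq * tt s / s) (at s)"
  proof -
    have "(tt has_real_derivative - qq * s powr (- qq - 1)) (at s)"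
      unfolding tt_def[abs_def] by (rule has_real_derivative_powr[OF s])
    then show ?thesis using s by (simp add: tt_def powr_diff)
  qed
  have R: "(rr has_real_derivative rr s * (qq * tt s / s)) (at s)"
    unfolding rr_def[abs_def] using T by (auto intro!: derivative_eq_intros)
  have P: "((\<lambda>s. s powr p) has_real_derivative p * s powr p / s) (at s)" for p
    using has_real_derivative_powr[OF s, of p] s by (simp add: powr_diff)
  have RA: "((\<lambda>s. rr s powr al) has_real_derivative rr s powr al * (al * (qq * tt s / s))) (at s)"
  proof -
    have D: "((\<lambda>s. rr s powr al) has_real_derivative al * rr s powr (al - 1) * (rr s * (qq * tt s / s))) (at s)"
      using DERIV_chain2[OF has_real_derivative_powr[OF rr_pos, of al] R] by simp
    have "rr s powr al = rr s powr (al - 1) * rr s" using rr_pos[of s] by (simp add: powr_diff)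
    then show ?thesis by (intro DERIV_cong[OF D]) (simp only: mult_ac)
  qed
  have aux: "A * (X / s) * B + p * B / s * A = A * B * (X + p) / s" for A B X p :: real
    by (simp add: add_divide_distrib distrib_left mult_ac)
  show "(cc has_real_derivative cc s * (qq * tt s - 1 / 2) / s) (at s)"
    using DERIV_mult[OF R P[of "- 1 / 2"]] unfolding cc_def[abs_def]
    by (rule DERIV_cong) (simp only: aux, simp)
  have "al * (qq * tt s / s) = qq * (al * tt s) / s" by simp
  then show "(psi has_real_derivative psi s * (qq * (al * tt s + be)) / s) (at s)"
    using DERIV_mult[OF RA P[of "be * qq"]] unfolding psi_def[abs_def]
    by (elim DERIV_cong) (simp only: aux distrib_left mult.commute[of be])
qed

lemma smooth_rr: "smooth_on {0<..} rr"
proof -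
  have "smooth_on {0<..} tt" unfolding tt_def[abs_def] by (rule smooth_on_powr)
  then have "smooth_on {0<..} (\<lambda>s. a - tt s)" by (intro smooth_on_diff) auto
  then have "smooth_on {0<..} (\<lambda>s. exp (a - tt s))"
    by (intro smooth_on_compose_real[OF _ open_UNIV _ smooth_on_exp]) auto
  then show ?thesis unfolding rr_def[abs_def] by (intro smooth_on_mult) auto
qed

lemma smooth_cc: "smooth_on {0<..} cc"
  unfolding cc_def[abs_def] by (intro smooth_on_mult smooth_rr smooth_on_powr) auto

lemma smooth_psi: "smooth_on {0<..} psi"
  unfolding psi_def[abs_def]
  by (intro smooth_on_mult smooth_on_powr smooth_on_compose_real[OF _ open_greaterThan _ smooth_on_powr smooth_rr])
     (auto simp: rr_pos)

lemma inner_self_smooth: "smooth_on (- {0}) (\<lambda>y::'a::euclidean_space. f (y \<bullet> y))" if "smooth_on {0<..} f"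
  by (rule smooth_on_compose_real[OF _ open_greaterThan _ that]) (auto intro: smooth_on_inner_self)

lemma smooth_transplant:
  fixes u :: "'a::euclidean_space \<Rightarrow> real"
  assumes "smooth u" shows "smooth_on (- {0}) (transplant u)"
proof -
  have "smooth_on (- {0}) (\<lambda>y::'a. u (cc (y \<bullet> y) *\<^sub>R y))"
  proof (rule smooth_on_compose[where T = UNIV and f = u and g = "\<lambda>y. cc (y \<bullet> y) *\<^sub>R y"])
    show "smooth_on (- {0}) (\<lambda>y::'a. (cc (y \<bullet> y) *\<^sub>R y) \<bullet> b)" for b
      unfolding inner_scaleR_left
      by (intro smooth_on_mult inner_self_smooth smooth_cc smooth_on_inner_const) auto
  qed (use assms in \<open>auto simp: smooth_on_UNIV\<close>)
  then show ?thesis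
    unfolding transplant_def[abs_def] by (intro smooth_on_mult inner_self_smooth smooth_psi) auto
qed

text \<open>Since \<open>psi\<close> is 1/phi, the terms of the product rule without a derivative of
  \<open>u\<close> combine with the gradient of \<open>u\<close> into the ground-state gradient.
  Apart from the common factor \<open>psi\<close>, tangential directions are scaled by
  \<open>cc\<close> and the radial direction by cc + 2 s c', with c' the derivative of
  \<open>cc\<close>.\<close>

lemma gradient_transplant:
  fixes u :: "'a::euclidean_space \<Rightarrow> real"
  assumes u: "smooth u" and y: "y \<noteq> 0"
  defines "s \<equiv> y \<bullet> y" defines "x \<equiv> cc s *\<^sub>R y"
  shows "gradient (transplant u) y = psi s *\<^sub>R (cc s *\<^sub>R ground_gradient u x
    + (2 * (cc s * (qq * tt s - 1 / 2) / s) * (ground_gradient u x \<bullet> y)) *\<^sub>R y)"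
proof (rule has_derivative_gradient_eqI)
  define c' where "c' = cc s * (qq * tt s - 1 / 2) / s"
  define p' where "p' = psi s * (qq * (al * tt s + be)) / s"
  have s: "s > 0" using y by (simp add: s_def)
  have sq: "((\<lambda>y. y \<bullet> y) has_derivative (\<lambda>h. 2 * (y \<bullet> h))) (at y)"
    by (auto intro!: derivative_eq_intros simp: inner_commute)
  have chain: "((\<lambda>y. f (y \<bullet> y)) has_derivative (\<lambda>h. f' * (2 * (y \<bullet> h)))) (at y)"
    if "(f has_real_derivative f') (at s)" for f f'
    using has_derivative_compose[OF sq, of f "\<lambda>v. f' * v"] that by (simp add: has_field_derivative_def s_def)
  have dc: "((\<lambda>y. cc (y \<bullet> y)) has_derivative (\<lambda>h. c' * (2 * (y \<bullet> h)))) (at y)"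
    unfolding c'_def by (rule chain[OF cc_psi_derivatives(1)[OF s]])
  have dp: "((\<lambda>y. psi (y \<bullet> y)) has_derivative (\<lambda>h. p' * (2 * (y \<bullet> h)))) (at y)"
    unfolding p'_def by (rule chain[OF cc_psi_derivatives(2)[OF s]])
  have dG: "((\<lambda>y. cc (y \<bullet> y) *\<^sub>R y) has_derivative (\<lambda>h. cc s *\<^sub>R h + (c' * (2 * (y \<bullet> h))) *\<^sub>R y)) (at y)"
    using has_derivative_scaleR[OF dc has_derivative_ident] by (simp add: s_def)
  have du: "((\<lambda>y. u (cc (y \<bullet> y) *\<^sub>R y)) has_derivative (\<lambda>h. (cc s *\<^sub>R h + (c' * (2 * (y \<bullet> h))) *\<^sub>R y) \<bullet> gradient u x)) (at y)"
    using has_derivative_compose[OF dG, of u] smooth_has_derivative_gradient[OF u, of x]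
    by (simp add: x_def s_def)
  have dz: "(transplant u has_derivative (\<lambda>h. u x * (p' * (2 * (y \<bullet> h))) + (cc s *\<^sub>R h + (c' * (2 * (y \<bullet> h))) *\<^sub>R y) \<bullet> gradient u x * psi s)) (at y)"
    using has_derivative_mult[OF du dp] unfolding transplant_def[abs_def] by (simp add: x_def s_def)
  have c0: "cc s > 0" using cc_pos s by simp
  have nx: "(norm x)\<^sup>2 = (cc s)\<^sup>2 * s" "norm x = rr s"
  proof -
    show "(norm x)\<^sup>2 = (cc s)\<^sup>2 * s" by (simp add: x_def s_def power_mult_distrib power2_norm_eq_inner)
    have "norm x = cc s * norm y" using c0 by (simp add: x_def)
    also have "norm y = sqrt s" by (simp add: s_def norm_eq_sqrt_inner)
    also have "cc s * sqrt s = rr s" using s by (simp add: cc_def powr_half_sqrt[symmetric] powr_add[symmetric])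
    finally show "norm x = rr s" .
  qed
  define E where "E = ground_gradient u x"
  define w where "w = (al + be / tt s) / ((cc s)\<^sup>2 * s) * u x"
  have gu: "gradient u x = E - w *\<^sub>R x"
    unfolding E_def ground_gradient_def w_def nx(1) unfolding nx(2) tt_rr_inverse(1)[OF s] by simp
  \<comment> \<open>The terms without a derivative of \<open>u\<close> cancel: the drift
    \<open>w\<close>, stretched radially, is matched by the derivative of
    \<open>psi\<close>.\<close>
  have key: "psi s * w * (cc s * (cc s + c' * (2 * s))) = u x * (p' * 2)"
  proof -
    \<comment> \<open>The stretching of the inverse radial map in the radial direction, that is
      dr/drho.\<close>
    have 1: "cc s + c' * (2 * s) = 2 * qq * tt s * cc s" using s by (simp add: c'_def field_simps)
    have "psi s * w * (cc s * (2 * qq * tt s * cc s)) = u x * (psi s * (2 * qq * (al * tt s + be)) / s)"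
      using s c0 tt_pos[OF s] by (simp add: w_def field_simps power2_eq_square)
    then show ?thesis by (simp add: 1 p'_def)
  qed
  have "u x * (p' * (2 * (y \<bullet> h))) + (cc s *\<^sub>R h + (c' * (2 * (y \<bullet> h))) *\<^sub>R y) \<bullet> gradient u x * psi s
    = h \<bullet> (psi s *\<^sub>R (cc s *\<^sub>R E + (2 * c' * (E \<bullet> y)) *\<^sub>R y))" for h
  proof -
    have eq: "(cc s *\<^sub>R h + (c' * (2 * (y \<bullet> h))) *\<^sub>R y) \<bullet> gradient u x
      = cc s * (h \<bullet> E) + c' * (2 * (y \<bullet> h)) * (E \<bullet> y) - w * (cc s * (cc s + c' * (2 * s))) * (y \<bullet> h)"
    proof -
      have "h \<bullet> x = cc s * (y \<bullet> h)" "y \<bullet> x = cc s * s"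
        by (simp_all add: x_def s_def inner_commute)
      then show ?thesis
        unfolding gu by (simp add: inner_diff_right inner_add_left inner_commute[of y E] algebra_simps)
    qed
    have "u x * (p' * (2 * (y \<bullet> h))) + (cc s *\<^sub>R h + (c' * (2 * (y \<bullet> h))) *\<^sub>R y) \<bullet> gradient u x * psi s
      = u x * (p' * 2) * (y \<bullet> h) + psi s * (cc s * (h \<bullet> E) + c' * (2 * (y \<bullet> h)) * (E \<bullet> y))
        - psi s * w * (cc s * (cc s + c' * (2 * s))) * (y \<bullet> h)"
      unfolding eq by (simp add: algebra_simps)
    also have "\<dots> = psi s * (cc s * (h \<bullet> E) + c' * (2 * (y \<bullet> h)) * (E \<bullet> y))"
      unfolding key by simp
    also have "\<dots> = h \<bullet> (psi s *\<^sub>R (cc s *\<^sub>R E + (2 * c' * (E \<bullet> y)) *\<^sub>R y))"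
      by (simp add: inner_add_right inner_commute[of h y] algebra_simps)
    finally show ?thesis .
  qed
  then show "(transplant u has_derivative (\<lambda>h. h \<bullet> (psi s *\<^sub>R (cc s *\<^sub>R ground_gradient u x
    + (2 * (cc s * (qq * tt s - 1 / 2) / s) * (ground_gradient u x \<bullet> y)) *\<^sub>R y)))) (at y)"
    using dz unfolding E_def c'_def by simp
qed

text \<open>The first identity says that radial energy is preserved up to the factor \<kappa>; the
  second turns the critical integrand into the weighted one. In the logarithms of \<open>r\<close>
  and \<open>tau r\<close> both are linear identities between exponents.\<close>

lemma jac_psi:
  assumes r: "0 < r" "r \<le> D"
  shows "\<kappa> * jac r * (psi ((rho r)\<^sup>2) * (2 * qq * tau r * (r / rho r)))\<^sup>2 = 1"
    and "jac r * psi ((rho r)\<^sup>2) powr (2 * n / (n - 2)) = \<kappa> * (1 / tau r) powr (2 * (n - 1) / (n - 2))"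
    and "jac r > 0"
proof -
  have t: "tau r > 0" and p: "rho r > 0" using tau_pos rho_pos r by auto
  show "jac r > 0" using t p r k0 by (simp add: jac_def)
  have ps: "psi ((rho r)\<^sup>2) = r powr al * tau r powr (- be)"
  proof -
    have "((rho r)\<^sup>2) powr (be * qq) = tt ((rho r)\<^sup>2) powr (- be)"
      unfolding tt_def powr_powr by (simp add: mult.commute)
    then show ?thesis by (simp add: psi_def inverse_relations[OF r])
  qed
  define L where "L = ln r"
  define M where "M = ln (tau r)"
  have re: "r = exp L" and te: "tau r = exp M" using r t by (simp_all add: L_def M_def)
  have pe: "rho r = exp (- \<kappa> * M)" using t by (simp add: rho_def powr_def M_def)
  have pse: "psi ((rho r)\<^sup>2) = exp (al * L - be * M)"
    unfolding ps using r t by (simp add: powr_def L_def M_def exp_add[symmetric])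
  have je: "jac r = \<kappa> * exp (n * (- \<kappa> * M - L) - M)"
  proof -
    have "(rho r / r) powr n = exp (n * (- \<kappa> * M - L))"
      using p r by (simp add: powr_def ln_div pe L_def)
    then show ?thesis by (simp add: jac_def te exp_diff)
  qed
  have ex: "exp L = r" "exp M = tau r" "exp (- \<kappa> * M) = rho r" "exp (\<kappa> * M) = 1 / rho r"
    using re te pe by (simp_all add: exp_minus inverse_eq_divide)
  have "psi ((rho r)\<^sup>2) * (2 * qq * tau r * (r / rho r)) = 1 / \<kappa> * exp ((al * L - be * M) + M + L + \<kappa> * M)"
    unfolding exp_add ex pse[symmetric] by (simp add: qq_def)
  then have "\<kappa> * jac r * (psi ((rho r)\<^sup>2) * (2 * qq * tau r * (r / rho r)))\<^sup>2
    = \<kappa> * (\<kappa> * exp (n * (- \<kappa> * M - L) - M)) * (1 / \<kappa> * exp ((al * L - be * M) + M + L + \<kappa> * M))\<^sup>2"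
    by (simp only: je)
  also have "\<dots> = exp (n * (- \<kappa> * M - L) - M) * exp (2 * ((al * L - be * M) + M + L + \<kappa> * M))"
  proof -
    have "\<kappa> * (\<kappa> * A) * (1 / \<kappa> * B)\<^sup>2 = A * B\<^sup>2" for A B :: real
      using k0 by (simp add: power2_eq_square)
    then show ?thesis by (simp only: exp_double)
  qed
  also have "\<dots> = exp (n * (- \<kappa> * M - L) - M + 2 * ((al * L - be * M) + M + L + \<kappa> * M))"
    by (rule exp_add[symmetric])
  \<comment> \<open>The coefficient of \<open>L\<close> vanishes because al = (n-2)/2, and that of
    \<open>M\<close> by the choice of \<open>be\<close>.\<close>
  also have "n * (- \<kappa> * M - L) - M + 2 * ((al * L - be * M) + M + L + \<kappa> * M) = 0"
  proof -
    have e: "al = n / 2 - 1" "be = 1 / 2 - \<kappa> * n / 2 + \<kappa>"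
      by (simp_all add: al_def be_def field_simps)
    show ?thesis unfolding e by (simp add: field_simps)
  qed
  finally show "\<kappa> * jac r * (psi ((rho r)\<^sup>2) * (2 * qq * tau r * (r / rho r)))\<^sup>2 = 1" by simp
  have n2: "n - 2 \<noteq> 0" using n3 by simp
  have "jac r * psi ((rho r)\<^sup>2) powr (2 * n / (n - 2)) = \<kappa> * exp ((n * (- \<kappa> * M - L) - M) + 2 * n / (n - 2) * (al * L - be * M))"
    by (simp add: je pse powr_def exp_add)
  \<comment> \<open>Here \<open>L\<close> drops out and \<kappa> disappears from the coefficient of
    \<open>M\<close>: the weight depends on tau alone, with the exponent of the theorem.\<close>
  also have "(n * (- \<kappa> * M - L) - M) + 2 * n / (n - 2) * (al * L - be * M) = - (2 * (n - 1) / (n - 2) * M)"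
  proof -
    have "2 * n / (n - 2) * al = n" using n2 by (simp add: al_def)
    moreover have "2 * n / (n - 2) * be = n / (n - 2) - n * \<kappa>" using n2 by (simp add: be_def field_simps)
    moreover have "2 * (n - 1) / (n - 2) = 1 + n / (n - 2)" using n2 by (simp add: field_simps)
    ultimately show ?thesis by (simp add: right_diff_distrib mult.assoc[symmetric]) (simp add: algebra_simps)
  qed
  also have "exp (- (2 * (n - 1) / (n - 2) * M)) = (1 / tau r) powr (2 * (n - 1) / (n - 2))"
    using t by (simp add: powr_def ln_div M_def)
  finally show "jac r * psi ((rho r)\<^sup>2) powr (2 * n / (n - 2)) = \<kappa> * (1 / tau r) powr (2 * (n - 1) / (n - 2))" .
qed

end

section \<open>Ground-state identity and transplantation on annuli\<close>

definition annulus :: "real \<Rightarrow> real \<Rightarrow> 'a::real_normed_vector set" where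
  "annulus r0 r1 = {x. r0 \<le> norm x \<and> norm x \<le> r1}"

lemma compact_annulus: "compact (annulus r0 r1 :: 'a::euclidean_space set)"
proof -
  have "annulus r0 r1 = cball 0 r1 - ball (0::'a) r0" by (auto simp: annulus_def)
  then show ?thesis by (simp add: compact_diff)
qed

lemma closed_annulus: "closed (annulus r0 r1 :: 'a::euclidean_space set)"
  by (rule compact_imp_closed[OF compact_annulus])

context hs_transform begin

lemma continuous_on_tau_norm: "0 < r0 \<Longrightarrow> continuous_on (annulus r0 r1 :: 'a::euclidean_space set) (\<lambda>x. tau (norm x))"
  unfolding tau_def using D0 by (intro continuous_intros) (auto simp: annulus_def)

lemma borel_measurable_tau [measurable]: "tau \<in> borel_measurable borel"
  unfolding tau_def[abs_def] by measurable

lemma borel_measurable_rho [measurable]: "rho \<in> borel_measurable borel"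
  unfolding rho_def[abs_def] by measurable

text \<open>The ground-state representation. The square of phi grad(u/phi) is |grad u|^2 plus a
  divergence minus the potential -(Laplacian of phi)/phi times u^2. The divergence integrates to 0,
  and the potential is al^2 + be (1 - be)/tau^2 over |x|^2.\<close>

lemma hardy_identity:
  fixes u :: "'a::euclidean_space \<Rightarrow> real"
  assumes n: "n = real DIM('a)" and u: "smooth u" and r: "0 < r0" "r0 \<le> r1" "r1 < D"
    and supp: "\<And>x. x \<notin> annulus r0 r1 \<Longrightarrow> u x = 0"
  shows "(LINT x|lborel. (norm (gradient u x))\<^sup>2) = (LINT x|lborel. (norm (ground_gradient u x))\<^sup>2)
    + (LINT x|lborel. (al\<^sup>2 + be * (1 - be) / (tau (norm x))\<^sup>2) * (u x)\<^sup>2 / (norm x)\<^sup>2)"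
    and "integrable lborel (\<lambda>x. (norm (ground_gradient u x))\<^sup>2)"
proof -
  let ?A = "annulus r0 r1 :: 'a set"
  define W where "W s = al + be / tau s" for s
  have g0: "gradient u x = 0" if "x \<notin> ?A" for x
    by (rule gradient_eq_0_outside[OF closed_annulus supp that])
  have taup: "tau (norm x) > 0" if "x \<in> ?A" for x
    using that r by (intro tau_pos) (auto simp: annulus_def)
  have np: "norm x > 0" if "x \<in> ?A" for x using that r by (auto simp: annulus_def)
  have cu: "continuous_on ?A u" using u smooth_on_continuous_on[of UNIV u] by (auto simp: smooth_on_UNIV intro: continuous_on_subset)
  have cg: "continuous_on ?A (gradient u)" using smooth_continuous_gradient[OF u] by (rule continuous_on_subset) simp
  have cn: "continuous_on ?A norm" by (intro continuous_intros)
  have ct: "continuous_on ?A (\<lambda>x. tau (norm x))" by (rule continuous_on_tau_norm[OF r(1)])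
  have cW: "continuous_on ?A (\<lambda>x. W (norm x))"
    unfolding W_def by (intro continuous_intros ct) (use taup in force)
  \<comment> \<open>The divergence of the vector field W(|x|) u(x)^2 x / |x|^2; the summand with be
    / tau^2 is r W'(r).\<close>
  define h where "h x = (2 * W (norm x) * u x * (gradient u x \<bullet> x) + (be / (tau (norm x))\<^sup>2 + (n - 2) * W (norm x)) * (u x)\<^sup>2) / (norm x)\<^sup>2" for x
  have h0: "h x = 0" if "x \<notin> ?A" for x using supp[OF that] by (simp add: h_def)
  have inth: "integrable lborel h"
  proof (rule integrable_continuous_compact_support[OF _ compact_annulus h0])
    show "continuous_on ?A h"
      unfolding h_def[abs_def] by (intro continuous_intros cu cg cW ct) (use taup np in force)+
  qed
  have E0: "ground_gradient u x = 0" if "x \<notin> ?A" for x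
    using supp[OF that] g0[OF that] by (simp add: ground_gradient_def)
  show intE: "integrable lborel (\<lambda>x. (norm (ground_gradient u x))\<^sup>2)"
  proof (rule integrable_continuous_compact_support[OF _ compact_annulus])
    show "continuous_on ?A (\<lambda>x. (norm (ground_gradient u x))\<^sup>2)"
      unfolding ground_gradient_def W_def[symmetric] by (intro continuous_intros cu cg cW) (use np in force)
    show "(norm (ground_gradient u x))\<^sup>2 = 0" if "x \<notin> ?A" for x using E0[OF that] by simp
  qed
  define V where "V x = (al\<^sup>2 + be * (1 - be) / (tau (norm x))\<^sup>2) * (u x)\<^sup>2 / (norm x)\<^sup>2" for x
  have intV: "integrable lborel V"
  proof (rule integrable_continuous_compact_support[OF _ compact_annulus])
    show "continuous_on ?A V" unfolding V_def[abs_def] by (intro continuous_intros cu ct) (use taup np in force)+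
    show "V x = 0" if "x \<notin> ?A" for x using supp[OF that] by (simp add: V_def)
  qed
  have pw: "(norm (gradient u x))\<^sup>2 = (norm (ground_gradient u x))\<^sup>2 - h x + V x" for x
  proof (cases "x \<in> ?A")
    case True
    define R where "R = (norm x)\<^sup>2"
    define w where "w = W (norm x)"
    define t where "t = be / tau (norm x)"
    have R: "R > 0" using np[OF True] by (simp add: R_def)
    have "(norm (ground_gradient u x))\<^sup>2 = (norm (gradient u x))\<^sup>2 + 2 * (w / R * u x) * (gradient u x \<bullet> x) + (w / R * u x)\<^sup>2 * R"
      unfolding ground_gradient_def W_def[symmetric] w_def[symmetric] R_def[symmetric]
    proof -
      have "(norm (g + q *\<^sub>R x))\<^sup>2 = (norm g)\<^sup>2 + 2 * q * (g \<bullet> x) + q\<^sup>2 * (norm x)\<^sup>2" for g :: 'a and q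
        by (simp add: power2_norm_eq_inner inner_add_left inner_add_right inner_commute power2_eq_square[of q] algebra_simps)
      then show "(norm (gradient u x + (w / R * u x) *\<^sub>R x))\<^sup>2 = (norm (gradient u x))\<^sup>2 + 2 * (w / R * u x) * (gradient u x \<bullet> x) + (w / R * u x)\<^sup>2 * R"
        unfolding R_def .
    qed
    also have "(w / R * u x)\<^sup>2 * R = w\<^sup>2 * (u x)\<^sup>2 / R" using R by (simp add: power2_eq_square)
    finally have 1: "(norm (ground_gradient u x))\<^sup>2 = (norm (gradient u x))\<^sup>2 + 2 * w * u x * (gradient u x \<bullet> x) / R + w\<^sup>2 * (u x)\<^sup>2 / R" by simp
    define bt where "bt = be / (tau (norm x))\<^sup>2"
    have 2: "h x = 2 * w * u x * (gradient u x \<bullet> x) / R + (bt + (n - 2) * w) * (u x)\<^sup>2 / R"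
      by (simp add: h_def R_def w_def bt_def add_divide_distrib)
    have "V x = (al\<^sup>2 + bt - t\<^sup>2) * (u x)\<^sup>2 / R"
      using taup[OF True] by (simp add: V_def R_def bt_def t_def power_divide power2_eq_square diff_divide_distrib right_diff_distrib)
    \<comment> \<open>Since n - 2 is 2 al and \<open>w\<close> is al + t, the mixed terms cancel and
      al^2 - t^2 remains.\<close>
    also have "al\<^sup>2 + bt - t\<^sup>2 = bt + (n - 2) * w - w\<^sup>2"
    proof -
      have w: "w = al + t" by (simp add: w_def W_def t_def)
      have n2: "n - 2 = 2 * al" by (simp add: al_def)
      show ?thesis unfolding w n2 by (simp add: power2_eq_square algebra_simps)
    qed
    finally have 3: "V x = (bt + (n - 2) * w) * (u x)\<^sup>2 / R - w\<^sup>2 * (u x)\<^sup>2 / R"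
      by (simp add: left_diff_distrib diff_divide_distrib)
    show ?thesis unfolding 1 2 3 by simp
  next
    case False
    then show ?thesis using g0 E0 h0 supp by (simp add: V_def)
  qed
  have "(LINT x|lborel. h x) = 0"
  proof (rule integral_polar_eq_0[OF inth])
    fix \<theta> :: 'a assume th: "norm \<theta> = 1"
    \<comment> \<open>The interval is enlarged slightly, still inside (0, D), so that the
      antiderivative vanishes at both ends directly by the support hypothesis.\<close>
    define b0 where "b0 = r0 / 2"
    define b1 where "b1 = (r1 + D) / 2"
    have b: "0 < b0" "b0 < r0" "r1 < b1" "b1 < D" "b0 \<le> b1" using r by (auto simp: b0_def b1_def)
    \<comment> \<open>The antiderivative of r^(n-1) h along the ray in direction \<theta>.\<close>
    define P where "P s = W s * s powr (n - 2) * (u (s *\<^sub>R \<theta>))\<^sup>2" for s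
    have z0: "u (s *\<^sub>R \<theta>) = 0" "h (s *\<^sub>R \<theta>) = 0" if "0 < s" "s < r0 \<or> r1 < s" for s
      using that th supp h0 by (auto simp: annulus_def)
    have dP: "(P has_real_derivative s ^ (DIM('a) - 1) * h (s *\<^sub>R \<theta>)) (at s)" if s: "s \<in> {b0..b1}" for s
    proof -
      have s0: "0 < s" "s \<le> D" using s b by auto
      have t0: "tau s > 0" by (rule tau_pos[OF s0])
      have dt: "(tau has_real_derivative - 1 / s) (at s)"
        unfolding tau_def[abs_def] using s0 D0 by (auto intro!: derivative_eq_intros)
      have dW: "(W has_real_derivative be / ((tau s)\<^sup>2 * s)) (at s)"
        unfolding W_def[abs_def] using dt t0 s0
        by (auto intro!: derivative_eq_intros simp: power2_eq_square)
      have dp: "((\<lambda>s. s powr (n - 2)) has_real_derivative (n - 2) * s powr (n - 2) / s) (at s)"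
      proof (rule DERIV_cong[OF has_real_derivative_powr[OF s0(1)]])
        have "s powr (n - 2 - 1) = s powr (n - 2) / s powr 1" by (rule powr_diff)
        also have "s powr 1 = s" using s0 by simp
        finally show "(n - 2) * s powr (n - 2 - 1) = (n - 2) * s powr (n - 2) / s"
          by (simp only: times_divide_eq_right)
      qed
      have "((\<lambda>s. s *\<^sub>R \<theta>) has_derivative (\<lambda>v. v *\<^sub>R \<theta>)) (at s)" by (auto intro!: derivative_eq_intros)
      from has_derivative_compose[OF this smooth_has_derivative_gradient[OF u]]
      have "((\<lambda>s. u (s *\<^sub>R \<theta>)) has_real_derivative \<theta> \<bullet> gradient u (s *\<^sub>R \<theta>)) (at s)"
        unfolding has_field_derivative_def by (rule has_derivative_eq_rhs) (auto simp: fun_eq_iff)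
      from DERIV_power[OF this, of 2]
      have du: "((\<lambda>s. (u (s *\<^sub>R \<theta>))\<^sup>2) has_real_derivative 2 * u (s *\<^sub>R \<theta>) * (\<theta> \<bullet> gradient u (s *\<^sub>R \<theta>))) (at s)"
        by (rule DERIV_cong) simp
      have "s ^ (DIM('a) - 1) = s powr (n - 2) * s"
      proof -
        have "s ^ (DIM('a) - 1) = s powr (real (DIM('a) - 1))" by (rule powr_realpow[OF s0(1), symmetric])
        also have "real (DIM('a) - 1) = (n - 2) + 1" using n n3 by (simp add: of_nat_diff)
        also have "s powr ((n - 2) + 1) = s powr (n - 2) * s powr 1" by (rule powr_add)
        also have "s powr 1 = s" using s0 by simp
        finally show ?thesis .
      qed
      then have "s ^ (DIM('a) - 1) * h (s *\<^sub>R \<theta>) = s powr (n - 2) * s * ((2 * W s * u (s *\<^sub>R \<theta>) * (s * (\<theta> \<bullet> gradient u (s *\<^sub>R \<theta>)))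
          + (be / (tau s)\<^sup>2 + (n - 2) * W s) * (u (s *\<^sub>R \<theta>))\<^sup>2) / s\<^sup>2)"
        using th s0 by (simp add: h_def inner_commute)
      also have "\<dots> = (be / ((tau s)\<^sup>2 * s) * s powr (n - 2) + (n - 2) * s powr (n - 2) / s * W s) * (u (s *\<^sub>R \<theta>))\<^sup>2
          + 2 * u (s *\<^sub>R \<theta>) * (\<theta> \<bullet> gradient u (s *\<^sub>R \<theta>)) * (W s * s powr (n - 2))"
      proof -
        have "Q * s * ((2 * w * U * (s * G) + (B + m * w) * U2) / s\<^sup>2) = (B / s * Q + m * Q / s * w) * U2 + 2 * U * G * (w * Q)"
          for Q w U G B m U2 :: real
          using s0 by (simp add: power2_eq_square field_simps)
        note aux = this[of "s powr (n - 2)" "W s" "u (s *\<^sub>R \<theta>)" "\<theta> \<bullet> gradient u (s *\<^sub>R \<theta>)" "be / (tau s)\<^sup>2" "n - 2" "(u (s *\<^sub>R \<theta>))\<^sup>2"]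
        show ?thesis unfolding aux by (simp only: divide_divide_eq_left)
      qed
      finally have e: "s ^ (DIM('a) - 1) * h (s *\<^sub>R \<theta>) = \<dots>" .
      show ?thesis
        unfolding P_def[abs_def] e by (rule DERIV_mult[OF DERIV_mult[OF dW dp] du])
    qed
    have "continuous_on {b0..b1} (\<lambda>s. s ^ (DIM('a) - 1) * h (s *\<^sub>R \<theta>))"
    proof -
      have c1: "continuous_on (annulus b0 b1) h"
      proof -
        have tb: "tau (norm x) > 0" "norm x > 0" if "x \<in> annulus b0 b1" for x :: 'a
          using that b by (auto simp: annulus_def intro!: tau_pos)
        have "continuous_on (annulus b0 b1) u" using u smooth_on_continuous_on[of UNIV u] by (auto simp: smooth_on_UNIV intro: continuous_on_subset)
        moreover have "continuous_on (annulus b0 b1) (gradient u)" using smooth_continuous_gradient[OF u] by (rule continuous_on_subset) simp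
        moreover note ct' = continuous_on_tau_norm[OF b(1), of b1]
        moreover have "continuous_on (annulus b0 b1) (\<lambda>x::'a. W (norm x))"
          unfolding W_def by (intro continuous_intros ct') (use tb in force)
        ultimately show ?thesis
          unfolding h_def[abs_def] by (intro continuous_intros) (use tb in force)+
      qed
      have c2: "(\<lambda>s. s *\<^sub>R \<theta>) ` {b0..b1} \<subseteq> annulus b0 b1" using b th by (auto simp: annulus_def)
      have "continuous_on {b0..b1} (\<lambda>s. h (s *\<^sub>R \<theta>))"
        by (rule continuous_on_compose2[OF c1 _ c2]) (intro continuous_intros)
      then show ?thesis by (intro continuous_intros)
    qed
    then have "(LINT s|lborel. indicator {b0..b1} s *\<^sub>R (s ^ (DIM('a) - 1) * h (s *\<^sub>R \<theta>))) = P b1 - P b0"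
      using b(5) dP
      by (intro integral_FTC_Icc)
         (auto simp: has_real_derivative_iff_has_vector_derivative[symmetric] intro: has_field_derivative_at_within)
    moreover have "P b1 = 0" "P b0 = 0" using z0[of b1] z0[of b0] b r by (auto simp: P_def)
    ultimately have I0: "(LINT s|lborel. indicator {b0..b1} s *\<^sub>R (s ^ (DIM('a) - 1) * h (s *\<^sub>R \<theta>))) = 0"
      by linarith
    have "(\<lambda>s. indicator {b0..b1} s *\<^sub>R (s ^ (DIM('a) - 1) * h (s *\<^sub>R \<theta>)))
        = (\<lambda>s. indicator {0<..} s * s ^ (DIM('a) - 1) * h (s *\<^sub>R \<theta>))"
    proof
      fix s show "indicator {b0..b1} s *\<^sub>R (s ^ (DIM('a) - 1) * h (s *\<^sub>R \<theta>)) = indicator {0<..} s * s ^ (DIM('a) - 1) * h (s *\<^sub>R \<theta>)"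
      proof (cases "s \<in> {b0..b1}")
        case True
        then show ?thesis using b by simp
      next
        case False
        then have "s > 0 \<Longrightarrow> h (s *\<^sub>R \<theta>) = 0" using b by (intro z0(2)) auto
        then show ?thesis using False by (cases "s > 0") auto
      qed
    qed
    with I0 show "(LINT s|lborel. indicator {0<..} s * s ^ (DIM('a) - 1) * h (s *\<^sub>R \<theta>)) = 0" by (simp only:)
  qed
  then show "(LINT x|lborel. (norm (gradient u x))\<^sup>2) = (LINT x|lborel. (norm (ground_gradient u x))\<^sup>2)
    + (LINT x|lborel. (al\<^sup>2 + be * (1 - be) / (tau (norm x))\<^sup>2) * (u x)\<^sup>2 / (norm x)\<^sup>2)"
    unfolding pw V_def[symmetric] using inth intE intV by simp
qed

lemma transplant_point:
  fixes x :: "'a::euclidean_space"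
  assumes r: "0 < norm x" "norm x \<le> D"
  defines "y \<equiv> (rho (norm x) / norm x) *\<^sub>R x"
  shows "y \<bullet> y = (rho (norm x))\<^sup>2" "cc (y \<bullet> y) *\<^sub>R y = x" "y \<noteq> 0"
proof -
  have p: "rho (norm x) > 0" using rho_pos r by auto
  show 1: "y \<bullet> y = (rho (norm x))\<^sup>2"
    using r by (simp add: y_def power2_norm_eq_inner[symmetric] power2_eq_square)
  show "cc (y \<bullet> y) *\<^sub>R y = x"
    unfolding 1 inverse_relations(3)[OF r] using p r by (simp add: y_def)
  show "y \<noteq> 0" using p r by (simp add: y_def)
qed

text \<open>The radial stretching exceeds the tangential one because tau is at least a, hence at
  least \<kappa>. By \<open>jac_psi\<close> the radial factor carries the energy exactly, so
  equality holds where the ground-state gradient is radial.\<close>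

lemma gradient_transplant_norm:
  fixes u :: "'a::euclidean_space \<Rightarrow> real"
  assumes u: "smooth u" and r: "0 < norm x" "norm x \<le> D"
  defines "y \<equiv> (rho (norm x) / norm x) *\<^sub>R x"
  shows "\<kappa> * (jac (norm x) * (norm (gradient (transplant u) y))\<^sup>2) \<le> (norm (ground_gradient u x))\<^sup>2"
    and "ground_gradient u x = e *\<^sub>R x \<Longrightarrow>
      \<kappa> * (jac (norm x) * (norm (gradient (transplant u) y))\<^sup>2) = (norm (ground_gradient u x))\<^sup>2"
proof -
  note tp = transplant_point[OF r, folded y_def]
  let ?r = "norm x"
  define s where "s = y \<bullet> y"
  define E where "E = ground_gradient u x"
  have s: "s = (rho ?r)\<^sup>2" "s > 0" using tp(1) rho_pos[OF r] by (simp_all add: s_def)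
  have c: "cc s > 0" using cc_pos s by simp
  have ps: "psi s > 0" using psi_pos s by simp
  have ts: "tt s = tau ?r" unfolding s(1) by (rule inverse_relations[OF r])
  have cs: "cc s = ?r / rho ?r" unfolding s(1) by (rule inverse_relations[OF r])
  define c' where "c' = cc s * (qq * tt s - 1 / 2) / s"
  have "tau ?r \<ge> \<kappa>" using tau_ge[OF r] ka by linarith
  then have "qq * tt s \<ge> 1 / 2" using k0 by (simp add: ts qq_def)
  then have c'0: "c' \<ge> 0" using c s by (simp add: c'_def)
  have L: "cc s + 2 * c' * s = 2 * qq * tt s * cc s" using s by (simp add: c'_def field_simps)
  have g: "gradient (transplant u) y = psi s *\<^sub>R (cc s *\<^sub>R E + (2 * c' * (E \<bullet> y)) *\<^sub>R y)"
    using gradient_transplant[OF u tp(3)] unfolding s_def[symmetric] c'_def E_def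
    unfolding s_def tp(2) by simp
  have j: "jac ?r > 0" by (rule jac_psi(3)[OF r])
  have one: "\<kappa> * jac ?r * (psi s * (2 * qq * tt s * cc s))\<^sup>2 = 1"
    using jac_psi(1)[OF r] by (simp only: s(1)[symmetric] ts cs)
  have "norm (cc s *\<^sub>R E + (2 * c' * (E \<bullet> y)) *\<^sub>R y) \<le> cc s * norm E + 2 * c' * \<bar>E \<bullet> y\<bar> * norm y"
    using norm_triangle_ineq[of "cc s *\<^sub>R E" "(2 * c' * (E \<bullet> y)) *\<^sub>R y"] c c'0 by (simp add: abs_mult)
  also have "2 * c' * \<bar>E \<bullet> y\<bar> * norm y \<le> 2 * c' * (norm E * norm y) * norm y"
    using c'0 Cauchy_Schwarz_ineq2[of E y] by (intro mult_right_mono mult_left_mono) auto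
  also have "2 * c' * (norm E * norm y) * norm y = 2 * c' * s * norm E"
    by (simp add: s_def power2_norm_eq_inner[symmetric] power2_eq_square)
  finally have "norm (cc s *\<^sub>R E + (2 * c' * (E \<bullet> y)) *\<^sub>R y) \<le> (2 * qq * tt s * cc s) * norm E"
    unfolding L[symmetric] by (simp add: algebra_simps)
  then have "norm (gradient (transplant u) y) \<le> psi s * ((2 * qq * tt s * cc s) * norm E)"
    using ps by (simp add: g)
  then have "(norm (gradient (transplant u) y))\<^sup>2 \<le> (psi s * (2 * qq * tt s * cc s) * norm E)\<^sup>2"
    by (intro power_mono) (simp_all add: mult.assoc)
  then have "\<kappa> * jac ?r * (norm (gradient (transplant u) y))\<^sup>2 \<le> \<kappa> * jac ?r * (psi s * (2 * qq * tt s * cc s) * norm E)\<^sup>2"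
    using k0 j by (intro mult_left_mono) auto
  also have "\<dots> = \<kappa> * jac ?r * (psi s * (2 * qq * tt s * cc s))\<^sup>2 * (norm E)\<^sup>2"
    unfolding power_mult_distrib[of "psi s * (2 * qq * tt s * cc s)" "norm E"] by (simp only: mult.assoc)
  finally show "\<kappa> * (jac ?r * (norm (gradient (transplant u) y))\<^sup>2) \<le> (norm (ground_gradient u x))\<^sup>2"
    unfolding one by (simp add: E_def mult.assoc)
  assume e: "ground_gradient u x = e *\<^sub>R x"
  have Ey: "E = (e * cc s) *\<^sub>R y" using e tp(2) by (metis E_def s_def scaleR_scaleR)
  have Eyy: "E \<bullet> y = e * cc s * s" unfolding Ey by (simp add: s_def)
  have "cc s *\<^sub>R E + (2 * c' * (E \<bullet> y)) *\<^sub>R y = (cc s + 2 * c' * s) *\<^sub>R E"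
    unfolding Eyy unfolding Ey by (simp add: algebra_simps)
  then have "gradient (transplant u) y = (psi s * (2 * qq * tt s * cc s)) *\<^sub>R E"
    unfolding g by (simp only: L scaleR_scaleR)
  then have "(norm (gradient (transplant u) y))\<^sup>2 = (psi s * (2 * qq * tt s * cc s))\<^sup>2 * (norm E)\<^sup>2"
    by (simp only: norm_scaleR power_mult_distrib[of "\<bar>_\<bar>"] power2_abs)
  then have "\<kappa> * (jac ?r * (norm (gradient (transplant u) y))\<^sup>2) = \<kappa> * jac ?r * (psi s * (2 * qq * tt s * cc s))\<^sup>2 * (norm E)\<^sup>2"
    by (simp only: mult.assoc)
  then show "\<kappa> * (jac ?r * (norm (gradient (transplant u) y))\<^sup>2) = (norm (ground_gradient u x))\<^sup>2"
    unfolding one by (simp add: E_def)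
qed

text \<open>\<open>rho\<close> is monotone, so points outside the new annulus come from points
  outside the old one.\<close>

lemma transplant_support:
  fixes u :: "'a::euclidean_space \<Rightarrow> real"
  assumes r: "0 < r0" "r0 \<le> r1" "r1 \<le> D" and supp: "\<And>x. x \<notin> annulus r0 r1 \<Longrightarrow> u x = 0"
    and y: "y \<notin> annulus (rho r0) (rho r1)"
  shows "transplant u y = 0"
proof (rule ccontr)
  assume "transplant u y \<noteq> 0"
  then have u: "cc (y \<bullet> y) *\<^sub>R y \<in> annulus r0 r1" using supp by (auto simp: transplant_def)
  have y0: "y \<noteq> 0" using u r by (auto simp: annulus_def)
  then have s: "y \<bullet> y > 0" by simp
  have "norm (cc (y \<bullet> y) *\<^sub>R y) = cc (y \<bullet> y) * norm y"
    using cc_pos[OF s] by simp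
  also have "norm y = sqrt (y \<bullet> y)" by (rule norm_eq_sqrt_inner)
  also have "cc (y \<bullet> y) * sqrt (y \<bullet> y) = rr (y \<bullet> y)" using s by (simp add: cc_def powr_half_sqrt[symmetric] powr_add[symmetric])
  finally have b: "r0 \<le> rr (y \<bullet> y)" "rr (y \<bullet> y) \<le> r1" using u by (auto simp: annulus_def)
  then have "rho (rr (y \<bullet> y)) = norm y" using tt_rr_inverse(2)[OF s] r by (simp add: norm_eq_sqrt_inner)
  moreover have "rho r0 \<le> rho (rr (y \<bullet> y))" "rho (rr (y \<bullet> y)) \<le> rho r1"
    using b r by (auto intro!: rho_mono)
  ultimately show False using y by (simp add: annulus_def)
qed

text \<open>Integrals over \<open>y\<close> are pulled back by the radial map with Jacobian
  \<open>jac\<close>, after which the pointwise relations of \<open>jac_psi\<close> and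
  \<open>gradient_transplant_norm\<close> apply. The equality case serves the construction of almost
  extremal functions.\<close>

lemma transplant_integrals:
  fixes u :: "'a::euclidean_space \<Rightarrow> real"
  assumes n: "n = real DIM('a)" and u: "smooth u" and r: "0 < r0" "r0 \<le> r1" "r1 < D"
    and supp: "\<And>x. x \<notin> annulus r0 r1 \<Longrightarrow> u x = 0"
  shows "smooth (transplant u)"
    and "(LINT y|lborel. \<bar>transplant u y\<bar> powr (2 * n / (n - 2)))
      = \<kappa> * (LINT x|lborel. (1 / tau (norm x)) powr (2 * (n - 1) / (n - 2)) * \<bar>u x\<bar> powr (2 * n / (n - 2)))"
    and "\<kappa> * (LINT y|lborel. (norm (gradient (transplant u) y))\<^sup>2) \<le> (LINT x|lborel. (norm (ground_gradient u x))\<^sup>2)"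
    and "(\<And>x. x \<in> annulus r0 r1 \<Longrightarrow> \<exists>e. ground_gradient u x = e *\<^sub>R x) \<Longrightarrow>
      \<kappa> * (LINT y|lborel. (norm (gradient (transplant u) y))\<^sup>2) = (LINT x|lborel. (norm (ground_gradient u x))\<^sup>2)"
proof -
  let ?A = "annulus r0 r1 :: 'a set"
  let ?z = "transplant u"
  define p' where "p' s = \<kappa> * rho s / (tau s * s)" for s
  have rho0: "rho r0 > 0" using r by (intro rho_pos) auto
  have z0: "?z y = 0" if "y \<notin> annulus (rho r0) (rho r1)" for y
    by (rule transplant_support[OF r(1,2) _ supp that]) (use r in auto)
  \<comment> \<open>The formula for the transplant is smooth off the origin, and the transplant
    vanishes near it because \<open>rho r0\<close> is positive.\<close>
  show zs: "smooth ?z"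
    by (rule smooth_on_extend[OF _ smooth_transplant[OF u] closed_annulus _ z0]) (use rho0 in \<open>auto simp: annulus_def\<close>)
  have gz0: "gradient ?z y = 0" if "y \<notin> annulus (rho r0) (rho r1)" for y
    by (rule gradient_eq_0_outside[OF closed_annulus z0 that])
  have [measurable]: "?z \<in> borel_measurable borel" "gradient ?z \<in> borel_measurable borel"
    using zs smooth_continuous_gradient[OF zs] smooth_on_continuous_on[of UNIV ?z]
    by (auto intro!: borel_measurable_continuous_onI simp: smooth_on_UNIV)
  have rD: "0 < s" "s \<le> D" if "s \<in> {r0..r1}" for s using that r by auto
  have change: "(LINT y|lborel. h y) = (LINT x|lborel. indicator ?A x * (jac (norm x) * h ((rho (norm x) / norm x) *\<^sub>R x)))"
    if [measurable]: "h \<in> borel_measurable borel" and "\<And>y. h y \<ge> 0" "\<And>y. y \<notin> annulus (rho r0) (rho r1) \<Longrightarrow> h y = 0" for h :: "'a \<Rightarrow> real"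
  proof -
    note hz = that(3)
    have "(LINT y|lborel. h y) = (LINT x|lborel. indicator {r0..r1} (norm x) *
      ((rho (norm x) / norm x) ^ (DIM('a) - 1) * p' (norm x)) * h ((rho (norm x) / norm x) *\<^sub>R x))"
    proof (rule integral_radial_change[OF that(1,2) r(1,2)])
      show "(rho has_real_derivative p' s) (at s)" if "s \<in> {r0..r1}" for s
        unfolding p'_def by (rule rho_has_derivative[OF rD[OF that]])
      have "continuous_on {r0..r1} rho"
        using DERIV_isCont[OF rho_has_derivative] rD by (intro continuous_at_imp_continuous_on) auto
      moreover have "continuous_on {r0..r1} tau"
        unfolding tau_def[abs_def] using r D0 by (intro continuous_intros) auto
      ultimately show "continuous_on {r0..r1} p'"
        unfolding p'_def[abs_def] using tau_pos[OF rD] rD(1) by (intro continuous_intros) force+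
      show "0 \<le> p' s" if "s \<in> {r0..r1}" for s
        using rD[OF that] tau_pos[OF rD[OF that]] rho_pos[OF rD[OF that]] k0 by (simp add: p'_def)
      show "p' \<in> borel_measurable borel" unfolding p'_def[abs_def] by measurable
      show "h y = 0" if "norm y \<notin> {rho r0..rho r1}" for y
        by (rule hz) (use that in \<open>auto simp: annulus_def\<close>)
    qed (use rho0 in auto)
    also have "\<dots> = (LINT x|lborel. indicator ?A x * (jac (norm x) * h ((rho (norm x) / norm x) *\<^sub>R x)))"
    proof (intro Bochner_Integration.integral_cong refl)
      fix x :: 'a
      show "indicator {r0..r1} (norm x) * ((rho (norm x) / norm x) ^ (DIM('a) - 1) * p' (norm x)) * h ((rho (norm x) / norm x) *\<^sub>R x)
        = indicator ?A x * (jac (norm x) * h ((rho (norm x) / norm x) *\<^sub>R x))"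
      proof (cases "x \<in> ?A")
        case True
        then have nx: "norm x \<in> {r0..r1}" by (simp add: annulus_def)
        have q: "rho (norm x) / norm x > 0" using rD[OF nx] rho_pos[OF rD[OF nx]] by simp
        have "(rho (norm x) / norm x) powr n = (rho (norm x) / norm x) ^ (DIM('a) - 1) * (rho (norm x) / norm x)"
          unfolding n using powr_realpow[OF q, of "DIM('a)"] power_minus_mult[OF DIM_positive[where 'a = 'a], of "rho (norm x) / norm x"]
          by (simp only:)
        then have "(rho (norm x) / norm x) ^ (DIM('a) - 1) * p' (norm x) = jac (norm x)"
          by (simp add: jac_def p'_def mult_ac)
        then show ?thesis using True nx by simp
      qed (simp add: annulus_def indicator_def)
    qed
    finally show ?thesis .
  qed
  show "(LINT y|lborel. \<bar>?z y\<bar> powr (2 * n / (n - 2)))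
      = \<kappa> * (LINT x|lborel. (1 / tau (norm x)) powr (2 * (n - 1) / (n - 2)) * \<bar>u x\<bar> powr (2 * n / (n - 2)))"
  proof -
    have "(LINT y|lborel. \<bar>?z y\<bar> powr (2 * n / (n - 2)))
      = (LINT x|lborel. indicator ?A x * (jac (norm x) * \<bar>?z ((rho (norm x) / norm x) *\<^sub>R x)\<bar> powr (2 * n / (n - 2))))"
      by (rule change) (use z0 in auto)
    also have "\<dots> = (LINT x|lborel. \<kappa> * ((1 / tau (norm x)) powr (2 * (n - 1) / (n - 2)) * \<bar>u x\<bar> powr (2 * n / (n - 2))))"
    proof (intro Bochner_Integration.integral_cong refl)
      fix x :: 'a
      show "indicator ?A x * (jac (norm x) * \<bar>?z ((rho (norm x) / norm x) *\<^sub>R x)\<bar> powr (2 * n / (n - 2)))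
        = \<kappa> * ((1 / tau (norm x)) powr (2 * (n - 1) / (n - 2)) * \<bar>u x\<bar> powr (2 * n / (n - 2)))"
      proof (cases "x \<in> ?A")
        case True
        then have nx: "0 < norm x" "norm x \<le> D" using r by (auto simp: annulus_def)
        note tp = transplant_point[OF nx]
        have "?z ((rho (norm x) / norm x) *\<^sub>R x) = u x * psi ((rho (norm x))\<^sup>2)"
          unfolding transplant_def tp(2) unfolding tp(1) ..
        then have "\<bar>?z ((rho (norm x) / norm x) *\<^sub>R x)\<bar> powr (2 * n / (n - 2))
            = \<bar>u x\<bar> powr (2 * n / (n - 2)) * psi ((rho (norm x))\<^sup>2) powr (2 * n / (n - 2))"
          using psi_pos[of "(rho (norm x))\<^sup>2"] rho_pos[OF nx] by (simp add: abs_mult powr_mult)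
        then show ?thesis using True jac_psi(2)[OF nx] by (simp add: mult_ac)
      next
        case False
        then show ?thesis using supp by simp
      qed
    qed
    finally show ?thesis by simp
  qed
  have ch: "(LINT y|lborel. (norm (gradient ?z y))\<^sup>2)
      = (LINT x|lborel. indicator ?A x * (jac (norm x) * (norm (gradient ?z ((rho (norm x) / norm x) *\<^sub>R x)))\<^sup>2))"
    by (rule change) (use gz0 in auto)
  have E0: "ground_gradient u x = 0" if "x \<notin> ?A" for x
    using supp[OF that] gradient_eq_0_outside[OF closed_annulus supp that] by (simp add: ground_gradient_def)
  have nA: "0 < norm x" "norm x \<le> D" if "x \<in> ?A" for x using that r by (auto simp: annulus_def)
  have "\<kappa> * (LINT y|lborel. (norm (gradient ?z y))\<^sup>2)
    = (LINT x|lborel. \<kappa> * (indicator ?A x * (jac (norm x) * (norm (gradient ?z ((rho (norm x) / norm x) *\<^sub>R x)))\<^sup>2)))"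
    unfolding ch by simp
  also have "\<dots> \<le> (LINT x|lborel. (norm (ground_gradient u x))\<^sup>2)"
  proof (rule integral_mono')
    show "integrable lborel (\<lambda>x. (norm (ground_gradient u x))\<^sup>2)" by (rule hardy_identity(2)[OF n u r supp])
    fix x
    show "\<kappa> * (indicator ?A x * (jac (norm x) * (norm (gradient ?z ((rho (norm x) / norm x) *\<^sub>R x)))\<^sup>2)) \<le> (norm (ground_gradient u x))\<^sup>2"
      using gradient_transplant_norm(1)[OF u nA, of x] by (cases "x \<in> ?A") auto
  qed auto
  finally show "\<kappa> * (LINT y|lborel. (norm (gradient ?z y))\<^sup>2) \<le> (LINT x|lborel. (norm (ground_gradient u x))\<^sup>2)" .
  assume par: "\<And>x. x \<in> annulus r0 r1 \<Longrightarrow> \<exists>e. ground_gradient u x = e *\<^sub>R x"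
  have "\<kappa> * (LINT y|lborel. (norm (gradient ?z y))\<^sup>2)
    = (LINT x|lborel. \<kappa> * (indicator ?A x * (jac (norm x) * (norm (gradient ?z ((rho (norm x) / norm x) *\<^sub>R x)))\<^sup>2)))"
    unfolding ch by simp
  also have "\<dots> = (LINT x|lborel. (norm (ground_gradient u x))\<^sup>2)"
  proof (intro Bochner_Integration.integral_cong refl)
    fix x
    show "\<kappa> * (indicator ?A x * (jac (norm x) * (norm (gradient ?z ((rho (norm x) / norm x) *\<^sub>R x)))\<^sup>2)) = (norm (ground_gradient u x))\<^sup>2"
    proof (cases "x \<in> ?A")
      case True
      then obtain e where "ground_gradient u x = e *\<^sub>R x" using par by auto
      from gradient_transplant_norm(2)[OF u nA[OF True] this] show ?thesis using True by simp
    next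
      case False
      then show ?thesis using E0 by simp
    qed
  qed
  finally show "\<kappa> * (LINT y|lborel. (norm (gradient ?z y))\<^sup>2) = (LINT x|lborel. (norm (ground_gradient u x))\<^sup>2)" .
qed

lemma hardy_sobolev_annulus:
  fixes u :: "'a::euclidean_space \<Rightarrow> real"
  assumes n: "n = real DIM('a)" and u: "smooth u" and r: "0 < r0" "r0 \<le> r1" "r1 < D"
    and supp: "\<And>x. x \<notin> annulus r0 r1 \<Longrightarrow> u x = 0"
  shows "((n - 2) / 2)\<^sup>2 * (LINT x|lborel. (u x)\<^sup>2 / (norm x)\<^sup>2)
    + \<kappa> powr (2 * (n - 1) / n) * sobolev_const DIM('a) *
      (LINT x|lborel. (1 / tau (norm x)) powr (2 * (n - 1) / (n - 2)) * \<bar>u x\<bar> powr (2 * n / (n - 2))) powr ((n - 2) / n)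
    \<le> (LINT x|lborel. (norm (gradient u x))\<^sup>2)"
proof -
  let ?A = "annulus r0 r1 :: 'a set"
  let ?z = "transplant u"
  define P where "P = (LINT x|lborel. (1 / tau (norm x)) powr (2 * (n - 1) / (n - 2)) * \<bar>u x\<bar> powr (2 * n / (n - 2)))"
  have P0: "P \<ge> 0" unfolding P_def by (intro integral_nonneg_AE) auto
  note ti = transplant_integrals[OF n u r supp]
  have dim: "DIM('a) \<ge> 3" using n n3 by simp
  have z0: "?z y = 0" if "y \<notin> annulus (rho r0) (rho r1)" for y
    by (rule transplant_support[OF r(1,2) _ supp that]) (use r in auto)
  have "sobolev_const DIM('a) * (LINT x|lborel. \<bar>?z x\<bar> powr (2 * n / (n - 2))) powr ((n - 2) / n)
    \<le> (LINT x|lborel. (norm (gradient ?z x))\<^sup>2)"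
    using sobolev_inequality[OF dim ti(1) compact_annulus z0] unfolding n[symmetric] .
  then have "sobolev_const DIM('a) * (\<kappa> * P) powr ((n - 2) / n) \<le> (LINT x|lborel. (norm (gradient ?z x))\<^sup>2)"
  proof -
    have "(LINT x|lborel. \<bar>?z x\<bar> powr (2 * n / (n - 2))) = \<kappa> * P" using ti(2) unfolding P_def .
    then show "sobolev_const DIM('a) * (LINT x|lborel. \<bar>?z x\<bar> powr (2 * n / (n - 2))) powr ((n - 2) / n)
      \<le> (LINT x|lborel. (norm (gradient ?z x))\<^sup>2) \<Longrightarrow>
      sobolev_const DIM('a) * (\<kappa> * P) powr ((n - 2) / n) \<le> (LINT x|lborel. (norm (gradient ?z x))\<^sup>2)" by (simp only:)
  qed
  then have "\<kappa> * (sobolev_const DIM('a) * (\<kappa> * P) powr ((n - 2) / n)) \<le> \<kappa> * (LINT x|lborel. (norm (gradient ?z x))\<^sup>2)"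
    using k0 by (intro mult_left_mono) auto
  also have "\<dots> \<le> (LINT x|lborel. (norm (ground_gradient u x))\<^sup>2)" by (rule ti(3))
  also have "\<kappa> * (sobolev_const DIM('a) * (\<kappa> * P) powr ((n - 2) / n)) = \<kappa> powr (2 * (n - 1) / n) * sobolev_const DIM('a) * P powr ((n - 2) / n)"
  proof -
    \<comment> \<open>One factor \<kappa> comes from the energy, and \<kappa>^((n-2)/n) from the
      weighted norm.\<close>
    have "2 * (n - 1) / n = 1 + (n - 2) / n" using n3 by (simp add: field_simps)
    then have "\<kappa> powr (2 * (n - 1) / n) = \<kappa> * \<kappa> powr ((n - 2) / n)" using k0 by (simp only: powr_add) simp
    then show ?thesis using k0 P0 by (simp add: powr_mult)
  qed
  finally have 1: "\<kappa> powr (2 * (n - 1) / n) * sobolev_const DIM('a) * P powr ((n - 2) / n) \<le> (LINT x|lborel. (norm (ground_gradient u x))\<^sup>2)" .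
  have "((n - 2) / 2)\<^sup>2 * (LINT x|lborel. (u x)\<^sup>2 / (norm x)\<^sup>2) = (LINT x|lborel. al\<^sup>2 * ((u x)\<^sup>2 / (norm x)\<^sup>2))"
    unfolding al_def by (rule integral_mult_right_zero[symmetric])
  \<comment> \<open>phi is a supersolution: with \<open>be\<close> between 0 and 1 the additional
    potential is nonnegative, so omitting it gives a lower bound.\<close>
  also have "\<dots> \<le> (LINT x|lborel. (al\<^sup>2 + be * (1 - be) / (tau (norm x))\<^sup>2) * (u x)\<^sup>2 / (norm x)\<^sup>2)"
  proof (rule integral_mono')
    have cu: "continuous_on ?A u" using u smooth_on_continuous_on[of UNIV u] by (auto simp: smooth_on_UNIV intro: continuous_on_subset)
    have "tau (norm x) > 0" "norm x > 0" if "x \<in> ?A" for x using that r by (auto simp: annulus_def intro!: tau_pos)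
    then have "continuous_on ?A (\<lambda>x. (al\<^sup>2 + be * (1 - be) / (tau (norm x))\<^sup>2) * (u x)\<^sup>2 / (norm x)\<^sup>2)"
      by (intro continuous_intros cu continuous_on_tau_norm[OF r(1)]) force+
    then show "integrable lborel (\<lambda>x. (al\<^sup>2 + be * (1 - be) / (tau (norm x))\<^sup>2) * (u x)\<^sup>2 / (norm x)\<^sup>2)"
      by (rule integrable_continuous_compact_support[OF _ compact_annulus]) (use supp in auto)
    fix x :: 'a
    have "0 \<le> be * (1 - be) / (tau (norm x))\<^sup>2" using be_bounds by simp
    then show "al\<^sup>2 * ((u x)\<^sup>2 / (norm x)\<^sup>2) \<le> (al\<^sup>2 + be * (1 - be) / (tau (norm x))\<^sup>2) * (u x)\<^sup>2 / (norm x)\<^sup>2"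
      by (simp add: divide_right_mono mult_right_mono)
    then show "0 \<le> (al\<^sup>2 + be * (1 - be) / (tau (norm x))\<^sup>2) * (u x)\<^sup>2 / (norm x)\<^sup>2"
      by (rule order_trans[rotated]) simp
  qed
  finally show ?thesis
    using 1 hardy_identity(1)[OF n u r supp] unfolding P_def by linarith
qed

end

section \<open>Approximation and sharpness\<close>

lemma smooth_real_has_derivative:
  fixes f :: "real \<Rightarrow> real"
  assumes "smooth f"
  shows "(f has_real_derivative deriv f x) (at x)" and "continuous_on UNIV (deriv f)"
proof -
  have f: "smooth_on UNIV f" using assms by (simp add: smooth_on_UNIV)
  have d: "(f has_real_derivative frechet_derivative f (at x) 1) (at x)" for x
  proof -
    have D: "(f has_derivative frechet_derivative f (at x)) (at x)" by (rule smooth_on_has_derivative[OF f]) simp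
    then have "linear (frechet_derivative f (at x))" by (rule has_derivative_linear)
    then have "frechet_derivative f (at x) (v *\<^sub>R 1) = v *\<^sub>R frechet_derivative f (at x) 1" for v
      by (rule linear_cmul)
    then have "frechet_derivative f (at x) v = frechet_derivative f (at x) 1 * v" for v
      by (metis mult.commute mult.right_neutral real_scaleR_def)
    then show ?thesis
      unfolding has_field_derivative_def by (intro has_derivative_eq_rhs[OF D] ext)
  qed
  then have e: "deriv f x = frechet_derivative f (at x) 1" for x by (rule DERIV_imp_deriv)
  show "(f has_real_derivative deriv f x) (at x)" using d e by simp
  show "continuous_on UNIV (deriv f)"
    using smooth_on_continuous_on[OF smooth_on_frechet_derivative[OF f, of 1]] by (simp add: e[abs_def])
qed

lemma gradient_radial:
  fixes c :: "'a::euclidean_space"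
  assumes "smooth f"
  shows "gradient (\<lambda>x. f ((x - c) \<bullet> (x - c))) x = (2 * deriv f ((x - c) \<bullet> (x - c))) *\<^sub>R (x - c)"
proof (rule has_derivative_gradient_eqI)
  have "((\<lambda>x. (x - c) \<bullet> (x - c)) has_derivative (\<lambda>h. 2 * ((x - c) \<bullet> h))) (at x)"
    by (auto intro!: derivative_eq_intros simp: inner_commute)
  moreover have "(f has_derivative (\<lambda>v. deriv f ((x - c) \<bullet> (x - c)) * v)) (at ((x - c) \<bullet> (x - c)))"
    using smooth_real_has_derivative(1)[OF assms] unfolding has_field_derivative_def .
  ultimately have "((\<lambda>x. f ((x - c) \<bullet> (x - c))) has_derivative (\<lambda>h. deriv f ((x - c) \<bullet> (x - c)) * (2 * ((x - c) \<bullet> h)))) (at x)"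
    by (rule has_derivative_compose)
  then show "((\<lambda>x. f ((x - c) \<bullet> (x - c))) has_derivative (\<lambda>h. h \<bullet> ((2 * deriv f ((x - c) \<bullet> (x - c))) *\<^sub>R (x - c)))) (at x)"
    by (rule has_derivative_eq_rhs) (simp add: fun_eq_iff inner_commute)
qed

lemma smooth_radial:
  fixes c :: "'a::euclidean_space"
  assumes "smooth f" shows "smooth (\<lambda>x. f ((x - c) \<bullet> (x - c)))"
proof -
  have "smooth_on UNIV (\<lambda>x::'a. x \<bullet> x - 2 * (x \<bullet> c) + c \<bullet> c)"
    by (intro smooth_on_add smooth_on_diff smooth_on_mult smooth_on_inner_self smooth_on_inner_const) auto
  then have sq: "smooth_on UNIV (\<lambda>x::'a. (x - c) \<bullet> (x - c))"
    by (rule smooth_on_cong[OF open_UNIV, rotated]) (simp add: inner_diff_left inner_diff_right inner_commute)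
  show ?thesis
    unfolding smooth_on_UNIV[symmetric]
    by (rule smooth_on_compose_real[OF open_UNIV open_UNIV _ _ sq]) (use assms in \<open>simp_all add: smooth_on_UNIV\<close>)
qed

text \<open>To be evaluated at |x|^2. The inner cut reduces general test functions to the annulus
  case; the outer one makes the support of the Talenti function compact.\<close>

definition cutoff :: "real \<Rightarrow> real \<Rightarrow> real" where
  "cutoff k s = smooth_step (k * s) * (1 - smooth_step (s / k))"

lemma smooth_cutoff: "smooth (cutoff k)"
proof -
  have st: "smooth_on UNIV (\<lambda>s. smooth_step (c * s))" for c
    by (rule smooth_on_compose_real[OF open_UNIV open_UNIV _ smooth_on_smooth_step])
       (auto intro!: smooth_on_mult smooth_on_ident)
  have "smooth_on UNIV (\<lambda>s. smooth_step (k * s) * (1 - smooth_step ((1 / k) * s)))"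
    by (intro smooth_on_mult smooth_on_diff st) auto
  then show ?thesis by (simp add: smooth_on_UNIV cutoff_def[abs_def])
qed

lemma cutoff_bounds: "0 \<le> cutoff k s" "cutoff k s \<le> 1"
  using smooth_step_nonneg[of "k * s"] smooth_step_le_1[of "k * s"] smooth_step_nonneg[of "s / k"] smooth_step_le_1[of "s / k"]
  by (auto simp: cutoff_def intro: mult_le_one)

lemma cutoff_eq_0: "k > 0 \<Longrightarrow> s < 1 / k \<or> s > 2 * k \<Longrightarrow> cutoff k s = 0"
  by (auto simp: cutoff_def field_simps intro!: smooth_step_eq_0 smooth_step_eq_1)

lemma cutoff_eq_1: "k > 0 \<Longrightarrow> 2 / k \<le> s \<Longrightarrow> s \<le> k \<Longrightarrow> cutoff k s = 1"
  using smooth_step_eq_1[of "k * s"] smooth_step_eq_0[of "s / k"] by (auto simp: cutoff_def field_simps)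

text \<open>The operator s d/ds commutes with dilations, so the bound for
  \<open>smooth_step\<close>, whose derivative lives on [1, 2], is inherited by both factors
  independently of \<open>k\<close>.\<close>

lemma deriv_cutoff_bound:
  obtains B where "B \<ge> 0" "\<And>k s. k > 0 \<Longrightarrow> \<bar>s * deriv (cutoff k) s\<bar> \<le> B"
proof -
  have st: "smooth smooth_step" using smooth_on_smooth_step by (simp add: smooth_on_UNIV)
  note d = smooth_real_has_derivative[OF st]
  have "bounded ((\<lambda>t. t * deriv smooth_step t) ` {1..2})"
    by (intro compact_imp_bounded compact_continuous_image continuous_intros continuous_on_subset[OF d(2)]) auto
  then obtain b where b: "\<And>t. t \<in> {1..2} \<Longrightarrow> \<bar>t * deriv smooth_step t\<bar> \<le> b" by (force simp: bounded_iff)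
  have b': "\<bar>t * deriv smooth_step t\<bar> \<le> \<bar>b\<bar>" for t
  proof (cases "t \<in> {1..2}")
    case False
    have "(smooth_step has_real_derivative 0) (at t)"
    proof (cases "t < 1")
      case True
      show ?thesis
        by (rule has_field_derivative_transform_within_open[where f = "\<lambda>_. 0" and S = "{..<1}"])
           (use True in \<open>auto simp: smooth_step_eq_0\<close>)
    next
      case F: False
      show ?thesis
        by (rule has_field_derivative_transform_within_open[where f = "\<lambda>_. 1" and S = "{2<..}"])
           (use F False in \<open>auto simp: smooth_step_eq_1\<close>)
    qed
    then show ?thesis by (simp add: DERIV_imp_deriv)
  qed (use b in force)
  have "\<bar>s * deriv (cutoff k) s\<bar> \<le> 2 * \<bar>b\<bar>" if k: "k > 0" for k s
  proof -
    have ch: "((\<lambda>s. smooth_step (c * s)) has_real_derivative deriv smooth_step (c * s) * c) (at s)" for c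
      by (rule DERIV_chain2[OF d(1)]) (auto intro!: derivative_eq_intros)
    have "(cutoff k has_real_derivative (deriv smooth_step (k * s) * k) * (1 - smooth_step ((1 / k) * s))
        + (0 - deriv smooth_step ((1 / k) * s) * (1 / k)) * smooth_step (k * s)) (at s)"
      using DERIV_mult[OF ch[of k] DERIV_diff[OF DERIV_const ch[of "1 / k"]], of 1] by (simp add: cutoff_def[abs_def])
    then have "s * deriv (cutoff k) s = (k * s) * deriv smooth_step (k * s) * (1 - smooth_step (s / k))
        - (s / k) * deriv smooth_step (s / k) * smooth_step (k * s)"
      by (simp add: DERIV_imp_deriv algebra_simps)
    also have "\<bar>\<dots>\<bar> \<le> \<bar>(k * s) * deriv smooth_step (k * s) * (1 - smooth_step (s / k))\<bar> + \<bar>(s / k) * deriv smooth_step (s / k) * smooth_step (k * s)\<bar>"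
      by (rule abs_triangle_ineq4)
    also have "\<dots> \<le> \<bar>b\<bar> * 1 + \<bar>b\<bar> * 1"
      unfolding abs_mult[of _ "1 - smooth_step (s / k)"] abs_mult[of _ "smooth_step (k * s)"]
      using smooth_step_nonneg smooth_step_le_1 by (intro add_mono mult_mono b') auto
    finally show ?thesis by simp
  qed
  then show thesis using that[of "2 * \<bar>b\<bar>"] by auto
qed

text \<open>The uniform bound makes the gradient of the cutoff at most 2 B / |x|, so the Hardy
  integral of \<open>u\<close> dominates the error and dominated convergence applies. At every point
  other than 0 the sequences are eventually constant.\<close>

lemma cutoff_approximation:
  fixes u :: "'a::euclidean_space \<Rightarrow> real"
  assumes u: "smooth u" and int: "integrable lborel (\<lambda>x. (norm (gradient u x))\<^sup>2)"
    "integrable lborel (\<lambda>x. (u x)\<^sup>2 / (norm x)\<^sup>2)"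
  defines "v \<equiv> \<lambda>k x. u x * cutoff (real (Suc k)) (x \<bullet> x)"
  shows "smooth (v k)"
    and "(\<lambda>k. LINT x|lborel. (norm (gradient (v k) x))\<^sup>2) \<longlonglongrightarrow> (LINT x|lborel. (norm (gradient u x))\<^sup>2)"
    and "(\<lambda>k. LINT x|lborel. (v k x)\<^sup>2 / (norm x)\<^sup>2) \<longlonglongrightarrow> (LINT x|lborel. (u x)\<^sup>2 / (norm x)\<^sup>2)"
    and "\<And>w p. w \<in> borel_measurable borel \<Longrightarrow> p \<ge> 0 \<Longrightarrow> integrable lborel (\<lambda>x. w x * \<bar>u x\<bar> powr p) \<Longrightarrow>
      (\<lambda>k. LINT x|lborel. w x * \<bar>v k x\<bar> powr p) \<longlonglongrightarrow> (LINT x|lborel. w x * \<bar>u x\<bar> powr p)"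
proof -
  define e where "e k x = cutoff (real (Suc k)) (x \<bullet> x)" for k and x :: 'a
  have es: "smooth (e k)" for k
    using smooth_radial[OF smooth_cutoff, of "real (Suc k)" 0] by (simp add: e_def[abs_def])
  have vs: "smooth (v k)" for k
    using u es[of k] unfolding v_def e_def[symmetric] smooth_on_UNIV[symmetric] by (intro smooth_on_mult) auto
  then show "smooth (v k)" .
  have e01: "0 \<le> e k x" "e k x \<le> 1" for k x by (simp_all add: e_def cutoff_bounds)
  have ge: "gradient (e k) x = (2 * deriv (cutoff (real (Suc k))) (x \<bullet> x)) *\<^sub>R x" for k x
    using gradient_radial[OF smooth_cutoff, of "real (Suc k)" 0 x] by (simp add: e_def[abs_def])
  have vk: "v k = (\<lambda>x. u x * e k x)" for k by (simp only: v_def e_def)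
  have gv: "gradient (v k) x = e k x *\<^sub>R gradient u x + u x *\<^sub>R gradient (e k) x" for k x
  proof (rule has_derivative_gradient_eqI)
    show "(v k has_derivative (\<lambda>h. h \<bullet> (e k x *\<^sub>R gradient u x + u x *\<^sub>R gradient (e k) x))) (at x)"
      using has_derivative_mult[OF smooth_has_derivative_gradient[OF u, of x] smooth_has_derivative_gradient[OF es, of k x]]
      unfolding vk by (rule has_derivative_eq_rhs) (simp add: fun_eq_iff inner_add_right algebra_simps)
  qed
  obtain B where B: "B \<ge> 0" "\<And>k s. k > 0 \<Longrightarrow> \<bar>s * deriv (cutoff k) s\<bar> \<le> B" using deriv_cutoff_bound by blast
  have geb: "norm (gradient (e k) x) \<le> 2 * B / norm x" for k x
  proof (cases "x = 0")
    case False
    have "norm (gradient (e k) x) * norm x = 2 * \<bar>(x \<bullet> x) * deriv (cutoff (real (Suc k))) (x \<bullet> x)\<bar>"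
      by (simp add: ge abs_mult power2_norm_eq_inner[symmetric] power2_eq_square)
    also have "\<dots> \<le> 2 * B" using B(2)[of "real (Suc k)" "x \<bullet> x"] by simp
    finally show ?thesis using False by (simp add: pos_le_divide_eq)
  qed (simp add: ge)
  have ev1: "\<forall>\<^sub>F k in sequentially. e k x = 1 \<and> gradient (e k) x = 0" if x: "x \<noteq> 0" for x :: 'a
  proof -
    \<comment> \<open>The 3 in place of 2 puts |x|^2 strictly inside the interval where the cutoff
      equals 1, so that its derivative vanishes there as well.\<close>
    obtain N :: nat where N: "3 / (x \<bullet> x) + (x \<bullet> x) + 1 < real N" using reals_Archimedean2 by blast
    have xx: "x \<bullet> x > 0" using x by simp
    have "e k x = 1 \<and> gradient (e k) x = 0" if "k \<ge> N" for k
    proof -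
      let ?K = "real (Suc k)"
      have K: "?K > 3 / (x \<bullet> x)" "?K > x \<bullet> x + 1" "?K > 0"
      proof -
        have "3 / (x \<bullet> x) > 0" using xx by simp
        moreover have "real N \<le> real k" using that by simp
        moreover have "?K = real k + 1" by simp
        ultimately show "?K > 3 / (x \<bullet> x)" "?K > x \<bullet> x + 1" "?K > 0" using N xx by linarith+
      qed
      have K3: "3 / ?K < x \<bullet> x" using K xx by (simp add: field_simps)
      have "2 / ?K < 3 / ?K" using K by (intro divide_strict_right_mono) auto
      then have in0: "x \<bullet> x \<in> {2 / ?K<..<?K}" using K K3 by auto
      then have 1: "e k x = 1" unfolding e_def using K by (intro cutoff_eq_1) auto
      have "(1::real) = cutoff ?K t" if "t \<in> {2 / ?K<..<?K}" for t
        using that K by (intro cutoff_eq_1[symmetric]) auto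
      then have "(cutoff ?K has_real_derivative 0) (at (x \<bullet> x))"
        by (intro has_field_derivative_transform_within_open[OF DERIV_const _ in0]) auto
      then show ?thesis using 1 by (simp add: ge DERIV_imp_deriv)
    qed
    then show ?thesis by (auto simp: eventually_sequentially)
  qed
  have nz: "AE x in (lborel :: 'a measure). x \<noteq> 0" by (rule AE_lborel_singleton)
  have cont: "continuous_on UNIV f" if "smooth f" for f :: "'a \<Rightarrow> real"
    using smooth_on_continuous_on[of UNIV f] that by (simp add: smooth_on_UNIV)
  have [measurable]: "u \<in> borel_measurable borel" "gradient u \<in> borel_measurable borel"
    using cont[OF u] smooth_continuous_gradient[OF u] by (auto intro!: borel_measurable_continuous_onI)
  have [measurable]: "v k \<in> borel_measurable borel" "gradient (v k) \<in> borel_measurable borel" for k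
    using cont[OF vs[of k]] smooth_continuous_gradient[OF vs[of k]] by (auto intro!: borel_measurable_continuous_onI)
  have ve: "v k x = u x * e k x" for k x by (simp add: v_def e_def)
  have evv: "\<forall>\<^sub>F k in sequentially. v k x = u x \<and> gradient (v k) x = gradient u x" if "x \<noteq> 0" for x
    using ev1[OF that] by eventually_elim (simp add: ve gv)
  show "(\<lambda>k. LINT x|lborel. (norm (gradient (v k) x))\<^sup>2) \<longlonglongrightarrow> (LINT x|lborel. (norm (gradient u x))\<^sup>2)"
  proof (rule integral_dominated_convergence[where w = "\<lambda>x. 2 * (norm (gradient u x))\<^sup>2 + 8 * B\<^sup>2 * ((u x)\<^sup>2 / (norm x)\<^sup>2)"])
    show "integrable lborel (\<lambda>x. 2 * (norm (gradient u x))\<^sup>2 + 8 * B\<^sup>2 * ((u x)\<^sup>2 / (norm x)\<^sup>2))"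
      by (intro Bochner_Integration.integrable_add integrable_mult_right int)
    show "AE x in lborel. (\<lambda>k. (norm (gradient (v k) x))\<^sup>2) \<longlonglongrightarrow> (norm (gradient u x))\<^sup>2"
      using nz by eventually_elim (rule tendsto_eventually, rule eventually_mono[OF evv], auto)
    show "AE x in lborel. norm ((norm (gradient (v k) x))\<^sup>2) \<le> 2 * (norm (gradient u x))\<^sup>2 + 8 * B\<^sup>2 * ((u x)\<^sup>2 / (norm x)\<^sup>2)" for k
    proof (rule AE_I2)
      fix x
      have "norm (gradient (v k) x) \<le> norm (gradient u x) + \<bar>u x\<bar> * (2 * B / norm x)"
      proof -
        have "norm (gradient (v k) x) \<le> e k x * norm (gradient u x) + \<bar>u x\<bar> * norm (gradient (e k) x)"
          unfolding gv using norm_triangle_ineq[of "e k x *\<^sub>R gradient u x" "u x *\<^sub>R gradient (e k) x"] e01 by simp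
        also have "\<dots> \<le> 1 * norm (gradient u x) + \<bar>u x\<bar> * (2 * B / norm x)"
          using e01 geb by (intro add_mono mult_right_mono mult_left_mono) auto
        finally show ?thesis by simp
      qed
      then have "(norm (gradient (v k) x))\<^sup>2 \<le> (norm (gradient u x) + \<bar>u x\<bar> * (2 * B / norm x))\<^sup>2"
        by (intro power_mono) auto
      also have "\<dots> \<le> 2 * (norm (gradient u x))\<^sup>2 + 2 * (\<bar>u x\<bar> * (2 * B / norm x))\<^sup>2"
      proof -
        have "(p + q)\<^sup>2 \<le> 2 * p\<^sup>2 + 2 * q\<^sup>2" for p q :: real
        proof -
          have "0 \<le> (p - q)\<^sup>2" by simp
          then show ?thesis by (simp add: power2_eq_square algebra_simps)
        qed
        then show ?thesis .
      qed
      also have "2 * (\<bar>u x\<bar> * (2 * B / norm x))\<^sup>2 = 8 * B\<^sup>2 * ((u x)\<^sup>2 / (norm x)\<^sup>2)"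
        by (simp add: power_mult_distrib power_divide)
      finally show "norm ((norm (gradient (v k) x))\<^sup>2) \<le> 2 * (norm (gradient u x))\<^sup>2 + 8 * B\<^sup>2 * ((u x)\<^sup>2 / (norm x)\<^sup>2)" by simp
    qed
  qed measurable
  have vu: "\<bar>v k x\<bar> \<le> \<bar>u x\<bar>" for k x
    using e01[of k x] mult_left_mono[of "e k x" 1 "\<bar>u x\<bar>"] by (simp add: ve abs_mult)
  show "(\<lambda>k. LINT x|lborel. (v k x)\<^sup>2 / (norm x)\<^sup>2) \<longlonglongrightarrow> (LINT x|lborel. (u x)\<^sup>2 / (norm x)\<^sup>2)"
  proof (rule integral_dominated_convergence[where w = "\<lambda>x. (u x)\<^sup>2 / (norm x)\<^sup>2"])
    show "AE x in lborel. (\<lambda>k. (v k x)\<^sup>2 / (norm x)\<^sup>2) \<longlonglongrightarrow> (u x)\<^sup>2 / (norm x)\<^sup>2"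
      using nz by eventually_elim (rule tendsto_eventually, rule eventually_mono[OF evv], auto)
    show "AE x in lborel. norm ((v k x)\<^sup>2 / (norm x)\<^sup>2) \<le> (u x)\<^sup>2 / (norm x)\<^sup>2" for k
      using vu by (intro AE_I2) (auto intro!: divide_right_mono simp: abs_le_square_iff)
  qed (use int in measurable)
  show "(\<lambda>k. LINT x|lborel. w x * \<bar>v k x\<bar> powr p) \<longlonglongrightarrow> (LINT x|lborel. w x * \<bar>u x\<bar> powr p)"
    if [measurable]: "w \<in> borel_measurable borel" and p: "p \<ge> 0" and iw: "integrable lborel (\<lambda>x. w x * \<bar>u x\<bar> powr p)" for w p
  proof (rule integral_dominated_convergence[where w = "\<lambda>x. \<bar>w x * \<bar>u x\<bar> powr p\<bar>"])
    show "integrable lborel (\<lambda>x. \<bar>w x * \<bar>u x\<bar> powr p\<bar>)" using iw by (rule integrable_abs)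
    show "AE x in lborel. (\<lambda>k. w x * \<bar>v k x\<bar> powr p) \<longlonglongrightarrow> w x * \<bar>u x\<bar> powr p"
      using nz by eventually_elim (rule tendsto_eventually, rule eventually_mono[OF evv], auto)
    show "AE x in lborel. norm (w x * \<bar>v k x\<bar> powr p) \<le> \<bar>w x * \<bar>u x\<bar> powr p\<bar>" for k
      using vu p by (intro AE_I2) (auto simp: abs_mult intro!: mult_left_mono powr_mono2)
  qed measurable
qed

lemma integrable_inverse_norm_square_ball:
  assumes "DIM('a::euclidean_space) \<ge> 3"
  shows "integrable lborel (\<lambda>x::'a. indicator (cball 0 R) x / (norm x)\<^sup>2)"
  by (rule integrableI_nonneg) (use nn_integral_inverse_norm_square_ball[OF assms] in auto)

section \<open>Almost extremal functions of the Sobolev inequality\<close>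

text \<open>The Talenti function (1 + |x|^2)^(-(n-2)/2) has energy n (n-2) K and critical integral
  K, which is equality in the Sobolev inequality, and cutoffs approximate it. The result is a
  profile in s = |x|^2 that vanishes near 0, the form in which it can be pulled back to a radial
  function.\<close>

lemma talenti_approximation:
  assumes dim: "DIM('a::euclidean_space) \<ge> 3" and \<epsilon>: "\<epsilon> > 0"
  defines "n \<equiv> real DIM('a)"
  obtains E \<alpha>1 \<alpha>2 where "smooth E" "0 < \<alpha>1" "\<alpha>1 \<le> \<alpha>2" "\<And>s. s \<notin> {\<alpha>1..\<alpha>2} \<Longrightarrow> E s = 0"
    "(LINT x::'a|lborel. \<bar>E (x \<bullet> x)\<bar> powr (2 * n / (n - 2))) > 0"
    "(LINT x::'a|lborel. (norm (gradient (\<lambda>x. E (x \<bullet> x)) x))\<^sup>2)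
      < (sobolev_const DIM('a) + \<epsilon>) * (LINT x::'a|lborel. \<bar>E (x \<bullet> x)\<bar> powr (2 * n / (n - 2))) powr ((n - 2) / n)"
proof -
  have n: "n \<ge> 3" using dim by (simp add: n_def)
  define P where "P x = 1 + x \<bullet> x" for x :: 'a
  have P0: "P x > 0" for x unfolding P_def by (intro add_pos_nonneg) auto
  have Pn: "P x = 1 + (norm x)\<^sup>2" for x by (simp add: P_def power2_norm_eq_inner)
  define U where "U x = P x powr (- (n - 2) / 2)" for x
  have Ps: "smooth_on UNIV P" unfolding P_def[abs_def] by (intro smooth_on_add smooth_on_inner_self) auto
  have Us: "smooth U"
    unfolding smooth_on_UNIV[symmetric] U_def[abs_def]
    by (rule smooth_on_compose_real[OF open_UNIV open_greaterThan _ smooth_on_powr Ps]) (simp add: P0)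
  have gU: "gradient U x = (- (n - 2) * P x powr (- n / 2)) *\<^sub>R x" for x
  proof (rule has_derivative_gradient_eqI)
    have 2: "(P has_derivative (\<lambda>h. 2 * (h \<bullet> x))) (at x)"
      unfolding P_def[abs_def] by (auto intro!: derivative_eq_intros simp: inner_commute)
    have e: "- (n - 2) / 2 - 1 = - n / 2" by (simp add: field_simps)
    show "(U has_derivative (\<lambda>h. h \<bullet> ((- (n - 2) * P x powr (- n / 2)) *\<^sub>R x))) (at x)"
      using has_derivative_powr_compose[OF 2 P0, of "- (n - 2) / 2"] unfolding e U_def[abs_def]
      by (rule has_derivative_eq_rhs) (auto simp: fun_eq_iff)
  qed
  have Pm: "P x powr (- real m) = 1 / (1 + (norm x)\<^sup>2) ^ m" for x m
    using P0[of x] by (simp add: powr_minus_divide powr_realpow Pn)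
  have Pm1: "P x powr (- (n - 1)) = 1 / (1 + (norm x)\<^sup>2) ^ (DIM('a) - 1)" for x
    using Pm[of x "DIM('a) - 1"] dim by (simp add: n_def of_nat_diff)
  define K where "K = (LINT x::'a|lborel. 1 / (1 + (norm x)\<^sup>2) ^ DIM('a))"
  note sc = sobolev_const_eq_integral[OF dim, folded n_def K_def]
  have i1: "integrable lborel (\<lambda>x::'a. 1 / (1 + (norm x)\<^sup>2) ^ (DIM('a) - 1))"
    and i2: "integrable lborel (\<lambda>x::'a. 1 / (1 + (norm x)\<^sup>2) ^ DIM('a))"
    by (rule integrable_1_plus_norm_square_power; use dim in auto)+
  have gU2: "(norm (gradient U x))\<^sup>2 = (n - 2)\<^sup>2 * (1 / (1 + (norm x)\<^sup>2) ^ (DIM('a) - 1) - 1 / (1 + (norm x)\<^sup>2) ^ DIM('a))" for x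
  proof -
    have "(norm (gradient U x))\<^sup>2 = (n - 2)\<^sup>2 * (P x powr (- n / 2))\<^sup>2 * (norm x)\<^sup>2"
      by (simp add: gU power_mult_distrib power2_commute[of 2 n])
    also have "(P x powr (- n / 2))\<^sup>2 = P x powr (- n)" unfolding powr_square by simp
    \<comment> \<open>Splits the energy into integrals with the exponents n - 1 and n, both known
      multiples of \<open>K\<close>.\<close>
    also have "(norm x)\<^sup>2 = P x - 1" by (simp add: Pn)
    also have "(n - 2)\<^sup>2 * P x powr (- n) * (P x - 1) = (n - 2)\<^sup>2 * (P x powr (- n) * P x powr 1 - P x powr (- n))"
      using P0[of x] by (simp add: algebra_simps)
    also have "P x powr (- n) * P x powr 1 = P x powr (- (n - 1))" unfolding powr_add[symmetric] by simp
    finally show ?thesis using Pm[of x "DIM('a)"] unfolding n_def[symmetric] by (simp only: Pm1)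
  qed
  have intg: "integrable lborel (\<lambda>x. (norm (gradient U x))\<^sup>2)"
    unfolding gU2 by (intro integrable_mult_right Bochner_Integration.integrable_diff i1 i2)
  have Ig: "(LINT x|lborel. (norm (gradient U x))\<^sup>2) = n * (n - 2) * K"
  proof -
    have "(LINT x|lborel. (norm (gradient U x))\<^sup>2) = (n - 2)\<^sup>2 * (K * (2 * n - 2) / (n - 2) - K)"
      unfolding gU2 using i1 i2 sc(3) by (simp add: K_def)
    also have "K * (2 * n - 2) / (n - 2) - K = K * n / (n - 2)" using n by (simp add: field_simps)
    also have "(n - 2)\<^sup>2 * (K * n / (n - 2)) = n * (n - 2) * K" using n by (simp add: power2_eq_square)
    finally show ?thesis .
  qed
  have Up: "\<bar>U x\<bar> powr (2 * n / (n - 2)) = 1 / (1 + (norm x)\<^sup>2) ^ DIM('a)" for x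
  proof -
    have "\<bar>U x\<bar> powr (2 * n / (n - 2)) = P x powr (- (n - 2) / 2 * (2 * n / (n - 2)))"
      by (simp add: U_def powr_powr)
    also have "- (n - 2) / 2 * (2 * n / (n - 2)) = - n" using n by (simp add: field_simps)
    finally show ?thesis using Pm[of x "DIM('a)"] by (simp add: n_def)
  qed
  have inth: "integrable lborel (\<lambda>x. (U x)\<^sup>2 / (norm x)\<^sup>2)"
  proof (rule Bochner_Integration.integrable_bound)
    \<comment> \<open>Near the origin \<open>U\<close> is at most 1; outside the unit ball |x|^2 is
      at least half of 1 + |x|^2.\<close>
    show "integrable lborel (\<lambda>x::'a. indicator (cball 0 1) x / (norm x)\<^sup>2 + 2 * (1 / (1 + (norm x)\<^sup>2) ^ (DIM('a) - 1)))"
      by (intro Bochner_Integration.integrable_add integrable_mult_right i1 integrable_inverse_norm_square_ball dim)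
    show "(\<lambda>x. (U x)\<^sup>2 / (norm x)\<^sup>2) \<in> borel_measurable lborel"
      unfolding U_def P_def by measurable
    show "AE x in lborel. norm ((U x)\<^sup>2 / (norm x)\<^sup>2) \<le> norm (indicator (cball 0 1) x / (norm x)\<^sup>2 + 2 * (1 / (1 + (norm x)\<^sup>2) ^ (DIM('a) - 1)))"
    proof (rule AE_I2)
      fix x :: 'a
      have U2: "(U x)\<^sup>2 = P x powr (- (n - 2))"
        unfolding U_def powr_square by (rule arg_cong[where f = "(powr) _"]) (simp add: field_simps)
      have nn: "0 \<le> 1 / (1 + (norm x)\<^sup>2) ^ (DIM('a) - 1)" by simp
      show "norm ((U x)\<^sup>2 / (norm x)\<^sup>2) \<le> norm (indicator (cball 0 1) x / (norm x)\<^sup>2 + 2 * (1 / (1 + (norm x)\<^sup>2) ^ (DIM('a) - 1)))"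
      proof (cases "norm x \<le> 1")
        case True
        have "P x powr (- (n - 2)) \<le> 1 powr (- (n - 2))"
          using n by (intro powr_mono2') (auto simp: P_def)
        then have "(U x)\<^sup>2 / (norm x)\<^sup>2 \<le> 1 / (norm x)\<^sup>2" unfolding U2 by (intro divide_right_mono) auto
        then have "(U x)\<^sup>2 / (norm x)\<^sup>2 \<le> 1 / (norm x)\<^sup>2 + 2 * (1 / (1 + (norm x)\<^sup>2) ^ (DIM('a) - 1))"
          using nn by linarith
        then show ?thesis using True nn by simp
      next
        case False
        then have nx: "norm x > 1" by simp
        have "P x powr (- (n - 2)) = P x powr (- (n - 1)) * P x powr 1" unfolding powr_add[symmetric] by simp
        also have "\<dots> \<le> P x powr (- (n - 1)) * (2 * (norm x)\<^sup>2)"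
          using nx P0[of x] by (intro mult_left_mono) (auto simp: Pn)
        finally have "(U x)\<^sup>2 / (norm x)\<^sup>2 \<le> 2 * P x powr (- (n - 1))"
          using nx unfolding U2 by (simp add: divide_simps mult_ac)
        then have "(U x)\<^sup>2 / (norm x)\<^sup>2 \<le> 2 * (1 / (1 + (norm x)\<^sup>2) ^ (DIM('a) - 1))" unfolding Pm1 .
        then show ?thesis using False nn by simp
      qed
    qed
  qed
  define p where "p = 2 * n / (n - 2)"
  have p0: "p \<ge> 0" using n by (simp add: p_def)
  define E where "E k s = (1 + s) powr (- (n - 2) / 2) * cutoff (real (Suc k)) s" for k s
  have vE: "U x * cutoff (real (Suc k)) (x \<bullet> x) = E k (x \<bullet> x)" for k x
    by (simp add: U_def E_def P_def)
  note ca = cutoff_approximation[OF Us intg inth, unfolded vE]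
  have A: "(\<lambda>k. LINT x::'a|lborel. \<bar>E k (x \<bullet> x)\<bar> powr p) \<longlonglongrightarrow> K"
  proof -
    have "(\<lambda>k. LINT x::'a|lborel. 1 * \<bar>E k (x \<bullet> x)\<bar> powr p) \<longlonglongrightarrow> (LINT x|lborel. 1 * \<bar>U x\<bar> powr p)"
      by (rule ca(4)) (use p0 i2 in \<open>simp_all add: p_def Up\<close>)
    then show ?thesis by (simp add: p_def Up K_def)
  qed
  define q where "q = (n - 2) / n"
  have q0: "q > 0" using n by (simp add: q_def)
  have "(\<lambda>k. (sobolev_const DIM('a) + \<epsilon>) * (LINT x::'a|lborel. \<bar>E k (x \<bullet> x)\<bar> powr p) powr q
      - (LINT x::'a|lborel. (norm (gradient (\<lambda>x. E k (x \<bullet> x)) x))\<^sup>2))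
    \<longlonglongrightarrow> (sobolev_const DIM('a) + \<epsilon>) * K powr q - n * (n - 2) * K"
    using ca(2) sc(1) unfolding Ig by (intro tendsto_intros A) auto
  \<comment> \<open>For the Talenti function itself the gap is \<epsilon> K^((n-2)/n), so it stays
    positive for a late cutoff.\<close>
  moreover have "(sobolev_const DIM('a) + \<epsilon>) * K powr q - n * (n - 2) * K > 0"
  proof -
    have "K powr (2 / n) * K powr q = K"
    proof -
      have "2 / n + q = 1" using n by (simp add: q_def field_simps)
      then show ?thesis using sc(1) by (simp only: powr_add[symmetric]) simp
    qed
    then have "sobolev_const DIM('a) * K powr q = n * (n - 2) * K" by (simp only: sc(2) mult.assoc)
    then show ?thesis using \<epsilon> sc(1) by (simp add: distrib_right)
  qed
  ultimately have ev: "\<forall>\<^sub>F k in sequentially. 0 < (sobolev_const DIM('a) + \<epsilon>) * (LINT x::'a|lborel. \<bar>E k (x \<bullet> x)\<bar> powr p) powr q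
      - (LINT x::'a|lborel. (norm (gradient (\<lambda>x. E k (x \<bullet> x)) x))\<^sup>2)"
    by (rule order_tendstoD(1))
  obtain k where k: "0 < (LINT x::'a|lborel. \<bar>E k (x \<bullet> x)\<bar> powr p)"
    "0 < (sobolev_const DIM('a) + \<epsilon>) * (LINT x::'a|lborel. \<bar>E k (x \<bullet> x)\<bar> powr p) powr q
      - (LINT x::'a|lborel. (norm (gradient (\<lambda>x. E k (x \<bullet> x)) x))\<^sup>2)"
    using eventually_conj[OF order_tendstoD(1)[OF A sc(1)] ev] by (auto simp: eventually_sequentially)
  let ?K = "real (Suc k)"
  show thesis
  proof (rule that[of "E k" "1 / ?K" "2 * ?K"])
    have E0: "E k s = 0" if "s \<notin> {1 / ?K..2 * ?K}" for s
      using that by (auto simp: E_def intro!: cutoff_eq_0)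
    then show "\<And>s. s \<notin> {1 / ?K..2 * ?K} \<Longrightarrow> E k s = 0" .
    show "smooth (E k)"
    proof (rule smooth_on_extend[where S = "{0<..}", OF _ _ _ _ E0])
      have 1: "smooth_on {0<..} (\<lambda>s::real. 1 + s)" by (intro smooth_on_add smooth_on_ident) auto
      show "smooth_on {0<..} (E k)"
        unfolding E_def[abs_def]
        by (intro smooth_on_mult smooth_on_compose_real[OF _ open_greaterThan _ smooth_on_powr 1]
            smooth_on_subset[OF smooth_cutoff[unfolded smooth_on_UNIV[symmetric]]]) auto
      have "0 < x" if "1 / ?K \<le> x" for x
        using that by (rule less_le_trans[rotated]) simp
      then show "{1 / ?K..2 * ?K} \<subseteq> {0<..}" by (auto simp del: of_nat_Suc)
    qed auto
    show "1 / ?K \<le> 2 * ?K"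
    proof -
      have "1 / ?K \<le> 1" by simp
      also have "1 \<le> 2 * ?K" by simp
      finally show ?thesis .
    qed
    show "0 < (LINT x::'a|lborel. \<bar>E k (x \<bullet> x)\<bar> powr (2 * n / (n - 2)))" using k(1) by (simp add: p_def)
    show "(LINT x::'a|lborel. (norm (gradient (\<lambda>x. E k (x \<bullet> x)) x))\<^sup>2)
      < (sobolev_const DIM('a) + \<epsilon>) * (LINT x::'a|lborel. \<bar>E k (x \<bullet> x)\<bar> powr (2 * n / (n - 2))) powr ((n - 2) / n)"
      using k(2) by (simp add: p_def q_def)
  qed auto
qed

lemma integral_lborel_affine:
  fixes h :: "'a::euclidean_space \<Rightarrow> real"
  assumes [measurable]: "h \<in> borel_measurable borel" and h0: "\<And>x. h x \<ge> 0" and c: "c > 0"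
  shows "(LINT x|lborel. h x) = c ^ DIM('a) * (LINT x|lborel. h (t + c *\<^sub>R x))"
  using nn_integral_lborel_affine[of "\<lambda>x. ennreal (h x)" c t] h0 c
  by (subst (1 2) integral_eq_nn_integral) (auto simp: enn2real_mult)

text \<open>Under a dilation by \<open>c\<close> both sides are multiplied by c^(n-2), so the outer
  end of the support can be placed at any prescribed value of |x|^2.\<close>

lemma talenti_approximation_small:
  assumes dim: "DIM('a::euclidean_space) \<ge> 3" and \<epsilon>: "\<epsilon> > 0" and R: "R > 0"
  defines "n \<equiv> real DIM('a)"
  obtains E \<alpha>1 \<alpha>2 where "smooth E" "0 < \<alpha>1" "\<alpha>1 \<le> \<alpha>2" "\<alpha>2 = R" "\<And>s. s \<notin> {\<alpha>1..\<alpha>2} \<Longrightarrow> E s = 0"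
    "(LINT x::'a|lborel. \<bar>E (x \<bullet> x)\<bar> powr (2 * n / (n - 2))) > 0"
    "(LINT x::'a|lborel. (norm (gradient (\<lambda>x. E (x \<bullet> x)) x))\<^sup>2)
      < (sobolev_const DIM('a) + \<epsilon>) * (LINT x::'a|lborel. \<bar>E (x \<bullet> x)\<bar> powr (2 * n / (n - 2))) powr ((n - 2) / n)"
proof -
  have n: "n \<ge> 3" using dim by (simp add: n_def)
  obtain E \<alpha>1 \<alpha>2 where E: "smooth E" "0 < \<alpha>1" "\<alpha>1 \<le> \<alpha>2" "\<And>s. s \<notin> {\<alpha>1..\<alpha>2} \<Longrightarrow> E s = 0"
    and A: "(LINT x::'a|lborel. \<bar>E (x \<bullet> x)\<bar> powr (2 * n / (n - 2))) > 0"
    and G: "(LINT x::'a|lborel. (norm (gradient (\<lambda>x. E (x \<bullet> x)) x))\<^sup>2)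
      < (sobolev_const DIM('a) + \<epsilon>) * (LINT x::'a|lborel. \<bar>E (x \<bullet> x)\<bar> powr (2 * n / (n - 2))) powr ((n - 2) / n)"
    unfolding n_def by (rule talenti_approximation[OF dim \<epsilon>]) blast
  define c where "c = sqrt (R / \<alpha>2)"
  have a2: "\<alpha>2 > 0" using E by linarith
  have c: "c > 0" "c\<^sup>2 = R / \<alpha>2" using R a2 by (auto simp: c_def)
  define F where "F s = E ((1 / c\<^sup>2) * s)" for s
  have Fs: "smooth F"
    unfolding smooth_on_UNIV[symmetric] F_def[abs_def]
  proof -
    have "smooth_on UNIV (\<lambda>s. (1 / c\<^sup>2) * s)" by (intro smooth_on_mult smooth_on_ident) auto
    from smooth_on_compose_real[OF open_UNIV open_UNIV _ _ this, of E]
    show "smooth_on UNIV (\<lambda>s. E ((1 / c\<^sup>2) * s))" using E(1) by (simp only: smooth_on_UNIV UNIV_I simp_thms)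
  qed
  have dF: "deriv F s = deriv E ((1 / c\<^sup>2) * s) * (1 / c\<^sup>2)" for s
    unfolding F_def[abs_def]
    by (rule DERIV_imp_deriv, rule DERIV_chain2[OF smooth_real_has_derivative(1)[OF E(1)] DERIV_cmult_Id])
  have Fe: "F ((0 + c *\<^sub>R x) \<bullet> (0 + c *\<^sub>R x)) = E (x \<bullet> x)" for x :: 'a
    using c(1) by (simp add: F_def power2_eq_square)
  have gF: "gradient (\<lambda>x::'a. F (x \<bullet> x)) (0 + c *\<^sub>R x) = (1 / c) *\<^sub>R gradient (\<lambda>x. E (x \<bullet> x)) x" for x :: 'a
  proof -
    have "(1 / c\<^sup>2) * c = 1 / c" using c(1) by (simp add: power2_eq_square)
    moreover have "(1 / c\<^sup>2) * ((c *\<^sub>R x) \<bullet> (c *\<^sub>R x)) = x \<bullet> x"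
      using c(1) by (simp add: power2_eq_square)
    moreover have "gradient (\<lambda>x::'a. F (x \<bullet> x)) (c *\<^sub>R x)
      = (2 * deriv E ((1 / c\<^sup>2) * ((c *\<^sub>R x) \<bullet> (c *\<^sub>R x))) * ((1 / c\<^sup>2) * c)) *\<^sub>R x"
      using gradient_radial[OF Fs, of 0 "c *\<^sub>R x"] by (simp only: diff_0_right dF scaleR_scaleR mult.assoc)
    moreover have "gradient (\<lambda>x::'a. E (x \<bullet> x)) x = (2 * deriv E (x \<bullet> x)) *\<^sub>R x"
      using gradient_radial[OF E(1), of 0 x] by (simp only: diff_0_right)
    ultimately show ?thesis by (simp only: add_0_left scaleR_scaleR mult_ac)
  qed
  have sm: "smooth (\<lambda>x::'a. F (x \<bullet> x))" using smooth_radial[OF Fs, of "0::'a"] by simp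
  have [measurable]: "(\<lambda>x::'a. F (x \<bullet> x)) \<in> borel_measurable borel" "gradient (\<lambda>x::'a. F (x \<bullet> x)) \<in> borel_measurable borel"
    using smooth_on_continuous_on[of UNIV "\<lambda>x::'a. F (x \<bullet> x)"] smooth_continuous_gradient[OF sm] sm
    by (auto intro!: borel_measurable_continuous_onI simp: smooth_on_UNIV)
  have 1: "(LINT x::'a|lborel. \<bar>F (x \<bullet> x)\<bar> powr (2 * n / (n - 2))) = c ^ DIM('a) * (LINT x::'a|lborel. \<bar>E (x \<bullet> x)\<bar> powr (2 * n / (n - 2)))"
    by (subst integral_lborel_affine[where c = c and t = 0]) (use c Fe in auto)
  have 2: "(LINT x::'a|lborel. (norm (gradient (\<lambda>x. F (x \<bullet> x)) x))\<^sup>2) = c ^ DIM('a) * (1 / c\<^sup>2 * (LINT x::'a|lborel. (norm (gradient (\<lambda>x. E (x \<bullet> x)) x))\<^sup>2))"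
  proof -
    have "(LINT x::'a|lborel. (norm (gradient (\<lambda>x. F (x \<bullet> x)) x))\<^sup>2)
      = c ^ DIM('a) * (LINT x::'a|lborel. (norm (gradient (\<lambda>x. F (x \<bullet> x)) (0 + c *\<^sub>R x)))\<^sup>2)"
      by (rule integral_lborel_affine) (use c in auto)
    also have "(LINT x::'a|lborel. (norm (gradient (\<lambda>x. F (x \<bullet> x)) (0 + c *\<^sub>R x)))\<^sup>2)
      = (LINT x::'a|lborel. 1 / c\<^sup>2 * (norm (gradient (\<lambda>x. E (x \<bullet> x)) x))\<^sup>2)"
      unfolding gF by (simp add: power_mult_distrib power_divide)
    finally show ?thesis by simp
  qed
  have cp: "(c ^ DIM('a)) powr ((n - 2) / n) = c ^ DIM('a) * (1 / c\<^sup>2)"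
  proof -
    have "(c ^ DIM('a)) powr ((n - 2) / n) = (c powr n) powr ((n - 2) / n)"
      using c(1) by (simp add: n_def powr_realpow)
    also have "\<dots> = c powr (n - 2)" using n by (simp add: powr_powr)
    also have "\<dots> = c powr n / c powr 2" by (rule powr_diff)
    also have "\<dots> = c ^ DIM('a) * (1 / c\<^sup>2)" using c(1) by (simp add: n_def powr_realpow powr_numeral)
    finally show ?thesis .
  qed
  show thesis
  proof (rule that[of F "c\<^sup>2 * \<alpha>1" "R"])
    have R2: "R = c\<^sup>2 * \<alpha>2" using a2 by (simp add: c(2))
    show "0 < c\<^sup>2 * \<alpha>1" using c(1) E(2) by simp
    show "c\<^sup>2 * \<alpha>1 \<le> R" unfolding R2 using E(3) by (intro mult_left_mono) auto
    show "F s = 0" if "s \<notin> {c\<^sup>2 * \<alpha>1..R}" for s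
    proof -
      have cc: "c\<^sup>2 > 0" using c(1) by simp
      have "(1 / c\<^sup>2) * s \<notin> {\<alpha>1..\<alpha>2}"
        using that cc unfolding R2 by (auto simp: field_simps)
      then show ?thesis unfolding F_def by (rule E(4))
    qed
    have "c ^ DIM('a) > 0" using c by simp
    then show "(LINT x::'a|lborel. \<bar>F (x \<bullet> x)\<bar> powr (2 * n / (n - 2))) > 0" unfolding 1 using A by simp
    have "c ^ DIM('a) * (1 / c\<^sup>2) * (LINT x::'a|lborel. (norm (gradient (\<lambda>x. E (x \<bullet> x)) x))\<^sup>2)
      < c ^ DIM('a) * (1 / c\<^sup>2) * ((sobolev_const DIM('a) + \<epsilon>) * (LINT x::'a|lborel. \<bar>E (x \<bullet> x)\<bar> powr (2 * n / (n - 2))) powr ((n - 2) / n))"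
      using G c(1) by (intro mult_strict_left_mono) auto
    then show "(LINT x::'a|lborel. (norm (gradient (\<lambda>x. F (x \<bullet> x)) x))\<^sup>2)
      < (sobolev_const DIM('a) + \<epsilon>) * (LINT x::'a|lborel. \<bar>F (x \<bullet> x)\<bar> powr (2 * n / (n - 2))) powr ((n - 2) / n)"
      unfolding 1 2 using A c by (simp only: powr_mult cp mult_ac)
  qed (use Fs in auto)
qed

section \<open>From the whole space to the domain\<close>

lemma set_integral_eq_integral:
  "(\<And>x. x \<notin> S \<Longrightarrow> f x = 0) \<Longrightarrow> (LINT x:S|M. f x) = (LINT x|M. (f x :: real))"
  unfolding set_lebesgue_integral_def
  by (rule Bochner_Integration.integral_cong) (auto simp: indicator_def)

text \<open>In an open set one can move outwards from every point, so the supremum of the norm is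
  not attained. Compact subsets of the domain therefore lie in the open ball of radius D.\<close>

lemma norm_less_radius_about_origin:
  fixes \<Omega> :: "'a::euclidean_space set"
  assumes "open \<Omega>" "bounded \<Omega>" "x \<in> \<Omega>"
  shows "norm x < radius_about_origin \<Omega>"
proof -
  obtain e where e: "e > 0" "ball x e \<subseteq> \<Omega>" using assms open_contains_ball by blast
  obtain b :: 'a where b: "b \<in> Basis" using nonempty_Basis by blast
  \<comment> \<open>At 0 no direction is distinguished as pointing outwards, and any unit vector
    serves.\<close>
  define d where "d = (if x = 0 then b else sgn x)"
  have d: "norm d = 1" "x = norm x *\<^sub>R d" using b by (auto simp: d_def norm_sgn norm_scaleR_sgn)
  define y where "y = x + (e / 2) *\<^sub>R d"
  have "dist x y < e" using e d by (simp add: y_def dist_norm)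
  then have y: "y \<in> \<Omega>" using e by auto
  have "y = (norm x + e / 2) *\<^sub>R d" unfolding y_def scaleR_add_left using d(2) by simp
  then have "norm y = norm x + e / 2" using d(1) e by simp
  moreover have "norm y \<le> radius_about_origin \<Omega>"
    unfolding radius_about_origin_def
    using assms(2) y by (intro cSUP_upper) (auto simp: bounded_iff bdd_above_def)
  ultimately show ?thesis using e by linarith
qed

text \<open>Merges the two cases of the constant into a power of the optimal \<kappa>.\<close>

lemma hardy_sobolev_const_eq:
  assumes "n \<ge> 3" "a > 0"
  shows "hardy_sobolev_const n a = min a (1 / (real n - 2)) powr (2 * (real n - 1) / real n) * sobolev_const n"
proof (cases "a \<ge> 1 / (real n - 2)")
  case True
  have "(real n - 2) powr (- (2 * (real n - 1) / real n)) = (1 / (real n - 2)) powr (2 * (real n - 1) / real n)"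
    using assms by (simp add: powr_minus_divide powr_divide)
  then show ?thesis using True by (simp add: hardy_sobolev_const_def min_absorb2)
qed (simp add: hardy_sobolev_const_def min_absorb1)

lemma sobolev_const_nonneg: "n \<ge> 2 \<Longrightarrow> sobolev_const n \<ge> 0"
  by (auto simp: sobolev_const_def intro!: mult_nonneg_nonneg)

text \<open>By translation, almost extremal functions concentrate at an arbitrary point.\<close>

lemma translated_talenti_approximation:
  fixes x0 :: "'a::euclidean_space"
  assumes dim: "DIM('a) \<ge> 3" and \<epsilon>: "\<epsilon> > 0" and \<delta>: "\<delta> > 0"
  defines "n \<equiv> real DIM('a)"
  obtains u where "smooth u" "\<And>x. x \<notin> cball x0 \<delta> \<Longrightarrow> u x = 0" "(LINT x|lborel. \<bar>u x\<bar> powr (2 * n / (n - 2))) > 0"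
    "(LINT x|lborel. (norm (gradient u x))\<^sup>2)
      < (sobolev_const DIM('a) + \<epsilon>) * (LINT x|lborel. \<bar>u x\<bar> powr (2 * n / (n - 2))) powr ((n - 2) / n)"
proof -
  have d2: "\<delta>\<^sup>2 > 0" using \<delta> by simp
  obtain E \<alpha>1 \<alpha>2 where E: "smooth E" "0 < \<alpha>1" "\<alpha>1 \<le> \<alpha>2" "\<alpha>2 = \<delta>\<^sup>2" "\<And>s. s \<notin> {\<alpha>1..\<alpha>2} \<Longrightarrow> E s = 0"
    and A: "(LINT x::'a|lborel. \<bar>E (x \<bullet> x)\<bar> powr (2 * n / (n - 2))) > 0"
    and G: "(LINT x::'a|lborel. (norm (gradient (\<lambda>x. E (x \<bullet> x)) x))\<^sup>2)
      < (sobolev_const DIM('a) + \<epsilon>) * (LINT x::'a|lborel. \<bar>E (x \<bullet> x)\<bar> powr (2 * n / (n - 2))) powr ((n - 2) / n)"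
    unfolding n_def by (rule talenti_approximation_small[OF dim \<epsilon> d2]) blast
  define u where "u x = E ((x - x0) \<bullet> (x - x0))" for x
  have us: "smooth u" unfolding u_def[abs_def] by (rule smooth_radial[OF E(1)])
  have [measurable]: "u \<in> borel_measurable borel" "gradient u \<in> borel_measurable borel"
    using smooth_on_continuous_on[of UNIV u] smooth_continuous_gradient[OF us] us
    by (auto intro!: borel_measurable_continuous_onI simp: smooth_on_UNIV)
  have ut: "u (x0 + 1 *\<^sub>R x) = E (x \<bullet> x)" for x by (simp add: u_def)
  have gt: "gradient u (x0 + 1 *\<^sub>R x) = gradient (\<lambda>x. E (x \<bullet> x)) x" for x
    using gradient_radial[OF E(1), of x0 "x0 + x"] gradient_radial[OF E(1), of 0 x] by (simp add: u_def[abs_def])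
  have 1: "(LINT x|lborel. \<bar>u x\<bar> powr (2 * n / (n - 2))) = (LINT x::'a|lborel. \<bar>E (x \<bullet> x)\<bar> powr (2 * n / (n - 2)))"
    by (subst integral_lborel_affine[where c = 1 and t = x0]) (auto simp only: ut, auto)
  have 2: "(LINT x|lborel. (norm (gradient u x))\<^sup>2) = (LINT x::'a|lborel. (norm (gradient (\<lambda>x. E (x \<bullet> x)) x))\<^sup>2)"
    by (subst integral_lborel_affine[where c = 1 and t = x0]) (auto simp only: gt, auto)
  show thesis
  proof (rule that[OF us])
    show "u x = 0" if "x \<notin> cball x0 \<delta>" for x
    proof -
      have "\<delta> < norm (x - x0)" using that by (simp add: dist_norm norm_minus_commute)
      then have "\<delta>\<^sup>2 < (norm (x - x0))\<^sup>2" using \<delta> by (intro power_strict_mono) auto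
      then show ?thesis unfolding u_def by (intro E(5)) (simp add: E(4) power2_norm_eq_inner)
    qed
  qed (use A G in \<open>simp_all only: 1 2\<close>)
qed

context hs_transform begin

text \<open>On the support, away from the origin, tau is at least a, so the weight is bounded by
  (1/a)^m.\<close>

lemma integrable_weighted_powr:
  fixes u :: "'a::euclidean_space \<Rightarrow> real"
  assumes u: "smooth u" and K: "compact K" "K \<subseteq> ball 0 D" "\<And>x. x \<notin> K \<Longrightarrow> u x = 0" and p: "p > 0" and m: "m \<ge> 0"
  shows "integrable lborel (\<lambda>x. \<bar>u x\<bar> powr p)" and "integrable lborel (\<lambda>x. (1 / tau (norm x)) powr m * \<bar>u x\<bar> powr p)"
proof -
  have cu: "continuous_on UNIV u" using u smooth_on_continuous_on[of UNIV u] by (simp add: smooth_on_UNIV)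
  then have [measurable]: "u \<in> borel_measurable borel" by (rule borel_measurable_continuous_onI)
  show i: "integrable lborel (\<lambda>x. \<bar>u x\<bar> powr p)"
  proof (rule integrable_continuous_compact_support[OF _ K(1)])
    show "continuous_on K (\<lambda>x. \<bar>u x\<bar> powr p)"
      by (rule continuous_on_powr') (use p in \<open>auto intro!: continuous_intros continuous_on_subset[OF cu]\<close>)
  qed (simp add: K(3))
  show "integrable lborel (\<lambda>x. (1 / tau (norm x)) powr m * \<bar>u x\<bar> powr p)"
  proof (rule Bochner_Integration.integrable_bound)
    show "integrable lborel (\<lambda>x. (1 / a) powr m * \<bar>u x\<bar> powr p)" by (intro integrable_mult_right i)
    show "AE x in lborel. norm ((1 / tau (norm x)) powr m * \<bar>u x\<bar> powr p) \<le> norm ((1 / a) powr m * \<bar>u x\<bar> powr p)"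
      using AE_lborel_singleton[of "0::'a"]
    proof eventually_elim
      fix x :: 'a assume x: "x \<noteq> 0"
      show "norm ((1 / tau (norm x)) powr m * \<bar>u x\<bar> powr p) \<le> norm ((1 / a) powr m * \<bar>u x\<bar> powr p)"
      proof (cases "x \<in> K")
        case True
        then have "norm x \<le> D" using K(2) by auto
        then have "tau (norm x) \<ge> a" using x by (intro tau_ge) auto
        then have "(1 / tau (norm x)) powr m \<le> (1 / a) powr m"
          using a0 m by (intro powr_mono2 divide_left_mono) auto
        then show ?thesis by (simp add: mult_right_mono)
      qed (simp add: K(3))
    qed
  qed measurable
qed

text \<open>The annulus inequality for \<open>u\<close> times a cutoff, followed by the limit. The
  Hardy integral of \<open>u\<close> is finite since \<open>u\<close> is bounded and 1/|x|^2 is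
  locally integrable.\<close>

lemma hardy_sobolev_compact_support:
  fixes u :: "'a::euclidean_space \<Rightarrow> real"
  assumes n: "n = real DIM('a)" and u: "smooth u" and K: "compact K" "K \<subseteq> ball 0 D" "\<And>x. x \<notin> K \<Longrightarrow> u x = 0"
  shows "((n - 2) / 2)\<^sup>2 * (LINT x|lborel. (u x)\<^sup>2 / (norm x)\<^sup>2)
    + \<kappa> powr (2 * (n - 1) / n) * sobolev_const DIM('a) *
      (LINT x|lborel. (1 / tau (norm x)) powr (2 * (n - 1) / (n - 2)) * \<bar>u x\<bar> powr (2 * n / (n - 2))) powr ((n - 2) / n)
    \<le> (LINT x|lborel. (norm (gradient u x))\<^sup>2)"
proof -
  have dim: "DIM('a) \<ge> 3" using n n3 by simp
  define p where "p = 2 * n / (n - 2)"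
  define m where "m = 2 * (n - 1) / (n - 2)"
  define q where "q = (n - 2) / n"
  have pmq: "p > 0" "m \<ge> 0" "q > 0" using n3 by (auto simp: p_def m_def q_def)
  have cu: "continuous_on UNIV u" using u smooth_on_continuous_on[of UNIV u] by (simp add: smooth_on_UNIV)
  then have [measurable]: "u \<in> borel_measurable borel" by (rule borel_measurable_continuous_onI)
  \<comment> \<open>The point 0 is added so that the maximum exists for empty \<open>K\<close> too.
    The largest norm is attained and hence strictly below \<open>D\<close>.\<close>
  have "\<exists>x\<in>insert 0 K. \<forall>y\<in>insert 0 K. norm y \<le> norm x"
    by (rule continuous_attains_sup) (auto intro: compact_insert[OF K(1)] continuous_on_norm_id)
  then obtain x1 where x1: "x1 \<in> insert 0 K" "\<And>y. y \<in> insert 0 K \<Longrightarrow> norm y \<le> norm x1" by blast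
  define r1 where "r1 = max (norm x1) (D / 2)"
  have r1: "0 < r1" "r1 < D" using x1(1) K(2) D0 by (auto simp: r1_def)
  have u0: "u x = 0" if "norm x > r1" for x
    using x1(2)[of x] that by (intro K(3)) (auto simp: r1_def)
  have ig: "integrable lborel (\<lambda>x. (norm (gradient u x))\<^sup>2)"
    by (rule integrable_continuous_compact_support[OF _ K(1)])
       (use gradient_eq_0_outside[OF compact_imp_closed[OF K(1)] K(3)] in
        \<open>auto intro!: continuous_intros continuous_on_subset[OF smooth_continuous_gradient[OF u]]\<close>)
  have "bounded (u ` cball 0 r1)"
    by (intro compact_imp_bounded compact_continuous_image continuous_on_subset[OF cu]) auto
  then obtain M where M: "\<And>x. norm x \<le> r1 \<Longrightarrow> \<bar>u x\<bar> \<le> M" unfolding bounded_iff by fastforce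
  have ih: "integrable lborel (\<lambda>x. (u x)\<^sup>2 / (norm x)\<^sup>2)"
  proof (rule Bochner_Integration.integrable_bound)
    show "integrable lborel (\<lambda>x::'a. M\<^sup>2 * (indicator (cball 0 r1) x / (norm x)\<^sup>2))"
      by (intro integrable_mult_right integrable_inverse_norm_square_ball dim)
    show "AE x in lborel. norm ((u x)\<^sup>2 / (norm x)\<^sup>2) \<le> norm (M\<^sup>2 * (indicator (cball 0 r1) x / (norm x)\<^sup>2))"
    proof (rule AE_I2)
      fix x
      show "norm ((u x)\<^sup>2 / (norm x)\<^sup>2) \<le> norm (M\<^sup>2 * (indicator (cball 0 r1) x / (norm x)\<^sup>2))"
      proof (cases "norm x \<le> r1")
        case True
        have "(u x)\<^sup>2 \<le> M\<^sup>2" using power_mono[OF M[OF True], of 2] by simp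
        then show ?thesis using True by (simp add: divide_right_mono)
      qed (simp add: u0)
    qed
  qed measurable
  define w where "w x = (1 / tau (norm x)) powr m" for x :: 'a
  have [measurable]: "w \<in> borel_measurable borel" unfolding w_def[abs_def] by measurable
  have iw: "integrable lborel (\<lambda>x. w x * \<bar>u x\<bar> powr p)"
    unfolding w_def by (rule integrable_weighted_powr(2)[OF u K pmq(1,2)])
  define v where "v k x = u x * cutoff (real (Suc k)) (x \<bullet> x)" for k x
  note ca = cutoff_approximation[OF u ig ih, folded v_def]
  define B where "B = \<kappa> powr (2 * (n - 1) / n) * sobolev_const DIM('a)"
  have "((n - 2) / 2)\<^sup>2 * (LINT x|lborel. (v k x)\<^sup>2 / (norm x)\<^sup>2) + B * (LINT x|lborel. w x * \<bar>v k x\<bar> powr p) powr q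
    \<le> (LINT x|lborel. (norm (gradient (v k) x))\<^sup>2)" for k
    unfolding B_def w_def p_def q_def m_def
  proof (rule hardy_sobolev_annulus[OF n ca(1)])
    \<comment> \<open>The cutoff vanishes where |x|^2 is below 1/(k+1); the minimum keeps the inner
      radius below the outer one.\<close>
    let ?r0 = "min (1 / sqrt (real (Suc k))) r1"
    show "0 < ?r0" "?r0 \<le> r1" "r1 < D" using r1 by auto
    show "v k x = 0" if x: "x \<notin> annulus ?r0 r1" for x
    proof (cases "norm x \<le> r1")
      case True
      then have "norm x < 1 / sqrt (real (Suc k))" using x by (auto simp: annulus_def)
      then have "(norm x)\<^sup>2 < (1 / sqrt (real (Suc k)))\<^sup>2" by (intro power_strict_mono) auto
      then have "x \<bullet> x < 1 / real (Suc k)" by (simp add: power2_norm_eq_inner power_divide)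
      then show ?thesis unfolding v_def by (subst cutoff_eq_0) auto
    qed (simp add: v_def u0)
  qed
  moreover have "(\<lambda>k. ((n - 2) / 2)\<^sup>2 * (LINT x|lborel. (v k x)\<^sup>2 / (norm x)\<^sup>2) + B * (LINT x|lborel. w x * \<bar>v k x\<bar> powr p) powr q)
    \<longlonglongrightarrow> ((n - 2) / 2)\<^sup>2 * (LINT x|lborel. (u x)\<^sup>2 / (norm x)\<^sup>2) + B * (LINT x|lborel. w x * \<bar>u x\<bar> powr p) powr q"
  proof (intro tendsto_add tendsto_mult tendsto_const ca(3) tendsto_powr2)
    show "(\<lambda>k. LINT x|lborel. w x * \<bar>v k x\<bar> powr p) \<longlonglongrightarrow> (LINT x|lborel. w x * \<bar>u x\<bar> powr p)"
      using pmq by (intro ca(4) iw) auto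
  qed (use pmq in \<open>auto simp: w_def intro!: always_eventually integral_nonneg_AE\<close>)
  ultimately have "((n - 2) / 2)\<^sup>2 * (LINT x|lborel. (u x)\<^sup>2 / (norm x)\<^sup>2) + B * (LINT x|lborel. w x * \<bar>u x\<bar> powr p) powr q
    \<le> (LINT x|lborel. (norm (gradient u x))\<^sup>2)"
    using ca(2) by (intro LIMSEQ_le) auto
  then show ?thesis by (simp only: B_def w_def p_def q_def m_def)
qed

lemma rr_mono: "0 < s \<Longrightarrow> s \<le> s' \<Longrightarrow> rr s \<le> rr s'"
  using powr_mono2'[of "- qq" s s'] qq_pos D0 by (simp add: rr_def tt_def)

text \<open>The transplantation is inverted on a Talenti profile. Nothing is lost: a radial function
  has a radial ground-state gradient, and \<kappa> = 1/(n-2) makes \<open>be\<close>, and with it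
  the additional potential, vanish.\<close>

lemma almost_extremal_origin:
  assumes n: "n = real DIM('a::euclidean_space)" and k: "\<kappa> = 1 / (n - 2)" and r1: "0 < r1" "r1 < D" and \<epsilon>: "\<epsilon> > 0"
  obtains u :: "'a::euclidean_space \<Rightarrow> real" and r0 where "smooth u" "0 < r0" "r0 \<le> r1" "\<And>x. x \<notin> annulus r0 r1 \<Longrightarrow> u x = 0"
    "(LINT x|lborel. (1 / tau (norm x)) powr (2 * (n - 1) / (n - 2)) * \<bar>u x\<bar> powr (2 * n / (n - 2))) > 0"
    "(LINT x|lborel. (norm (gradient u x))\<^sup>2) - ((n - 2) / 2)\<^sup>2 * (LINT x|lborel. (u x)\<^sup>2 / (norm x)\<^sup>2)
      < \<kappa> powr (2 * (n - 1) / n) * (sobolev_const DIM('a) + \<epsilon>) *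
      (LINT x|lborel. (1 / tau (norm x)) powr (2 * (n - 1) / (n - 2)) * \<bar>u x\<bar> powr (2 * n / (n - 2))) powr ((n - 2) / n)"
proof -
  have dim: "DIM('a) \<ge> 3" using n n3 by simp
  have R: "(rho r1)\<^sup>2 > 0" using rho_pos[of r1] r1 by simp
  obtain E \<alpha>1 \<alpha>2 where E: "smooth E" "0 < \<alpha>1" "\<alpha>1 \<le> \<alpha>2" "\<alpha>2 = (rho r1)\<^sup>2" "\<And>s. s \<notin> {\<alpha>1..\<alpha>2} \<Longrightarrow> E s = 0"
    and A: "(LINT x::'a|lborel. \<bar>E (x \<bullet> x)\<bar> powr (2 * n / (n - 2))) > 0"
    and G: "(LINT x::'a|lborel. (norm (gradient (\<lambda>x. E (x \<bullet> x)) x))\<^sup>2)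
      < (sobolev_const DIM('a) + \<epsilon>) * (LINT x::'a|lborel. \<bar>E (x \<bullet> x)\<bar> powr (2 * n / (n - 2))) powr ((n - 2) / n)"
    unfolding n by (rule talenti_approximation_small[OF dim \<epsilon> R]) blast
  define r0 where "r0 = rr \<alpha>1"
  have rr2: "rr \<alpha>2 = r1" unfolding E(4) using r1 by (intro inverse_relations) auto
  have r0: "0 < r0" "r0 \<le> r1" using rr_pos rr_mono[OF E(2,3)] rr2 by (auto simp: r0_def)
  \<comment> \<open>(rho r)^2 as a function of s = r^2. Since ln r is half of ln s, no square root
    appears and smoothness in s is immediate.\<close>
  define g where "g s = (a + ln D - (1 / 2) * ln s) powr (- (2 * \<kappa>))" for s
  have g: "g (r\<^sup>2) = (rho r)\<^sup>2" if "0 < r" for r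
  proof -
    have "a + ln D - (1 / 2) * ln (r\<^sup>2) = tau r"
      using that D0 by (simp add: tau_def ln_div ln_realpow)
    then show ?thesis unfolding g_def rho_def powr_square by simp
  qed
  \<comment> \<open>The profile of \<open>u\<close> in |x|^2; dividing by \<open>psi\<close> undoes
    the multiplication in \<open>transplant\<close>. Continuing by 0 is smooth because
    \<open>E (g s)\<close> already vanishes near both ends of the interval.\<close>
  define H where "H s = (if s \<in> {0<..<D\<^sup>2} then E (g s) / psi (g s) else 0)" for s
  have gp: "g s > 0" if s: "s \<in> {0<..<D\<^sup>2}" for s
  proof -
    have "sqrt s \<le> D" using s D0 by (intro real_le_lsqrt) auto
    then have "rho (sqrt s) > 0" using s by (intro rho_pos) auto
    then show ?thesis using g[of "sqrt s"] s by simp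
  qed
  have H0: "H s = 0" if s: "s \<notin> {r0\<^sup>2..r1\<^sup>2}" for s
  proof (cases "s \<in> {0<..<D\<^sup>2}")
    case True
    define r where "r = sqrt s"
    have r: "0 < r" "r \<le> D" "r\<^sup>2 = s" using True D0 by (auto simp: r_def intro!: real_le_lsqrt)
    have "\<not> (\<alpha>1 \<le> (rho r)\<^sup>2 \<and> (rho r)\<^sup>2 \<le> \<alpha>2)"
    proof
      assume "\<alpha>1 \<le> (rho r)\<^sup>2 \<and> (rho r)\<^sup>2 \<le> \<alpha>2"
      then have "rr \<alpha>1 \<le> rr ((rho r)\<^sup>2)" "rr ((rho r)\<^sup>2) \<le> rr \<alpha>2"
        using E(2) rho_pos[OF r(1,2)] by (auto intro!: rr_mono)
      then have "r0 \<le> r" "r \<le> r1" unfolding inverse_relations(2)[OF r(1,2)] rr2 r0_def .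
      then have "r0\<^sup>2 \<le> s" "s \<le> r1\<^sup>2" unfolding r(3)[symmetric] using r0 r by (auto intro!: power_mono)
      then show False using s by auto
    qed
    then have "E (g s) = 0" unfolding r(3)[symmetric] g[OF r(1)] by (intro E(5)) auto
    then show ?thesis by (simp add: H_def)
  qed (auto simp: H_def)
  have Hs: "smooth H"
  proof (rule smooth_on_extend[where S = "{0<..<D\<^sup>2}", OF _ _ _ _ H0])
    have "smooth_on {0<..<D\<^sup>2} ln" by (rule smooth_on_subset[OF smooth_on_ln]) auto
    then have "smooth_on {0<..<D\<^sup>2} (\<lambda>s. a + ln D - (1 / 2) * ln s)"
      by (intro smooth_on_diff smooth_on_mult) auto
    moreover have "a + ln D - (1 / 2) * ln s > 0" if s: "s \<in> {0<..<D\<^sup>2}" for s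
    proof -
      have "ln s < ln (D\<^sup>2)" using s D0 by (subst ln_less_cancel_iff) auto
      then show ?thesis using D0 a0 by (simp add: ln_realpow)
    qed
    ultimately have gs: "smooth_on {0<..<D\<^sup>2} g"
      unfolding g_def[abs_def]
      by (intro smooth_on_compose_real[OF open_greaterThanLessThan open_greaterThan _ smooth_on_powr]) auto
    have 1: "smooth_on {0<..<D\<^sup>2} (\<lambda>s. E (g s))"
      by (rule smooth_on_compose_real[OF open_greaterThanLessThan open_UNIV _ _ gs]) (use E(1) in \<open>auto simp: smooth_on_UNIV\<close>)
    have 2: "smooth_on {0<..<D\<^sup>2} (\<lambda>s. psi (g s))"
      by (rule smooth_on_compose_real[OF open_greaterThanLessThan open_greaterThan _ smooth_psi gs]) (use gp in auto)
    have "smooth_on {0<..<D\<^sup>2} (\<lambda>s. E (g s) / psi (g s))"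
      by (rule smooth_on_divide[OF _ 1 2]) (use psi_pos gp in force)+
    then show "smooth_on {0<..<D\<^sup>2} H" by (rule smooth_on_cong[OF open_greaterThanLessThan, rotated]) (simp add: H_def)
    show "{r0\<^sup>2..r1\<^sup>2} \<subseteq> {0<..<D\<^sup>2}"
    proof -
      have "r0\<^sup>2 > 0" "r1\<^sup>2 < D\<^sup>2" using r0 r1 by (auto intro!: power_strict_mono)
      then have "0 < s" if "r0\<^sup>2 \<le> s" for s using that by linarith
      then show ?thesis using \<open>r1\<^sup>2 < D\<^sup>2\<close> by auto
    qed
  qed auto
  define u where "u x = H (x \<bullet> x)" for x :: 'a
  have us: "smooth u" using smooth_radial[OF Hs, of 0] by (simp add: u_def[abs_def])
  have u0: "u x = 0" if x: "x \<notin> annulus r0 r1" for x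
  proof -
    have "norm x < r0 \<or> r1 < norm x" using x by (auto simp: annulus_def)
    then have "(norm x)\<^sup>2 < r0\<^sup>2 \<or> r1\<^sup>2 < (norm x)\<^sup>2" using r1 by (auto intro!: power_strict_mono)
    then show ?thesis unfolding u_def power2_norm_eq_inner[symmetric] by (intro H0) auto
  qed
  have tr: "transplant u = (\<lambda>y. E (y \<bullet> y))"
  proof
    fix y :: 'a
    show "transplant u y = E (y \<bullet> y)"
    proof (cases "y = 0")
      case True
      then show ?thesis using E(2) by (simp add: transplant_def u_def H_def E(5))
    next
      case False
      define s where "s = y \<bullet> y"
      have s: "s > 0" using False by (simp add: s_def)
      define x where "x = cc s *\<^sub>R y"
      have "x \<bullet> x = (cc s)\<^sup>2 * s" by (simp add: x_def s_def power2_eq_square)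
      also have "\<dots> = (rr s)\<^sup>2 * ((s powr (- 1 / 2))\<^sup>2 * s)" by (simp add: cc_def power_mult_distrib)
      also have "(s powr (- 1 / 2))\<^sup>2 = 1 / s" unfolding powr_square using s by (simp add: powr_minus_divide)
      finally have xx: "x \<bullet> x = (rr s)\<^sup>2" using s by simp
      have tu: "transplant u y = H ((rr s)\<^sup>2) * psi s"
        unfolding transplant_def s_def[symmetric] x_def[symmetric] u_def xx ..
      show ?thesis
      proof (cases "rr s < D")
        case True
        have "(rr s)\<^sup>2 \<in> {0<..<D\<^sup>2}" using True rr_pos[of s] by (auto intro!: power_strict_mono)
        then have "H ((rr s)\<^sup>2) = E (g ((rr s)\<^sup>2)) / psi (g ((rr s)\<^sup>2))" by (simp add: H_def)
        also have "g ((rr s)\<^sup>2) = s" using g[OF rr_pos] tt_rr_inverse(2)[OF s] True s by simp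
        finally show ?thesis unfolding tu using psi_pos[OF s] by (simp add: s_def)
      next
        case F: False
        \<comment> \<open>A preimage beyond radius D belongs to an \<open>s\<close> above \<alpha>2
          = (rho r1)^2, where \<open>E\<close> vanishes too.\<close>
        have "\<not> s \<le> \<alpha>2" using rr_mono[OF s, of \<alpha>2] rr2 r1 F by auto
        then have "E s = 0" by (intro E(5)) auto
        moreover have "H ((rr s)\<^sup>2) = 0"
        proof (rule H0)
          have "r1\<^sup>2 < (rr s)\<^sup>2" using F r1 by (intro power_strict_mono) auto
          then show "(rr s)\<^sup>2 \<notin> {r0\<^sup>2..r1\<^sup>2}" by simp
        qed
        ultimately show ?thesis unfolding tu by (simp add: s_def)
      qed
    qed
  qed
  note ti = transplant_integrals[OF n us r0 r1(2) u0, unfolded tr]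
  define P where "P = (LINT x|lborel. (1 / tau (norm x)) powr (2 * (n - 1) / (n - 2)) * \<bar>u x\<bar> powr (2 * n / (n - 2)))"
  have kP: "(LINT x::'a|lborel. \<bar>E (x \<bullet> x)\<bar> powr (2 * n / (n - 2))) = \<kappa> * P"
    using ti(2) unfolding P_def .
  have "\<exists>e. ground_gradient u x = e *\<^sub>R x" for x
    using gradient_radial[OF Hs, of 0 x] unfolding ground_gradient_def u_def[abs_def]
    by (auto simp: scaleR_add_left[symmetric])
  then have gg: "\<kappa> * (LINT x::'a|lborel. (norm (gradient (\<lambda>x. E (x \<bullet> x)) x))\<^sup>2) = (LINT x|lborel. (norm (ground_gradient u x))\<^sup>2)"
    by (intro ti(4)) auto
  have be0: "be = 0" unfolding be_def unfolding k using n3 by simp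
  have "(LINT x|lborel. (al\<^sup>2 + be * (1 - be) / (tau (norm x))\<^sup>2) * (u x)\<^sup>2 / (norm x)\<^sup>2)
    = ((n - 2) / 2)\<^sup>2 * (LINT x|lborel. (u x)\<^sup>2 / (norm x)\<^sup>2)"
    unfolding be0 al_def[symmetric] by (simp flip: integral_mult_right_zero)
  then have "(LINT x|lborel. (norm (gradient u x))\<^sup>2) - ((n - 2) / 2)\<^sup>2 * (LINT x|lborel. (u x)\<^sup>2 / (norm x)\<^sup>2)
    = \<kappa> * (LINT x::'a|lborel. (norm (gradient (\<lambda>x. E (x \<bullet> x)) x))\<^sup>2)"
    unfolding gg using hardy_identity(1)[OF n us r0 r1(2) u0] by simp
  also have "\<dots> < \<kappa> * ((sobolev_const DIM('a) + \<epsilon>) * (\<kappa> * P) powr ((n - 2) / n))"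
    using G k0 unfolding kP by (intro mult_strict_left_mono) auto
  also have "\<dots> = (\<kappa> powr 1 * \<kappa> powr ((n - 2) / n)) * (sobolev_const DIM('a) + \<epsilon>) * P powr ((n - 2) / n)"
    using k0 A unfolding kP by (simp add: powr_mult zero_less_mult_iff)
  also have "\<kappa> powr 1 * \<kappa> powr ((n - 2) / n) = \<kappa> powr (2 * (n - 1) / n)"
    unfolding powr_add[symmetric] using n3 by (intro arg_cong[where f = "(powr) _"]) (simp add: field_simps)
  finally have fin: "(LINT x|lborel. (norm (gradient u x))\<^sup>2) - ((n - 2) / 2)\<^sup>2 * (LINT x|lborel. (u x)\<^sup>2 / (norm x)\<^sup>2)
    < \<kappa> powr (2 * (n - 1) / n) * (sobolev_const DIM('a) + \<epsilon>) * P powr ((n - 2) / n)" .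
  have P0: "P > 0" using A k0 unfolding kP by (simp add: zero_less_mult_iff)
  show thesis by (rule that[OF us r0 u0 P0[unfolded P_def] fin[unfolded P_def]])
qed

end

section \<open>The best constant\<close>

text \<open>Outside \<Omega> both \<open>u\<close> and its gradient vanish, so integrals over
  \<Omega> are integrals over the whole space; the weight \<open>X1\<close> is 1/tau.\<close>

lemma hardy_sobolev_ineq_iff:
  fixes \<Omega> :: "(real ^ 'n::finite) set"
  assumes "hs_transform (real CARD('n)) a (radius_about_origin \<Omega>) \<kappa>" and K: "closed K" "K \<subseteq> \<Omega>" "\<And>x. x \<notin> K \<Longrightarrow> u x = 0"
  defines "n \<equiv> real CARD('n)"
  shows "hardy_sobolev_ineq a \<Omega> C u \<longleftrightarrow>
    ((n - 2) / 2)\<^sup>2 * (LINT x|lborel. (u x)\<^sup>2 / (norm x)\<^sup>2) +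
    C * (LINT x|lborel. (1 / hs_transform.tau a (radius_about_origin \<Omega>) (norm x)) powr (2 * (n - 1) / (n - 2)) * \<bar>u x\<bar> powr (2 * n / (n - 2))) powr ((n - 2) / n)
    \<le> (LINT x|lborel. (norm (gradient u x))\<^sup>2)"
proof -
  interpret hs_transform "real CARD('n)" a "radius_about_origin \<Omega>" \<kappa> by fact
  have X: "X1 a (norm x / radius_about_origin \<Omega>) = 1 / tau (norm x)" for x :: "real ^ 'n"
    by (simp add: X1_def tau_def inverse_eq_divide)
  have u0: "u x = 0" if "x \<notin> \<Omega>" for x using that K by auto
  have g0: "gradient u x = 0" if "x \<notin> \<Omega>" for x
    using that K(2) by (intro gradient_eq_0_outside[OF K(1,3)]) auto
  show ?thesis
    unfolding hardy_sobolev_ineq_def Let_def X n_def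
    by (subst (1 2 3) set_integral_eq_integral) (simp_all add: u0 g0)
qed

lemma hs_transform_domain:
  fixes \<Omega> :: "(real ^ 'n::finite) set"
  assumes "CARD('n) \<ge> 3" "bounded_domain_around_origin \<Omega>" "a > 0"
  shows "hs_transform (real CARD('n)) a (radius_about_origin \<Omega>) (min a (1 / (real CARD('n) - 2)))"
proof
  have "norm (0 :: real ^ 'n) < radius_about_origin \<Omega>"
    by (rule norm_less_radius_about_origin) (use assms(2) in \<open>auto simp: bounded_domain_around_origin_def\<close>)
  then show "radius_about_origin \<Omega> > 0" by simp
qed (use assms in auto)

lemma hardy_sobolev_ineq_test_function:
  fixes \<Omega> :: "(real ^ 'n::finite) set"
  assumes "CARD('n) \<ge> 3" "bounded_domain_around_origin \<Omega>" "a > 0" and u: "u \<in> test_functions \<Omega>"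
  shows "hardy_sobolev_ineq a \<Omega> (hardy_sobolev_const CARD('n) a) u"
proof -
  let ?D = "radius_about_origin \<Omega>" and ?k = "min a (1 / (real CARD('n) - 2))"
  note hs = hs_transform_domain[OF assms(1-3)]
  interpret hs_transform "real CARD('n)" a ?D ?k by (rule hs)
  define K where "K = closure {x. u x \<noteq> 0}"
  have K: "compact K" "K \<subseteq> \<Omega>" and us: "smooth u" using u by (auto simp: test_functions_def K_def)
  have u0: "u x = 0" if "x \<notin> K" for x
    using that closure_subset[of "{x. u x \<noteq> 0}"] by (auto simp: K_def)
  have KD: "K \<subseteq> ball 0 ?D"
    using K(2) assms(2) norm_less_radius_about_origin[of \<Omega>] by (auto simp: bounded_domain_around_origin_def)
  show ?thesis
    unfolding hardy_sobolev_const_eq[OF assms(1,3)]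
    by (rule iffD2[OF hardy_sobolev_ineq_iff[OF hs compact_imp_closed[OF K(1)] K(2) u0]])
       (use hardy_sobolev_compact_support[OF _ us K(1) KD u0] in simp_all)
qed

text \<open>Any compact set in \<Omega> outside which \<open>u\<close> vanishes contains the closure
  used in the definition.\<close>

lemma test_functionsI:
  assumes "smooth u" "compact K" "K \<subseteq> \<Omega>" "\<And>x. x \<notin> K \<Longrightarrow> u x = 0"
  shows "u \<in> test_functions \<Omega>"
proof -
  have "closure {x. u x \<noteq> 0} \<subseteq> K"
    using assms by (intro closure_minimal) (auto intro: compact_imp_closed)
  moreover from this have "compact (closure {x. u x \<noteq> 0})"
    using compact_Int_closed[OF assms(2) closed_closure, of "{x. u x \<noteq> 0}"] by (simp add: inf.absorb2)
  ultimately show ?thesis using assms(1,3) by (auto simp: test_functions_def)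
qed

text \<open>If \<open>a\<close> is small, the weight is largest at the outermost points of the domain, and Talenti functions
  concentrating there are almost extremal since the Hardy term is negligible; otherwise the
  almost extremal functions are the pull-backs of Talenti functions under the change of variables.\<close>

lemma hardy_sobolev_const_upper_bound:
  fixes \<Omega> :: "(real ^ 'n::finite) set"
  assumes "CARD('n) \<ge> 3" "bounded_domain_around_origin \<Omega>" "a > 0"
    and C: "\<And>u. u \<in> test_functions \<Omega> \<Longrightarrow> hardy_sobolev_ineq a \<Omega> C u"
  shows "C \<le> hardy_sobolev_const CARD('n) a"
proof -
  define n where "n = real CARD('n)"
  define D where "D = radius_about_origin \<Omega>"
  define \<kappa> where "\<kappa> = min a (1 / (n - 2))"
  define S where "S = sobolev_const CARD('n)"
  define q where "q = (n - 2) / n"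
  define m where "m = 2 * (n - 1) / (n - 2)"
  define p where "p = 2 * n / (n - 2)"
  have \<Omega>: "open \<Omega>" "bounded \<Omega>" "0 \<in> \<Omega>" using assms(2) by (auto simp: bounded_domain_around_origin_def)
  note hs = hs_transform_domain[OF assms(1-3), folded n_def, folded D_def \<kappa>_def]
  interpret hs_transform n a D \<kappa> by (rule hs)
  have nd: "n = real DIM(real ^ 'n)" by (simp add: n_def)
  have dim: "DIM(real ^ 'n) \<ge> 3" using assms(1) by simp
  have pmq: "p > 0" "m \<ge> 0" "q > 0" "m * q = 2 * (n - 1) / n" using n3 by (auto simp: p_def m_def q_def)
  have S0: "S \<ge> 0" unfolding S_def using assms(1) by (intro sobolev_const_nonneg) auto
  note iff = hardy_sobolev_ineq_iff[of a \<Omega> \<kappa>, folded n_def D_def, OF hs, folded m_def p_def q_def]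
  have bound: "C * (LINT x|lborel. (1 / tau (norm x)) powr m * \<bar>u x\<bar> powr p) powr q
    \<le> (LINT x|lborel. (norm (gradient u x))\<^sup>2) - ((n - 2) / 2)\<^sup>2 * (LINT x|lborel. (u x)\<^sup>2 / (norm x)\<^sup>2)"
    if "smooth u" "compact K" "K \<subseteq> \<Omega>" "\<And>x. x \<notin> K \<Longrightarrow> u x = 0" for u K
    using C[OF test_functionsI[OF that]] iff[OF compact_imp_closed[OF that(2)] that(3,4)] by simp
  show ?thesis
  proof (cases "a \<ge> 1 / (n - 2)")
    case True
    then have k: "\<kappa> = 1 / (n - 2)" by (simp add: \<kappa>_def)
    obtain e where e: "e > 0" "cball 0 e \<subseteq> \<Omega>" using \<Omega> open_contains_cball by blast
    define r1 where "r1 = min e (D / 2)"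
    have r1: "0 < r1" "r1 < D" using e D0 by (auto simp: r1_def)
    have "C \<le> \<kappa> powr (2 * (n - 1) / n) * (S + t)" if t: "t > 0" for t
    proof -
      obtain u :: "real ^ 'n \<Rightarrow> real" and r0 where u: "smooth u" "0 < r0" "r0 \<le> r1" "\<And>x. x \<notin> annulus r0 r1 \<Longrightarrow> u x = 0"
        and P0: "(LINT x|lborel. (1 / tau (norm x)) powr m * \<bar>u x\<bar> powr p) > 0"
        and G: "(LINT x|lborel. (norm (gradient u x))\<^sup>2) - ((n - 2) / 2)\<^sup>2 * (LINT x|lborel. (u x)\<^sup>2 / (norm x)\<^sup>2)
          < \<kappa> powr (2 * (n - 1) / n) * (S + t) * (LINT x|lborel. (1 / tau (norm x)) powr m * \<bar>u x\<bar> powr p) powr q"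
        using almost_extremal_origin[OF nd k r1 t] unfolding m_def p_def q_def S_def by auto
      have "annulus r0 r1 \<subseteq> \<Omega>" using e by (auto simp: annulus_def r1_def)
      from bound[OF u(1) compact_annulus this u(4)] G
      have "C * (LINT x|lborel. (1 / tau (norm x)) powr m * \<bar>u x\<bar> powr p) powr q
        < \<kappa> powr (2 * (n - 1) / n) * (S + t) * (LINT x|lborel. (1 / tau (norm x)) powr m * \<bar>u x\<bar> powr p) powr q"
        by (rule le_less_trans)
      then show ?thesis using P0 by (simp add: mult_less_cancel_right)
    qed
    then have "\<forall>\<^sub>F t in at_right 0. C \<le> \<kappa> powr (2 * (n - 1) / n) * (S + t)"
      by (auto simp: eventually_at_right_field intro: exI[of _ 1])
    moreover have "((\<lambda>t. \<kappa> powr (2 * (n - 1) / n) * (S + t)) \<longlongrightarrow> \<kappa> powr (2 * (n - 1) / n) * (S + 0)) (at_right 0)"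
      by (intro tendsto_intros)
    ultimately have "C \<le> \<kappa> powr (2 * (n - 1) / n) * (S + 0)"
      by (intro tendsto_lowerbound) auto
    then show ?thesis by (simp add: hardy_sobolev_const_eq[OF assms(1,3)] \<kappa>_def n_def S_def)
  next
    case False
    then have k: "\<kappa> = a" by (simp add: \<kappa>_def)
    have ineq: "C \<le> (S + t) * (a + t) powr (2 * (n - 1) / n)" if t: "t > 0" for t
    proof (rule ccontr)
      assume C: "\<not> C \<le> (S + t) * (a + t) powr (2 * (n - 1) / n)"
      have "0 \<le> (S + t) * (a + t) powr (2 * (n - 1) / n)" using S0 t by simp
      \<comment> \<open>Positivity of \<open>C\<close>, gained from the assumption to be refuted,
        permits lowering the weighted norm under the factor \<open>C\<close>.\<close>
      then have C0: "C > 0" using C by linarith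
      \<comment> \<open>Between this radius and D, tau is at most a + t, so the weight there is
        almost its supremum (1/a)^m.\<close>
      define r where "r = D * exp (- t)"
      have r: "0 < r" "r < D" using D0 t by (auto simp: r_def)
      have taur: "tau r = a + t" using D0 by (simp add: tau_def r_def)
      have "bdd_above (norm ` \<Omega>)" using \<Omega>(2) by (auto simp: bounded_iff bdd_above_def)
      then obtain x0 where x0: "x0 \<in> \<Omega>" "r < norm x0"
        using r(2) \<Omega>(3) unfolding D_def radius_about_origin_def by (subst (asm) less_cSUP_iff) auto
      have "open (\<Omega> \<inter> {x. r < norm x})" by (intro open_Int \<Omega> open_Collect_less continuous_intros)
      then obtain d where d: "d > 0" "cball x0 d \<subseteq> \<Omega> \<inter> {x. r < norm x}"
        using x0 open_contains_cball by (metis (no_types, lifting) IntI mem_Collect_eq)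
      obtain u where u: "smooth u" "\<And>x. x \<notin> cball x0 d \<Longrightarrow> u x = 0" and I0: "(LINT x|lborel. \<bar>u x\<bar> powr p) > 0"
        and G: "(LINT x|lborel. (norm (gradient u x))\<^sup>2) < (S + t) * (LINT x|lborel. \<bar>u x\<bar> powr p) powr q"
        using translated_talenti_approximation[OF dim t d(1), of x0] unfolding nd[symmetric] p_def q_def S_def by auto
      have cd: "cball x0 d \<subseteq> \<Omega>" "cball x0 d \<subseteq> ball 0 D"
        using d(2) norm_less_radius_about_origin[OF \<Omega>(1,2)] unfolding D_def by auto
      note iw = integrable_weighted_powr[OF u(1) compact_cball cd(2) u(2) pmq(1,2)]
      have "(1 / (a + t)) powr m * (LINT x|lborel. \<bar>u x\<bar> powr p) = (LINT x|lborel. (1 / (a + t)) powr m * \<bar>u x\<bar> powr p)"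
        by simp
      also have "\<dots> \<le> (LINT x|lborel. (1 / tau (norm x)) powr m * \<bar>u x\<bar> powr p)"
      proof (rule integral_mono[OF integrable_mult_right[OF iw(1)] iw(2)])
        fix x
        show "(1 / (a + t)) powr m * \<bar>u x\<bar> powr p \<le> (1 / tau (norm x)) powr m * \<bar>u x\<bar> powr p"
        proof (cases "x \<in> cball x0 d")
          case True
          then have x: "r < norm x" "norm x < D" using d(2) cd(2) by auto
          then have "0 < norm x" using r(1) by linarith
          then have "tau (norm x) \<le> a + t" "tau (norm x) > 0"
            using x tau_antimono[of r "norm x"] taur r tau_pos[of "norm x"] by auto
          then show ?thesis using a0 t pmq(2) by (intro mult_right_mono powr_mono2 divide_left_mono) auto
        qed (simp add: u(2))
      qed
      finally have "((1 / (a + t)) powr m * (LINT x|lborel. \<bar>u x\<bar> powr p)) powr q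
        \<le> (LINT x|lborel. (1 / tau (norm x)) powr m * \<bar>u x\<bar> powr p) powr q"
        using pmq I0 by (intro powr_mono2) auto
      then have "C * ((1 / (a + t)) powr m * (LINT x|lborel. \<bar>u x\<bar> powr p)) powr q
        \<le> C * (LINT x|lborel. (1 / tau (norm x)) powr m * \<bar>u x\<bar> powr p) powr q"
        using C0 by (intro mult_left_mono) auto
      also have "\<dots> \<le> (LINT x|lborel. (norm (gradient u x))\<^sup>2) - ((n - 2) / 2)\<^sup>2 * (LINT x|lborel. (u x)\<^sup>2 / (norm x)\<^sup>2)"
        by (rule bound[OF u(1) compact_cball cd(1) u(2)])
      \<comment> \<open>Dropping the Hardy term only enlarges the right side.\<close>
      also have "\<dots> \<le> (LINT x|lborel. (norm (gradient u x))\<^sup>2)"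
        by (simp add: integral_nonneg_AE)
      also note G
      also have "((1 / (a + t)) powr m * (LINT x|lborel. \<bar>u x\<bar> powr p)) powr q
        = (1 / (a + t)) powr (2 * (n - 1) / n) * (LINT x|lborel. \<bar>u x\<bar> powr p) powr q"
        using I0 a0 t by (simp only: powr_mult powr_powr pmq(4))
      finally have "C * (1 / (a + t)) powr (2 * (n - 1) / n) < S + t"
        using I0 by (simp add: mult.assoc[symmetric] mult_less_cancel_right)
      also have "(1 / (a + t)) powr (2 * (n - 1) / n) = 1 / (a + t) powr (2 * (n - 1) / n)"
        using a0 t by (simp add: powr_divide)
      finally show False using C a0 t by (simp add: pos_divide_less_eq)
    qed
    then have "\<forall>\<^sub>F t in at_right 0. C \<le> (S + t) * (a + t) powr (2 * (n - 1) / n)"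
      by (auto simp: eventually_at_right_field intro: exI[of _ 1])
    moreover have "((\<lambda>t. (S + t) * (a + t) powr (2 * (n - 1) / n)) \<longlongrightarrow> (S + 0) * (a + 0) powr (2 * (n - 1) / n)) (at_right 0)"
      using a0 by (intro tendsto_intros) auto
    ultimately have "C \<le> (S + 0) * (a + 0) powr (2 * (n - 1) / n)"
      by (intro tendsto_lowerbound) auto
    then show ?thesis using k by (simp add: hardy_sobolev_const_eq[OF assms(1,3)] \<kappa>_def n_def S_def mult.commute)
  qed
qed

theorem theoremB:
  fixes \<Omega> :: "(real ^ 'n::finite) set" and a :: real
  assumes "CARD('n) \<ge> 3"
    and "bounded_domain_around_origin \<Omega>"
    and "a > 0"
  shows "(\<forall>u\<in>test_functions \<Omega>.
            hardy_sobolev_ineq a \<Omega> (hardy_sobolev_const CARD('n) a) u) \<and>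
         is_best_hardy_sobolev_const a \<Omega> (hardy_sobolev_const CARD('n) a) \<and>
         (\<forall>\<Omega>' :: (real ^ 'n) set. bounded_domain_around_origin \<Omega>' \<longrightarrow>
            (\<forall>C. is_best_hardy_sobolev_const a \<Omega>' C \<longleftrightarrow> is_best_hardy_sobolev_const a \<Omega> C))"
proof -
  \<comment> \<open>The two defining conditions determine the best constant uniquely, and its
    formula does not mention the domain; this yields both the optimality and the independence of the
    domain.\<close>
  have best: "is_best_hardy_sobolev_const a \<Omega>' C \<longleftrightarrow> C = hardy_sobolev_const CARD('n) a"
    if "bounded_domain_around_origin \<Omega>'" for \<Omega>' :: "(real ^ 'n) set" and C
    using hardy_sobolev_ineq_test_function[OF assms(1) that assms(3)]
      hardy_sobolev_const_upper_bound[OF assms(1) that assms(3)]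
    unfolding is_best_hardy_sobolev_const_def by (auto intro: antisym)
  then show ?thesis
    using hardy_sobolev_ineq_test_function[OF assms] assms(2) by auto
qed

end
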